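(* Let $V$ be a simple Euclidean Jordan algebra with $\dim V>1$ and let $\mathcal F_\Xi=e^{-\pi i\frac{r\lambda}2}\pi(\widetilde j)$ be the unitary inversion operator on $L^2(\Xi,d\mu)$, where $\widetilde j=\exp_{\widetilde G}(\frac\pi2(\mathbf e,0,-\mathbf e))$. Then $$\mathcal F_\Xi u(x)=2^{-r\lambda}\,\Gamma(\lambda)\int_\Xi\widetilde J_{\lambda-1}\big(2\sqrt{(x|y)}\big)\,u(y)\,d\mu(y).$$ That is, for $u$ in the dense subspace $\mathcal P(\Xi)e^{-\operatorname{tr}(x)}$ of $\mathfrak k$-finite vectors the integral converges and equals $\mathcal F_\Xi u(x)$, and $\mathcal F_\Xi$ is the unitary extension to $L^2(\Xi,d\mu)$ of the operator so defined.
   Context: Write $i=\sqrt{-1}$. $V$: simple Euclidean Jordan algebra, unit $\mathbf e$, rank $r$, $n=\dim V$; $d$ = common dimension of the Peirce spaces $V_{jk}$, $j<k$; $\lambda=\frac d2$. $(x|y)=\operatorname{tr}(xy)$ is the trace form. $L(x)$ is multiplication by $x$, $P(x)=2L(x)^2-L(x^2)$, $P(x,y)=L(x)L(y)+L(y)L(x)-L(xy)$, $x\Box y=L(xy)+[L(x),L(y)]$. $L=\operatorname{Str}(V)_0$ is the identity component of the structure group, $K^L=\{g\in L:g\mathbf e=\mathbf e\}$, $c_1\in V$ a primitive idempotent, $\Xi=L\cdot c_1$, and $\int_\Xi f\,d\mu=\frac{2^{r\lambda}}{\Gamma(r\lambda)}\int_{K^L}\int_0^\infty f(ktc_1)t^{r\lambda-1}dt\,dk$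 ($dk$ normalized Haar measure). $\mathcal P(\Xi)$ = restrictions to $\Xi$ of polynomials on $V$. $\widetilde J_\alpha(t)=(t/2)^{-\alpha}J_\alpha(t)$, an even entire function. $\mathfrak g=\mathfrak{co}(V)=V\oplus\mathfrak{str}(V)\oplus V$, $\mathfrak{str}(V)=\mathfrak{aut}(V)\oplus L(V)$, $(u,T,v)$ corresponding to the vector field $u+Tz-P(z)v$ on $V$; bracket $[(u,T,v),(u',T',v')]=(Tu'-T'u,[T,T']+2u\Box v'-2u'\Box v,-T^*v'+T'^*v)$. $G=\operatorname{Co}(V)_0$ has Lie algebra $\mathfrak g$; $\widetilde G$ is its universal cover; $\mathfrak k=\{(u,D,-u):D\in\mathfrak{aut}(V)\}$. Bessel operator: $\mathcal Bf=\sum_{\alpha,\beta}\frac{\partial^2f}{\partial x_\alpha\partial x_\beta}P(e_\alpha,e_\beta)x+\lambda\sum_\alpha\frac{\partial f}{\partial x_\alpha}e_\alpha$ in an orthonormal basis of $V$; it is tangential to $\Xi$. $\pi$ is the (known) irreducible unitary representation of $\widetilde G$ on $L^2(\Xi,d\mu)$ with space of $\mathfrak k$-finite vectors $\mathcal P(\Xi)e^{-\operatorname{tr}(x)}$, on which $d\pi(u,0,0)=i(u|x)$, $d\pi(0,T,0)=D_{T^*x}+\frac{r\lambda}{2n}\operatorname{Tr}(T^* )$, $d\pi(0,0,v)=i(v|\mathcal B)$, with $D_u$ the directional derivative and $T^*$ the adjoint with respect to the trace form. *)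

theory Defs
  imports "HOL-Analysis.Analysis" "HOL-Algebra.Group"
begin

class euclidean_jordan_algebra = euclidean_space +
  fixes jmult :: "'a \<Rightarrow> 'a \<Rightarrow> 'a"  (infixl "\<star>" 70)
    and junit :: "'a"
  assumes jmult_add_left: "(x + y) \<star> z = x \<star> z + y \<star> z"
    and jmult_scaleR_left: "(s *\<^sub>R x) \<star> y = s *\<^sub>R (x \<star> y)"
    and jmult_commute: "x \<star> y = y \<star> x"
    and jordan_identity: "x \<star> ((x \<star> x) \<star> y) = (x \<star> x) \<star> (x \<star> y)"
    and junit_left: "junit \<star> x = x"
    and inner_jmult: "inner (x \<star> y) z = inner y (x \<star> z)"

primrec jpow :: "'a::euclidean_jordan_algebra \<Rightarrow> nat \<Rightarrow> 'a" where
  "jpow x 0 = junit"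
| "jpow x (Suc k) = x \<star> jpow x k"

text \<open>Degree of the minimal polynomial of an element; the rank is the maximal such degree, and
  an element is regular if it attains the rank.\<close>

definition jdegree :: "'a::euclidean_jordan_algebra \<Rightarrow> nat" where
  "jdegree x = (LEAST k. jpow x k \<in> span (jpow x ` {..<k}))"

definition jrank :: "'a::euclidean_jordan_algebra itself \<Rightarrow> nat" where
  "jrank _ = Max (range (jdegree :: 'a \<Rightarrow> nat))"

text \<open>The Jordan trace is the coefficient \<open>a\<^sub>1\<close> of the generic minimal polynomial
  \<open>X^r - a\<^sub>1(x) X^(r-1) + \<dots>\<close>: it is a linear form, and on the (dense) set of regular
  elements it is read off from the minimal polynomial.\<close>

definition jtr :: "'a::euclidean_jordan_algebra \<Rightarrow> real" where
  "jtr = (THE \<tau>. linear \<tau> \<and>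
     (\<forall>x::'a. jdegree x = jrank TYPE('a) \<longrightarrow>
        jpow x (jrank TYPE('a)) - \<tau> x *\<^sub>R jpow x (jrank TYPE('a) - 1)
          \<in> span (jpow x ` {..<jrank TYPE('a) - 1})))"

definition jideal :: "'a::euclidean_jordan_algebra set \<Rightarrow> bool" where
  "jideal I \<longleftrightarrow> subspace I \<and> (\<forall>x\<in>I. \<forall>y. y \<star> x \<in> I)"

definition simple_jordan_algebra :: "'a::euclidean_jordan_algebra itself \<Rightarrow> bool" where
  "simple_jordan_algebra _ \<longleftrightarrow> (\<forall>I::'a set. jideal I \<longrightarrow> I = {0} \<or> I = UNIV)"

text \<open>The inner product of the type is normalised to be the trace form. This loses no generality,
  because the trace form of a Euclidean Jordan algebra is an associative inner product. Under this
  normalisation \<^const>\<open>adjoint\<close> is the adjoint for the trace form, and \<^const>\<open>Basis\<close>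
  is orthonormal for the trace form.\<close>

definition inner_is_trace_form :: "'a::euclidean_jordan_algebra itself \<Rightarrow> bool" where
  "inner_is_trace_form _ \<longleftrightarrow> (\<forall>x y::'a. inner x y = jtr (x \<star> y))"

definition primitive_idempotent :: "'a::euclidean_jordan_algebra \<Rightarrow> bool" where
  "primitive_idempotent c \<longleftrightarrow> c \<star> c = c \<and> c \<noteq> 0 \<and>
     (\<forall>a b. a \<star> a = a \<and> b \<star> b = b \<and> a \<star> b = 0 \<and> c = a + b \<longrightarrow> a = 0 \<or> b = 0)"

definition jordan_frame :: "'a::euclidean_jordan_algebra set \<Rightarrow> bool" where
  "jordan_frame C \<longleftrightarrow> finite C \<and> (\<forall>c\<in>C. primitive_idempotent c) \<and>
     (\<forall>c\<in>C. \<forall>c'\<in>C. c \<noteq> c' \<longrightarrow> c \<star> c' = 0) \<and> \<Sum>C = junit"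

definition peirce_space :: "'a::euclidean_jordan_algebra \<Rightarrow> 'a \<Rightarrow> 'a set" where
  "peirce_space c c' = {x. c \<star> x = (1/2) *\<^sub>R x \<and> c' \<star> x = (1/2) *\<^sub>R x}"

definition peirce_dim :: "'a::euclidean_jordan_algebra itself \<Rightarrow> nat" where
  "peirce_dim _ = (THE d. \<forall>C::'a set. jordan_frame C \<longrightarrow>
     (\<forall>c\<in>C. \<forall>c'\<in>C. c \<noteq> c' \<longrightarrow> dim (peirce_space c c') = d))"

definition jlambda :: "'a::euclidean_jordan_algebra itself \<Rightarrow> real" where
  "jlambda _ = real (peirce_dim TYPE('a)) / 2"

definition rlambda :: "'a::euclidean_jordan_algebra itself \<Rightarrow> real" where
  "rlambda _ = real (jrank TYPE('a)) * jlambda TYPE('a)"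

definition jL :: "'a::euclidean_jordan_algebra \<Rightarrow> 'a \<Rightarrow>\<^sub>L 'a" where
  "jL x = Blinfun (\<lambda>y. x \<star> y)"

definition jP :: "'a::euclidean_jordan_algebra \<Rightarrow> 'a \<Rightarrow>\<^sub>L 'a" where
  "jP x = 2 *\<^sub>R (jL x o\<^sub>L jL x) - jL (x \<star> x)"

definition jP2 :: "'a::euclidean_jordan_algebra \<Rightarrow> 'a \<Rightarrow> 'a \<Rightarrow>\<^sub>L 'a" where
  "jP2 x y = (jL x o\<^sub>L jL y) + (jL y o\<^sub>L jL x) - jL (x \<star> y)"

definition jbox :: "'a::euclidean_jordan_algebra \<Rightarrow> 'a \<Rightarrow> 'a \<Rightarrow>\<^sub>L 'a" where
  "jbox x y = jL (x \<star> y) + ((jL x o\<^sub>L jL y) - (jL y o\<^sub>L jL x))"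

definition adj :: "('a::euclidean_space \<Rightarrow>\<^sub>L 'a) \<Rightarrow> 'a \<Rightarrow>\<^sub>L 'a" where
  "adj T = Blinfun (adjoint (blinfun_apply T))"

definition op_trace :: "('a::euclidean_space \<Rightarrow>\<^sub>L 'a) \<Rightarrow> real" where
  "op_trace T = (\<Sum>b\<in>Basis. inner (blinfun_apply T b) b)"

definition structure_group :: "('a::euclidean_jordan_algebra \<Rightarrow>\<^sub>L 'a) set" where
  "structure_group = {g. (\<exists>h. g o\<^sub>L h = id_blinfun \<and> h o\<^sub>L g = id_blinfun) \<and>
     (\<forall>x. jP (blinfun_apply g x) = g o\<^sub>L jP x o\<^sub>L adj g)}"

definition structure_group_0 :: "('a::euclidean_jordan_algebra \<Rightarrow>\<^sub>L 'a) set" where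
  "structure_group_0 = connected_component_set structure_group id_blinfun"

definition unit_stabilizer :: "('a::euclidean_jordan_algebra \<Rightarrow>\<^sub>L 'a) set" where
  "unit_stabilizer = {g \<in> structure_group_0. blinfun_apply g junit = junit}"

definition orbit :: "'a::euclidean_jordan_algebra \<Rightarrow> 'a set" where
  "orbit c = (\<lambda>g. blinfun_apply g c) ` structure_group_0"

definition normalized_haar_measure ::
    "('a::euclidean_space \<Rightarrow>\<^sub>L 'a) set \<Rightarrow> ('a \<Rightarrow>\<^sub>L 'a) measure \<Rightarrow> bool" where
  "normalized_haar_measure K dk \<longleftrightarrow>
     sets dk = sets (restrict_space borel K) \<and> emeasure dk (space dk) = 1 \<and>
     (\<forall>g\<in>K. distr dk dk (\<lambda>k. g o\<^sub>L k) = dk)"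

text \<open>A measure whose underlying space is the orbit; the integration formula in polar
  coordinates is lemma \<open>nn_integral_orbit_measure\<close> below.\<close>

definition orbit_measure ::
    "'a::euclidean_jordan_algebra \<Rightarrow> ('a \<Rightarrow>\<^sub>L 'a) measure \<Rightarrow> 'a measure" where
  "orbit_measure c dk =
     scale_measure (ennreal (2 powr rlambda TYPE('a) / Gamma (rlambda TYPE('a))))
       (distr
         (dk \<Otimes>\<^sub>M density (restrict_space lborel {0<..})
                  (\<lambda>t. ennreal (t powr (rlambda TYPE('a) - 1))))
         (restrict_space borel (orbit c))
         (\<lambda>(k, t). blinfun_apply k (t *\<^sub>R c)))"

lemma bounded_linear_jmult: "bounded_linear (\<lambda>y. x \<star> y)" for x :: "'a::euclidean_jordan_algebra"
proof -
  have "linear (\<lambda>y. x \<star> y)"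
    by (rule linearI)
      (simp_all only: jmult_commute[of x] jmult_add_left jmult_scaleR_left)
  then show ?thesis by (simp add: linear_conv_bounded_linear)
qed

lemma jL_apply [simp]: "blinfun_apply (jL x) y = x \<star> y"
  unfolding jL_def by (simp add: bounded_linear_Blinfun_apply bounded_linear_jmult)

lemma jL_scaleR: "jL (s *\<^sub>R x) = s *\<^sub>R jL x"
  by (rule blinfun_eqI) (simp add: jmult_scaleR_left scaleR_blinfun.rep_eq)

lemma jP_scaleR: "jP (s *\<^sub>R x) = (s * s) *\<^sub>R jP x"
proof -
  have "(s *\<^sub>R x) \<star> (s *\<^sub>R x) = (s * s) *\<^sub>R (x \<star> x)"
    using jmult_commute[of x "s *\<^sub>R x"] by (simp add: jmult_scaleR_left)
  then show ?thesis
    unfolding jP_def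
    by (intro blinfun_eqI)
       (simp add: jL_scaleR blinfun.diff_left blinfun.scaleR_left blinfun.scaleR_right
          algebra_simps jmult_scaleR_left)
qed

lemma adj_scaleR: "adj (s *\<^sub>R T) = s *\<^sub>R adj T"
proof -
  have lin: "linear (blinfun_apply T')" for T' :: "'a \<Rightarrow>\<^sub>L 'a"
    by (simp add: blinfun.bounded_linear_right bounded_linear.linear)
  have app: "blinfun_apply (adj T') = adjoint (blinfun_apply T')" for T' :: "'a \<Rightarrow>\<^sub>L 'a"
    unfolding adj_def
    by (rule bounded_linear_Blinfun_apply)
       (simp add: adjoint_linear[OF lin] flip: linear_conv_bounded_linear)
  have "adjoint (blinfun_apply (s *\<^sub>R T)) = (\<lambda>y. s *\<^sub>R adjoint (blinfun_apply T) y)"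
    by (rule adjoint_unique)
       (simp add: blinfun.scaleR_left adjoint_works[OF lin] inner_commute)
  then show ?thesis
    by (intro blinfun_eqI) (simp add: app blinfun.scaleR_left)
qed

lemma structure_group_scaleR:
  assumes "g \<in> structure_group" "s > 0"
  shows "s *\<^sub>R g \<in> structure_group"
proof -
  from assms obtain h where h: "g o\<^sub>L h = id_blinfun" "h o\<^sub>L g = id_blinfun"
    and P: "\<And>x. jP (blinfun_apply g x) = g o\<^sub>L jP x o\<^sub>L adj g"
    unfolding structure_group_def by auto
  have h': "g (h x) = x" "h (g x) = x" for x
    using arg_cong[OF h(1), of "\<lambda>T. blinfun_apply T x"]
      arg_cong[OF h(2), of "\<lambda>T. blinfun_apply T x"] by simp_all
  have "(s *\<^sub>R g) o\<^sub>L ((1 / s) *\<^sub>R h) = id_blinfun" "((1 / s) *\<^sub>R h) o\<^sub>L (s *\<^sub>R g) = id_blinfun"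
    using assms by (auto intro!: blinfun_eqI simp: blinfun.scaleR_left blinfun.scaleR_right h')
  moreover have "jP (blinfun_apply (s *\<^sub>R g) x) = (s *\<^sub>R g) o\<^sub>L jP x o\<^sub>L adj (s *\<^sub>R g)" for x
    by (rule blinfun_eqI)
       (simp add: blinfun.scaleR_left jP_scaleR P adj_scaleR blinfun.scaleR_right)
  ultimately show ?thesis unfolding structure_group_def by blast
qed

lemma structure_group_0_scaleR:
  assumes "g \<in> structure_group_0" "s > 0"
  shows "s *\<^sub>R g \<in> structure_group_0"
proof -
  have g: "g \<in> structure_group"
    using assms connected_component_subset unfolding structure_group_0_def by blast
  have "connected ((\<lambda>s. s *\<^sub>R g) ` {0<..})"
    by (intro connected_continuous_image continuous_intros) auto
  moreover have "(\<lambda>s. s *\<^sub>R g) ` {0<..} \<subseteq> structure_group"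
    using g structure_group_scaleR by auto
  ultimately have "connected_component structure_group g (s *\<^sub>R g)"
    unfolding connected_component_def using assms
    by (intro exI[of _ "(\<lambda>s. s *\<^sub>R g) ` {0<..}"]) (auto intro: image_eqI[of _ _ 1])
  with assms show ?thesis
    unfolding structure_group_0_def by (auto intro: connected_component_trans)
qed

lemma nn_integral_orbit_measure:
  fixes c :: "'a::euclidean_jordan_algebra" and f :: "'a \<Rightarrow> ennreal"
  assumes dk: "normalized_haar_measure unit_stabilizer dk"
    and f: "f \<in> borel_measurable (restrict_space borel (orbit c))"
  shows "(\<integral>\<^sup>+x. f x \<partial>orbit_measure c dk) =
    ennreal (2 powr rlambda TYPE('a) / Gamma (rlambda TYPE('a))) *
    (\<integral>\<^sup>+k. (\<integral>\<^sup>+t\<in>{0<..}. f (blinfun_apply k (t *\<^sub>R c)) * ennreal (t powr (rlambda TYPE('a) - 1)) \<partial>lborel) \<partial>dk)"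
proof -
  let ?\<rho> = "rlambda TYPE('a)"
  define R where "R = restrict_space lborel {0::real<..}"
  define D where "D = density R (\<lambda>t. ennreal (t powr (?\<rho> - 1)))"
  define \<phi> where "\<phi> = (\<lambda>(k :: 'a \<Rightarrow>\<^sub>L 'a, t). blinfun_apply k (t *\<^sub>R c))"
  have sets_dk [measurable_cong]: "sets dk = sets (restrict_space borel unit_stabilizer)"
    using dk by (simp add: normalized_haar_measure_def)
  have space_dk: "space dk = unit_stabilizer"
    using sets_eq_imp_space_eq[OF sets_dk] by (simp add: space_restrict_space)
  have sets_D [measurable_cong]: "sets D = sets (restrict_space borel {0::real<..})"
    by (simp add: D_def R_def sets_restrict_space)
  have space_D: "space D = {0<..}" by (simp add: D_def R_def space_restrict_space)
  interpret R: sigma_finite_measure R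
    unfolding R_def by (rule sigma_finite_measure_restrict_space) (auto simp: lborel.sigma_finite_measure_axioms)
  have wm: "(\<lambda>t. ennreal (t powr (?\<rho> - 1))) \<in> borel_measurable R"
    unfolding R_def by (rule measurable_restrict_space1) measurable
  interpret D: sigma_finite_measure D
    unfolding D_def using wm
    by (subst R.sigma_finite_iff_density_finite[OF wm]) auto
  have sc: "(\<lambda>k. blinfun_apply k c) \<in> borel_measurable dk"
    unfolding measurable_cong_sets[OF sets_dk refl]
    by (intro measurable_restrict_space1 borel_measurable_continuous_onI continuous_intros)
  have st: "(\<lambda>t. t) \<in> borel_measurable D"
    unfolding measurable_cong_sets[OF sets_D refl] by (intro measurable_restrict_space1) measurable
  have "(\<lambda>z. snd z *\<^sub>R blinfun_apply (fst z) c) \<in> borel_measurable (dk \<Otimes>\<^sub>M D)"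
    by (intro borel_measurable_scaleR measurable_compose[OF measurable_fst sc]
        measurable_compose[OF measurable_snd st])
  moreover have "\<phi> = (\<lambda>z. snd z *\<^sub>R blinfun_apply (fst z) c)"
    by (auto simp: \<phi>_def blinfun.scaleR_right)
  moreover have "\<phi> \<in> space (dk \<Otimes>\<^sub>M D) \<rightarrow> orbit c"
  proof
    fix z assume "z \<in> space (dk \<Otimes>\<^sub>M D)"
    then have "fst z \<in> structure_group_0" "snd z > 0"
      by (auto simp: space_pair_measure space_dk space_D unit_stabilizer_def)
    then have "snd z *\<^sub>R fst z \<in> structure_group_0" by (rule structure_group_0_scaleR)
    then show "\<phi> z \<in> orbit c"
      unfolding orbit_def
      by (rule rev_image_eqI) (simp add: \<phi>_def case_prod_beta blinfun.scaleR_left blinfun.scaleR_right)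
  qed
  ultimately have \<phi>: "\<phi> \<in> measurable (dk \<Otimes>\<^sub>M D) (restrict_space borel (orbit c))"
    by (simp add: measurable_restrict_space2_iff)
  have f\<phi>: "(\<lambda>z. f (\<phi> z)) \<in> borel_measurable (dk \<Otimes>\<^sub>M D)"
    using measurable_compose[OF \<phi> f] .
  have inner: "(\<integral>\<^sup>+t. f (\<phi> (k, t)) \<partial>D) =
      (\<integral>\<^sup>+t\<in>{0<..}. f (blinfun_apply k (t *\<^sub>R c)) * ennreal (t powr (?\<rho> - 1)) \<partial>lborel)"
    if k: "k \<in> space dk" for k
  proof -
    have "(\<lambda>t. f (\<phi> (k, t))) \<in> borel_measurable D"
      using measurable_compose[OF measurable_Pair1'[OF k] f\<phi>] .
    then have "(\<lambda>t. f (\<phi> (k, t))) \<in> borel_measurable R"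
      unfolding D_def by simp
    then have "(\<integral>\<^sup>+t. f (\<phi> (k, t)) \<partial>D) = (\<integral>\<^sup>+t. ennreal (t powr (?\<rho> - 1)) * f (\<phi> (k, t)) \<partial>R)"
      unfolding D_def by (rule nn_integral_density[OF wm])
    then show ?thesis
      unfolding R_def by (simp add: nn_integral_restrict_space \<phi>_def mult_ac)
  qed
  have "(\<integral>\<^sup>+x. f x \<partial>orbit_measure c dk) =
      ennreal (2 powr ?\<rho> / Gamma ?\<rho>) * (\<integral>\<^sup>+z. f (\<phi> z) \<partial>(dk \<Otimes>\<^sub>M D))"
    unfolding orbit_measure_def R_def[symmetric] D_def[symmetric] \<phi>_def[symmetric]
    using f by (simp add: nn_integral_scale_measure nn_integral_distr[OF \<phi>])
  also have "(\<integral>\<^sup>+z. f (\<phi> z) \<partial>(dk \<Otimes>\<^sub>M D)) = (\<integral>\<^sup>+k. (\<integral>\<^sup>+t. f (\<phi> (k, t)) \<partial>D) \<partial>dk)"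
    using D.nn_integral_fst[OF f\<phi>] by simp
  also have "\<dots> = (\<integral>\<^sup>+k. (\<integral>\<^sup>+t\<in>{0<..}. f (blinfun_apply k (t *\<^sub>R c)) * ennreal (t powr (?\<rho> - 1)) \<partial>lborel) \<partial>dk)"
    by (rule nn_integral_cong) (rule inner)
  finally show ?thesis .
qed

type_synonym 'a conf = "'a \<times> ('a \<Rightarrow>\<^sub>L 'a) \<times> 'a"

definition aut_alg :: "('a::euclidean_jordan_algebra \<Rightarrow>\<^sub>L 'a) set" where
  "aut_alg = {D. \<forall>x y. blinfun_apply D (x \<star> y) = blinfun_apply D x \<star> y + x \<star> blinfun_apply D y}"

definition str_alg :: "('a::euclidean_jordan_algebra \<Rightarrow>\<^sub>L 'a) set" where
  "str_alg = {D + jL x | D x. D \<in> aut_alg}"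

definition co_alg :: "'a::euclidean_jordan_algebra conf set" where
  "co_alg = {(u, T, v) | u T v. T \<in> str_alg}"

definition k_alg :: "'a::euclidean_jordan_algebra conf set" where
  "k_alg = {(u, D, - u) | u D. D \<in> aut_alg}"

fun conf_field :: "'a::euclidean_jordan_algebra conf \<Rightarrow> 'a \<Rightarrow> 'a" where
  "conf_field (u, T, v) z = u + blinfun_apply T z - blinfun_apply (jP z) v"

fun conf_bracket :: "'a::euclidean_jordan_algebra conf \<Rightarrow> 'a conf \<Rightarrow> 'a conf" where
  "conf_bracket (u, T, v) (u', T', v') =
     (blinfun_apply T u' - blinfun_apply T' u,
      ((T o\<^sub>L T') - (T' o\<^sub>L T)) + 2 *\<^sub>R jbox u v' - 2 *\<^sub>R jbox u' v,
      - blinfun_apply (adj T) v' + blinfun_apply (adj T') v)"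

text \<open>The Jordan inverse: the element \<open>y\<close> of the subalgebra generated by \<open>x\<close> with
  \<open>x \<star> y = junit\<close>. It is only relevant on the open dense set of invertible elements.\<close>

definition jinverse :: "'a::euclidean_jordan_algebra \<Rightarrow> 'a" where
  "jinverse x = (THE y. y \<in> span (range (jpow x)) \<and> x \<star> y = junit)"

text \<open>Representatives of the rational transformations generated by the translations, the structure
  group and the conformal inversion \<open>z \<mapsto> - z\<^sup>-\<^sup>1\<close>. Rational transformations are
  only compared on open dense sets, so the values of a representative outside its domain of
  definition play no role. (The inverses of the generators are again generators.)\<close>

inductive_set conformal_maps :: "('a::euclidean_jordan_algebra \<Rightarrow> 'a) set" where
  identity: "(\<lambda>z. z) \<in> conformal_maps"
| translation: "f \<in> conformal_maps \<Longrightarrow> (\<lambda>z. f z + a) \<in> conformal_maps"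
| structure_map: "f \<in> conformal_maps \<Longrightarrow> g \<in> structure_group \<Longrightarrow>
    (\<lambda>z. blinfun_apply g (f z)) \<in> conformal_maps"
| inversion: "f \<in> conformal_maps \<Longrightarrow> (\<lambda>z. - jinverse (f z)) \<in> conformal_maps"

definition pushes_forward ::
    "('a::euclidean_jordan_algebra \<Rightarrow> 'a) \<Rightarrow> 'a conf \<Rightarrow> 'a conf \<Rightarrow> bool" where
  "pushes_forward f X Y \<longleftrightarrow> (\<exists>U. open U \<and> closure U = UNIV \<and>
     (\<forall>z\<in>U. \<exists>D. (f has_derivative D) (at z) \<and> conf_field Y (f z) = D (conf_field X z)))"

text \<open>A conformal transformation acts on the Lie algebra by pushing forward vector fields (the
  adjoint action). This action is faithful: a map preserving all constant fields has derivative
  \<open>1\<close>, and a translation preserving the Euler field \<open>z\<close> is trivial. Hence the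
  conformal group is realised as a group of linear maps of the Lie algebra (extensional functions,
  in the sense of \<open>FuncSet\<close>), with the topology of pointwise convergence; on a group of linear
  maps of a finite-dimensional space this is the usual topology, and it is the Lie group topology
  of the conformal group.\<close>

definition conformal_group :: "('a::euclidean_jordan_algebra conf \<Rightarrow> 'a conf) set" where
  "conformal_group = {A \<in> co_alg \<rightarrow>\<^sub>E co_alg.
     \<exists>f\<in>conformal_maps. \<forall>X\<in>co_alg. pushes_forward f X (A X)}"

definition conformal_group_0 :: "('a::euclidean_jordan_algebra conf \<Rightarrow> 'a conf) set" where
  "conformal_group_0 = connected_component_set conformal_group (\<lambda>X\<in>co_alg. X)"

definition topological_group :: "'g::topological_space monoid \<Rightarrow> bool" where
  "topological_group H \<longleftrightarrow> group H \<and>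
     continuous_on (carrier H \<times> carrier H) (\<lambda>(g, h). g \<otimes>\<^bsub>H\<^esub> h) \<and>
     continuous_on (carrier H) (\<lambda>g. inv\<^bsub>H\<^esub> g)"

definition universal_cover_of_conformal_group ::
    "'g::topological_space monoid \<Rightarrow> ('g \<Rightarrow> 'a::euclidean_jordan_algebra conf \<Rightarrow> 'a conf) \<Rightarrow> bool"
  where
  "universal_cover_of_conformal_group H q \<longleftrightarrow>
     topological_group H \<and> simply_connected (carrier H) \<and>
     covering_space (carrier H) q conformal_group_0 \<and>
     (\<forall>g\<in>carrier H. \<forall>h\<in>carrier H. q (g \<otimes>\<^bsub>H\<^esub> h) = compose co_alg (q g) (q h))"

text \<open>The one-parameter subgroup of the covering group with tangent vector \<open>X\<close> at \<open>0\<close>. In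
  the adjoint realisation of the conformal group, the tangent vector \<open>X\<close> is the operator
  \<open>[X, \<cdot>]\<close>. The bracket \<^const>\<open>conf_bracket\<close> is the negative of the usual bracket of vector
  fields; so this is the flow of the vector field of \<open>X\<close>, not that of its negative.\<close>

definition one_parameter_subgroup ::
    "'g::topological_space monoid \<Rightarrow> ('g \<Rightarrow> 'a::euclidean_jordan_algebra conf \<Rightarrow> 'a conf) \<Rightarrow>
     'a conf \<Rightarrow> (real \<Rightarrow> 'g) \<Rightarrow> bool" where
  "one_parameter_subgroup H q X \<gamma> \<longleftrightarrow>
     continuous_on UNIV \<gamma> \<and> range \<gamma> \<subseteq> carrier H \<and>
     (\<forall>s t. \<gamma> (s + t) = \<gamma> s \<otimes>\<^bsub>H\<^esub> \<gamma> t) \<and>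
     (\<forall>Y\<in>co_alg. ((\<lambda>t. q (\<gamma> t) Y) has_vector_derivative conf_bracket X Y) (at 0))"

definition cover_exp ::
    "'g::topological_space monoid \<Rightarrow> ('g \<Rightarrow> 'a::euclidean_jordan_algebra conf \<Rightarrow> 'a conf) \<Rightarrow>
     'a conf \<Rightarrow> 'g" where
  "cover_exp H q X = (THE g. \<exists>\<gamma>. one_parameter_subgroup H q X \<gamma> \<and> g = \<gamma> 1)"

text \<open>Elements of the Hilbert space are represented by functions, and equality in the Hilbert space
  is equality almost everywhere.\<close>

definition L2 :: "'a measure \<Rightarrow> ('a \<Rightarrow> complex) set" where
  "L2 M = {f \<in> borel_measurable M. integrable M (\<lambda>x. (cmod (f x))\<^sup>2)}"

definition L2_inner :: "'a measure \<Rightarrow> ('a \<Rightarrow> complex) \<Rightarrow> ('a \<Rightarrow> complex) \<Rightarrow> complex" where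
  "L2_inner M f g = (LINT x|M. f x * cnj (g x))"

definition L2_norm :: "'a measure \<Rightarrow> ('a \<Rightarrow> complex) \<Rightarrow> real" where
  "L2_norm M f = sqrt (LINT x|M. (cmod (f x))\<^sup>2)"

definition L2_unitary :: "'a measure \<Rightarrow> (('a \<Rightarrow> complex) \<Rightarrow> 'a \<Rightarrow> complex) \<Rightarrow> bool" where
  "L2_unitary M U \<longleftrightarrow>
     (\<forall>f\<in>L2 M. U f \<in> L2 M) \<and>
     (\<forall>f\<in>L2 M. \<forall>g\<in>L2 M. \<forall>a b.
        AE x in M. U (\<lambda>y. a * f y + b * g y) x = a * U f x + b * U g x) \<and>
     (\<forall>f\<in>L2 M. \<forall>g\<in>L2 M. L2_inner M (U f) (U g) = L2_inner M f g) \<and>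
     (\<forall>g\<in>L2 M. \<exists>f\<in>L2 M. AE x in M. U f x = g x)"

definition L2_dense :: "'a measure \<Rightarrow> ('a \<Rightarrow> complex) set \<Rightarrow> bool" where
  "L2_dense M W \<longleftrightarrow> W \<subseteq> L2 M \<and>
     (\<forall>f\<in>L2 M. \<forall>\<epsilon>>0. \<exists>w\<in>W. L2_norm M (\<lambda>x. f x - w x) < \<epsilon>)"

definition L2_closed_subspace :: "'a measure \<Rightarrow> ('a \<Rightarrow> complex) set \<Rightarrow> bool" where
  "L2_closed_subspace M W \<longleftrightarrow> W \<subseteq> L2 M \<and> (\<lambda>x. 0) \<in> W \<and>
     (\<forall>f\<in>W. \<forall>g\<in>W. \<forall>a b. (\<lambda>x. a * f x + b * g x) \<in> W) \<and>
     (\<forall>f\<in>L2 M. (\<forall>\<epsilon>>0. \<exists>w\<in>W. L2_norm M (\<lambda>x. f x - w x) < \<epsilon>) \<longrightarrow> f \<in> W)"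

definition unitary_representation ::
    "'g::topological_space monoid \<Rightarrow> 'a measure \<Rightarrow>
     ('g \<Rightarrow> ('a \<Rightarrow> complex) \<Rightarrow> 'a \<Rightarrow> complex) \<Rightarrow> bool" where
  "unitary_representation H M \<pi> \<longleftrightarrow>
     (\<forall>g\<in>carrier H. L2_unitary M (\<pi> g)) \<and>
     (\<forall>g\<in>carrier H. \<forall>h\<in>carrier H. \<forall>f\<in>L2 M. AE x in M. \<pi> (g \<otimes>\<^bsub>H\<^esub> h) f x = \<pi> g (\<pi> h f) x) \<and>
     (\<forall>f\<in>L2 M. \<forall>g\<in>carrier H.
        ((\<lambda>h. L2_norm M (\<lambda>x. \<pi> h f x - \<pi> g f x)) \<longlongrightarrow> 0) (at g within carrier H))"

definition irreducible_representation ::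
    "'g::topological_space monoid \<Rightarrow> 'a measure \<Rightarrow>
     ('g \<Rightarrow> ('a \<Rightarrow> complex) \<Rightarrow> 'a \<Rightarrow> complex) \<Rightarrow> bool" where
  "irreducible_representation H M \<pi> \<longleftrightarrow>
     (\<exists>f\<in>L2 M. \<not> (AE x in M. f x = 0)) \<and>
     (\<forall>W. L2_closed_subspace M W \<and> (\<forall>g\<in>carrier H. \<forall>f\<in>W. \<pi> g f \<in> W) \<longrightarrow>
        W = L2 M \<or> (\<forall>f\<in>W. AE x in M. f x = 0))"

text \<open>\<open>f\<close> is in the domain of the derived representation at \<open>X\<close>, with image \<open>h\<close>.\<close>

definition derived_representation ::
    "'g::topological_space monoid \<Rightarrow> ('g \<Rightarrow> 'a::euclidean_jordan_algebra conf \<Rightarrow> 'a conf) \<Rightarrow>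
     'a measure \<Rightarrow> ('g \<Rightarrow> ('a \<Rightarrow> complex) \<Rightarrow> 'a \<Rightarrow> complex) \<Rightarrow>
     'a conf \<Rightarrow> ('a \<Rightarrow> complex) \<Rightarrow> ('a \<Rightarrow> complex) \<Rightarrow> bool" where
  "derived_representation H q M \<pi> X f h \<longleftrightarrow> f \<in> L2 M \<and> h \<in> L2 M \<and>
     ((\<lambda>t::real. L2_norm M
        (\<lambda>x. (\<pi> (cover_exp H q (t *\<^sub>R X)) f x - f x) / complex_of_real t - h x)) \<longlongrightarrow> 0) (at 0)"

definition L2_span :: "'a measure \<Rightarrow> ('a \<Rightarrow> complex) set \<Rightarrow> ('a \<Rightarrow> complex) set" where
  "L2_span M B = {f \<in> L2 M. \<exists>a. AE x in M. f x = (\<Sum>b\<in>B. a b * b x)}"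

text \<open>\<open>f\<close> lies in a finite-dimensional space stable under the derived action of \<^const>\<open>k_alg\<close>.\<close>

definition k_finite ::
    "'g::topological_space monoid \<Rightarrow> ('g \<Rightarrow> 'a::euclidean_jordan_algebra conf \<Rightarrow> 'a conf) \<Rightarrow>
     'a measure \<Rightarrow> ('g \<Rightarrow> ('a \<Rightarrow> complex) \<Rightarrow> 'a \<Rightarrow> complex) \<Rightarrow> ('a \<Rightarrow> complex) \<Rightarrow> bool" where
  "k_finite H q M \<pi> f \<longleftrightarrow> (\<exists>B. finite B \<and> B \<subseteq> L2 M \<and> f \<in> L2_span M B \<and>
     (\<forall>X\<in>k_alg. \<forall>b\<in>B. \<exists>h\<in>L2_span M B. derived_representation H q M \<pi> X b h))"

definition dir_deriv :: "'a::real_normed_vector \<Rightarrow> ('a \<Rightarrow> complex) \<Rightarrow> 'a \<Rightarrow> complex" where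
  "dir_deriv u f x = frechet_derivative f (at x) u"

text \<open>The component \<open>(v | B f)\<close> of the Bessel operator \<open>B\<close>; for complex-valued \<open>f\<close> the vector
  \<open>B f(x)\<close> lies in the complexification, and the trace form is extended bilinearly.\<close>

definition bessel_component ::
    "'a::euclidean_jordan_algebra \<Rightarrow> ('a \<Rightarrow> complex) \<Rightarrow> 'a \<Rightarrow> complex" where
  "bessel_component v f x =
     (\<Sum>a\<in>Basis. \<Sum>b\<in>Basis.
        dir_deriv a (dir_deriv b f) x * complex_of_real (inner v (blinfun_apply (jP2 a b) x)))
     + complex_of_real (jlambda TYPE('a)) * (\<Sum>a\<in>Basis. dir_deriv a f x * complex_of_real (inner v a))"

definition poly_exp :: "('a::euclidean_jordan_algebra \<Rightarrow> complex) \<Rightarrow> 'a \<Rightarrow> complex" where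
  "poly_exp F x = F x * complex_of_real (exp (- jtr x))"

text \<open>Functions whose restriction to the orbit is a restricted polynomial times \<open>exp (- jtr x)\<close>;
  values outside the orbit are irrelevant.\<close>

definition orbit_poly_exp :: "'a::euclidean_jordan_algebra \<Rightarrow> ('a \<Rightarrow> complex) set" where
  "orbit_poly_exp c = {u. \<exists>F. polynomial_function F \<and> (\<forall>x\<in>orbit c. u x = poly_exp F x)}"

definition minimal_representation ::
    "'g::topological_space monoid \<Rightarrow> ('g \<Rightarrow> 'a::euclidean_jordan_algebra conf \<Rightarrow> 'a conf) \<Rightarrow>
     'a \<Rightarrow> 'a measure \<Rightarrow> ('g \<Rightarrow> ('a \<Rightarrow> complex) \<Rightarrow> 'a \<Rightarrow> complex) \<Rightarrow> bool" where
  "minimal_representation H q c M \<pi> \<longleftrightarrow>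
     unitary_representation H M \<pi> \<and>
     irreducible_representation H M \<pi> \<and>
     (\<forall>f\<in>L2 M. k_finite H q M \<pi> f \<longleftrightarrow> (\<exists>u\<in>orbit_poly_exp c. AE x in M. f x = u x)) \<and>
     (\<forall>F. polynomial_function F \<longrightarrow>
       (\<forall>u. derived_representation H q M \<pi> (u, 0, 0) (poly_exp F)
              (\<lambda>x. \<i> * complex_of_real (inner u x) * poly_exp F x)) \<and>
       (\<forall>T\<in>str_alg. derived_representation H q M \<pi> (0, T, 0) (poly_exp F)
              (\<lambda>x. dir_deriv (blinfun_apply (adj T) x) (poly_exp F) x
                 + complex_of_real (rlambda TYPE('a) / (2 * real DIM('a)) * op_trace (adj T))
                     * poly_exp F x)) \<and>
       (\<forall>v. derived_representation H q M \<pi> (0, 0, v) (poly_exp F)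
              (\<lambda>x. \<i> * bessel_component v (poly_exp F) x)))"

definition unitary_inversion ::
    "'g::topological_space monoid \<Rightarrow> ('g \<Rightarrow> 'a::euclidean_jordan_algebra conf \<Rightarrow> 'a conf) \<Rightarrow>
     ('g \<Rightarrow> ('a \<Rightarrow> complex) \<Rightarrow> 'a \<Rightarrow> complex) \<Rightarrow> ('a \<Rightarrow> complex) \<Rightarrow> 'a \<Rightarrow> complex" where
  "unitary_inversion H q \<pi> u x =
     exp (- (complex_of_real pi * \<i> * complex_of_real (rlambda TYPE('a)) / 2))
       * \<pi> (cover_exp H q ((pi / 2) *\<^sub>R (junit, 0, - junit))) u x"

definition bessel_J :: "real \<Rightarrow> real \<Rightarrow> real" where
  "bessel_J \<alpha> t = (\<Sum>m. (-1) ^ m * rGamma (real m + \<alpha> + 1) / fact m * (t / 2) powr (2 * real m + \<alpha>))"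

text \<open>The even entire function \<open>(t/2)\<^sup>-\<^sup>\<alpha> J\<^sub>\<alpha>(t)\<close>, written as a power series so that it
  has the right value at \<open>0\<close>.\<close>

definition bessel_Jt :: "real \<Rightarrow> real \<Rightarrow> real" where
  "bessel_Jt \<alpha> t = (\<Sum>m. (-1) ^ m * rGamma (real m + \<alpha> + 1) / fact m * (t / 2) ^ (2 * m))"

lemma summable_bessel_Jt:
  "summable (\<lambda>m. (-1) ^ m * rGamma (real m + \<alpha> + 1) / fact m * (t / 2) ^ (2 * m))"
proof -
  define g where "g m = (-1) ^ m * rGamma (real m + \<alpha> + 1) / fact m * (t / 2) ^ (2 * m)" for m
  define N where "N = nat \<lceil>max (\<bar>\<alpha>\<bar>) (2 * (t / 2)\<^sup>2)\<rceil>"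
  have "norm (g (Suc m)) \<le> 1 / 2 * norm (g m)" if "m \<ge> N" for m
  proof -
    have "max (\<bar>\<alpha>\<bar>) (2 * (t / 2)\<^sup>2) \<le> real m"
      using that unfolding N_def by linarith
    then have m: "\<bar>\<alpha>\<bar> \<le> real m" "2 * (t / 2)\<^sup>2 \<le> real m" by auto
    define z where "z = real m + \<alpha> + 1"
    have z: "z \<ge> 1" using m by (simp add: z_def)
    have rec: "rGamma z = z * rGamma (z + 1)" by (rule rGamma_plus1[symmetric])
    have Suc: "real (Suc m) + \<alpha> + 1 = z + 1" by (simp add: z_def)
    have "norm (g (Suc m)) =
        \<bar>rGamma (z + 1)\<bar> / fact m * \<bar>t / 2\<bar> ^ (2 * m) * ((t / 2)\<^sup>2 / real (Suc m))"
      unfolding g_def Suc by (simp add: abs_mult power_abs power2_eq_square field_simps)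
    also have "\<dots> \<le> \<bar>rGamma z\<bar> / fact m * \<bar>t / 2\<bar> ^ (2 * m) * (1 / 2)"
    proof (intro mult_mono divide_right_mono)
      show "\<bar>rGamma (z + 1)\<bar> \<le> \<bar>rGamma z\<bar>"
        using z mult_right_mono[of 1 z "\<bar>rGamma (z + 1)\<bar>"] unfolding rec by (simp add: abs_mult)
      show "(t / 2)\<^sup>2 / real (Suc m) \<le> 1 / 2" using m by (simp add: divide_le_eq)
    qed auto
    also have "\<dots> = 1 / 2 * norm (g m)"
      by (simp add: g_def z_def[symmetric] abs_mult power_abs)
    finally show ?thesis .
  qed
  then have "summable g" by (intro summable_ratio_test[of "1/2" N g]) auto
  then show ?thesis unfolding g_def .
qed

lemma bessel_Jt_eq_bessel_J:
  assumes "t > 0"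
  shows "bessel_Jt \<alpha> t = (t / 2) powr (- \<alpha>) * bessel_J \<alpha> t"
proof -
  have *: "(t / 2) powr (2 * real m + \<alpha>) = (t / 2) powr \<alpha> * (t / 2) ^ (2 * m)" for m
  proof -
    have "(t / 2) powr (2 * real m + \<alpha>) = (t / 2) powr real (2 * m) * (t / 2) powr \<alpha>"
      by (simp add: powr_add)
    also have "(t / 2) powr real (2 * m) = (t / 2) ^ (2 * m)"
      using assms by (subst powr_realpow) auto
    finally show ?thesis by simp
  qed
  define g where "g m = (-1) ^ m * rGamma (real m + \<alpha> + 1) / fact m * (t / 2) ^ (2 * m)" for m
  have nz: "(t / 2) powr \<alpha> \<noteq> 0" using assms by simp
  have "bessel_J \<alpha> t = (\<Sum>m. (t / 2) powr \<alpha> * g m)"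
    unfolding bessel_J_def * g_def by (simp add: mult_ac)
  also have "\<dots> = (t / 2) powr \<alpha> * suminf g"
    using summable_bessel_Jt[of \<alpha> t, folded g_def] by (rule suminf_mult)
  finally show ?thesis
    using nz by (simp add: bessel_Jt_def g_def[abs_def] powr_minus)
qed

end

theory Submission
  imports Defs
begin

text \<open>Write \<open>D\<close> for the component of the Bessel operator along the unit, \<open>E\<close> for the Euler operator,
  \<open>M\<^sub>v\<close> for the multiplication by \<open>(v|x)\<close>, \<open>B\<^sub>v\<close> for the component \<open>v\<close> of the Bessel operator. The
  subgroup \<open>exp t(e, 0, -e)\<close> is, for small \<open>t\<close>, a product of three shears, so its derivative on
  \<open>F exp (- tr)\<close> follows from those of the translations and is \<open>i (2 E - D + r \<lambda>) F exp (- tr)\<close>. Hence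
  the inversion acts by \<open>(-1)\<^sup>k\<close> on the polynomials with \<open>(2 E - D) F = 2 k F\<close>. Put
  \<open>W\<^sub>v = M\<^sub>v - [D, M\<^sub>v] + B\<^sub>v\<close>. Decomposing \<open>M\<^sub>v\<close> and \<open>W\<^sub>v\<close> into eigenvectors of the commutator with
  \<open>2 E - D\<close> shows that the inversion maps \<open>W\<^sub>v\<^sub>1 \<dots> W\<^sub>v\<^sub>k 1\<close> to \<open>(-1)\<^sup>k (v\<^sub>1|x) \<dots> (v\<^sub>k|x)\<close>, up to the factor
  \<open>exp (- tr)\<close>. The Bessel transform does the same: \<open>W\<^sub>v\<close> is the transpose of \<open>B\<^sub>v\<close> for the integral
  against \<open>exp (- tr)\<close>, because \<open>d\<pi>(0, 0, e)\<close> is skew, and the kernel is an eigenfunction of \<open>B\<^sub>v\<close> with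
  eigenvalue \<open>- (v|x)\<close>. As the polynomials \<open>W\<^sub>v\<^sub>1 \<dots> W\<^sub>v\<^sub>k 1\<close> span all polynomials, the two agree. The
  normalisations \<open>tr e = r\<close> and \<open>|c\<^sub>1| = 1\<close> are read off from the action of the representation on
  polynomials of degree at most one.\<close>

section \<open>Idempotents in Euclidean Jordan algebras\<close>

text \<open>The operators come from conjugation by exp D. As [E, D] = - D, the operator 2 E - D is
  exp (- D/2) (2 E) exp (D/2), so on polynomials the inversion ought to be exp (- D/2) (-1)^E exp
  (D/2). Conjugation by it carries exp (- D) M_v exp D to - M_v, since (-1)^E changes the sign of
  both M_v and D under conjugation; this is the origin of W_v. The proof works with the expanded
  forms only. The obstacle is that the representation is given through derivatives along single
  generators, on polynomials times exp (- tr). They do not directly give the derivative along a sum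
  of generators, hence the shears. Moreover \<open>cover_exp\<close> is a definite description, so
  its subgroups must be shown to exist and to be unique; for this the matrices of SL(2,R) are
  realised by conformal maps and their paths are lifted to the covering group. The integration by
  parts behind the transposes is extracted from the unitarity of the representation, and the
  positivity of \<lambda> from the fact that the Hilbert space is not zero.\<close>

lemma bilinear_jmult: "bilinear ((\<star>) :: 'a::euclidean_jordan_algebra \<Rightarrow> 'a \<Rightarrow> 'a)"
  unfolding bilinear_def
  by (auto intro!: linearI simp: jmult_add_left jmult_scaleR_left)
     (metis jmult_add_left jmult_commute jmult_scaleR_left)+

interpretation jmult: bounded_bilinear "(\<star>) :: 'a::euclidean_jordan_algebra \<Rightarrow> 'a \<Rightarrow> 'a"
  using bilinear_jmult by (simp add: bilinear_conv_bounded_bilinear)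

lemmas jmult_simps = jmult.add_left jmult.add_right jmult.diff_left jmult.diff_right
  jmult.scaleR_left jmult.scaleR_right jmult.minus_left jmult.minus_right

lemma junit_right [simp]: "x \<star> junit = x"
  using junit_left jmult_commute by metis

declare junit_left [simp] jmult.zero_left [simp] jmult.zero_right [simp]

lemma linear_jmult [simp]: "linear (\<lambda>y. x \<star> y)"
  by (rule bounded_linear.linear[OF bounded_linear_jmult])

lemma inner_jmult': "inner (x \<star> y) z = inner x (y \<star> z)"
  using inner_jmult jmult_commute by metis

section \<open>The linearised Jordan identity and power associativity\<close>

lemma jordan_linearized:
  fixes x y z :: "'a::euclidean_jordan_algebra"
  shows "z \<star> ((x \<star> x) \<star> y) + 2 *\<^sub>R (x \<star> ((x \<star> z) \<star> y)) = 2 *\<^sub>R ((x \<star> z) \<star> (x \<star> y)) + (x \<star> x) \<star> (z \<star> y)"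
proof -
  let ?P = "\<lambda>x::'a. x \<star> ((x \<star> x) \<star> y)" and ?Q = "\<lambda>x::'a. (x \<star> x) \<star> (x \<star> y)"
  have eq: "?P x = ?Q x" for x by (rule jordan_identity)
  have zx: "z \<star> x = x \<star> z" by (rule jmult_commute)
  \<comment> \<open>For a map cubic in \<open>x\<close>, the difference of the values at
    \<open>x + z\<close> and \<open>x - z\<close> is twice the part linear in \<open>z\<close> plus
    twice the value at \<open>z\<close>.\<close>
  have "2 *\<^sub>R (z \<star> ((x \<star> x) \<star> y) + 2 *\<^sub>R (x \<star> ((x \<star> z) \<star> y))) = ?P (x + z) - ?P (x - z) - 2 *\<^sub>R ?P z"
    by (simp add: jmult_simps zx scaleR_2 algebra_simps)
  also have "\<dots> = ?Q (x + z) - ?Q (x - z) - 2 *\<^sub>R ?Q z" by (simp only: eq)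
  also have "\<dots> = 2 *\<^sub>R (2 *\<^sub>R ((x \<star> z) \<star> (x \<star> y)) + (x \<star> x) \<star> (z \<star> y))"
    by (simp add: jmult_simps zx scaleR_2 algebra_simps)
  finally show ?thesis by simp
qed

text \<open>Exchanging the roles of \<open>z\<close> and \<open>y\<close> in the linearised identity
  expresses multiplication by a^2 b through the multiplications by a, b, ab and a^2. Most Jordan
  identities below are instances of this one.\<close>

lemma jordan_triple_op:
  fixes a b w :: "'a::euclidean_jordan_algebra"
  shows "((a \<star> a) \<star> b) \<star> w
    = 2 *\<^sub>R ((a \<star> b) \<star> (a \<star> w)) + (a \<star> a) \<star> (b \<star> w) - 2 *\<^sub>R (a \<star> (b \<star> (a \<star> w)))"
proof -
  have 1: "b \<star> ((a \<star> a) \<star> w) + 2 *\<^sub>R (a \<star> ((a \<star> b) \<star> w))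
      = 2 *\<^sub>R ((a \<star> b) \<star> (a \<star> w)) + (a \<star> a) \<star> (b \<star> w)"
    by (rule jordan_linearized)
  have 2: "w \<star> ((a \<star> a) \<star> b) + 2 *\<^sub>R (a \<star> ((a \<star> w) \<star> b))
      = 2 *\<^sub>R ((a \<star> w) \<star> (a \<star> b)) + (a \<star> a) \<star> (w \<star> b)"
    by (rule jordan_linearized)
  show ?thesis
    using 2 by (simp add: jmult_commute[of w] jmult_commute[of _ b] jmult_commute[of "a \<star> w"] algebra_simps)
qed

text \<open>Multiplications by powers of \<open>x\<close> lie in the commutative algebra generated by
  multiplication by \<open>x\<close> and by \<open>x \<star> x\<close>; this gives power associativity.\<close>

lemma jpow_commutes:
  fixes x :: "'a::euclidean_jordan_algebra"
  assumes T: "linear T" "\<And>w. T (x \<star> w) = x \<star> T w" "\<And>w. T ((x \<star> x) \<star> w) = (x \<star> x) \<star> T w"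
  shows "T (jpow x n \<star> w) = jpow x n \<star> T w"
  using assms
proof (induction n arbitrary: T w rule: less_induct)
  case (less n)
  note T = less.prems
  consider "n = 0" | "n = 1" | m where "n = Suc (Suc m)" by (metis One_nat_def not0_implies_Suc)
  then show ?case
  proof cases
    case 3
    \<comment> \<open>The hypothesis is applied with multiplication by \<open>x\<close> in the role
      of \<open>T\<close>; this is why \<open>T\<close> is generalised in the induction.\<close>
    have comm: "x \<star> (jpow x k \<star> w) = jpow x k \<star> (x \<star> w)" if "k < n" for k w
      using less.IH[OF that, of "\<lambda>w. x \<star> w" w] by (simp add: jordan_identity)
    have "jpow x n = x \<star> (x \<star> jpow x m)" using 3 by simp
    also have "\<dots> = x \<star> (jpow x m \<star> x)" by (simp add: jmult_commute)
    also have "\<dots> = jpow x m \<star> (x \<star> x)" by (rule comm) (use 3 in simp)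
    also have "\<dots> = (x \<star> x) \<star> jpow x m" by (rule jmult_commute)
    finally have n: "jpow x n \<star> w = 2 *\<^sub>R (jpow x (Suc m) \<star> (x \<star> w)) + (x \<star> x) \<star> (jpow x m \<star> w)
        - 2 *\<^sub>R (x \<star> (jpow x m \<star> (x \<star> w)))" for w
      using jordan_triple_op[of x "jpow x m" w] by simp
    have IH: "T (jpow x m \<star> w) = jpow x m \<star> T w" "T (jpow x (Suc m) \<star> w) = jpow x (Suc m) \<star> T w" for w
      using less.IH[of m T] less.IH[of "Suc m" T] T 3 by auto
    show ?thesis
      unfolding n using T(1) by (simp only: linear_add linear_diff linear_scale T(2,3) IH)
  qed (use T in auto)
qed

lemma jpow_mult_commute:
  "jpow x m \<star> (jpow x n \<star> w) = jpow x n \<star> (jpow x m \<star> w)" for x :: "'a::euclidean_jordan_algebra"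
proof (rule jpow_commutes)
  show "jpow x m \<star> (x \<star> v) = x \<star> (jpow x m \<star> v)" for v
    using jpow_commutes[of "\<lambda>w. x \<star> w" x m v] linear_jmult
    by (metis jordan_identity)
  show "jpow x m \<star> ((x \<star> x) \<star> v) = (x \<star> x) \<star> (jpow x m \<star> v)" for v
    using jpow_commutes[of "\<lambda>w. (x \<star> x) \<star> w" x m v] linear_jmult
    by (metis jordan_identity)
qed (rule linear_jmult)

lemma jpow_add: "jpow x m \<star> jpow x n = jpow x (m + n)" for x :: "'a::euclidean_jordan_algebra"
proof (induction m)
  case (Suc m)
  have "jpow x (Suc m) \<star> jpow x n = jpow x n \<star> (jpow x 1 \<star> jpow x m)" by (simp add: jmult_commute)
  also have "\<dots> = jpow x 1 \<star> (jpow x n \<star> jpow x m)" by (rule jpow_mult_commute)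
  also have "\<dots> = x \<star> jpow x (m + n)" using Suc by (simp add: jmult_commute)
  finally show ?case by simp
qed simp

section \<open>The subalgebra generated by one element and the spectral theorem\<close>

definition jalg :: "'a::euclidean_jordan_algebra \<Rightarrow> 'a set" where
  "jalg x = span (range (jpow x))"

lemma subspace_jalg [simp]: "subspace (jalg x)" by (simp add: jalg_def)

lemma jpow_in_jalg [simp]: "jpow x n \<in> jalg x" by (simp add: jalg_def span_base)

lemma junit_in_jalg [simp]: "junit \<in> jalg x" using jpow_in_jalg[of x 0] by simp

lemma self_in_jalg [simp]: "x \<in> jalg x" using jpow_in_jalg[of x 1] by simp

lemma jalg_induct [consumes 1, case_names zero pow]:
  assumes "y \<in> jalg x" "P 0" "\<And>c n y. P y \<Longrightarrow> P (c *\<^sub>R jpow x n + y)"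
  shows "P y"
  using assms(1) unfolding jalg_def
  by (induction rule: span_induct_alt) (use assms(2,3) in auto)

text \<open>The vector \<open>w\<close> is arbitrary: the multiplications commute as operators on
  the whole algebra, which is more than associativity inside \<open>jalg x\<close> and is what the
  identities for inverses require.\<close>

lemma jalg_commute:
  assumes "a \<in> jalg x" "b \<in> jalg x"
  shows "a \<star> (b \<star> w) = b \<star> (a \<star> w)"
  using assms(1)
proof (induction rule: jalg_induct)
  case (pow c n y)
  have "jpow x n \<star> (b \<star> w) = b \<star> (jpow x n \<star> w)"
    using assms(2) by (induction rule: jalg_induct) (simp_all add: jmult_simps jpow_mult_commute)
  with pow show ?case by (simp add: jmult_simps)
qed simp

lemma jalg_assoc: "a \<in> jalg x \<Longrightarrow> b \<in> jalg x \<Longrightarrow> (a \<star> b) \<star> w = a \<star> (b \<star> w)" if "w \<in> jalg x"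
  using jalg_commute[of w x a b] that by (metis jmult_commute)

lemma jalg_mult: assumes "a \<in> jalg x" "b \<in> jalg x" shows "a \<star> b \<in> jalg x"
  using assms(1)
proof (induction rule: jalg_induct)
  case (pow c n y)
  have "jpow x n \<star> b \<in> jalg x" using assms(2)
    by (induction rule: jalg_induct)
       (auto simp: jmult_simps jpow_add intro!: subspace_add[OF subspace_jalg] subspace_scale[OF subspace_jalg] subspace_0[OF subspace_jalg])
  with pow show ?case by (simp add: jmult_simps subspace_add subspace_scale)
qed (simp add: subspace_0)

lemma jalg_subset: assumes "a \<in> jalg x" shows "jalg a \<subseteq> jalg x"
proof -
  have "jpow a n \<in> jalg x" for n by (induction n) (auto intro: jalg_mult assms)
  then show ?thesis unfolding jalg_def[of a] by (intro span_minimal) auto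
qed

text \<open>A maximiser of the Rayleigh quotient on the unit sphere of \<open>N\<close> is an
  eigenvector: moving it along its residual \<open>w\<close> would otherwise increase the quotient
  to first order.\<close>

lemma selfadjoint_eigenvector:
  fixes T :: "'a::euclidean_space \<Rightarrow> 'a"
  assumes N: "subspace N" "N \<noteq> {0}" and T: "linear T" "\<And>x. x \<in> N \<Longrightarrow> T x \<in> N"
    and sym: "\<And>x y. x \<in> N \<Longrightarrow> y \<in> N \<Longrightarrow> inner (T x) y = inner x (T y)"
  obtains v \<mu> where "v \<in> N" "v \<noteq> 0" "T v = \<mu> *\<^sub>R v"
proof -
  let ?S = "sphere 0 1 \<inter> N"
  have comp: "compact ?S" using closed_subspace[OF N(1)] by (simp add: compact_Int_closed)
  obtain x where x: "x \<in> N" "x \<noteq> 0" using N subspace_0 by blast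
  have ne: "(1 / norm x) *\<^sub>R x \<in> ?S" using x N by (simp add: subspace_scale)
  interpret T: bounded_linear T using T(1) by (simp add: linear_conv_bounded_linear)
  have "continuous_on ?S (\<lambda>x. inner (T x) x)" by (intro continuous_intros T.continuous_on)
  then obtain a where a: "a \<in> ?S" and max: "\<And>y. y \<in> ?S \<Longrightarrow> inner (T y) y \<le> inner (T a) a"
    using continuous_attains_sup[OF comp, of "\<lambda>x. inner (T x) x"] ne by blast
  define M where "M = inner (T a) a"
  have le: "inner (T y) y \<le> M * inner y y" if "y \<in> N" for y
  proof (cases "y = 0")
    case False
    have "inner (T ((1 / norm y) *\<^sub>R y)) ((1 / norm y) *\<^sub>R y) \<le> M"
      unfolding M_def by (rule max) (use that False N in \<open>simp add: subspace_scale\<close>)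
    then show ?thesis using False
      by (simp add: T.scaleR divide_le_eq dot_square_norm power2_eq_square mult.assoc)
  qed simp
  define w where "w = T a - M *\<^sub>R a"
  have aN: "a \<in> N" "norm a = 1" using a by auto
  then have aa: "inner a a = 1" by (simp add: dot_square_norm)
  have wN: "w \<in> N" unfolding w_def by (intro subspace_diff subspace_scale N aN T)
  define q where "q = inner (T w) w - M * inner w w"
  have "w = 0"
  proof (rule ccontr)
    assume "w \<noteq> 0"
    then have W: "inner w w > 0" by simp
    \<comment> \<open>So small that the quadratic term \<open>t * q\<close> stays below the
      first-order gain \<open>inner w w\<close>.\<close>
    define t where "t = inner w w / (\<bar>q\<bar> + 1)"
    have t: "t > 0" using W by (simp add: t_def add_pos_nonneg)
    have "inner (T (a + t *\<^sub>R w)) (a + t *\<^sub>R w) \<le> M * inner (a + t *\<^sub>R w) (a + t *\<^sub>R w)"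
      by (rule le) (intro subspace_add subspace_scale N aN wN)
    moreover have "inner (T w) a = inner w (T a)" by (rule sym[OF wN aN(1)])
    then have "inner (T (a + t *\<^sub>R w)) (a + t *\<^sub>R w) = M + 2 * t * inner w (T a) + t * t * inner (T w) w"
      by (simp add: T.add T.scaleR inner_add_left inner_add_right M_def inner_commute[of "T a" w] algebra_simps)
    moreover have "M * inner (a + t *\<^sub>R w) (a + t *\<^sub>R w) = M + 2 * t * (M * inner w a) + t * t * (M * inner w w)"
      using aa by (simp only: inner_add_left inner_add_right inner_commute[of a w] inner_scaleR_left
          inner_scaleR_right) (simp add: algebra_simps)
    ultimately have "2 * t * (inner w (T a) - M * inner w a) + t * t * q \<le> 0"
      by (simp add: q_def algebra_simps)
    moreover have "inner w (T a) - M * inner w a = inner w w" by (simp add: w_def inner_diff_right)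
    ultimately have "t * (2 * inner w w + t * q) \<le> 0" by (simp add: algebra_simps)
    then have "2 * inner w w + t * q \<le> 0" using t by (simp add: mult_le_0_iff)
    moreover have "\<bar>t * q\<bar> \<le> inner w w"
    proof -
      have "\<bar>t * q\<bar> = inner w w * (\<bar>q\<bar> / (\<bar>q\<bar> + 1))" by (simp add: t_def abs_mult)
      also have "\<dots> \<le> inner w w * 1" by (intro mult_left_mono) auto
      finally show ?thesis by simp
    qed
    ultimately show False using W by linarith
  qed
  moreover have "a \<noteq> 0" using aN(2) by auto
  ultimately show ?thesis using that[of a M] aN by (simp add: w_def)
qed

definition orthogonal_idempotents :: "'a::euclidean_jordan_algebra set \<Rightarrow> bool" where
  "orthogonal_idempotents C \<longleftrightarrow> finite C \<and> (\<forall>c\<in>C. c \<star> c = c \<and> c \<noteq> 0) \<and>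
     (\<forall>c\<in>C. \<forall>d\<in>C. c \<noteq> d \<longrightarrow> c \<star> d = 0)"

text \<open>A minimal ideal of an associative subalgebra consists of common eigenvectors of all
  multiplications, so it is spanned by an idempotent.\<close>

lemma associative_subalgebra_spectral:
  fixes S :: "'a::euclidean_jordan_algebra set"
  assumes "subspace S" "\<And>a b. a \<in> S \<Longrightarrow> b \<in> S \<Longrightarrow> a \<star> b \<in> S"
    and "\<And>a b w. a \<in> S \<Longrightarrow> b \<in> S \<Longrightarrow> w \<in> S \<Longrightarrow> a \<star> (b \<star> w) = b \<star> (a \<star> w)"
  shows "\<exists>C. orthogonal_idempotents C \<and> C \<subseteq> S \<and> span C = S"
  using assms
proof (induction "dim S" arbitrary: S rule: less_induct)
  case less
  note S = less.prems
  show ?case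
  proof (cases "S = {0}")
    case True
    then show ?thesis by (intro exI[of _ "{}"]) (simp add: orthogonal_idempotents_def)
  next
    case False
    define \<N> where "\<N> = {N. subspace N \<and> N \<noteq> {0} \<and> N \<subseteq> S \<and> (\<forall>b\<in>S. \<forall>v\<in>N. b \<star> v \<in> N)}"
    have "S \<in> \<N>" using S False by (auto simp: \<N>_def)
    then obtain N where N: "N \<in> \<N>" and min: "\<And>N'. N' \<in> \<N> \<Longrightarrow> dim N \<le> dim N'"
      using ex_has_least_nat[of "\<lambda>N. N \<in> \<N>" S dim] by blast
    have Ns: "subspace N" "N \<noteq> {0}" "N \<subseteq> S" "\<And>b v. b \<in> S \<Longrightarrow> v \<in> N \<Longrightarrow> b \<star> v \<in> N"
      using N by (auto simp: \<N>_def)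
    have scalar: "\<exists>\<mu>. \<forall>v\<in>N. b \<star> v = \<mu> *\<^sub>R v" if b: "b \<in> S" for b
    proof -
      obtain v \<mu> where v: "v \<in> N" "v \<noteq> 0" "b \<star> v = \<mu> *\<^sub>R v"
        using selfadjoint_eigenvector[OF Ns(1,2), of "\<lambda>v. b \<star> v"] Ns(4)[OF b] inner_jmult
        by (metis bounded_linear.linear bounded_linear_jmult)
      \<comment> \<open>The eigenspace of \<open>b\<close> inside \<open>N\<close> is again stable
        under \<open>S\<close>, because the multiplications commute; minimality of \<open>N\<close>
        makes it all of \<open>N\<close>.\<close>
      define N' where "N' = {v \<in> N. b \<star> v = \<mu> *\<^sub>R v}"
      have sub: "subspace N'" using Ns(1)
        by (auto simp: N'_def subspace_def jmult_simps algebra_simps)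
      have "N' \<in> \<N>" unfolding \<N>_def
      proof (intro CollectI conjI ballI sub)
        show "N' \<noteq> {0}" using v by (auto simp: N'_def)
        show "N' \<subseteq> S" using Ns(3) by (auto simp: N'_def)
        fix b' w assume b': "b' \<in> S" and w: "w \<in> N'"
        have "b \<star> (b' \<star> w) = b' \<star> (b \<star> w)" using S(3)[OF b b'] w Ns(3) by (auto simp: N'_def)
        then show "b' \<star> w \<in> N'" using w b' Ns(4) by (auto simp: N'_def jmult_simps)
      qed
      then have "dim N \<le> dim N'" by (rule min)
      then have "N' = N" using subspace_dim_equal[OF sub Ns(1)] by (auto simp: N'_def)
      then show ?thesis by (auto simp: N'_def)
    qed
    obtain a where a: "a \<in> N" "a \<noteq> 0" using Ns subspace_0 by blast
    obtain \<mu> where \<mu>: "a \<star> a = \<mu> *\<^sub>R a" using scalar[of a] a Ns by blast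
    \<comment> \<open>Positivity of the inner product excludes a square zero, so \<open>a\<close>
      can be rescaled to an idempotent.\<close>
    have "inner (a \<star> a) junit = inner a a" by (simp add: inner_jmult)
    then have "\<mu> \<noteq> 0" using \<mu> a by auto
    define c where "c = (1 / \<mu>) *\<^sub>R a"
    have c: "c \<in> N" "c \<noteq> 0" "c \<star> c = c"
      using a \<mu> \<open>\<mu> \<noteq> 0\<close> Ns(1) by (simp_all add: c_def subspace_scale jmult_simps)
    then have c: "c \<in> N" "c \<noteq> 0" "c \<star> c = c" "c \<in> S" using Ns(3) by auto
    \<comment> \<open>Every multiplication from \<open>S\<close> acts on \<open>c\<close> as a
      scalar, so \<open>S\<close> is the span of \<open>c\<close> plus the annihilator of
      \<open>c\<close>, and the induction continues in the latter.\<close>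
    define S' where "S' = {b \<in> S. b \<star> c = 0}"
    have sub': "subspace S'" using S(1) by (auto simp: S'_def subspace_def jmult_simps)
    have "dim S' < dim S"
    proof -
      have "c \<notin> S'" using c by (simp add: S'_def)
      moreover have "S' \<subseteq> S" by (auto simp: S'_def)
      ultimately have "S' \<subset> S" using c(4) by blast
      then show ?thesis using dim_subset[of S' S] subspace_dim_equal[OF sub' S(1)] by fastforce
    qed
    moreover have "a \<star> b \<in> S'" if "a \<in> S'" "b \<in> S'" for a b
    proof -
      have "c \<star> (a \<star> b) = a \<star> (c \<star> b)" using that c by (intro S(3)) (auto simp: S'_def)
      then show ?thesis using that S(2) by (auto simp: S'_def jmult_commute)
    qed
    moreover have "a \<star> (b \<star> w) = b \<star> (a \<star> w)" if "a \<in> S'" "b \<in> S'" "w \<in> S'" for a b w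
      using that S(3) by (auto simp: S'_def)
    ultimately obtain C where C: "orthogonal_idempotents C" "C \<subseteq> S'" "span C = S'"
      using less.hyps[of S'] sub' by blast
    have "orthogonal_idempotents (insert c C)"
      unfolding orthogonal_idempotents_def
    proof (intro conjI ballI impI)
      fix x y assume xy: "x \<in> insert c C" "y \<in> insert c C" "x \<noteq> y"
      have "w \<star> c = 0" "c \<star> w = 0" if "w \<in> C" for w
        using that C(2) jmult_commute[of c w] by (auto simp: S'_def)
      then show "x \<star> y = 0" using xy C(1) by (auto simp: orthogonal_idempotents_def)
    qed (use C(1) c in \<open>auto simp: orthogonal_idempotents_def\<close>)
    moreover have "insert c C \<subseteq> S" using C c by (auto simp: S'_def)
    moreover have "b \<in> span (insert c C)" if b: "b \<in> S" for b
    proof -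
      obtain \<nu> where \<nu>: "b \<star> c = \<nu> *\<^sub>R c" using scalar[OF b] c by blast
      have "b - \<nu> *\<^sub>R c \<in> S'"
        using b c S(1) \<nu> by (auto simp: S'_def subspace_diff subspace_scale jmult_simps)
      then show ?thesis using C(3) by (auto simp: span_insert)
    qed
    ultimately show ?thesis
      using span_minimal[of "insert c C" S] S(1) by (intro exI[of _ "insert c C"]) auto
  qed
qed

lemma orthogonal_idempotents_sum_mult:
  assumes "orthogonal_idempotents C" "d \<in> C"
  shows "(\<Sum>c\<in>C. f c *\<^sub>R c) \<star> d = f d *\<^sub>R d"
proof -
  have "(\<Sum>c\<in>C. f c *\<^sub>R c) \<star> d = (\<Sum>c\<in>C. if c = d then f d *\<^sub>R d else 0)"
    unfolding jmult.sum_left using assms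
    by (intro sum.cong) (auto simp: orthogonal_idempotents_def jmult_simps)
  then show ?thesis using assms by (simp add: orthogonal_idempotents_def)
qed

lemma orthogonal_idempotents_sum_mult_sum:
  assumes "orthogonal_idempotents C"
  shows "(\<Sum>c\<in>C. f c *\<^sub>R c) \<star> (\<Sum>c\<in>C. g c *\<^sub>R c) = (\<Sum>c\<in>C. (f c * g c) *\<^sub>R c)"
  unfolding jmult.sum_right
  by (intro sum.cong) (simp_all add: jmult_simps orthogonal_idempotents_sum_mult[OF assms] mult.commute)

lemma spectral_jalg:
  fixes x :: "'a::euclidean_jordan_algebra"
  obtains C f where "orthogonal_idempotents C" "C \<subseteq> jalg x" "\<Sum>C = junit" "x = (\<Sum>c\<in>C. f c *\<^sub>R c)"
proof -
  obtain C where C: "orthogonal_idempotents C" "C \<subseteq> jalg x" "span C = jalg x"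
    using associative_subalgebra_spectral[of "jalg x"] jalg_mult jalg_commute by (metis subspace_jalg)
  have fin: "finite C" using C by (simp add: orthogonal_idempotents_def)
  have rep: "\<exists>f. y = (\<Sum>c\<in>C. f c *\<^sub>R c)" if "y \<in> jalg x" for y
    using that C(3) span_finite[OF fin] by auto
  obtain f where f: "x = (\<Sum>c\<in>C. f c *\<^sub>R c)" using rep[of x] by auto
  obtain g where g: "junit = (\<Sum>c\<in>C. g c *\<^sub>R c)" using rep[of junit] by auto
  have "g c *\<^sub>R c = c" if "c \<in> C" for c
    using orthogonal_idempotents_sum_mult[OF C(1) that, of g] by (simp flip: g)
  then have "\<Sum>C = junit" using g by simp
  then show ?thesis using that C f by blast
qed

section \<open>Peirce eigenspaces and primitive idempotents\<close>

lemma peirce_mult: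
  assumes "c \<star> c = c" "c \<star> y = i *\<^sub>R y" "c \<star> z = j *\<^sub>R z" "j \<noteq> 1 / 2"
  shows "c \<star> (y \<star> z) = i *\<^sub>R (y \<star> z)"
proof -
  have "i *\<^sub>R (y \<star> z) = (2 * i * j) *\<^sub>R (y \<star> z) + c \<star> (y \<star> z) - (2 * j) *\<^sub>R (c \<star> (y \<star> z))"
    using jordan_triple_op[of c y z] assms(1-3) by (simp add: jmult_simps mult_ac)
  \<comment> \<open>The factor vanishes exactly at the Peirce eigenvalue 1/2, which is therefore
    excluded for \<open>z\<close>.\<close>
  then have "(1 - 2 * j) *\<^sub>R (c \<star> (y \<star> z)) = (1 - 2 * j) *\<^sub>R (i *\<^sub>R (y \<star> z))"
    by (simp add: algebra_simps)
  moreover have "1 - 2 * j \<noteq> 0" using assms(4) by auto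
  ultimately show ?thesis using scaleR_left_imp_eq by blast
qed

text \<open>Multiplication by an idempotent is annihilated by t (2 t - 1) (t - 1); this is
  \<open>jordan_triple_op\<close> with both arguments equal to \<open>c\<close>.\<close>

lemma peirce_cubic:
  assumes "c \<star> c = c"
  shows "2 *\<^sub>R (c \<star> (c \<star> (c \<star> w))) = 3 *\<^sub>R (c \<star> (c \<star> w)) - c \<star> w"
proof -
  have "c \<star> w = 2 *\<^sub>R (c \<star> (c \<star> w)) + c \<star> (c \<star> w) - 2 *\<^sub>R (c \<star> (c \<star> (c \<star> w)))"
    using jordan_triple_op[of c c w] assms by simp
  moreover have "3 *\<^sub>R u = 2 *\<^sub>R u + u" for u :: 'a
    using scaleR_add_left[of 2 1 u] by simp
  ultimately show ?thesis by (simp add: algebra_simps)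
qed

lemma peirce_one_mult: "c \<star> c = c \<Longrightarrow> c \<star> y = y \<Longrightarrow> c \<star> z = z \<Longrightarrow> c \<star> (y \<star> z) = y \<star> z"
  using peirce_mult[of c y 1 z 1] by simp

lemma peirce_one_zero:
  assumes "c \<star> c = c" "c \<star> y = y" "c \<star> z = 0"
  shows "y \<star> z = 0"
proof -
  have "c \<star> (y \<star> z) = 1 *\<^sub>R (y \<star> z)" by (rule peirce_mult[of c y 1 z 0]) (use assms in auto)
  moreover have "c \<star> (z \<star> y) = 0 *\<^sub>R (z \<star> y)" by (rule peirce_mult[of c z 0 y 1]) (use assms in auto)
  ultimately show ?thesis by (simp add: jmult_commute)
qed

text \<open>Each spectral idempotent of \<open>y\<close> with nonzero coefficient is fixed by
  multiplication by \<open>c\<close>. It then splits off from \<open>c\<close>, so it equals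
  \<open>c\<close> by primitivity.\<close>

lemma primitive_peirce_one:
  assumes c: "primitive_idempotent c" and y: "c \<star> y = y"
  shows "\<exists>s. y = s *\<^sub>R c"
proof -
  have cc: "c \<star> c = c" using c by (simp add: primitive_idempotent_def)
  obtain C f where C: "orthogonal_idempotents C" "C \<subseteq> jalg y" and f: "y = (\<Sum>c\<in>C. f c *\<^sub>R c)"
    by (rule spectral_jalg)
  have cpow: "c \<star> jpow y (Suc n) = jpow y (Suc n)" for n
    by (induction n) (use y in \<open>simp_all add: peirce_one_mult[OF cc y]\<close>)
  \<comment> \<open>All positive powers of \<open>y\<close> are fixed by \<open>c\<close>. The
    zeroth power is the unit of the whole algebra instead of \<open>c\<close>, which accounts for
    the correction by \<open>c - junit\<close>.\<close>
  have ex: "\<exists>\<alpha>. c \<star> w = w + \<alpha> *\<^sub>R (c - junit)" if "w \<in> jalg y" for w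
    using that
  proof (induction rule: jalg_induct)
    case zero
    then show ?case by (auto intro: exI[of _ 0])
  next
    case (pow s n w)
    then obtain \<alpha> where \<alpha>: "c \<star> w = w + \<alpha> *\<^sub>R (c - junit)" by blast
    show ?case
    proof (cases n)
      case 0
      then show ?thesis using \<alpha>
        by (intro exI[of _ "s + \<alpha>"]) (simp add: jmult_simps algebra_simps)
    next
      case (Suc m)
      then show ?thesis using \<alpha> cpow[of m]
        by (intro exI[of _ \<alpha>]) (simp add: jmult.add_right jmult.scaleR_right del: jpow.simps)
    qed
  qed
  have eq: "d = c" if d: "d \<in> C" "f d \<noteq> 0" for d
  proof -
    have dd: "d \<star> d = d" "d \<noteq> 0" using C d by (auto simp: orthogonal_idempotents_def)
    obtain \<alpha> where \<alpha>: "c \<star> d = d + \<alpha> *\<^sub>R (c - junit)" using ex C d by blast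
    \<comment> \<open>The component \<open>v\<close> of \<open>d\<close> is fixed by
      \<open>c\<close>, and \<open>y\<close> does not see the difference of \<open>d\<close> and
      \<open>v\<close>. Thus \<open>y \<star> d\<close>, a nonzero multiple of \<open>d\<close>, is
      fixed by \<open>c\<close>.\<close>
    define v where "v = c \<star> d"
    have v: "c \<star> v = v" unfolding v_def \<alpha>
      by (simp add: jmult_simps cc) (simp add: \<alpha> algebra_simps)
    have dv: "d = v - \<alpha> *\<^sub>R (c - junit)" by (simp add: v_def \<alpha>)
    have "y \<star> d = y \<star> v" unfolding dv using y by (simp add: jmult_simps jmult_commute)
    then have "c \<star> (y \<star> d) = y \<star> d" using peirce_one_mult[OF cc y v] by simp
    moreover have "y \<star> d = f d *\<^sub>R d" using orthogonal_idempotents_sum_mult[OF C(1) d(1), of f] f by simp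
    ultimately have cd: "c \<star> d = d" using d by (simp add: jmult_simps)
    have "(c - d) \<star> (c - d) = c - d" "d \<star> (c - d) = 0"
      using cd dd cc by (simp_all add: jmult_simps jmult_commute[of d c])
    then have "d = 0 \<or> c - d = 0" using c dd unfolding primitive_idempotent_def by (metis add.commute diff_add_cancel)
    then show ?thesis using dd by simp
  qed
  show ?thesis
  proof (cases "\<exists>d\<in>C. f d \<noteq> 0")
    case True
    then have "c \<in> C" using eq by metis
    have "y = (\<Sum>d\<in>C. if d = c then f c *\<^sub>R c else 0)"
      unfolding f by (rule sum.cong) (use eq in \<open>auto\<close>)
    then show ?thesis using \<open>c \<in> C\<close> C(1) by (auto simp: orthogonal_idempotents_def)
  next
    case False
    then show ?thesis using f by (auto intro!: exI[of _ 0])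
  qed
qed

text \<open>The left side is P(c) w, which lies in the eigenspace of \<open>c\<close> for the
  eigenvalue 1, a line for primitive \<open>c\<close>. Pairing with \<open>c\<close> gives the
  coefficient.\<close>

lemma primitive_jP:
  assumes c: "primitive_idempotent c"
  shows "2 *\<^sub>R (c \<star> (c \<star> w)) - c \<star> w = (inner w c / inner c c) *\<^sub>R c"
proof -
  have cc: "c \<star> c = c" "c \<noteq> 0" using c by (simp_all add: primitive_idempotent_def)
  have "c \<star> (2 *\<^sub>R (c \<star> (c \<star> w)) - c \<star> w) = 2 *\<^sub>R (c \<star> (c \<star> w)) - c \<star> w"
    using peirce_cubic[OF cc(1), of w] scaleR_add_left[of 2 1 "c \<star> (c \<star> w)"]
    by (simp add: jmult_simps algebra_simps)
  then obtain s where s: "2 *\<^sub>R (c \<star> (c \<star> w)) - c \<star> w = s *\<^sub>R c"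
    using primitive_peirce_one[OF c] by blast
  have "inner (2 *\<^sub>R (c \<star> (c \<star> w)) - c \<star> w) c = inner w c"
    by (simp add: inner_diff_left inner_jmult cc)
  then have "s * inner c c = inner w c" by (simp add: s)
  then show ?thesis using cc s by (simp add: field_simps)
qed

lemma primitive_mult_norm:
  assumes c: "primitive_idempotent c"
  shows "2 * inner (c \<star> d) (c \<star> d) - inner (c \<star> d) d = (inner c d)\<^sup>2 / inner c c"
proof -
  have "2 * inner (c \<star> d) (c \<star> d) - inner (c \<star> d) d = inner (2 *\<^sub>R (c \<star> (c \<star> d)) - c \<star> d) d"
    by (simp only: inner_diff_left inner_scaleR_left inner_jmult[of c "c \<star> d" d])
  also have "\<dots> = (inner c d)\<^sup>2 / inner c c"
    unfolding primitive_jP[OF c] by (simp add: inner_commute[of d c] power2_eq_square)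
  finally show ?thesis .
qed

text \<open>The left side of \<open>primitive_mult_norm\<close> becomes symmetric in the two
  idempotents, so its right side must be symmetric too.\<close>

lemma primitive_norm_eq:
  assumes "primitive_idempotent c" "primitive_idempotent d" "inner c d \<noteq> 0"
  shows "inner c c = inner d d"
proof -
  have cc: "c \<star> c = c" "d \<star> d = d" "c \<noteq> 0" "d \<noteq> 0"
    using assms by (simp_all add: primitive_idempotent_def)
  have 1: "inner (c \<star> d) d = inner c d" by (simp only: inner_jmult' cc)
  have 2: "inner (c \<star> d) c = inner c d" by (simp only: inner_jmult cc inner_commute[of d c])
  show ?thesis
    using primitive_mult_norm[OF assms(1), of d] primitive_mult_norm[OF assms(2), of c] assms(3) cc
    by (simp only: 1 2 jmult_commute[of d c] inner_commute[of d c]) auto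
qed

lemma primitive_orthogonal:
  assumes "primitive_idempotent c" "primitive_idempotent d" "inner c d = 0"
  shows "c \<star> d = 0"
proof -
  have "d \<star> d = d" using assms by (simp add: primitive_idempotent_def)
  then have "inner (c \<star> d) d = 0" using assms(3) by (simp only: inner_jmult')
  then show ?thesis using primitive_mult_norm[OF assms(1), of d] assms(3) by simp
qed

text \<open>Boundedness of the product keeps nonzero idempotents away from 0. This makes the
  repeated splitting of idempotents terminate.\<close>

lemma idempotent_norm_bound:
  obtains \<delta> where "\<delta> > 0" "\<And>c::'a::euclidean_jordan_algebra. c \<star> c = c \<Longrightarrow> c \<noteq> 0 \<Longrightarrow> inner c c \<ge> \<delta>"
proof -
  obtain K where K: "K > 0" "\<And>x y::'a. norm (x \<star> y) \<le> norm x * norm y * K"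
    using jmult.pos_bounded by blast
  have "inner c c \<ge> (1 / K)\<^sup>2" if "c \<star> c = c" "c \<noteq> 0" for c :: 'a
  proof -
    have "norm c \<le> norm c * norm c * K" using K(2)[of c c] that by simp
    then have "1 / K \<le> norm c" using that K(1) by (simp add: divide_le_eq mult.commute)
    then have "(1 / K)\<^sup>2 \<le> (norm c)\<^sup>2" using K(1) by (intro power_mono) auto
    then show ?thesis by (simp add: dot_square_norm)
  qed
  then show ?thesis using K(1) by (intro that[of "(1 / K)\<^sup>2"]) auto
qed

lemma idempotents_below_orthogonal:
  assumes "a \<star> a = a" "b \<star> b = b" "a \<star> b = 0" "a \<star> c = c" "b \<star> d = d"
  shows "c \<star> d = 0"
proof -
  have "b \<star> a = 0" using assms(3) by (simp add: jmult_commute)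
  then have "d \<star> a = 0" using peirce_one_zero[of b d a] assms by simp
  then have "a \<star> d = 0" by (simp add: jmult_commute)
  then show ?thesis using peirce_one_zero[of a c d] assms by simp
qed

lemma idempotent_primitive_decomposition:
  fixes p :: "'a::euclidean_jordan_algebra"
  assumes "p \<star> p = p"
  shows "\<exists>C. orthogonal_idempotents C \<and> (\<forall>c\<in>C. primitive_idempotent c \<and> p \<star> c = c) \<and> \<Sum>C = p"
proof -
  obtain \<delta> where \<delta>: "\<delta> > 0" "\<And>c::'a. c \<star> c = c \<Longrightarrow> c \<noteq> 0 \<Longrightarrow> inner c c \<ge> \<delta>"
    using idempotent_norm_bound by blast
  show ?thesis using assms
  \<comment> \<open>In a splitting p = a + b each summand has squared norm at least
    \<open>\<delta>\<close> below that of \<open>p\<close>, since the other summand takes at least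
    \<open>\<delta>\<close>.\<close>
  proof (induction "nat \<lfloor>inner p p / \<delta>\<rfloor>" arbitrary: p rule: less_induct)
    case less
    note pp = less.prems
    consider "p = 0" | "primitive_idempotent p" |
      a b where "a \<star> a = a" "b \<star> b = b" "a \<star> b = 0" "p = a + b" "a \<noteq> 0" "b \<noteq> 0"
      using pp unfolding primitive_idempotent_def by blast
    then show ?case
    proof cases
      case 1
      then show ?thesis by (intro exI[of _ "{}"]) (simp add: orthogonal_idempotents_def)
    next
      case 2
      then show ?thesis using pp
        by (intro exI[of _ "{p}"]) (auto simp: orthogonal_idempotents_def primitive_idempotent_def)
    next
      case ab: 3
      have "inner a b = inner (a \<star> b) junit" by (metis inner_jmult inner_commute junit_right)
      then have "inner p p = inner a a + inner b b" using ab by (simp add: inner_add inner_commute)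
      then have le: "inner a a / \<delta> + 1 \<le> inner p p / \<delta>" "inner b b / \<delta> + 1 \<le> inner p p / \<delta>"
        using \<delta>(1) \<delta>(2)[OF ab(1,5)] \<delta>(2)[OF ab(2,6)] by (simp_all add: field_simps)
      have lt: "nat \<lfloor>inner q q / \<delta>\<rfloor> < nat \<lfloor>inner p p / \<delta>\<rfloor>" if "inner q q / \<delta> + 1 \<le> inner p p / \<delta>" for q :: 'a
      proof -
        have "inner q q / \<delta> \<ge> 0" using \<delta> by simp
        then show ?thesis using that by linarith
      qed
      obtain A where A: "orthogonal_idempotents A" "\<And>c. c \<in> A \<Longrightarrow> primitive_idempotent c \<and> a \<star> c = c" "\<Sum>A = a"
        using less.hyps[of a] lt[OF le(1)] ab by blast
      obtain B where B: "orthogonal_idempotents B" "\<And>c. c \<in> B \<Longrightarrow> primitive_idempotent c \<and> b \<star> c = c" "\<Sum>B = b"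
        using less.hyps[of b] lt[OF le(2)] ab by blast
      have AB: "c \<star> d = 0" if "c \<in> A" "d \<in> B" for c d
        by (rule idempotents_below_orthogonal[OF ab(1,2,3)]) (use A B that in auto)
      have zero: "b \<star> c = 0" if "c \<in> A" for c
        using idempotents_below_orthogonal[OF ab(1,2,3), of c b] A(2)[OF that] ab by (simp add: jmult_commute)
      have zero': "a \<star> d = 0" if "d \<in> B" for d
        using idempotents_below_orthogonal[OF ab(1,2,3), of a d] B(2)[OF that] ab by simp
      have disj: "A \<inter> B = {}" using AB A B by (force simp: orthogonal_idempotents_def)
      have BA: "d \<star> c = 0" if "c \<in> A" "d \<in> B" for c d
        using AB[OF that] by (simp add: jmult_commute)
      have "orthogonal_idempotents (A \<union> B)"
        using A(1) B(1) AB BA unfolding orthogonal_idempotents_def by (simp add: ball_Un)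
      moreover have "\<Sum>(A \<union> B) = p"
        using A B ab disj by (simp add: sum.union_disjoint orthogonal_idempotents_def)
      moreover have "primitive_idempotent c \<and> p \<star> c = c" if "c \<in> A \<union> B" for c
        using A(2)[of c] B(2)[of c] zero[of c] zero'[of c] that unfolding ab(4) jmult.add_left
        by (cases "c \<in> A") simp_all
      ultimately show ?thesis by blast
    qed
  qed
qed

lemma spectral_primitive:
  fixes x :: "'a::euclidean_jordan_algebra"
  obtains C f where "orthogonal_idempotents C" "\<And>c. c \<in> C \<Longrightarrow> primitive_idempotent c"
    "\<Sum>C = junit" "x = (\<Sum>c\<in>C. f c *\<^sub>R c)"
proof -
  obtain C f where C: "orthogonal_idempotents C" "\<Sum>C = junit" and f: "x = (\<Sum>c\<in>C. f c *\<^sub>R c)"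
    by (rule spectral_jalg)
  have fin: "finite C" and idem: "\<And>c. c \<in> C \<Longrightarrow> c \<star> c = c"
    and orth: "\<And>c d. c \<in> C \<Longrightarrow> d \<in> C \<Longrightarrow> c \<noteq> d \<Longrightarrow> c \<star> d = 0"
    using C by (auto simp: orthogonal_idempotents_def)
  have "\<forall>c\<in>C. \<exists>D. orthogonal_idempotents D \<and> (\<forall>d\<in>D. primitive_idempotent d \<and> c \<star> d = d) \<and> \<Sum>D = c"
    using idempotent_primitive_decomposition idem by blast
  then obtain D where D: "\<And>c. c \<in> C \<Longrightarrow> orthogonal_idempotents (D c)"
    "\<And>c d. c \<in> C \<Longrightarrow> d \<in> D c \<Longrightarrow> primitive_idempotent d \<and> c \<star> d = d" "\<And>c. c \<in> C \<Longrightarrow> \<Sum>(D c) = c"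
    by metis
  have cross: "d \<star> d' = 0" if "c \<in> C" "c' \<in> C" "c \<noteq> c'" "d \<in> D c" "d' \<in> D c'" for c c' d d'
    by (rule idempotents_below_orthogonal[OF idem idem orth]) (use that D in auto)
  have nz: "d \<star> d = d" "d \<noteq> 0" if "c \<in> C" "d \<in> D c" for c d
    using D(2)[OF that] by (auto simp: primitive_idempotent_def)
  have disj: "D c \<inter> D c' = {}" if "c \<in> C" "c' \<in> C" "c \<noteq> c'" for c c'
    using cross[OF that] nz[OF that(1)] by fastforce
  have finD: "finite (D c)" if "c \<in> C" for c using D(1)[OF that] by (simp add: orthogonal_idempotents_def)
  define E where "E = (\<Union>c\<in>C. D c)"
  define g where "g d = f (THE c. c \<in> C \<and> d \<in> D c)" for d
  have g: "g d = f c" if "c \<in> C" "d \<in> D c" for c d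
  proof -
    have "(THE c. c \<in> C \<and> d \<in> D c) = c" using that disj by (intro the_equality) auto
    then show ?thesis by (simp add: g_def)
  qed
  have sumE: "sum h E = (\<Sum>c\<in>C. sum h (D c))" for h :: "'a \<Rightarrow> 'a"
    unfolding E_def using fin finD disj by (intro sum.UNION_disjoint) auto
  have "orthogonal_idempotents E"
    unfolding orthogonal_idempotents_def
  proof (intro conjI ballI impI)
    show "finite E" using fin finD by (auto simp: E_def)
    show "c \<star> c = c" "c \<noteq> 0" if "c \<in> E" for c using that nz by (auto simp: E_def)
    fix d d' assume dd: "d \<in> E" "d' \<in> E" "d \<noteq> d'"
    then obtain c c' where "c \<in> C" "c' \<in> C" "d \<in> D c" "d' \<in> D c'" by (auto simp: E_def)
    then show "d \<star> d' = 0" using cross[of c c' d d'] D(1)[of c] dd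
      by (cases "c = c'") (auto simp: orthogonal_idempotents_def)
  qed
  moreover have "primitive_idempotent d" if "d \<in> E" for d using that D(2) by (auto simp: E_def)
  moreover have "\<Sum>E = junit" using sumE[of "\<lambda>x. x"] D(3) C(2) by simp
  moreover have "x = (\<Sum>d\<in>E. g d *\<^sub>R d)"
  proof -
    have "(\<Sum>d\<in>E. g d *\<^sub>R d) = (\<Sum>c\<in>C. \<Sum>d\<in>D c. f c *\<^sub>R d)"
      unfolding sumE using g by (intro sum.cong) auto
    also have "\<dots> = x" unfolding f using D(3) by (intro sum.cong) (auto simp flip: scaleR_sum_right)
    finally show ?thesis ..
  qed
  ultimately show ?thesis using that by blast
qed

lemma orthogonal_idempotents_inner:
  assumes "orthogonal_idempotents C" "c \<in> C" "d \<in> C" "c \<noteq> d"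
  shows "inner c d = 0"
proof -
  have "c \<star> d = 0" using assms by (auto simp: orthogonal_idempotents_def)
  then have "inner (c \<star> d) junit = 0" by simp
  then show ?thesis by (simp only: inner_jmult' junit_right)
qed

text \<open>Primitive idempotents of different norm are orthogonal and have product 0. Sorting them
  by norm would therefore split the algebra into two complementary ideals.\<close>

lemma simple_primitive_norm:
  fixes c d :: "'a::euclidean_jordan_algebra"
  assumes simple: "simple_jordan_algebra TYPE('a)"
    and c: "primitive_idempotent c" and d: "primitive_idempotent d"
  shows "inner d d = inner c c"
proof (rule ccontr)
  assume ne: "inner d d \<noteq> inner c c"
  define A where "A = span {a::'a. primitive_idempotent a \<and> inner a a = inner c c}"
  define B where "B = span {a::'a. primitive_idempotent a \<and> inner a a \<noteq> inner c c}"
  have AB0: "inner a b = 0 \<and> a \<star> b = 0"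
    if "primitive_idempotent a" "inner a a = inner c c" "primitive_idempotent b" "inner b b \<noteq> inner c c" for a b :: 'a
    using primitive_norm_eq[of a b] primitive_orthogonal[of a b] that by metis
  have AB: "inner a b = 0 \<and> a \<star> b = 0" if a: "a \<in> A" and b: "b \<in> B" for a b
    using a unfolding A_def
  proof (induction rule: span_induct_alt)
    case base
    show ?case by simp
  next
    case (step s x y)
    have "inner x b = 0 \<and> x \<star> b = 0"
      using b unfolding B_def
      by (induction rule: span_induct_alt)
         (use step AB0 in \<open>auto simp: jmult_simps inner_add_right\<close>)
    with step show ?case by (simp add: jmult_simps inner_add_left)
  qed
  have sum: "\<exists>a\<in>A. \<exists>b\<in>B. x = a + b" for x
  proof -
    obtain C f where C: "orthogonal_idempotents C" "\<And>c. c \<in> C \<Longrightarrow> primitive_idempotent c"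
      "\<Sum>C = junit" and f: "x = (\<Sum>c\<in>C. f c *\<^sub>R c)" using spectral_primitive[of x] by blast
    have fin: "finite C" using C by (simp add: orthogonal_idempotents_def)
    let ?P = "{a \<in> C. inner a a = inner c c}"
    have "x = (\<Sum>c\<in>?P. f c *\<^sub>R c) + (\<Sum>c\<in>C - ?P. f c *\<^sub>R c)"
      unfolding f using fin by (subst sum.subset_diff[of ?P C]) (auto simp: add.commute)
    moreover have "(\<Sum>c\<in>?P. f c *\<^sub>R c) \<in> A"
      unfolding A_def by (intro span_sum span_scale span_base) (use C in auto)
    moreover have "(\<Sum>c\<in>C - ?P. f c *\<^sub>R c) \<in> B"
      unfolding B_def by (intro span_sum span_scale span_base) (use C in auto)
    ultimately show ?thesis by blast
  qed
  \<comment> \<open>Associativity of the inner product moves one factor from \<open>A\<close> onto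
    the component in \<open>B\<close>, where the product vanishes; so that component is orthogonal
    to itself.\<close>
  have mult: "a \<star> a' \<in> A" if "a \<in> A" "a' \<in> A" for a a'
  proof -
    obtain a2 b2 where ab: "a2 \<in> A" "b2 \<in> B" "a \<star> a' = a2 + b2" using sum by blast
    have "inner b2 (a2 + b2) = inner (a \<star> a') b2" by (simp add: ab inner_commute)
    also have "\<dots> = inner a' (a \<star> b2)" by (rule inner_jmult)
    also have "\<dots> = 0" using AB[OF that(1) ab(2)] by simp
    finally have "inner b2 b2 = 0" using AB[OF ab(1,2)] by (simp add: inner_add_right inner_commute)
    then show ?thesis using ab by simp
  qed
  have "jideal A"
    unfolding jideal_def
  proof (intro conjI ballI allI)
    show "subspace A" by (simp add: A_def)
    fix x y assume x: "x \<in> A"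
    obtain a b where "a \<in> A" "b \<in> B" "y = a + b" using sum by blast
    then show "y \<star> x \<in> A"
      using mult[of a x] AB[of x b] x by (simp add: jmult_simps jmult_commute[of b x])
  qed
  then have "A = {0} \<or> A = UNIV" using simple by (simp add: simple_jordan_algebra_def)
  moreover have "c \<in> A" unfolding A_def using c by (intro span_base) auto
  moreover have "d \<in> B" unfolding B_def using d ne by (intro span_base) auto
  moreover have "c \<noteq> 0" "d \<noteq> 0" using c d by (simp_all add: primitive_idempotent_def)
  ultimately show False using AB[of d d] by auto
qed

section \<open>Degree, rank and the norm of primitive idempotents\<close>

lemma jpow_orthogonal_sum:
  assumes "orthogonal_idempotents C" "\<Sum>C = junit" "x = (\<Sum>c\<in>C. f c *\<^sub>R c)"
  shows "jpow x n = (\<Sum>c\<in>C. (f c ^ n) *\<^sub>R c)"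
proof (induction n)
  case 0
  then show ?case using assms(2) by simp
next
  case (Suc n)
  then show ?case unfolding jpow.simps Suc using orthogonal_idempotents_sum_mult_sum[OF assms(1)]
    by (simp add: assms(3))
qed

text \<open>Powers below the degree are independent, and all powers lie in the span of
  \<open>C\<close>.\<close>

lemma jdegree_le:
  fixes x :: "'a::euclidean_jordan_algebra"
  assumes "orthogonal_idempotents C" "\<Sum>C = junit" "x = (\<Sum>c\<in>C. f c *\<^sub>R c)"
  shows "jdegree x \<le> card C"
proof (rule ccontr)
  assume "\<not> jdegree x \<le> card C"
  then have nin: "jpow x k \<notin> span (jpow x ` {..<k})" if "k \<le> card C" for k
    unfolding jdegree_def using not_less_Least[of k "\<lambda>k. jpow x k \<in> span (jpow x ` {..<k})"] that by simp
  have ind: "independent (jpow x ` {..<k}) \<and> card (jpow x ` {..<k}) = k" if "k \<le> Suc (card C)" for k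
    using that
  proof (induction k)
    case (Suc k)
    have eq: "jpow x ` {..<Suc k} = insert (jpow x k) (jpow x ` {..<k})" by (auto simp: lessThan_Suc)
    have "jpow x k \<notin> jpow x ` {..<k}" using nin[of k] Suc.prems span_base[of "jpow x k" "jpow x ` {..<k}"] by linarith
    then show ?case using Suc nin[of k] unfolding eq by (simp add: independent_insert)
  qed (simp add: independent_empty)
  have fin: "finite C" using assms by (simp add: orthogonal_idempotents_def)
  have "jpow x ` {..<Suc (card C)} \<subseteq> span C"
    unfolding jpow_orthogonal_sum[OF assms]
    by (intro image_subsetI, rule span_sum, rule span_scale, rule span_base)
  then have "card (jpow x ` {..<Suc (card C)}) \<le> card C"
    using independent_span_bound[OF fin] ind by blast
  then show False using ind[of "Suc (card C)"] by simp
qed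

text \<open>A relation among the powers is a nonzero polynomial that vanishes at all coefficients,
  of which there are \<open>card C\<close> by injectivity.\<close>

lemma jdegree_ge:
  fixes x :: "'a::euclidean_jordan_algebra"
  assumes C: "orthogonal_idempotents C" "\<Sum>C = junit" "x = (\<Sum>c\<in>C. f c *\<^sub>R c)" and inj: "inj_on f C"
  shows "card C \<le> jdegree x"
proof -
  define k where "k = jdegree x"
  \<comment> \<open>The \<open>LEAST\<close> in \<open>jdegree\<close> is meaningful only if some
    power depends on the lower ones; otherwise independent sets would exceed the dimension.\<close>
  have "\<exists>k. jpow x k \<in> span (jpow x ` {..<k})"
  proof (rule ccontr)
    assume *: "\<nexists>k. jpow x k \<in> span (jpow x ` {..<k})"
    show False
    proof -
      have ind: "independent (jpow x ` {..<k}) \<and> card (jpow x ` {..<k}) = k" for k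
      proof (induction k)
        case (Suc k)
        have eq: "jpow x ` {..<Suc k} = insert (jpow x k) (jpow x ` {..<k})" by (auto simp: lessThan_Suc)
        have "jpow x k \<notin> jpow x ` {..<k}" using * span_base[of "jpow x k" "jpow x ` {..<k}"] by blast
        then show ?case using Suc * unfolding eq by (simp add: independent_insert)
      qed (simp add: independent_empty)
      have "card (jpow x ` {..<Suc DIM('a)}) \<le> DIM('a)" using independent_card_le ind by blast
      then show False using ind[of "Suc DIM('a)"] by simp
    qed
  qed
  then have "jpow x k \<in> span (jpow x ` {..<k})"
    unfolding k_def jdegree_def by (rule LeastI_ex)
  then obtain P where P: "P \<in> span (jpow x ` {..<k})" "jpow x k = P" by blast
  have "\<exists>p::real poly. (p = 0 \<or> degree p < k) \<and> P = (\<Sum>c\<in>C. poly p (f c) *\<^sub>R c)"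
    using P(1)
  proof (induction rule: span_induct_alt)
    case base
    show ?case by (intro exI[of _ 0]) simp
  next
    case (step s y z)
    then obtain p where p: "p = 0 \<or> degree p < k" "z = (\<Sum>c\<in>C. poly p (f c) *\<^sub>R c)" by blast
    obtain j where j: "j < k" "y = jpow x j" using step by auto
    have "degree (monom s j + p) < k" using p(1) j degree_monom_le[of s j]
      by (intro degree_add_less) auto
    moreover have "s *\<^sub>R y + z = (\<Sum>c\<in>C. poly (monom s j + p) (f c) *\<^sub>R c)"
      unfolding j p jpow_orthogonal_sum[OF C]
      by (simp add: poly_monom scaleR_sum_right sum.distrib algebra_simps)
    ultimately show ?case by blast
  qed
  then obtain p :: "real poly" where p: "p = 0 \<or> degree p < k" "P = (\<Sum>c\<in>C. poly p (f c) *\<^sub>R c)" by blast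
  define q where "q = monom 1 k - p"
  have "coeff q k = 1" using p(1) by (auto simp: q_def coeff_eq_0)
  then have "q \<noteq> 0" by auto
  have "degree q \<le> k" unfolding q_def using p(1) by (intro degree_diff_le) (auto simp: degree_monom_le)
  have root: "poly q (f c) = 0" if "c \<in> C" for c
  proof -
    have "f c ^ k *\<^sub>R c = jpow x k \<star> c"
      unfolding jpow_orthogonal_sum[OF C] by (rule orthogonal_idempotents_sum_mult[OF C(1) that, symmetric])
    also have "\<dots> = poly p (f c) *\<^sub>R c"
      unfolding P(2) p(2) by (rule orthogonal_idempotents_sum_mult[OF C(1) that])
    finally have "f c ^ k *\<^sub>R c = poly p (f c) *\<^sub>R c" .
    moreover have "c \<noteq> 0" using C that by (simp add: orthogonal_idempotents_def)
    ultimately show ?thesis by (simp add: q_def poly_monom)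
  qed
  have "card C = card (f ` C)" using inj by (simp add: card_image)
  also have "\<dots> \<le> card {t. poly q t = 0}"
    by (intro card_mono poly_roots_finite \<open>q \<noteq> 0\<close>) (use root in auto)
  also have "\<dots> \<le> degree q" by (rule card_poly_roots_bound[OF \<open>q \<noteq> 0\<close>])
  finally show ?thesis using \<open>degree q \<le> k\<close> by (simp add: k_def)
qed

text \<open>The members of a complete orthogonal system of primitive idempotents have equal norms
  and their squared norms add up to that of the unit, so all such systems have the same size. This
  size is the largest degree.\<close>

lemma jrank_times_norm:
  fixes c :: "'a::euclidean_jordan_algebra"
  assumes simple: "simple_jordan_algebra TYPE('a)" and c: "primitive_idempotent c"
  shows "real (jrank TYPE('a)) * inner c c = inner junit (junit :: 'a)"
proof -
  have cc: "inner c c > 0" using c by (simp add: primitive_idempotent_def)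
  have card: "real (card C) * inner c c = inner junit (junit :: 'a)"
    if C: "orthogonal_idempotents C" "\<And>c. c \<in> C \<Longrightarrow> primitive_idempotent c" "\<Sum>C = junit" for C :: "'a set"
  proof -
    have fin: "finite C" using C by (simp add: orthogonal_idempotents_def)
    have "inner junit (junit :: 'a) = inner (\<Sum>C) (\<Sum>C)" by (simp add: C(3))
    also have "\<dots> = (\<Sum>a\<in>C. \<Sum>b\<in>C. inner a b)" unfolding inner_sum_left by (simp add: inner_sum_right)
    also have "\<dots> = (\<Sum>a\<in>C. \<Sum>b\<in>C. if b = a then inner c c else 0)"
      by (intro sum.cong refl) (use orthogonal_idempotents_inner[OF C(1)] simple_primitive_norm[OF simple c C(2)] in auto)
    also have "\<dots> = real (card C) * inner c c" using fin by simp
    finally show ?thesis ..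
  qed
  obtain C f where C: "orthogonal_idempotents C" "\<And>c. c \<in> C \<Longrightarrow> primitive_idempotent c"
      "\<Sum>C = junit" "(0::'a) = (\<Sum>c\<in>C. f c *\<^sub>R c)" using spectral_primitive[of 0] by blast
  have le: "jdegree x \<le> card C" for x :: 'a
  proof -
    obtain D g where D: "orthogonal_idempotents D" "\<And>c. c \<in> D \<Longrightarrow> primitive_idempotent c"
      "\<Sum>D = junit" "x = (\<Sum>c\<in>D. g c *\<^sub>R c)" using spectral_primitive[of x] by blast
    have "real (card D) * inner c c = real (card C) * inner c c"
      using card[OF D(1-3)] card[OF C(1-3)] by simp
    then show ?thesis using jdegree_le[OF D(1,3,4)] cc by simp
  qed
  have fin: "finite C" using C by (simp add: orthogonal_idempotents_def)
  \<comment> \<open>Any injective choice of coefficients yields an element of maximal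
    degree.\<close>
  obtain h :: "'a \<Rightarrow> nat" where h: "inj_on h C" using finite_imp_inj_to_nat_seg[OF fin] by blast
  have "inj_on (\<lambda>c. real (h c)) C" using h by (auto simp: inj_on_def)
  then have "card C \<le> jdegree (\<Sum>c\<in>C. real (h c) *\<^sub>R c)"
    using jdegree_ge[OF C(1,3) refl, of "\<lambda>c. real (h c)"] by simp
  then have eq: "jdegree (\<Sum>c\<in>C. real (h c) *\<^sub>R c) = card C" using le by (simp add: order_antisym)
  have "finite (range (jdegree :: 'a \<Rightarrow> nat))"
    by (rule finite_subset[of _ "{..card C}"]) (use le in auto)
  moreover have "card C \<in> range (jdegree :: 'a \<Rightarrow> nat)" using eq by (metis rangeI)
  ultimately have "jrank TYPE('a) = card C"
    unfolding jrank_def using le by (intro Max_eqI) auto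
  then show ?thesis using card[OF C(1-3)] by simp
qed

section \<open>Moebius transformations\<close>

lemma jP_apply: "blinfun_apply (jP x) w = 2 *\<^sub>R (x \<star> (x \<star> w)) - (x \<star> x) \<star> w"
  by (simp add: jP_def blinfun.diff_left blinfun.scaleR_left)

lemma jP2_apply: "blinfun_apply (jP2 x y) w = x \<star> (y \<star> w) + y \<star> (x \<star> w) - (x \<star> y) \<star> w"
  by (simp add: jP2_def blinfun.diff_left blinfun.add_left)

lemma jP_add_apply:
  "blinfun_apply (jP (x + h)) w = blinfun_apply (jP x) w + 2 *\<^sub>R blinfun_apply (jP2 x h) w + blinfun_apply (jP h) w"
  by (simp add: jP_apply jP2_apply jmult_simps jmult_commute[of h x] scaleR_2 algebra_simps)

lemma jP_minus_apply: "blinfun_apply (jP (- x)) w = blinfun_apply (jP x) w"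
  by (simp add: jP_apply jmult_simps)

text \<open>Inverse elements are considered inside the subalgebra of a third element
  \<open>z\<close>, so that \<open>x\<close> and \<open>y\<close> enter symmetrically and quotients
  of polynomials in \<open>z\<close> are covered.\<close>

context
  fixes x y z :: "'a::euclidean_jordan_algebra"
  assumes x: "x \<in> jalg z" and y: "y \<in> jalg z" and xy: "x \<star> y = junit"
begin

lemma inverse_comm: "y \<star> (x \<star> w) = x \<star> (y \<star> w)"
  by (rule jalg_commute[OF y x])

lemma inverse_sq: "(x \<star> x) \<star> y = x" "x \<star> (y \<star> y) = y" "(x \<star> x) \<star> (y \<star> y) = junit"
proof -
  have yx: "y \<star> x = junit" using xy by (simp add: jmult_commute)
  show 1: "(x \<star> x) \<star> y = x" using jalg_assoc[OF y x x] xy by simp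
  show 2: "x \<star> (y \<star> y) = y" using jalg_assoc[OF y x y] xy by simp
  show "(x \<star> x) \<star> (y \<star> y) = junit" using jalg_assoc[OF jalg_mult[OF y y] x x] 2 xy by simp
qed

lemma jP_mult_inverse: "blinfun_apply (jP x) (y \<star> w) = x \<star> w"
  using jordan_triple_op[of x y w] by (simp add: jP_apply inverse_sq xy inverse_comm scaleR_2 algebra_simps)

lemma jP_jP_inverse: "blinfun_apply (jP x) (blinfun_apply (jP y) w) = w"
proof -
  \<comment> \<open>The triple identity with \<open>y \<star> y\<close> as second argument; on its
    left stands multiplication by \<open>(x \<star> x) \<star> (y \<star> y)\<close>, which is the
    identity.\<close>
  have 1: "w = 2 *\<^sub>R (y \<star> (x \<star> w)) + (x \<star> x) \<star> ((y \<star> y) \<star> w) - 2 *\<^sub>R (x \<star> (x \<star> ((y \<star> y) \<star> w)))"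
    using jordan_triple_op[of x "y \<star> y" w] jalg_commute[OF jalg_mult[OF y y] x, of w]
    by (simp add: inverse_sq)
  have "blinfun_apply (jP x) (blinfun_apply (jP y) w)
      = 2 *\<^sub>R blinfun_apply (jP x) (y \<star> (y \<star> w)) - blinfun_apply (jP x) ((y \<star> y) \<star> w)"
    by (simp add: jP_apply[of y] blinfun.diff_right blinfun.scaleR_right)
  also have "\<dots> = 2 *\<^sub>R (x \<star> (y \<star> w)) - blinfun_apply (jP x) ((y \<star> y) \<star> w)"
    by (simp add: jP_mult_inverse)
  also have "\<dots> = w"
    unfolding jP_apply using 1 by (simp add: inverse_comm algebra_simps)
  finally show ?thesis .
qed

text \<open>Twice this is the derivative of P at \<open>x\<close> in direction \<open>h\<close>,
  applied to the inverse; it gives the linear term in the expansion of the inverse.\<close>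

lemma jP2_inverse: "blinfun_apply (jP2 x h) y = h"
proof -
  have "x \<star> (h \<star> y) = (x \<star> h) \<star> y"
    using inverse_comm[of h] by (simp add: jmult_commute)
  moreover have "h \<star> (x \<star> y) = h" by (simp add: xy)
  ultimately show ?thesis by (simp add: jP2_apply)
qed

end

section \<open>Invertible elements and the derivative of the inverse\<close>

definition jinvertible :: "'a::euclidean_jordan_algebra \<Rightarrow> bool" where
  "jinvertible x \<longleftrightarrow> (\<exists>y\<in>jalg x. x \<star> y = junit)"

lemma jinverse_eqI:
  assumes "jinvertible x" "x \<in> jalg z" "y \<in> jalg z" "x \<star> y = junit"
  shows "jinverse x = y"
proof -
  have uniq: "y' = y" if "y' \<in> jalg x" "x \<star> y' = junit" for y'
  proof -
    have y': "y' \<in> jalg z" using that jalg_subset[OF assms(2)] by blast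
    have "y' \<star> (x \<star> y) = x \<star> (y' \<star> y)" by (rule jalg_commute[OF y' assms(2)])
    moreover have "(x \<star> y') \<star> y = x \<star> (y' \<star> y)" by (rule jalg_assoc[OF assms(3) assms(2) y'])
    ultimately show ?thesis using assms(4) that by simp
  qed
  show ?thesis unfolding jinverse_def jalg_def[symmetric]
  proof (rule the1_equality)
    show "\<exists>!y. y \<in> jalg x \<and> x \<star> y = junit"
      using assms(1) uniq unfolding jinvertible_def by metis
    show "y \<in> jalg x \<and> x \<star> y = junit"
      using assms(1) uniq assms(4) unfolding jinvertible_def by metis
  qed
qed

lemma jinverse_works:
  assumes "jinvertible x"
  shows "jinverse x \<in> jalg x" "x \<star> jinverse x = junit"
  using jinverse_eqI[OF assms self_in_jalg] assms unfolding jinvertible_def by blast+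

text \<open>An eigenidempotent of \<open>x\<close> with coefficient 0 would lie in the kernel of
  P(x). The criterion no longer mentions \<open>jalg x\<close>, which varies with \<open>x\<close>,
  so it can be perturbed.\<close>

lemma jinvertible_iff: "jinvertible x \<longleftrightarrow> (\<forall>v. blinfun_apply (jP x) v = 0 \<longrightarrow> v = 0)"
proof
  assume "jinvertible x"
  then obtain y where y: "y \<in> jalg x" "x \<star> y = junit" unfolding jinvertible_def by blast
  show "\<forall>v. blinfun_apply (jP x) v = 0 \<longrightarrow> v = 0"
    using jP_jP_inverse[OF y(1) self_in_jalg] y(2) by (metis blinfun.zero_right jmult_commute)
next
  assume inj: "\<forall>v. blinfun_apply (jP x) v = 0 \<longrightarrow> v = 0"
  obtain C f where C: "orthogonal_idempotents C" "C \<subseteq> jalg x" "\<Sum>C = junit" and f: "x = (\<Sum>c\<in>C. f c *\<^sub>R c)"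
    by (rule spectral_jalg)
  have nz: "f c \<noteq> 0" if c: "c \<in> C" for c
  proof
    assume "f c = 0"
    then have "x \<star> c = 0" using orthogonal_idempotents_sum_mult[OF C(1) c, of f] f by simp
    moreover have "(x \<star> x) \<star> c = x \<star> (x \<star> c)"
      using C(2) c by (intro jalg_assoc[of _ x]) auto
    ultimately have "blinfun_apply (jP x) c = 0" by (simp add: jP_apply)
    then show False using inj C(1) c by (auto simp: orthogonal_idempotents_def)
  qed
  define y where "y = (\<Sum>c\<in>C. (1 / f c) *\<^sub>R c)"
  have "x \<star> y = (\<Sum>c\<in>C. (f c * (1 / f c)) *\<^sub>R c)"
    unfolding f y_def by (rule orthogonal_idempotents_sum_mult_sum[OF C(1)])
  also have "\<dots> = junit" unfolding C(3)[symmetric] using nz by (intro sum.cong) auto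
  finally have "x \<star> y = junit" .
  moreover have "y \<in> jalg x" unfolding y_def
    using C(2) by (intro subspace_sum subspace_scale) auto
  ultimately show "jinvertible x" unfolding jinvertible_def by blast
qed

text \<open>An inverse found in the subalgebra of any \<open>z\<close> makes P(x) injective, and
  hence forces an inverse inside \<open>jalg x\<close> itself.\<close>

lemma jinvertibleI:
  assumes "x \<in> jalg z" "y \<in> jalg z" "x \<star> y = junit"
  shows "jinvertible x" "jinverse x = y"
proof -
  show "jinvertible x"
    unfolding jinvertible_iff
    using jP_jP_inverse[OF assms(2,1)] assms(3) by (metis blinfun.zero_right jmult_commute)
  then show "jinverse x = y" by (rule jinverse_eqI[OF _ assms])
qed

lemma jP2_norm_bound:
  obtains K where "K > 0"
    "\<And>x h w :: 'a::euclidean_jordan_algebra. norm (blinfun_apply (jP2 x h) w) \<le> K * norm x * norm h * norm w"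
    "\<And>h w :: 'a. norm (blinfun_apply (jP h) w) \<le> K * norm h * norm h * norm w"
proof -
  obtain K where K: "K > 0" "\<And>x y::'a. norm (x \<star> y) \<le> norm x * norm y * K"
    using jmult.pos_bounded by blast
  have three: "norm (x \<star> (y \<star> w)) \<le> K * K * norm x * norm y * norm w"
    "norm ((x \<star> y) \<star> w) \<le> K * K * norm x * norm y * norm w" for x y w :: 'a
  proof -
    have "norm (x \<star> (y \<star> w)) \<le> norm x * norm (y \<star> w) * K" by (rule K)
    also have "\<dots> \<le> norm x * (norm y * norm w * K) * K" using K by (intro mult_right_mono mult_left_mono) auto
    finally show "norm (x \<star> (y \<star> w)) \<le> K * K * norm x * norm y * norm w" by (simp add: mult_ac)
    have "norm ((x \<star> y) \<star> w) \<le> norm (x \<star> y) * norm w * K" by (rule K)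
    also have "\<dots> \<le> (norm x * norm y * K) * norm w * K" using K by (intro mult_right_mono) auto
    finally show "norm ((x \<star> y) \<star> w) \<le> K * K * norm x * norm y * norm w" by (simp add: mult_ac)
  qed
  show ?thesis
  proof (rule that[of "3 * (K * K)"])
    show "3 * (K * K) > 0" using K by simp
    show "norm (blinfun_apply (jP2 x h) w) \<le> 3 * (K * K) * norm x * norm h * norm w" for x h w :: 'a
      unfolding jP2_apply
      using three(1)[of x h w] three(1)[of h x w] three(2)[of x h w]
        norm_triangle_ineq4[of "x \<star> (h \<star> w) + h \<star> (x \<star> w)" "(x \<star> h) \<star> w"]
        norm_triangle_ineq[of "x \<star> (h \<star> w)" "h \<star> (x \<star> w)"]
      by (simp add: mult_ac)
    show "norm (blinfun_apply (jP h) w) \<le> 3 * (K * K) * norm h * norm h * norm w" for h w :: 'a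
      unfolding jP_apply
      using three(1)[of h h w] three(2)[of h h w]
        norm_triangle_ineq4[of "2 *\<^sub>R (h \<star> (h \<star> w))" "(h \<star> h) \<star> w"]
      by (simp add: mult_ac)
  qed
qed

text \<open>P(y) inverts P(x) and its norm is at most \<open>C\<close>. The radius \<open>e\<close>
  keeps the change of P(x) too small to produce a kernel.\<close>

lemma open_jinvertible: "open {x :: 'a::euclidean_jordan_algebra. jinvertible x}"
  unfolding open_dist
proof (intro ballI)
  fix x :: 'a assume "x \<in> {x. jinvertible x}"
  then obtain y where y: "y \<in> jalg x" "x \<star> y = junit" by (auto simp: jinvertible_def)
  obtain K where K: "K > 0"
    "\<And>x h w :: 'a. norm (blinfun_apply (jP2 x h) w) \<le> K * norm x * norm h * norm w"
    "\<And>h w :: 'a. norm (blinfun_apply (jP h) w) \<le> K * norm h * norm h * norm w"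
    using jP2_norm_bound by blast
  define C where "C = K * norm y * norm y + 1"
  define e where "e = min 1 (1 / (C * K * (2 * norm x + 1) + 1))"
  have C: "C > 0" using K by (simp add: C_def add_nonneg_pos)
  have den: "C * K * (2 * norm x + 1) + 1 > 0" using C K by (simp add: add_nonneg_pos)
  have e: "e > 0" unfolding e_def using den by simp
  have "jinvertible x'" if x': "dist x' x < e" for x'
    unfolding jinvertible_iff
  proof (intro allI impI)
    fix v assume v: "blinfun_apply (jP x') v = 0"
    define h where "h = x' - x"
    have h: "norm h < e" using x' by (simp add: h_def dist_norm)
    have "blinfun_apply (jP x) v = - (2 *\<^sub>R blinfun_apply (jP2 x h) v + blinfun_apply (jP h) v)"
      using jP_add_apply[of x h v] v by (simp add: h_def algebra_simps eq_neg_iff_add_eq_0)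
    then have "norm (blinfun_apply (jP x) v) = norm (2 *\<^sub>R blinfun_apply (jP2 x h) v + blinfun_apply (jP h) v)"
      by (simp only: norm_minus_cancel)
    then have "norm (blinfun_apply (jP x) v) \<le> 2 * norm (blinfun_apply (jP2 x h) v) + norm (blinfun_apply (jP h) v)"
      using norm_triangle_ineq[of "2 *\<^sub>R blinfun_apply (jP2 x h) v" "blinfun_apply (jP h) v"] by simp
    also have "\<dots> \<le> 2 * (K * norm x * norm h * norm v) + K * norm h * norm h * norm v"
      using K(2)[of x h v] K(3)[of h v] by simp
    also have "K * norm h * norm h * norm v \<le> K * norm h * 1 * norm v"
      using h K e_def by (intro mult_right_mono mult_left_mono) auto
    finally have 1: "norm (blinfun_apply (jP x) v) \<le> K * (2 * norm x + 1) * norm h * norm v"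
      by (simp add: algebra_simps)
    have "v = blinfun_apply (jP y) (blinfun_apply (jP x) v)"
      using jP_jP_inverse[OF y(1) self_in_jalg] y(2) by (simp add: jmult_commute)
    then have "norm v \<le> K * norm y * norm y * norm (blinfun_apply (jP x) v)" using K(3) by metis
    also have "\<dots> \<le> C * norm (blinfun_apply (jP x) v)" by (intro mult_right_mono) (auto simp: C_def)
    also have "\<dots> \<le> C * (K * (2 * norm x + 1) * norm h * norm v)" using 1 C by (intro mult_left_mono) auto
    finally have 2: "norm v \<le> (C * K * (2 * norm x + 1)) * norm h * norm v" by (simp add: mult_ac)
    have "(C * K * (2 * norm x + 1)) * norm h < 1"
    proof -
      have "(C * K * (2 * norm x + 1)) * norm h \<le> (C * K * (2 * norm x + 1) + 1) * norm h"
        by (intro mult_right_mono) auto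
      also have "\<dots> < (C * K * (2 * norm x + 1) + 1) * (1 / (C * K * (2 * norm x + 1) + 1))"
        using h den e_def by (intro mult_strict_left_mono) auto
      also have "\<dots> = 1" using den by simp
      finally show ?thesis .
    qed
    then show "v = 0" using 2 mult_le_cancel_right2[of "(C * K * (2 * norm x + 1)) * norm h" "norm v"]
      by (metis mult_less_cancel_right2 norm_eq_zero norm_ge_zero not_less order_le_less)
  qed
  then show "\<exists>e>0. \<forall>x'. dist x' x < e \<longrightarrow> x' \<in> {x. jinvertible x}" using e by blast
qed

text \<open>Solving \<open>P(x + h) z = x + h\<close> for \<open>z = (x + h)\<^sup>-\<^sup>1\<close> around \<open>y = x\<^sup>-\<^sup>1\<close> gives
  \<open>z - y = - P(y) h + O(h\<^sup>2)\<close>.\<close>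

lemma has_derivative_jinverse:
  fixes x :: "'a::euclidean_jordan_algebra"
  assumes "jinvertible x"
  shows "(jinverse has_derivative (\<lambda>h. - blinfun_apply (jP (jinverse x)) h)) (at x)"
proof -
  define y where "y = jinverse x"
  have y: "y \<in> jalg x" "x \<star> y = junit" using jinverse_works[OF assms] by (simp_all add: y_def)
  obtain K where K: "K > 0"
    "\<And>x h w :: 'a. norm (blinfun_apply (jP2 x h) w) \<le> K * norm x * norm h * norm w"
    "\<And>h w :: 'a. norm (blinfun_apply (jP h) w) \<le> K * norm h * norm h * norm w"
    using jP2_norm_bound by blast
  define Q where "Q = K * norm y * norm y"
  define A where "A = Q * (2 * K * norm x + K)"
  define B where "B = Q * (K * norm y)"
  have nn: "Q \<ge> 0" "A \<ge> 0" "B \<ge> 0" using K by (simp_all add: Q_def A_def B_def)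
  obtain e where e: "e > 0" "\<And>x'. dist x' x < e \<Longrightarrow> jinvertible x'"
    using open_jinvertible assms unfolding open_dist by (metis mem_Collect_eq)
  have bound: "norm (jinverse (x + h) - jinverse x + blinfun_apply (jP y) h)
      \<le> (2 * A * (Q + B) + B) * norm h * norm h"
    if h: "norm h < e" "norm h \<le> 1" "A * norm h \<le> 1 / 2" for h
  proof -
    have inv: "jinvertible (x + h)" using e(2)[of "x + h"] h by (simp add: dist_norm)
    define z where "z = jinverse (x + h)"
    have z: "z \<in> jalg (x + h)" "(x + h) \<star> z = junit" using jinverse_works[OF inv] by (simp_all add: z_def)
    have Pz: "blinfun_apply (jP (x + h)) z = x + h"
      using jP_mult_inverse[OF self_in_jalg z(1) z(2), of junit] by simp
    have Py: "blinfun_apply (jP x) y = x"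
      using jP_mult_inverse[OF self_in_jalg y(1) y(2), of junit] by simp
    define \<delta> where "\<delta> = z - y"
    \<comment> \<open>The equation P(x + h) z = x + h is expanded at z = y + \<delta>; P(x) y = x
      and P(x, h) y = h remove the terms of order 0 and one half of those of order 1.\<close>
    have "blinfun_apply (jP x) \<delta> = - h - (2 *\<^sub>R blinfun_apply (jP2 x h) \<delta> + blinfun_apply (jP h) y + blinfun_apply (jP h) \<delta>)"
      using Pz[unfolded jP_add_apply] jP2_inverse[OF self_in_jalg y, of h]
      by (simp add: \<delta>_def blinfun.diff_right Py scaleR_2 algebra_simps)
    moreover have "blinfun_apply (jP y) (blinfun_apply (jP x) \<delta>) = \<delta>"
      using jP_jP_inverse[OF y(1) self_in_jalg] y(2) by (simp add: jmult_commute)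
    ultimately have "\<delta> = blinfun_apply (jP y) (- h - (2 *\<^sub>R blinfun_apply (jP2 x h) \<delta> + blinfun_apply (jP h) y + blinfun_apply (jP h) \<delta>))"
      by simp
    moreover have "blinfun_apply (jP y) (- h - Z) + blinfun_apply (jP y) h = - blinfun_apply (jP y) Z" for Z
      by (simp add: blinfun.diff_right blinfun.minus_right)
    ultimately have eq: "\<delta> + blinfun_apply (jP y) h = - blinfun_apply (jP y) (2 *\<^sub>R blinfun_apply (jP2 x h) \<delta> + blinfun_apply (jP h) y + blinfun_apply (jP h) \<delta>)"
      by metis
    have "norm (\<delta> + blinfun_apply (jP y) h) \<le> Q * norm (2 *\<^sub>R blinfun_apply (jP2 x h) \<delta> + blinfun_apply (jP h) y + blinfun_apply (jP h) \<delta>)"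
      unfolding eq norm_minus_cancel Q_def by (rule K)
    also have "\<dots> \<le> Q * (2 * (K * norm x * norm h * norm \<delta>) + K * norm h * norm h * norm y + K * norm h * norm h * norm \<delta>)"
      using K(2)[of x h \<delta>] K(3)[of h y] K(3)[of h \<delta>] nn
        norm_triangle_ineq[of "2 *\<^sub>R blinfun_apply (jP2 x h) \<delta> + blinfun_apply (jP h) y" "blinfun_apply (jP h) \<delta>"]
        norm_triangle_ineq[of "2 *\<^sub>R blinfun_apply (jP2 x h) \<delta>" "blinfun_apply (jP h) y"]
      by (intro mult_left_mono) auto
    also have "\<dots> \<le> Q * (2 * (K * norm x * norm h * norm \<delta>) + K * norm h * norm h * norm y + K * norm h * 1 * norm \<delta>)"
      using h K nn by (intro mult_left_mono add_mono mult_right_mono) auto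
    also have "\<dots> = A * norm h * norm \<delta> + B * norm h * norm h"
      by (simp add: A_def B_def algebra_simps)
    finally have 1: "norm (\<delta> + blinfun_apply (jP y) h) \<le> A * norm h * norm \<delta> + B * norm h * norm h" .
    have "norm \<delta> \<le> norm (\<delta> + blinfun_apply (jP y) h) + norm (blinfun_apply (jP y) h)"
      using norm_triangle_ineq4[of "\<delta> + blinfun_apply (jP y) h" "blinfun_apply (jP y) h"] by simp
    also have "\<dots> \<le> (A * norm h) * norm \<delta> + B * norm h * norm h + Q * norm h"
      using 1 K(3)[of y h] by (simp add: Q_def)
    \<comment> \<open>For small \<open>h\<close> the remainder involving \<open>\<delta>\<close> is
      absorbed into the left side, so \<open>\<delta>\<close> is of the order of
      \<open>h\<close>.\<close>
    also have "\<dots> \<le> (1/2) * norm \<delta> + B * norm h * 1 + Q * norm h"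
      using h nn by (intro add_mono mult_right_mono mult_left_mono) auto
    finally have 2: "norm \<delta> \<le> 2 * (Q + B) * norm h" by (simp add: algebra_simps)
    have "A * norm h * norm \<delta> \<le> A * norm h * (2 * (Q + B) * norm h)"
      using 2 nn by (intro mult_left_mono) auto
    then have "norm (\<delta> + blinfun_apply (jP y) h) \<le> (2 * A * (Q + B) + B) * norm h * norm h"
      using 1 by (simp add: algebra_simps)
    then show ?thesis by (simp add: \<delta>_def z_def y_def)
  qed
  show ?thesis
    unfolding has_derivative_at y_def[symmetric]
  proof
    show "bounded_linear (\<lambda>h. - blinfun_apply (jP y) h)"
      by (intro bounded_linear_minus blinfun.bounded_linear_right)
    define \<eta> where "\<eta> = min e (min 1 (1 / (2 * A + 1)))"
    have \<eta>: "\<eta> > 0" using e nn by (simp add: \<eta>_def)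
    have "eventually (\<lambda>h::'a. norm h < \<eta>) (at 0)"
      using \<eta> by (auto simp: eventually_at dist_norm)
    then have "eventually (\<lambda>h. norm (norm (jinverse (x + h) - y - - blinfun_apply (jP y) h) / norm h)
        \<le> (2 * A * (Q + B) + B) * norm h) (at 0)"
    proof eventually_elim
      case (elim h)
      have "A * norm h \<le> A * (1 / (2 * A + 1))" using elim nn by (intro mult_left_mono) (auto simp: \<eta>_def)
      also have "\<dots> \<le> 1 / 2" using nn by (simp add: field_simps)
      finally have "norm (jinverse (x + h) - jinverse x + blinfun_apply (jP y) h)
          \<le> (2 * A * (Q + B) + B) * norm h * norm h"
        using elim by (intro bound) (auto simp: \<eta>_def)
      then show ?case using nn by (cases "h = 0") (auto simp: y_def divide_le_eq)
    qed
    moreover have "((\<lambda>h. (2 * A * (Q + B) + B) * norm h) \<longlongrightarrow> 0) (at (0::'a))"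
      by (auto intro!: tendsto_eq_intros)
    ultimately show "((\<lambda>h. norm (jinverse (x + h) - y - - blinfun_apply (jP y) h) / norm h) \<longlongrightarrow> 0) (at 0)"
      by (rule Lim_null_comparison)
  qed
qed

text \<open>Moving \<open>z\<close> along the unit keeps its spectral idempotents and shifts all
  coefficients, so invertibility fails for finitely many shifts only.\<close>

lemma dense_jinvertible_affine:
  fixes c d :: real
  assumes "c \<noteq> 0 \<or> d \<noteq> 0"
  shows "closure {z :: 'a::euclidean_jordan_algebra. jinvertible (c *\<^sub>R z + d *\<^sub>R junit)} = UNIV"
proof -
  have "z \<in> closure {z. jinvertible (c *\<^sub>R z + d *\<^sub>R junit)}" for z :: 'a
  proof -
  obtain C f where C: "orthogonal_idempotents C" "C \<subseteq> jalg z" "\<Sum>C = junit" and f: "z = (\<Sum>c\<in>C. f c *\<^sub>R c)"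
    by (rule spectral_jalg)
  have fin: "finite C" using C by (simp add: orthogonal_idempotents_def)
  show "z \<in> closure {z. jinvertible (c *\<^sub>R z + d *\<^sub>R junit)}"
    unfolding closure_approachable
  proof (intro allI impI)
    fix e :: real assume e: "e > 0"
    \<comment> \<open>The shifts for which some spectral coefficient of the affine expression
      vanishes; for c = 0 there are none, as then d is nonzero.\<close>
    define B where "B = {t. \<exists>p\<in>C. c * (f p + t) + d = 0}"
    have "finite B"
    proof (cases "c = 0")
      case True
      then show ?thesis using assms by (simp add: B_def)
    next
      case False
      have "t \<in> (\<lambda>p. - d / c - f p) ` C" if tB: "t \<in> B" for t
      proof -
        obtain p where p: "p \<in> C" "c * (f p + t) + d = 0" using tB by (auto simp: B_def)
        then have "t = - d / c - f p" using False by (simp add: field_simps) 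
        then show ?thesis using p by blast
      qed
      then have "B \<subseteq> (\<lambda>p. - d / c - f p) ` C" by blast
      then show ?thesis using fin finite_subset by blast
    qed
    moreover have "infinite {0 <..< e / (norm (junit :: 'a) + 1)}"
      using e by (intro infinite_Ioo) (simp add: add_nonneg_pos)
    ultimately obtain t where t: "0 < t" "t < e / (norm (junit :: 'a) + 1)" "t \<notin> B"
      by (metis Diff_infinite_finite finite.emptyI equals0I DiffD1 DiffD2 greaterThanLessThan_iff)
    define z' where "z' = z + t *\<^sub>R junit"
    define g where "g p = c * (f p + t) + d" for p
    have nz: "g p \<noteq> 0" if "p \<in> C" for p using t(3) that by (auto simp: B_def g_def)
    have eq: "c *\<^sub>R z' + d *\<^sub>R junit = (\<Sum>p\<in>C. g p *\<^sub>R p)"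
      unfolding z'_def g_def f C(3)[symmetric]
      by (simp add: scaleR_sum_right sum.distrib algebra_simps)
    have "(\<Sum>p\<in>C. g p *\<^sub>R p) \<star> (\<Sum>p\<in>C. (1 / g p) *\<^sub>R p) = (\<Sum>p\<in>C. (g p * (1 / g p)) *\<^sub>R p)"
      by (rule orthogonal_idempotents_sum_mult_sum[OF C(1)])
    also have "\<dots> = junit" unfolding C(3)[symmetric] using nz by (intro sum.cong) auto
    finally have "jinvertible (c *\<^sub>R z' + d *\<^sub>R junit)"
      unfolding eq using C(2)
      by (intro jinvertibleI(1)[of _ z "\<Sum>p\<in>C. (1 / g p) *\<^sub>R p"] subspace_sum subspace_scale subspace_jalg) auto
    moreover have "dist z' z < e"
    proof -
      have "dist z' z = t * norm (junit :: 'a)" using t by (simp add: z'_def dist_norm)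
      also have "\<dots> \<le> t * (norm (junit :: 'a) + 1)" using t by (intro mult_left_mono) auto
      also have "\<dots> < e" using t(2) by (simp add: pos_less_divide_eq add_nonneg_pos)
      finally show ?thesis .
    qed
    ultimately show "\<exists>y\<in>{z. jinvertible (c *\<^sub>R z + d *\<^sub>R junit)}. dist y z < e" by blast
  qed
qed
  then show ?thesis by blast
qed

section \<open>The Lie algebra of conformal vector fields and real matrices\<close>

lemma linear_jL: "linear (jL :: 'a::euclidean_jordan_algebra \<Rightarrow> _)"
  by (auto intro!: linearI blinfun_eqI simp: blinfun.add_left blinfun.scaleR_left jmult_simps)

lemmas jL_simps = linear_add[OF linear_jL] linear_diff[OF linear_jL] linear_scale[OF linear_jL]
  linear_neg[OF linear_jL]

lemma bounded_linear_jL: "bounded_linear (jL :: 'a::euclidean_jordan_algebra \<Rightarrow> _)"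
  using linear_jL by (simp add: linear_conv_bounded_linear)

lemma derivation_junit:
  assumes "D \<in> aut_alg"
  shows "blinfun_apply D junit = 0"
proof -
  have "blinfun_apply D (junit \<star> junit) = blinfun_apply D junit \<star> junit + junit \<star> blinfun_apply D junit"
    using assms unfolding aut_alg_def by blast
  then show ?thesis by simp
qed

text \<open>Pairing the Leibniz rule with the unit, once as it stands and once after multiplication
  by \<open>c\<close>, gives two relations whose only common solution is 0.\<close>

lemma derivation_idempotent_inner:
  assumes D: "D \<in> aut_alg" and c: "c \<star> c = c"
  shows "inner (blinfun_apply D c) junit = 0"
proof -
  let ?u = "blinfun_apply D c"
  have "?u = ?u \<star> c + c \<star> ?u" using D c unfolding aut_alg_def by (metis (mono_tags, lifting) mem_Collect_eq)
  then have "inner ?u junit = inner (?u \<star> c + c \<star> ?u) junit" by simp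
  also have "\<dots> = 2 * inner (c \<star> ?u) junit" by (simp add: inner_add_left jmult_commute[of _ c])
  finally have 1: "inner ?u junit = 2 * inner (c \<star> ?u) junit" .
  have "c \<star> ?u = c \<star> (?u \<star> c) + c \<star> (c \<star> ?u)"
    using \<open>?u = ?u \<star> c + c \<star> ?u\<close> jmult.add_right by metis
  then have "inner (c \<star> ?u) junit = inner (c \<star> (?u \<star> c)) junit + inner (c \<star> (c \<star> ?u)) junit"
    by (metis inner_add_left)
  also have "\<dots> = 2 * inner (c \<star> ?u) junit"
    by (simp only: inner_jmult[of c] jmult_commute[of "?u" c] junit_right c)
  finally show ?thesis using 1 by simp
qed

lemma derivation_inner_junit:
  fixes D :: "'a::euclidean_jordan_algebra \<Rightarrow>\<^sub>L 'a"
  assumes "D \<in> aut_alg"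
  shows "inner junit (blinfun_apply D x) = 0"
proof -
  obtain C f where C: "orthogonal_idempotents C" and f: "x = (\<Sum>c\<in>C. f c *\<^sub>R c)"
    using spectral_jalg[of x] by metis
  have "inner junit (blinfun_apply D c) = 0" if "c \<in> C" for c
    using derivation_idempotent_inner[OF assms, of c] C that by (auto simp: orthogonal_idempotents_def inner_commute)
  then show ?thesis unfolding f by (simp add: blinfun.sum_right blinfun.scaleR_right inner_sum_right)
qed

lemma inner_adj: "inner (blinfun_apply (adj T) x) y = inner x (blinfun_apply T y)"
proof -
  have lin: "linear (blinfun_apply T)" by (simp add: blinfun.bounded_linear_right bounded_linear.linear)
  have "blinfun_apply (adj T) = adjoint (blinfun_apply T)"
    unfolding adj_def by (rule bounded_linear_Blinfun_apply)
      (simp add: adjoint_linear[OF lin] flip: linear_conv_bounded_linear)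
  then show ?thesis using adjoint_works[OF lin, of y x] by (simp add: inner_commute)
qed

text \<open>The derivation part of \<open>T\<close> kills the unit and has range orthogonal to it,
  and multiplications are self-adjoint. Hence the adjoint in the bracket is harmless at multiples of
  the unit.\<close>

lemma adj_str_alg_junit:
  assumes "T \<in> str_alg"
  shows "blinfun_apply (adj T) junit = blinfun_apply T junit"
proof -
  obtain D a where D: "D \<in> aut_alg" "T = D + jL a" using assms by (auto simp: str_alg_def)
  have "inner (blinfun_apply (adj T) junit) w = inner (blinfun_apply T junit) w" for w
    using derivation_inner_junit[OF D(1), of w] derivation_junit[OF D(1)]
    by (simp add: inner_adj D(2) blinfun.add_left inner_add_right) (metis inner_jmult' junit_left inner_commute)
  then show ?thesis by (metis vector_eq_rdot)
qed

text \<open>The action of a \<open>2 \<times> 2\<close> matrix on \<open>co_alg\<close>: the triple \<open>(u, D + L(a), v)\<close> is treated as the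
  matrix \<open>(a/2, u; v, -a/2)\<close> with entries in \<open>V\<close>, which is conjugated, while \<open>D\<close> is fixed;
  \<open>a\<close> is recovered as the value of \<open>D + L(a)\<close> at the unit.\<close>

definition moebius_conf :: "real \<Rightarrow> real \<Rightarrow> real \<Rightarrow> real \<Rightarrow> 'a::euclidean_jordan_algebra conf \<Rightarrow> 'a conf" where
  "moebius_conf a b c d = (\<lambda>(u, T, v).
     let h = blinfun_apply T junit in
     (a\<^sup>2 *\<^sub>R u - (a * b) *\<^sub>R h - b\<^sup>2 *\<^sub>R v,
      T + jL ((a * d + b * c - 1) *\<^sub>R h + (2 * b * d) *\<^sub>R v - (2 * a * c) *\<^sub>R u),
      d\<^sup>2 *\<^sub>R v + (c * d) *\<^sub>R h - c\<^sup>2 *\<^sub>R u))"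

lemma moebius_conf_apply:
  "moebius_conf a b c d (u, T, v) =
     (a\<^sup>2 *\<^sub>R u - (a * b) *\<^sub>R blinfun_apply T junit - b\<^sup>2 *\<^sub>R v,
      T + jL ((a * d + b * c - 1) *\<^sub>R blinfun_apply T junit + (2 * b * d) *\<^sub>R v - (2 * a * c) *\<^sub>R u),
      d\<^sup>2 *\<^sub>R v + (c * d) *\<^sub>R blinfun_apply T junit - c\<^sup>2 *\<^sub>R u)"
  by (simp add: moebius_conf_def Let_def)

lemma moebius_conf_compose:
  "moebius_conf a b c d (moebius_conf a' b' c' d' X) =
   moebius_conf (a * a' + b * c') (a * b' + b * d') (c * a' + d * c') (c * b' + d * d') X"
proof -
  obtain u T v where X: "X = (u, T, v)" by (cases X)
  define h where "h = blinfun_apply T junit"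
  have h: "blinfun_apply (T + jL w) junit = h + w" for w by (simp add: h_def blinfun.add_left)
  have eqI: "(\<And>w. inner p w = inner r w) \<Longrightarrow> p = r" for p r :: 'a using vector_eq_rdot by blast
  have jLI: "w1 + w2 = w3 \<Longrightarrow> T + jL w1 + jL w2 = T + jL w3" for w1 w2 w3 :: 'a
    by (simp add: jL_simps add.assoc flip: jL_simps(1))
  show ?thesis
    unfolding X moebius_conf_apply h h_def[symmetric] prod.inject
    by (intro conjI jLI; rule eqI)
       (simp_all add: inner_simps power2_eq_square algebra_simps)
qed

lemma moebius_conf_one: "moebius_conf 1 0 0 1 X = X"
  by (cases X) (simp add: moebius_conf_apply jL_simps linear_0[OF linear_jL])

text \<open>The action factors through PSL(2,R). The sign matters because building a matrix from
  shifts and inversions yields it only up to sign.\<close>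

lemma moebius_conf_neg: "moebius_conf (- a) (- b) (- c) (- d) X = moebius_conf a b c d X"
  by (cases X) (simp add: moebius_conf_apply)

lemma moebius_conf_co_alg: "X \<in> co_alg \<Longrightarrow> moebius_conf a b c d X \<in> co_alg"
proof -
  assume "X \<in> co_alg"
  then obtain u T v D w where X: "X = (u, T, v)" "T = D + jL w" "D \<in> aut_alg"
    by (auto simp: co_alg_def str_alg_def)
  have "T + jL z \<in> str_alg" for z
    unfolding str_alg_def X(2) using X(3) by (auto simp: add.assoc intro!: exI[of _ D] exI[of _ "w + z"] simp: jL_simps)
  then show ?thesis by (simp add: X(1) moebius_conf_apply co_alg_def)
qed

lemma conf_field_shift:
  "conf_field (moebius_conf 1 s 0 1 Y) (w + s *\<^sub>R junit) = conf_field Y w"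
proof -
  obtain u T v where Y: "Y = (u, T, v)" by (cases Y)
  have eqI: "(\<And>w. inner p w = inner r w) \<Longrightarrow> p = r" for p r :: 'a using vector_eq_rdot by blast
  have P: "blinfun_apply (jP (w + s *\<^sub>R junit)) v = blinfun_apply (jP w) v + (2 * s) *\<^sub>R (w \<star> v) + s\<^sup>2 *\<^sub>R v"
    by (rule eqI) (simp add: jP_apply jmult_simps inner_simps algebra_simps power2_eq_square)
  show ?thesis
    by (rule eqI) (simp add: Y moebius_conf_apply P blinfun.add_left blinfun.add_right blinfun.scaleR_right
        jL_simps blinfun.scaleR_left jmult_simps inner_simps power2_eq_square jmult_commute[of v w] algebra_simps)
qed

text \<open>The derivative of the inversion at \<open>w\<close> is P(y), where \<open>y\<close> is
  the inverse of \<open>w\<close>; the statement is thus the push-forward of a field by the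
  inversion, whose matrix is (0, -1; 1, 0).\<close>

lemma conf_field_inversion:
  assumes Y: "Y \<in> co_alg" and w: "w \<in> jalg z" "y \<in> jalg z" "w \<star> y = junit"
  shows "conf_field (moebius_conf 0 (- 1) 1 0 Y) (- y) = blinfun_apply (jP y) (conf_field Y w)"
proof -
  obtain u T v D a where X: "Y = (u, T, v)" "T = D + jL a" "D \<in> aut_alg"
    using Y by (auto simp: co_alg_def str_alg_def)
  have yw: "y \<star> w = junit" using w by (simp add: jmult_commute)
  have der: "blinfun_apply D (p \<star> q) = blinfun_apply D p \<star> q + p \<star> blinfun_apply D q" for p q
    using X(3) unfolding aut_alg_def by blast
  have Pa: "blinfun_apply (jP y) (a \<star> w) = a \<star> y"
    using jP_mult_inverse[OF w(2,1) yw, of a] by (simp add: jmult_commute)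
  have Pv: "blinfun_apply (jP y) (blinfun_apply (jP w) v) = v" by (rule jP_jP_inverse[OF w(2,1) yw])
  \<comment> \<open>The derivation \<open>D\<close> is applied to P(w) y = w; the terms in which it
    hits P(w) are evaluated by \<open>jP2_inverse\<close>.\<close>
  have PD: "blinfun_apply (jP y) (blinfun_apply D w) = - blinfun_apply D y"
  proof -
    have wy: "blinfun_apply (jP w) y = w" using jP_mult_inverse[OF w, of junit] by simp
    have "blinfun_apply D w = blinfun_apply D (blinfun_apply (jP w) y)" by (simp add: wy)
    also have "\<dots> = 2 *\<^sub>R blinfun_apply (jP2 w (blinfun_apply D w)) y + blinfun_apply (jP w) (blinfun_apply D y)"
      by (simp add: jP_apply jP2_apply der blinfun.diff_right blinfun.add_right blinfun.scaleR_right jmult_simps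
          jmult_commute[of "blinfun_apply D w" w] scaleR_2 algebra_simps)
    also have "\<dots> = 2 *\<^sub>R blinfun_apply D w + blinfun_apply (jP w) (blinfun_apply D y)"
      by (simp add: jP2_inverse[OF w])
    finally have "blinfun_apply D w = - blinfun_apply (jP w) (blinfun_apply D y)"
      by (simp add: scaleR_2 eq_neg_iff_add_eq_0)
    then show ?thesis by (simp add: blinfun.minus_right jP_jP_inverse[OF w(2,1) yw])
  qed
  show ?thesis
    unfolding X(1,2)
    by (simp add: moebius_conf_apply blinfun.add_left blinfun.diff_right blinfun.add_right blinfun.minus_right
        jL_simps Pa Pv PD jP_minus_apply derivation_junit[OF X(3)] blinfun.diff_left blinfun.minus_left
        blinfun.scaleR_left jmult_simps scaleR_2 algebra_simps)
qed

section \<open>Realising matrices of determinant one by conformal maps\<close>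

lemma closure_Int_open_dense:
  assumes "open U" "open V" "closure U = UNIV" "closure V = UNIV"
  shows "closure (U \<inter> V) = UNIV"
proof -
  have "U \<subseteq> closure (U \<inter> V)" using open_Int_closure_subset[OF assms(1), of V] assms(4) by simp
  then have "closure U \<subseteq> closure (U \<inter> V)" by (simp add: closure_minimal)
  then show ?thesis using assms(3) by blast
qed

text \<open>The equation for \<open>f z\<close> is the division-free form of (a z + b) / (c z + d).
  Keeping \<open>f z\<close> in \<open>jalg z\<close> lets its inverse be computed by associative
  algebra.\<close>

definition realizes_moebius ::
  "('a::euclidean_jordan_algebra \<Rightarrow> 'a) \<Rightarrow> 'a set \<Rightarrow> real \<Rightarrow> real \<Rightarrow> real \<Rightarrow> real \<Rightarrow> bool" where
  "realizes_moebius f U a b c d \<longleftrightarrow> f \<in> conformal_maps \<and> open U \<and> closure U = UNIV \<and>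
     (\<forall>z\<in>U. f z \<in> jalg z \<and> (c *\<^sub>R z + d *\<^sub>R junit) \<star> f z = a *\<^sub>R z + b *\<^sub>R junit \<and>
        (\<exists>D. (f has_derivative D) (at z) \<and>
           (\<forall>Y\<in>co_alg. conf_field (moebius_conf a b c d Y) (f z) = D (conf_field Y z))))"

lemma realizes_moebius_identity: "realizes_moebius (\<lambda>z. z) UNIV 1 0 0 1"
  unfolding realizes_moebius_def
  by (auto simp: conformal_maps.identity moebius_conf_one intro!: exI[of _ "\<lambda>h. h"])

lemma realizes_moebius_shift:
  assumes "realizes_moebius f U a b c d"
  shows "realizes_moebius (\<lambda>z. f z + s *\<^sub>R junit) U (a + s * c) (b + s * d) c d"
proof -
  have comp: "moebius_conf (a + s * c) (b + s * d) c d Y = moebius_conf 1 s 0 1 (moebius_conf a b c d Y)" for Y :: "'a conf"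
    by (simp add: moebius_conf_compose)
  show ?thesis
    unfolding realizes_moebius_def
  proof (intro conjI ballI)
    show "(\<lambda>z. f z + s *\<^sub>R junit) \<in> conformal_maps" "open U" "closure U = UNIV"
      using assms unfolding realizes_moebius_def by (auto intro: conformal_maps.translation)
    fix z assume z: "z \<in> U"
    then have fz: "f z \<in> jalg z" "(c *\<^sub>R z + d *\<^sub>R junit) \<star> f z = a *\<^sub>R z + b *\<^sub>R junit"
      and "\<exists>D. (f has_derivative D) (at z) \<and>
           (\<forall>Y\<in>co_alg. conf_field (moebius_conf a b c d Y) (f z) = D (conf_field Y z))"
      using assms unfolding realizes_moebius_def by blast+
    then obtain D where D: "(f has_derivative D) (at z)"
      "\<And>Y. Y \<in> co_alg \<Longrightarrow> conf_field (moebius_conf a b c d Y) (f z) = D (conf_field Y z)" by blast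
    show "f z + s *\<^sub>R junit \<in> jalg z"
      using fz by (intro subspace_add subspace_scale subspace_jalg) auto
    show "(c *\<^sub>R z + d *\<^sub>R junit) \<star> (f z + s *\<^sub>R junit) = (a + s * c) *\<^sub>R z + (b + s * d) *\<^sub>R junit"
      using fz(2) by (simp add: jmult.add_right[of "c *\<^sub>R z + d *\<^sub>R junit"] jmult.scaleR_right algebra_simps)
    have "((\<lambda>z. f z + s *\<^sub>R junit) has_derivative D) (at z)"
      using D(1) by (auto intro!: derivative_eq_intros)
    then show "\<exists>D. ((\<lambda>z. f z + s *\<^sub>R junit) has_derivative D) (at z) \<and>
        (\<forall>Y\<in>co_alg. conf_field (moebius_conf (a + s * c) (b + s * d) c d Y) (f z + s *\<^sub>R junit) = D (conf_field Y z))"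
      using D(2) by (auto simp: comp conf_field_shift)
  qed
qed

lemma realizes_moebius_inversion:
  fixes f :: "'a::euclidean_jordan_algebra \<Rightarrow> 'a"
  assumes f: "realizes_moebius f U a b c d" and ab: "a \<noteq> 0 \<or> b \<noteq> 0"
  shows "\<exists>(f' :: 'a \<Rightarrow> 'a) U'. realizes_moebius f' U' (- c) (- d) a b"
proof -
  \<comment> \<open>The inverse of \<open>f z\<close> is (c z + d) / (a z + b), so the domain
    shrinks to the points where the denominator is invertible.\<close>
  define V where "V = {z. jinvertible (a *\<^sub>R z + b *\<^sub>R junit :: 'a)}"
  have V: "open V"
    unfolding V_def
    using open_vimage[OF open_jinvertible, of "\<lambda>z. a *\<^sub>R z + b *\<^sub>R junit"] by (simp add: vimage_def continuous_intros)
  have dense: "closure V = UNIV" unfolding V_def by (rule dense_jinvertible_affine[OF ab])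
  have "realizes_moebius (\<lambda>z. - jinverse (f z)) (U \<inter> V) (- c) (- d) a b"
    unfolding realizes_moebius_def
  proof (intro conjI ballI)
    show "(\<lambda>z. - jinverse (f z)) \<in> conformal_maps"
      using f by (simp add: realizes_moebius_def conformal_maps.inversion)
    show "open (U \<inter> V)" using f V by (simp add: realizes_moebius_def open_Int)
    show "closure (U \<inter> V) = UNIV"
      using f V dense by (simp add: realizes_moebius_def closure_Int_open_dense)
    fix z assume z: "z \<in> U \<inter> V"
    have fz: "f z \<in> jalg z" and eq: "(c *\<^sub>R z + d *\<^sub>R junit) \<star> f z = a *\<^sub>R z + b *\<^sub>R junit"
      using f z unfolding realizes_moebius_def by auto
    obtain D where D: "(f has_derivative D) (at z)"
      "\<And>Y. Y \<in> co_alg \<Longrightarrow> conf_field (moebius_conf a b c d Y) (f z) = D (conf_field Y z)"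
      using f z unfolding realizes_moebius_def by blast
    define p where "p = a *\<^sub>R z + b *\<^sub>R junit"
    define r where "r = c *\<^sub>R z + d *\<^sub>R junit"
    have p: "p \<in> jalg z" and r: "r \<in> jalg z"
      unfolding p_def r_def by (intro subspace_add subspace_scale subspace_jalg; simp)+
    have "jinvertible p" using z by (simp add: V_def p_def)
    then obtain i where i: "i \<in> jalg p" "p \<star> i = junit" unfolding jinvertible_def by blast
    have iz: "i \<in> jalg z" using i(1) jalg_subset[OF p] by blast
    define y where "y = r \<star> i"
    have y: "y \<in> jalg z" unfolding y_def by (rule jalg_mult[OF r iz])
    have fy: "f z \<star> y = junit"
      using jalg_assoc[OF iz r fz] jalg_commute[OF fz r, of i] eq i(2)
      by (simp add: y_def p_def r_def)
    note inv = jinvertibleI[OF fz y fy]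
    have py: "p \<star> y = r"
      unfolding y_def using jalg_commute[OF p r, of i] i(2) by simp
    show "- jinverse (f z) \<in> jalg z" unfolding inv(2) using y subspace_neg subspace_jalg by blast
    show "(a *\<^sub>R z + b *\<^sub>R junit) \<star> - jinverse (f z) = - c *\<^sub>R z + - d *\<^sub>R junit"
      unfolding inv(2) using py by (simp add: p_def r_def jmult.minus_right)
    have "((\<lambda>z. jinverse (f z)) has_derivative (\<lambda>h. - blinfun_apply (jP (jinverse (f z))) (D h))) (at z)"
      by (rule has_derivative_compose[OF D(1) has_derivative_jinverse[OF inv(1)]])
    then have der: "((\<lambda>z. - jinverse (f z)) has_derivative (\<lambda>h. blinfun_apply (jP y) (D h))) (at z)"
      using has_derivative_minus inv(2) by fastforce
    have "conf_field (moebius_conf (- c) (- d) a b Y) (- jinverse (f z)) = blinfun_apply (jP y) (D (conf_field Y z))"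
      if Y: "Y \<in> co_alg" for Y
    proof -
      have "moebius_conf (- c) (- d) a b Y = moebius_conf 0 (- 1) 1 0 (moebius_conf a b c d Y)"
        by (simp add: moebius_conf_compose)
      then show ?thesis
        unfolding inv(2) D(2)[OF Y, symmetric]
        using conf_field_inversion[OF moebius_conf_co_alg[OF Y] fz y fy] by simp
    qed
    then show "\<exists>D. ((\<lambda>z. - jinverse (f z)) has_derivative D) (at z) \<and>
        (\<forall>Y\<in>co_alg. conf_field (moebius_conf (- c) (- d) a b Y) (- jinverse (f z)) = D (conf_field Y z))"
      using der by blast
  qed
  then show ?thesis by blast
qed

text \<open>A matrix with \<open>c \<noteq> 0\<close> is a product of a shift, a conjugate of a shift by the inversion, and a shift.\<close>

lemma realizes_moebius_lower:
  assumes "a * d - b * c = 1" "c \<noteq> 0"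
  shows "\<exists>(f :: 'a::euclidean_jordan_algebra \<Rightarrow> 'a) U. realizes_moebius f U (- a) (- b) (- c) (- d)"
proof -
  \<comment> \<open>The two outer shifts are determined by the diagonal entries; the entry
    \<open>b\<close> then follows from the determinant.\<close>
  define x y where "x = (a - 1) / c" and "y = (d - 1) / c"
  have xy: "1 + x * c = a" "1 + c * y = d" "y + x * d = b"
    using assms by (simp_all add: x_def y_def field_simps)
  have 1: "realizes_moebius (\<lambda>z :: 'a. z + y *\<^sub>R junit) UNIV 1 y 0 1"
    using realizes_moebius_shift[OF realizes_moebius_identity, of y] by simp
  obtain f2 :: "'a \<Rightarrow> 'a" and U2 where 2: "realizes_moebius f2 U2 0 (- 1) 1 y"
    using realizes_moebius_inversion[OF 1] by auto
  have 3: "realizes_moebius (\<lambda>z. f2 z + (- c) *\<^sub>R junit) U2 (- c) (- d) 1 y"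
  proof -
    have "- 1 - c * y = - d" using xy(2) by linarith
    then show ?thesis using realizes_moebius_shift[OF 2, of "- c"] by simp
  qed
  obtain f4 :: "'a \<Rightarrow> 'a" and U4 where 4: "realizes_moebius f4 U4 (- 1) (- y) (- c) (- d)"
    using realizes_moebius_inversion[OF 3] assms(2) by auto
  have "- 1 + x * (- c) = - a" "- y + x * (- d) = - b" using xy by (simp_all add: algebra_simps)
  then have "realizes_moebius (\<lambda>z. f4 z + x *\<^sub>R junit) U4 (- a) (- b) (- c) (- d)"
    using realizes_moebius_shift[OF 4, of x] by (simp only:)
  then show ?thesis by blast
qed

lemma realizes_moebius_exists:
  assumes "a * d - b * c = 1"
  shows "\<exists>(f :: 'a::euclidean_jordan_algebra \<Rightarrow> 'a) U. realizes_moebius f U (- a) (- b) (- c) (- d)"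
proof (cases "c = 0")
  case True
  then have "a \<noteq> 0" using assms by auto
  \<comment> \<open>Multiplying by the inversion matrix moves the nonzero entry \<open>a\<close> to
    the lower left corner; one further inversion undoes this.\<close>
  then obtain f :: "'a \<Rightarrow> 'a" and U where f: "realizes_moebius f U (- c) (- d) a b"
    using realizes_moebius_lower[of c "- b" d "- a"] assms by (auto simp: algebra_simps)
  have "- c \<noteq> 0 \<or> - d \<noteq> 0" using assms True by auto
  then show ?thesis using realizes_moebius_inversion[OF f] by blast
next
  case False
  then show ?thesis using realizes_moebius_lower[OF assms] by blast
qed

definition moebius_map :: "real \<Rightarrow> real \<Rightarrow> real \<Rightarrow> real \<Rightarrow> 'a::euclidean_jordan_algebra conf \<Rightarrow> 'a conf" where
  "moebius_map a b c d = restrict (moebius_conf a b c d) co_alg"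

lemma moebius_map_in_conformal_group:
  assumes "a * d - b * c = 1"
  shows "moebius_map a b c d \<in> (conformal_group :: ('a::euclidean_jordan_algebra conf \<Rightarrow> _) set)"
proof -
  obtain f :: "'a \<Rightarrow> 'a" and U where f: "realizes_moebius f U (- a) (- b) (- c) (- d)"
    using realizes_moebius_exists[OF assms] by blast
  have "pushes_forward f X (moebius_map a b c d X)" if X: "X \<in> co_alg" for X
    unfolding pushes_forward_def moebius_map_def restrict_apply if_P[OF X]
  proof (intro exI[of _ U] conjI ballI)
    show "open U" "closure U = UNIV" using f by (simp_all add: realizes_moebius_def)
    fix z assume "z \<in> U"
    then obtain D where "(f has_derivative D) (at z)"
      "conf_field (moebius_conf a b c d X) (f z) = D (conf_field X z)"
      using f X unfolding realizes_moebius_def moebius_conf_neg by meson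
    then show "\<exists>D. (f has_derivative D) (at z) \<and> conf_field (moebius_conf a b c d X) (f z) = D (conf_field X z)"
      by blast
  qed
  moreover have "f \<in> conformal_maps" using f by (simp add: realizes_moebius_def)
  moreover have "moebius_map a b c d \<in> co_alg \<rightarrow>\<^sub>E (co_alg :: 'a conf set)"
    unfolding moebius_map_def by (intro restrict_PiE_iff[THEN iffD2] ballI moebius_conf_co_alg)
  ultimately show ?thesis
    unfolding conformal_group_def by blast
qed

section \<open>One-parameter subgroups of the covering group\<close>

lemma covering_space_sheets:
  assumes "covering_space C p S" "x \<in> S"
  obtains T \<U> where "x \<in> T" "openin (top_of_set S) T" "\<Union>\<U> = C \<inter> p -` T"
    "\<And>u. u \<in> \<U> \<Longrightarrow> openin (top_of_set C) u" "pairwise disjnt \<U>"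
    "\<And>u. u \<in> \<U> \<Longrightarrow> \<exists>r. homeomorphism u T p r"
  using assms unfolding covering_space_def by metis

text \<open>Unlike the library version, the covering space is neither normed nor assumed to be Hausdorff:
  two points of the same fibre are separated by disjoint sheets.\<close>

lemma covering_lift_unique:
  fixes g1 g2 :: "'t::topological_space \<Rightarrow> 'c::topological_space" and p :: "'c \<Rightarrow> 'b::topological_space"
  assumes cov: "covering_space C p S" and I: "connected I" "a \<in> I" "x \<in> I"
    and g1: "continuous_on I g1" "g1 \<in> I \<rightarrow> C" and g2: "continuous_on I g2" "g2 \<in> I \<rightarrow> C"
    and eq: "\<And>t. t \<in> I \<Longrightarrow> p (g1 t) = p (g2 t)" and a: "g1 a = g2 a"
  shows "g1 x = g2 x"
proof -
  define E where "E = {t \<in> I. g1 t = g2 t}"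
  have pre: "openin (top_of_set I) (I \<inter> g -` u)"
    if "continuous_on I g" "g \<in> I \<rightarrow> C" "openin (top_of_set C) u" for g :: "'t \<Rightarrow> 'c" and u
    using continuous_openin_preimage that by blast
  have "\<exists>W. openin (top_of_set I) W \<and> z \<in> W \<and> (W \<subseteq> E \<or> W \<inter> E = {})" if z: "z \<in> I" for z
  proof -
    have "p (g1 z) \<in> S" using covering_space_imp_surjective[OF cov] g1(2) z by blast
    then obtain T \<U> where T: "p (g1 z) \<in> T" "openin (top_of_set S) T" "\<Union>\<U> = C \<inter> p -` T"
      "\<And>u. u \<in> \<U> \<Longrightarrow> openin (top_of_set C) u" "pairwise disjnt \<U>"
      "\<And>u. u \<in> \<U> \<Longrightarrow> \<exists>r. homeomorphism u T p r"
      using covering_space_sheets[OF cov] by metis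
    have "g1 z \<in> \<Union>\<U>" "g2 z \<in> \<Union>\<U>" using T(1,3) g1(2) g2(2) z eq[OF z] by auto
    then obtain u1 u2 where u: "u1 \<in> \<U>" "g1 z \<in> u1" "u2 \<in> \<U>" "g2 z \<in> u2" by blast
    define W where "W = (I \<inter> g1 -` u1) \<inter> (I \<inter> g2 -` u2)"
    have W: "openin (top_of_set I) W" "z \<in> W"
      unfolding W_def using pre[OF g1 T(4)[OF u(1)]] pre[OF g2 T(4)[OF u(3)]] u z by auto
    have "W \<subseteq> E \<or> W \<inter> E = {}"
    proof (cases "u1 = u2")
      case True
      obtain r where "homeomorphism u1 T p r" using T(6)[OF u(1)] by blast
      then have "inj_on p u1" by (metis homeomorphism_apply1 inj_on_def)
      then have "W \<subseteq> E" using eq True unfolding W_def E_def inj_on_def by auto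
      then show ?thesis ..
    next
      case False
      then have "u1 \<inter> u2 = {}" using T(5) u by (auto simp: pairwise_def disjnt_def)
      then show ?thesis by (auto simp: W_def E_def)
    qed
    then show ?thesis using W by blast
  qed
  then obtain W where W: "\<And>z. z \<in> I \<Longrightarrow> openin (top_of_set I) (W z) \<and> z \<in> W z \<and> (W z \<subseteq> E \<or> W z \<inter> E = {})"
    by metis
  have "openin (top_of_set I) E"
    by (subst openin_subopen) (use W in \<open>fastforce simp: E_def\<close>)
  moreover have "openin (top_of_set I) (I - E)"
  proof (subst openin_subopen, intro ballI)
    fix z assume z: "z \<in> I - E"
    then have "W z \<inter> E = {}" using W[of z] by blast
    moreover have "W z \<subseteq> I" using W[of z] z openin_imp_subset by blast
    ultimately show "\<exists>T. openin (top_of_set I) T \<and> z \<in> T \<and> T \<subseteq> I - E" using W[of z] z by blast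
  qed
  then have "closedin (top_of_set I) E" by (simp add: closedin_def E_def)
  ultimately have "E = {} \<or> E = I" using I(1) by (simp add: connected_clopen)
  then show ?thesis using a I by (auto simp: E_def)
qed

lemma topological_group_continuous_mult:
  assumes "topological_group H" "continuous_on I f" "continuous_on I g" "f \<in> I \<rightarrow> carrier H" "g \<in> I \<rightarrow> carrier H"
  shows "continuous_on I (\<lambda>t. f t \<otimes>\<^bsub>H\<^esub> g t)"
proof -
  have "continuous_on (carrier H \<times> carrier H) (\<lambda>(g, h). g \<otimes>\<^bsub>H\<^esub> h)"
    using assms(1) by (simp add: topological_group_def)
  moreover have "continuous_on I (\<lambda>t. (f t, g t))" by (intro continuous_intros assms)
  ultimately have "continuous_on I ((\<lambda>(g, h). g \<otimes>\<^bsub>H\<^esub> h) \<circ> (\<lambda>t. (f t, g t)))"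
    by (intro continuous_on_compose) (use assms(4,5) in \<open>auto elim!: continuous_on_subset\<close>)
  then show ?thesis by (simp add: o_def)
qed

text \<open>Near \<open>0\<close> the path is lifted through the sheet of the unit by a local section \<open>\<sigma>\<close>;
  globally the lift is \<open>\<sigma>(t / n)\<^sup>n\<close>, which does not depend on large \<open>n\<close>.\<close>

lemma one_parameter_lift:
  fixes H :: "'g::topological_space monoid" and p :: "'g \<Rightarrow> 'b::topological_space" and \<beta> :: "real \<Rightarrow> 'b"
  assumes H: "topological_group H" and cov: "covering_space (carrier H) p S"
    and mult: "\<And>g h. g \<in> carrier H \<Longrightarrow> h \<in> carrier H \<Longrightarrow> p (g \<otimes>\<^bsub>H\<^esub> h) = m (p g) (p h)"
    and \<beta>: "continuous_on UNIV \<beta>" "\<And>t. \<beta> t \<in> S" "\<And>s t. \<beta> (s + t) = m (\<beta> s) (\<beta> t)" "\<beta> 0 = p \<one>\<^bsub>H\<^esub>"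
  obtains \<gamma> where "continuous_on UNIV \<gamma>" "range \<gamma> \<subseteq> carrier H"
    "\<And>s t. \<gamma> (s + t) = \<gamma> s \<otimes>\<^bsub>H\<^esub> \<gamma> t" "\<And>t. p (\<gamma> t) = \<beta> t"
proof -
  interpret H: group H using H by (simp add: topological_group_def)
  obtain T \<U> where T: "\<beta> 0 \<in> T" "openin (top_of_set S) T" "\<Union>\<U> = carrier H \<inter> p -` T"
      "\<And>u. u \<in> \<U> \<Longrightarrow> openin (top_of_set (carrier H)) u" "pairwise disjnt \<U>"
      "\<And>u. u \<in> \<U> \<Longrightarrow> \<exists>r. homeomorphism u T p r"
    using covering_space_sheets[OF cov \<beta>(2)[of 0]] by metis
  have "\<one>\<^bsub>H\<^esub> \<in> \<Union>\<U>" using T(1,3) \<beta>(4) by auto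
  then obtain u where u: "u \<in> \<U>" "\<one>\<^bsub>H\<^esub> \<in> u" by blast
  obtain r where r: "homeomorphism u T p r" using T(6)[OF u(1)] by blast
  have uH: "u \<subseteq> carrier H" using T(3) u(1) by blast
  have "openin (top_of_set UNIV) (UNIV \<inter> \<beta> -` T)"
    by (rule continuous_openin_preimage[OF \<beta>(1) _ T(2)]) (use \<beta>(2) in auto)
  then have "open (\<beta> -` T)" by simp
  then obtain \<epsilon> where \<epsilon>: "\<epsilon> > 0" "\<And>t. \<bar>t\<bar> < \<epsilon> \<Longrightarrow> \<beta> t \<in> T"
  proof -
    have "0 \<in> \<beta> -` T" using T(1) by simp
    then obtain e where "e > 0" "\<forall>y. dist y 0 < e \<longrightarrow> y \<in> \<beta> -` T"
      using \<open>open (\<beta> -` T)\<close> unfolding open_dist by blast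
    then show ?thesis using that[of e] by (simp add: dist_real_def)
  qed
  define \<sigma> where "\<sigma> t = r (\<beta> t)" for t
  have \<sigma>: "\<sigma> t \<in> carrier H" "p (\<sigma> t) = \<beta> t" if "\<bar>t\<bar> < \<epsilon>" for t
    using r \<epsilon>(2)[OF that] uH by (auto simp: \<sigma>_def homeomorphism_def)
  have \<sigma>0: "\<sigma> 0 = \<one>\<^bsub>H\<^esub>" unfolding \<sigma>_def \<beta>(4) using r u(2) by (simp add: homeomorphism_apply1)
  have \<sigma>c: "continuous_on {-\<epsilon><..<\<epsilon>} \<sigma>"
  proof -
    have "continuous_on {-\<epsilon><..<\<epsilon>} (r \<circ> \<beta>)"
      by (intro continuous_on_compose continuous_on_subset[OF \<beta>(1)] continuous_on_subset[OF homeomorphism_cont2[OF r]])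
         (use \<epsilon>(2) in auto)
    then show ?thesis by (simp add: \<sigma>_def o_def[abs_def])
  qed
  define I where "I n = {- (real n * \<epsilon>)<..<real n * \<epsilon>}" for n
  define g where "g n t = \<sigma> (t / real n) [^]\<^bsub>H\<^esub> n" for n :: nat and t
  have small: "\<bar>t / real n\<bar> < \<epsilon>" if "n > 0" "t \<in> I n" for n t
    using that by (auto simp: I_def abs_less_iff field_simps)
  have gH: "g n t \<in> carrier H" if "n > 0" "t \<in> I n" for n t
    unfolding g_def using \<sigma>(1)[OF small[OF that]] by simp
  have pow: "p (h [^]\<^bsub>H\<^esub> k) = \<beta> (real k * s)" if "h \<in> carrier H" "p h = \<beta> s" for h k s
    using that
  proof (induction k)
    case (Suc k)
    have "p (h [^]\<^bsub>H\<^esub> Suc k) = m (p (h [^]\<^bsub>H\<^esub> k)) (p h)" using that by (simp add: mult)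
    also have "\<dots> = \<beta> (real k * s + s)" using Suc by (simp add: \<beta>(3))
    finally show ?case by (simp add: algebra_simps)
  qed (simp add: \<beta>(4))
  have pg: "p (g n t) = \<beta> t" if "n > 0" "t \<in> I n" for n t
    unfolding g_def using pow[OF \<sigma>[OF small[OF that]]] that by simp
  have contpow: "continuous_on I (\<lambda>t. f t [^]\<^bsub>H\<^esub> k)"
    if "continuous_on I f" "f \<in> I \<rightarrow> carrier H" for f :: "real \<Rightarrow> 'g" and I and k :: nat
  proof (induction k)
    case (Suc k)
    then show ?case using that
      by (simp, intro topological_group_continuous_mult[OF H]) auto
  qed simp
  have gc: "continuous_on (I n) (g n)" if "n > 0" for n
  proof -
    have "(\<lambda>t. t / real n) ` I n \<subseteq> {-\<epsilon><..<\<epsilon>}"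
    proof (rule image_subsetI)
      fix t assume "t \<in> I n"
      from small[OF that this] show "t / real n \<in> {-\<epsilon><..<\<epsilon>}"
        unfolding abs_less_iff greaterThanLessThan_iff by linarith
    qed
    then have "continuous_on (I n) (\<sigma> \<circ> (\<lambda>t. t / real n))"
      using that by (intro continuous_on_compose continuous_intros continuous_on_subset[OF \<sigma>c]) auto
    then show ?thesis
      unfolding g_def[abs_def] o_def using \<sigma>(1) small[OF that] by (intro contpow) auto
  qed
  have g0: "g n 0 = \<one>\<^bsub>H\<^esub>" for n by (simp add: g_def \<sigma>0)
  have sub: "I n \<subseteq> I k" if "n \<le> k" for n k
  proof -
    have "real n * \<epsilon> \<le> real k * \<epsilon>" using that \<epsilon> by (intro mult_right_mono) auto
    then show ?thesis by (auto simp: I_def)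
  qed
  have consistent: "g n t = g k t" if "0 < n" "n \<le> k" "t \<in> I n" for n k t
  proof (rule covering_lift_unique[OF cov, of "I n" 0 t "g n" "g k"])
    show "connected (I n)" by (simp add: I_def)
    show "0 \<in> I n" using that \<epsilon> by (simp add: I_def)
    show "continuous_on (I n) (g k)" using gc[of k] that sub continuous_on_subset by fastforce
    show "g k \<in> I n \<rightarrow> carrier H" using gH[of k] that sub[OF that(2)] by auto
    show "p (g n t) = p (g k t)" if "t \<in> I n" for t
      using pg[of n t] pg[of k t] that \<open>0 < n\<close> \<open>n \<le> k\<close> sub[OF \<open>n \<le> k\<close>] by auto
    show "g n \<in> I n \<rightarrow> carrier H" using gH[OF that(1)] by blast
    show "g n 0 = g k 0" by (simp add: g0)
  qed (rule that gc[OF that(1)])+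
  define N where "N t = nat \<lceil>\<bar>t\<bar> / \<epsilon>\<rceil> + 1" for t
  have N: "N t > 0" "t \<in> I (N t)" for t
  proof -
    have "\<bar>t\<bar> / \<epsilon> < real (N t)" unfolding N_def by linarith
    then have "\<bar>t\<bar> < real (N t) * \<epsilon>" using \<epsilon> by (simp add: divide_less_eq)
    then show "t \<in> I (N t)" by (auto simp: I_def)
  qed (simp add: N_def)
  define \<gamma> where "\<gamma> t = g (N t) t" for t
  have \<gamma>g: "\<gamma> t = g n t" if "n > 0" "t \<in> I n" for n t
  proof (cases "n \<le> N t")
    case True
    show ?thesis unfolding \<gamma>_def by (rule consistent[OF that(1) True that(2), symmetric])
  next
    case False
    then have "N t \<le> n" by simp
    show ?thesis unfolding \<gamma>_def by (rule consistent[OF N(1) \<open>N t \<le> n\<close> N(2)])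
  qed
  have \<gamma>H: "\<gamma> t \<in> carrier H" for t unfolding \<gamma>_def by (rule gH[OF N])
  have p\<gamma>: "p (\<gamma> t) = \<beta> t" for t unfolding \<gamma>_def by (rule pg[OF N])
  have \<gamma>0: "\<gamma> 0 = \<one>\<^bsub>H\<^esub>" by (simp add: \<gamma>_def g0)
  have \<gamma>c: "continuous_on UNIV \<gamma>"
  proof -
    have "continuous_on (\<Union>(I ` {0<..})) \<gamma>"
    proof (rule continuous_on_open_Union)
      fix s assume "s \<in> I ` {0<..}"
      then obtain n where n: "n > 0" "s = I n" by auto
      show "open s" by (simp add: n I_def)
      show "continuous_on s \<gamma>" unfolding n(2)
        using gc[OF n(1)] by (rule continuous_on_eq) (use \<gamma>g n in auto)
    qed
    moreover have "\<Union>(I ` {0<..}) = UNIV" using N by blast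
    ultimately show ?thesis by simp
  qed
  \<comment> \<open>For fixed \<open>s\<close> both sides are lifts of the same path and agree at t
    = 0.\<close>
  have "\<gamma> (s + t) = \<gamma> s \<otimes>\<^bsub>H\<^esub> \<gamma> t" for s t
  proof (rule covering_lift_unique[OF cov, of UNIV 0 t "\<lambda>t. \<gamma> (s + t)" "\<lambda>t. \<gamma> s \<otimes>\<^bsub>H\<^esub> \<gamma> t"])
    show "continuous_on UNIV (\<lambda>t. \<gamma> (s + t))"
      using continuous_on_compose2[OF \<gamma>c, of UNIV "\<lambda>t. s + t"] by (simp add: continuous_intros)
    show "continuous_on UNIV (\<lambda>t. \<gamma> s \<otimes>\<^bsub>H\<^esub> \<gamma> t)"
      by (intro topological_group_continuous_mult[OF H] continuous_on_const \<gamma>c) (use \<gamma>H in auto)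
  qed (use \<gamma>H in \<open>auto simp: \<gamma>0 mult p\<gamma> \<beta>(3)\<close>)
  then show ?thesis using that[OF \<gamma>c _ _ p\<gamma>] \<gamma>H by blast
qed

text \<open>On a ball of radius 1/(2 K) around a zero, the maximum of the norm is at most half of
  itself. So the zero set is open, and it is closed by continuity.\<close>

lemma linear_ode_zero:
  fixes w :: "real \<Rightarrow> 'b::real_normed_vector"
  assumes L: "bounded_linear L" and w: "\<And>t. (w has_vector_derivative L (w t)) (at t)" and w0: "w 0 = 0"
  shows "w t = 0"
proof -
  obtain K where K: "K > 0" "\<And>x. norm (L x) \<le> norm x * K" using bounded_linear.pos_bounded[OF L] by blast
  define \<delta> where "\<delta> = 1 / (2 * K)"
  have \<delta>: "\<delta> > 0" using K by (simp add: \<delta>_def)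
  have wc: "continuous_on I w" for I
    using w by (intro continuous_at_imp_continuous_on ballI has_vector_derivative_continuous)
  have loc: "w s = 0" if t0: "w t0 = 0" and s: "s \<in> cball t0 \<delta>" for t0 s
  proof -
    have "continuous_on (cball t0 \<delta>) (\<lambda>t. norm (w t))" by (intro continuous_intros wc)
    then obtain t1 where t1: "t1 \<in> cball t0 \<delta>" "\<And>t. t \<in> cball t0 \<delta> \<Longrightarrow> norm (w t) \<le> norm (w t1)"
      using continuous_attains_sup[of "cball t0 \<delta>" "\<lambda>t. norm (w t)"] \<delta> by auto
    have "norm (w t1 - w t0) \<le> (norm (w t1) * K) * norm (t1 - t0)"
    proof (rule differentiable_bound[of "cball t0 \<delta>" w "\<lambda>t h. h *\<^sub>R L (w t)"])
      show "(w has_derivative (\<lambda>h. h *\<^sub>R L (w t))) (at t within cball t0 \<delta>)" for t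
        using w[of t] has_derivative_at_withinI unfolding has_vector_derivative_def by blast
      show "onorm (\<lambda>h. h *\<^sub>R L (w t)) \<le> norm (w t1) * K" if "t \<in> cball t0 \<delta>" for t
      proof (rule onorm_le)
        fix h :: real
        have "norm (L (w t)) \<le> norm (w t1) * K"
          using K(2)[of "w t"] t1(2)[OF that] K(1) by (meson mult_right_mono order_trans less_imp_le)
        then show "norm (h *\<^sub>R L (w t)) \<le> norm (w t1) * K * norm h"
          by (simp add: mult.commute mult_left_mono)
      qed
    qed (use t1 \<delta> in auto)
    also have "\<dots> \<le> (norm (w t1) * K) * \<delta>"
      using t1(1) K by (intro mult_left_mono) (auto simp: dist_norm norm_minus_commute)
    also have "\<dots> = norm (w t1) / 2" using K by (simp add: \<delta>_def)
    finally have "norm (w t1) = 0" using t0 by simp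
    then show ?thesis using t1(2)[OF s] by simp
  qed
  define E where "E = {t. w t = 0}"
  have "open E" unfolding open_contains_cball E_def using loc \<delta> by blast
  moreover have "closed E"
    unfolding E_def using continuous_closed_preimage_constant[OF wc[of UNIV] closed_UNIV, of 0] by simp
  ultimately have "E = {} \<or> E = UNIV" using clopen[of E] by blast
  then show ?thesis using w0 by (auto simp: E_def)
qed

lemma has_vector_derivative_at_shift:
  assumes "((\<lambda>h. f (t + h)) has_vector_derivative D) (at 0)"
  shows "(f has_vector_derivative D) (at t)"
  using assms unfolding has_vector_derivative_def has_derivative_at by simp

section \<open>Curves in SL(2,R) and their tangent vectors\<close>

lemma jbox_junit: "jbox junit v = jL v" "jbox u junit = jL u"
  by (auto intro!: blinfun_eqI simp: jbox_def blinfun.add_left blinfun.diff_left)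

lemma jbox_scaleR: "jbox (s *\<^sub>R u) v = s *\<^sub>R jbox u v" "jbox u (s *\<^sub>R v) = s *\<^sub>R jbox u v"
  by (auto intro!: blinfun_eqI simp: jbox_def blinfun.add_left blinfun.diff_left blinfun.scaleR_left
      jmult_simps algebra_simps)

text \<open>On \<open>co_alg\<close> this is the bracket with
  \<open>(P *\<^sub>R junit, 0, Q *\<^sub>R junit)\<close>. Written without the adjoint it is
  bounded linear on the whole product space, where \<open>linear_ode_zero\<close> applies.\<close>

definition sl2_bracket :: "real \<Rightarrow> real \<Rightarrow> 'a::euclidean_jordan_algebra conf \<Rightarrow> 'a conf" where
  "sl2_bracket P Q = (\<lambda>(u, T, v). (- (P *\<^sub>R blinfun_apply T junit), jL ((2 * P) *\<^sub>R v - (2 * Q) *\<^sub>R u),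
     Q *\<^sub>R blinfun_apply T junit))"

lemma bounded_linear_sl2_bracket: "bounded_linear (sl2_bracket P Q)"
proof -
  have [simp]: "bounded_linear (\<lambda>X::'a conf. blinfun_apply (fst (snd X)) junit)"
    by (intro bounded_linear_compose[OF blinfun.bounded_linear_left]
        bounded_linear_compose[OF bounded_linear_fst bounded_linear_snd])
  have [simp]: "bounded_linear (\<lambda>X::'a conf. snd (snd X))"
    by (intro bounded_linear_compose[OF bounded_linear_snd bounded_linear_snd])
  have "bounded_linear (\<lambda>X::'a conf. (- (P *\<^sub>R blinfun_apply (fst (snd X)) junit),
      jL ((2 * P) *\<^sub>R snd (snd X) - (2 * Q) *\<^sub>R fst X), Q *\<^sub>R blinfun_apply (fst (snd X)) junit))"
    by (intro bounded_linear_Pair bounded_linear_minus bounded_linear_compose[OF bounded_linear_scaleR_right]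
        bounded_linear_compose[OF bounded_linear_jL] bounded_linear_sub bounded_linear_fst; simp)
  moreover have "sl2_bracket P Q = (\<lambda>X::'a conf. (- (P *\<^sub>R blinfun_apply (fst (snd X)) junit),
      jL ((2 * P) *\<^sub>R snd (snd X) - (2 * Q) *\<^sub>R fst X), Q *\<^sub>R blinfun_apply (fst (snd X)) junit))"
    by (auto simp: sl2_bracket_def case_prod_beta)
  ultimately show ?thesis by simp
qed

lemma conf_bracket_sl2:
  fixes Y :: "'a::euclidean_jordan_algebra conf"
  assumes "Y \<in> co_alg"
  shows "conf_bracket (P *\<^sub>R junit, 0, Q *\<^sub>R junit) Y = sl2_bracket P Q Y"
proof -
  obtain u T v where Y: "Y = (u, T, v)" "T \<in> str_alg" using assms by (auto simp: co_alg_def)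
  have "blinfun_apply (adj (0 :: 'a \<Rightarrow>\<^sub>L 'a)) v = 0"
  proof -
    have "inner (blinfun_apply (adj 0) v) w = 0" for w by (simp add: inner_adj)
    then show ?thesis by (metis inner_eq_zero_iff)
  qed
  moreover have "(0 :: 'a \<Rightarrow>\<^sub>L 'a) o\<^sub>L T - T o\<^sub>L 0 = 0" by (rule blinfun_eqI) (simp add: blinfun.diff_left)
  ultimately show ?thesis
    by (simp add: Y sl2_bracket_def jbox_scaleR jbox_junit jL_simps blinfun.scaleR_right adj_str_alg_junit[OF Y(2)])
qed

text \<open>A one-parameter subgroup of SL(2,R), by matrix entries, with tangent matrix (0, P; Q, 0)
  at 0.\<close>

locale sl2_curve =
  fixes P Q :: real and a b c d :: "real \<Rightarrow> real"
  assumes det: "a t * d t - b t * c t = 1"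
    and hom: "a (s + t) = a s * a t + b s * c t" "b (s + t) = a s * b t + b s * d t"
      "c (s + t) = c s * a t + d s * c t" "d (s + t) = c s * b t + d s * d t"
    and zero: "a 0 = 1" "b 0 = 0" "c 0 = 0" "d 0 = 1"
    and deriv: "(a has_real_derivative 0) (at 0)" "(b has_real_derivative P) (at 0)"
      "(c has_real_derivative Q) (at 0)" "(d has_real_derivative 0) (at 0)"
    and cont: "continuous_on UNIV a" "continuous_on UNIV b" "continuous_on UNIV c" "continuous_on UNIV d"
begin

definition path :: "real \<Rightarrow> 'a::euclidean_jordan_algebra conf \<Rightarrow> 'a conf" where
  "path t = moebius_map (a t) (b t) (c t) (d t)"

lemma path_0: "path 0 = (\<lambda>X\<in>co_alg. X)"
  unfolding path_def zero moebius_map_def by (simp add: moebius_conf_one restrict_def fun_eq_iff)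

lemma path_apply: "Y \<in> co_alg \<Longrightarrow> path t Y = moebius_conf (a t) (b t) (c t) (d t) Y"
  by (simp add: path_def moebius_map_def)

lemma path_co_alg: "Y \<in> co_alg \<Longrightarrow> path t Y \<in> co_alg"
  by (simp add: path_apply moebius_conf_co_alg)

lemma path_add: "path (s + t) = compose co_alg (path s) (path t)"
proof
  fix X :: "'a::euclidean_jordan_algebra conf"
  show "path (s + t) X = compose co_alg (path s) (path t) X"
  proof (cases "X \<in> co_alg")
    case True
    then show ?thesis
      by (simp add: compose_eq path_apply[OF path_co_alg] path_apply moebius_conf_compose hom moebius_conf_co_alg)
  next
    case False
    then show ?thesis by (simp add: compose_def path_def moebius_map_def)
  qed
qed

lemma path_continuous: "continuous_on UNIV (path :: real \<Rightarrow> 'a::euclidean_jordan_algebra conf \<Rightarrow> 'a conf)"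
proof (rule continuous_on_coordinatewise_then_product)
  fix X :: "'a conf"
  obtain u T v where X: "X = (u, T, v)" by (cases X)
  show "continuous_on UNIV (\<lambda>t. path t X)"
  proof (cases "X \<in> co_alg")
    case True
    show ?thesis
      unfolding path_apply[OF True] unfolding X moebius_conf_apply
      by (intro continuous_intros cont bounded_linear.continuous_on[OF bounded_linear_jL])
  next
    case False
    then show ?thesis by (simp add: path_def moebius_map_def)
  qed
qed

lemma path_in_group: "path t \<in> (conformal_group_0 :: ('a::euclidean_jordan_algebra conf \<Rightarrow> 'a conf) set)"
proof -
  have "connected (range (path :: real \<Rightarrow> 'a conf \<Rightarrow> 'a conf))"
    by (rule connected_continuous_image[OF path_continuous connected_UNIV])
  moreover have "range (path :: real \<Rightarrow> 'a conf \<Rightarrow> 'a conf) \<subseteq> conformal_group"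
    unfolding path_def using moebius_map_in_conformal_group[OF det] by blast
  moreover have "(\<lambda>X\<in>co_alg. X) \<in> range (path :: real \<Rightarrow> 'a conf \<Rightarrow> 'a conf)"
    using path_0 by (metis rangeI)
  ultimately show ?thesis
    unfolding conformal_group_0_def mem_Collect_eq connected_component_def by blast
qed

lemma moebius_derivative:
  "((\<lambda>t. moebius_conf (a t) (b t) (c t) (d t) Y) has_vector_derivative sl2_bracket P Q Y) (at 0)"
proof -
  obtain u T v where Y: "Y = (u, T, v)" by (cases Y)
  define h where "h = blinfun_apply T junit"
  note der = deriv[unfolded has_real_derivative_iff_has_vector_derivative[symmetric]]
  have 1: "((\<lambda>t. (a t)\<^sup>2 *\<^sub>R u - (a t * b t) *\<^sub>R h - (b t)\<^sup>2 *\<^sub>R v) has_vector_derivative - (P *\<^sub>R h)) (at 0)"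
    unfolding has_vector_derivative_def
    by (rule derivative_eq_intros deriv[unfolded has_field_derivative_def] refl)+ (auto simp: zero algebra_simps)
  have 2: "((\<lambda>t. (a t * d t + b t * c t - 1) *\<^sub>R h + (2 * b t * d t) *\<^sub>R v - (2 * a t * c t) *\<^sub>R u)
      has_vector_derivative (2 * P) *\<^sub>R v - (2 * Q) *\<^sub>R u) (at 0)"
    unfolding has_vector_derivative_def
    by (rule derivative_eq_intros deriv[unfolded has_field_derivative_def] refl)+ (auto simp: zero algebra_simps)
  have 3: "((\<lambda>t. (d t)\<^sup>2 *\<^sub>R v + (c t * d t) *\<^sub>R h - (c t)\<^sup>2 *\<^sub>R u) has_vector_derivative Q *\<^sub>R h) (at 0)"
    unfolding has_vector_derivative_def
    by (rule derivative_eq_intros deriv[unfolded has_field_derivative_def] refl)+ (auto simp: zero algebra_simps)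
  have 4: "((\<lambda>t. T + jL ((a t * d t + b t * c t - 1) *\<^sub>R h + (2 * b t * d t) *\<^sub>R v - (2 * a t * c t) *\<^sub>R u))
      has_vector_derivative 0 + jL ((2 * P) *\<^sub>R v - (2 * Q) *\<^sub>R u)) (at 0)"
    by (intro has_vector_derivative_add has_vector_derivative_const
        bounded_linear.has_vector_derivative[OF bounded_linear_jL 2])
  show ?thesis
    unfolding Y moebius_conf_apply h_def[symmetric] sl2_bracket_def
    using has_vector_derivative_Pair[OF 1 has_vector_derivative_Pair[OF 4 3]] by (simp add: h_def)
qed

end

section \<open>Exponentials in the covering group\<close>

locale covering_group =
  fixes H :: "'g::topological_space monoid" and q :: "'g \<Rightarrow> 'a::euclidean_jordan_algebra conf \<Rightarrow> 'a conf"
  assumes cover: "universal_cover_of_conformal_group H q"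
begin

lemma H: "topological_group H" and cov: "covering_space (carrier H) q conformal_group_0"
  and q_mult: "g \<in> carrier H \<Longrightarrow> h \<in> carrier H \<Longrightarrow> q (g \<otimes>\<^bsub>H\<^esub> h) = compose co_alg (q g) (q h)"
  using cover by (auto simp: universal_cover_of_conformal_group_def)

sublocale H: group H using H by (simp add: topological_group_def)

lemma q_in: "g \<in> carrier H \<Longrightarrow> q g \<in> conformal_group_0"
  using covering_space_imp_surjective[OF cov] by blast

lemma q_co_alg: "g \<in> carrier H \<Longrightarrow> q g \<in> co_alg \<rightarrow>\<^sub>E co_alg"
proof -
  assume "g \<in> carrier H"
  then have "q g \<in> conformal_group"
    using q_in connected_component_subset[of conformal_group] unfolding conformal_group_0_def by blast
  then show ?thesis by (simp add: conformal_group_def)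
qed

text \<open>Multiplicativity is applied to the unit and an element over the identity map; such an
  element exists because the covering map is onto.\<close>

lemma q_one: "q \<one>\<^bsub>H\<^esub> = (\<lambda>X\<in>co_alg. X)"
proof -
  interpret sl2_curve 1 0 "\<lambda>t. 1" "\<lambda>t. t" "\<lambda>t. 0" "\<lambda>t. 1"
    by unfold_locales (auto intro!: derivative_eq_intros continuous_intros)
  have "(\<lambda>X\<in>co_alg. X) \<in> (conformal_group_0 :: ('a conf \<Rightarrow> 'a conf) set)"
    using path_in_group[of 0] by (simp add: path_0)
  then obtain h where h: "h \<in> carrier H" "q h = (\<lambda>X\<in>co_alg. X)"
    using covering_space_imp_surjective[OF cov] by (metis imageE)
  have "(\<lambda>X\<in>co_alg. X) = compose co_alg (\<lambda>X\<in>co_alg. X) (q \<one>\<^bsub>H\<^esub>)"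
    using q_mult[OF h(1) H.one_closed] h by simp
  also have "\<dots> = q \<one>\<^bsub>H\<^esub>"
    using q_co_alg[OF H.one_closed] by (intro Id_compose) (auto simp: PiE_def)
  finally show ?thesis ..
qed

text \<open>The projected subgroup and the matrix path solve the same linear differential equation
  pointwise on \<open>co_alg\<close>, with the same initial value.\<close>

lemma one_parameter_unique:
  assumes c: "sl2_curve P Q a b c d"
    and \<gamma>: "one_parameter_subgroup H q (P *\<^sub>R junit, 0, Q *\<^sub>R junit) \<gamma>"
  shows "q (\<gamma> t) = sl2_curve.path a b c d t"
proof
  interpret sl2_curve P Q a b c d by (rule c)
  have \<gamma>H: "\<gamma> t \<in> carrier H" for t using \<gamma> by (auto simp: one_parameter_subgroup_def)
  have \<gamma>add: "\<gamma> (s + t) = \<gamma> s \<otimes>\<^bsub>H\<^esub> \<gamma> t" for s t using \<gamma> by (simp add: one_parameter_subgroup_def)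
  have "\<gamma> 0 = \<gamma> 0 \<otimes>\<^bsub>H\<^esub> \<gamma> 0" using \<gamma>add[of 0 0] by simp
  then have \<gamma>0: "\<gamma> 0 = \<one>\<^bsub>H\<^esub>" using \<gamma>H H.r_cancel_one' by metis
  have \<gamma>d: "((\<lambda>t. q (\<gamma> t) Y) has_vector_derivative sl2_bracket P Q Y) (at 0)" if "Y \<in> co_alg" for Y
    using \<gamma> that conf_bracket_sl2[OF that, of P Q] by (auto simp: one_parameter_subgroup_def)
  fix Y :: "'a conf"
  show "q (\<gamma> t) Y = path t Y"
  proof (cases "Y \<in> co_alg")
    case Y: True
    define w where "w t = q (\<gamma> t) Y - path t Y" for t
    have "(w has_vector_derivative sl2_bracket P Q (w t)) (at t)" for t
    proof -
      have qY: "q (\<gamma> t) Y \<in> co_alg" using q_co_alg[OF \<gamma>H[of t]] Y by auto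
      have "(\<lambda>h. q (\<gamma> (t + h)) Y) = (\<lambda>h. q (\<gamma> h) (q (\<gamma> t) Y))"
        unfolding add.commute[of t] \<gamma>add q_mult[OF \<gamma>H \<gamma>H] compose_eq[OF Y] ..
      then have 1: "((\<lambda>t. q (\<gamma> t) Y) has_vector_derivative sl2_bracket P Q (q (\<gamma> t) Y)) (at t)"
        using \<gamma>d[OF qY] by (rule_tac has_vector_derivative_at_shift) (simp only:)
      have "(\<lambda>h. path (t + h) Y) = (\<lambda>h. path h (path t Y))"
        unfolding add.commute[of t] path_add compose_eq[OF Y] ..
      moreover have "((\<lambda>h. path h (path t Y)) has_vector_derivative sl2_bracket P Q (path t Y)) (at 0)"
        unfolding path_apply[OF path_co_alg[OF Y]] by (rule moebius_derivative)
      ultimately have 2: "((\<lambda>t. path t Y) has_vector_derivative sl2_bracket P Q (path t Y)) (at t)"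
        by (rule_tac has_vector_derivative_at_shift) (simp only:)
      have "((\<lambda>t. q (\<gamma> t) Y - path t Y) has_vector_derivative
          sl2_bracket P Q (q (\<gamma> t) Y) - sl2_bracket P Q (path t Y)) (at t)"
        by (rule has_vector_derivative_diff[OF 1 2])
      then show ?thesis
        unfolding w_def[abs_def] by (simp add: bounded_linear.linear[OF bounded_linear_sl2_bracket] linear_diff)
    qed
    moreover have "w 0 = 0" by (simp add: w_def \<gamma>0 q_one path_0)
    ultimately have "w t = 0" by (rule linear_ode_zero[OF bounded_linear_sl2_bracket])
    then show ?thesis by (simp add: w_def)
  next
    case False
    then show ?thesis using PiE_arb[OF q_co_alg[OF \<gamma>H[of t]] False]
      by (simp add: path_def moebius_map_def)
  qed
qed

lemma one_parameter_exists:
  assumes c: "sl2_curve P Q a b c d"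
  shows "\<exists>\<gamma>. one_parameter_subgroup H q (P *\<^sub>R junit, 0, Q *\<^sub>R junit) \<gamma>"
proof -
  interpret sl2_curve P Q a b c d by (rule c)
  obtain \<gamma> where \<gamma>: "continuous_on UNIV \<gamma>" "range \<gamma> \<subseteq> carrier H"
    "\<And>s t. \<gamma> (s + t) = \<gamma> s \<otimes>\<^bsub>H\<^esub> \<gamma> t" "\<And>t. q (\<gamma> t) = path t"
    using one_parameter_lift[OF H cov q_mult path_continuous path_in_group path_add] q_one path_0 by metis
  have "((\<lambda>t. q (\<gamma> t) Y) has_vector_derivative conf_bracket (P *\<^sub>R junit, 0, Q *\<^sub>R junit) Y) (at 0)"
    if "Y \<in> co_alg" for Y
    unfolding \<gamma>(4) path_apply[OF that] conf_bracket_sl2[OF that] by (rule moebius_derivative)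
  then show ?thesis using \<gamma> unfolding one_parameter_subgroup_def by blast
qed

lemma lift_unique:
  assumes "connected I" "0 \<in> I" "t \<in> I" "continuous_on I g1" "g1 \<in> I \<rightarrow> carrier H"
    "continuous_on I g2" "g2 \<in> I \<rightarrow> carrier H" "\<And>t. t \<in> I \<Longrightarrow> q (g1 t) = q (g2 t)" "g1 0 = g2 0"
  shows "g1 t = g2 t"
  using covering_lift_unique[OF cov assms(1,2,3,4,5,6,7)] assms(8,9) by blast

lemma one_parameter_0:
  assumes "one_parameter_subgroup H q X \<gamma>"
  shows "\<gamma> 0 = \<one>\<^bsub>H\<^esub>"
proof -
  have "\<gamma> 0 \<in> carrier H" "\<gamma> (0 + 0) = \<gamma> 0 \<otimes>\<^bsub>H\<^esub> \<gamma> 0"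
    using assms unfolding one_parameter_subgroup_def by blast+
  then have "\<gamma> 0 \<in> carrier H" "\<gamma> 0 = \<gamma> 0 \<otimes>\<^bsub>H\<^esub> \<gamma> 0" by simp_all
  then show ?thesis using H.r_cancel_one' by metis
qed

text \<open>Two subgroups with the same tangent vector have the same projection, hence coincide as
  lifts that start at the unit. This makes the definite description in \<open>cover_exp\<close>
  meaningful.\<close>

lemma cover_exp_eq:
  assumes c: "sl2_curve P Q a b c d"
    and \<gamma>: "one_parameter_subgroup H q (P *\<^sub>R junit, 0, Q *\<^sub>R junit) \<gamma>"
  shows "cover_exp H q (P *\<^sub>R junit, 0, Q *\<^sub>R junit) = \<gamma> 1"
  unfolding cover_exp_def
proof (rule the_equality)
  show "\<exists>\<gamma>'. one_parameter_subgroup H q (P *\<^sub>R junit, 0, Q *\<^sub>R junit) \<gamma>' \<and> \<gamma> 1 = \<gamma>' 1"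
    using \<gamma> by blast
  fix g assume "\<exists>\<gamma>. one_parameter_subgroup H q (P *\<^sub>R junit, 0, Q *\<^sub>R junit) \<gamma> \<and> g = \<gamma> 1"
  then obtain \<gamma>' where \<gamma>': "one_parameter_subgroup H q (P *\<^sub>R junit, 0, Q *\<^sub>R junit) \<gamma>'" "g = \<gamma>' 1" by blast
  have "q (\<gamma>' t) = q (\<gamma> t)" for t
    using one_parameter_unique[OF c \<gamma>'(1)] one_parameter_unique[OF c \<gamma>] by simp
  moreover have "\<gamma>' 0 = \<gamma> 0" using one_parameter_0[OF \<gamma>'(1)] one_parameter_0[OF \<gamma>] by simp
  ultimately have "\<gamma>' 1 = \<gamma> 1"
    using \<gamma> \<gamma>'(1) unfolding one_parameter_subgroup_def
    by (intro lift_unique[of UNIV 1 \<gamma>' \<gamma>]) auto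
  then show "g = \<gamma> 1" using \<gamma>' by simp
qed

lemma one_parameter_scale:
  assumes "one_parameter_subgroup H q (P *\<^sub>R junit, 0, Q *\<^sub>R junit) \<gamma>"
  shows "one_parameter_subgroup H q ((s * P) *\<^sub>R junit, 0, (s * Q) *\<^sub>R junit) (\<lambda>t. \<gamma> (s * t))"
  unfolding one_parameter_subgroup_def
proof (intro conjI allI ballI)
  have cont: "continuous_on UNIV \<gamma>" using assms by (simp add: one_parameter_subgroup_def)
  show "continuous_on UNIV (\<lambda>t. \<gamma> (s * t))"
    using continuous_on_compose2[OF cont, of UNIV "\<lambda>t. s * t"] by (simp add: continuous_intros)
  show "range (\<lambda>t. \<gamma> (s * t)) \<subseteq> carrier H" using assms by (auto simp: one_parameter_subgroup_def)
  show "\<gamma> (s * (t + t')) = \<gamma> (s * t) \<otimes>\<^bsub>H\<^esub> \<gamma> (s * t')" for t t'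
    using assms by (simp add: one_parameter_subgroup_def distrib_left)
  fix Y :: "'a conf" assume Y: "Y \<in> co_alg"
  have "((\<lambda>t. q (\<gamma> t) Y) has_vector_derivative conf_bracket (P *\<^sub>R junit, 0, Q *\<^sub>R junit) Y) (at 0)"
    using assms Y unfolding one_parameter_subgroup_def by blast
  then have "((\<lambda>t. q (\<gamma> t) Y) has_vector_derivative sl2_bracket P Q Y) (at (s * 0))"
    by (simp only: conf_bracket_sl2[OF Y] mult_zero_right)
  moreover have "((\<lambda>t. s * t) has_real_derivative s) (at 0)" by (auto intro!: derivative_eq_intros)
  ultimately have "((\<lambda>t. q (\<gamma> (s * t)) Y) has_vector_derivative s *\<^sub>R sl2_bracket P Q Y) (at 0)"
    using vector_diff_chain_at[of "\<lambda>t. s * t" s 0 "\<lambda>t. q (\<gamma> t) Y"]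
    by (simp add: o_def has_real_derivative_iff_has_vector_derivative)
  moreover have "s *\<^sub>R sl2_bracket P Q Y = sl2_bracket (s * P) (s * Q) Y"
    by (cases Y) (simp add: sl2_bracket_def jL_simps algebra_simps)
  ultimately show "((\<lambda>t. q (\<gamma> (s * t)) Y) has_vector_derivative
      conf_bracket ((s * P) *\<^sub>R junit, 0, (s * Q) *\<^sub>R junit) Y) (at 0)"
    by (simp add: conf_bracket_sl2[OF Y])
qed

lemma cover_exp_scale:
  assumes c: "sl2_curve P Q a b c d"
    and \<gamma>: "one_parameter_subgroup H q (P *\<^sub>R junit, 0, Q *\<^sub>R junit) \<gamma>"
  shows "cover_exp H q ((s * P) *\<^sub>R junit, 0, (s * Q) *\<^sub>R junit) = \<gamma> s"
proof -
  interpret sl2_curve P Q a b c d by (rule c)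
  have der: "((\<lambda>t. f (s * t)) has_real_derivative s * D) (at 0)" if "(f has_real_derivative D) (at 0)" for f D
  proof -
    have "(f has_real_derivative D) (at (s * 0))" using that by simp
    from DERIV_chain2[OF this DERIV_cmult_Id] show ?thesis by (simp add: mult.commute)
  qed
  have con: "continuous_on UNIV (\<lambda>t. f (s * t))" if "continuous_on UNIV f" for f :: "real \<Rightarrow> real"
    using continuous_on_compose2[OF that, of UNIV "\<lambda>t. s * t"] by (simp add: continuous_intros)
  have "sl2_curve (s * P) (s * Q) (\<lambda>t. a (s * t)) (\<lambda>t. b (s * t)) (\<lambda>t. c (s * t)) (\<lambda>t. d (s * t))"
    by unfold_locales
       (use der[OF deriv(1)] der[OF deriv(2)] der[OF deriv(3)] der[OF deriv(4)] in
         \<open>auto simp: det distrib_left hom zero intro!: con cont\<close>)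
  from cover_exp_eq[OF this one_parameter_scale[OF \<gamma>]] show ?thesis by simp
qed

section \<open>The three one-parameter subgroups and the shear factorisation of rotations\<close>

definition shift_group :: "real \<Rightarrow> 'g" where
  "shift_group = (SOME \<gamma>. one_parameter_subgroup H q (junit, 0, 0) \<gamma>)"
definition coshift_group :: "real \<Rightarrow> 'g" where
  "coshift_group = (SOME \<gamma>. one_parameter_subgroup H q (0, 0, junit) \<gamma>)"
definition rotation_group :: "real \<Rightarrow> 'g" where
  "rotation_group = (SOME \<gamma>. one_parameter_subgroup H q (junit, 0, - junit) \<gamma>)"

lemma shift_curve: "sl2_curve 1 0 (\<lambda>t. 1) (\<lambda>t. t) (\<lambda>t. 0) (\<lambda>t. 1)"
  by unfold_locales (auto intro!: derivative_eq_intros continuous_intros)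

lemma coshift_curve: "sl2_curve 0 1 (\<lambda>t. 1) (\<lambda>t. 0) (\<lambda>t. t) (\<lambda>t. 1)"
  by unfold_locales (auto intro!: derivative_eq_intros continuous_intros)

lemma rotation_curve: "sl2_curve 1 (- 1) cos sin (\<lambda>t. - sin t) cos"
  by unfold_locales
     (auto intro!: derivative_eq_intros continuous_intros simp: cos_add sin_add sin_cos_squared_add3)

lemma one_parameter_groups:
  "one_parameter_subgroup H q (1 *\<^sub>R junit, 0, 0 *\<^sub>R junit) shift_group"
  "one_parameter_subgroup H q (0 *\<^sub>R junit, 0, 1 *\<^sub>R junit) coshift_group"
  "one_parameter_subgroup H q (1 *\<^sub>R junit, 0, (- 1) *\<^sub>R junit) rotation_group"
  using someI_ex[OF one_parameter_exists[OF shift_curve]] someI_ex[OF one_parameter_exists[OF coshift_curve]]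
    someI_ex[OF one_parameter_exists[OF rotation_curve]]
  by (simp_all add: shift_group_def coshift_group_def rotation_group_def)

lemma cover_exp_shift: "cover_exp H q (t *\<^sub>R (junit, 0, 0)) = shift_group t"
  using cover_exp_scale[OF shift_curve one_parameter_groups(1), of t] by simp

lemma cover_exp_coshift: "cover_exp H q (t *\<^sub>R (0, 0, junit)) = coshift_group t"
  using cover_exp_scale[OF coshift_curve one_parameter_groups(2), of t] by simp

lemma cover_exp_rotation: "cover_exp H q (t *\<^sub>R (junit, 0, - junit)) = rotation_group t"
  using cover_exp_scale[OF rotation_curve one_parameter_groups(3), of t] by simp

lemma groups_closed: "shift_group t \<in> carrier H" "coshift_group t \<in> carrier H" "rotation_group t \<in> carrier H"
  using one_parameter_groups by (auto simp: one_parameter_subgroup_def)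

lemma groups_add:
  "shift_group (s + t) = shift_group s \<otimes>\<^bsub>H\<^esub> shift_group t"
  "coshift_group (s + t) = coshift_group s \<otimes>\<^bsub>H\<^esub> coshift_group t"
  "rotation_group (s + t) = rotation_group s \<otimes>\<^bsub>H\<^esub> rotation_group t"
  using one_parameter_groups by (auto simp: one_parameter_subgroup_def)

lemma groups_0: "shift_group 0 = \<one>\<^bsub>H\<^esub>" "coshift_group 0 = \<one>\<^bsub>H\<^esub>" "rotation_group 0 = \<one>\<^bsub>H\<^esub>"
  using one_parameter_groups one_parameter_0 by blast+

text \<open>The factorisation of a rotation matrix into shears by tan (t/2), - sin t, tan (t/2)
  holds for |t| < pi, where the tangent is continuous. Uniqueness of lifts on this interval
  transfers it to the covering group.\<close>

lemma rotation_eq_shears: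
  assumes "\<bar>t\<bar> < pi"
  shows "rotation_group t = shift_group (tan (t / 2)) \<otimes>\<^bsub>H\<^esub> (coshift_group (- sin t) \<otimes>\<^bsub>H\<^esub> shift_group (tan (t / 2)))"
proof (rule lift_unique[of "{-pi<..<pi}" t rotation_group
      "\<lambda>t. shift_group (tan (t / 2)) \<otimes>\<^bsub>H\<^esub> (coshift_group (- sin t) \<otimes>\<^bsub>H\<^esub> shift_group (tan (t / 2)))"])
  have cosnz: "cos (t / 2) \<noteq> 0" if "t \<in> {-pi<..<pi}" for t :: real
    using cos_gt_zero_pi[of "t / 2"] that by auto
  have c: "continuous_on UNIV shift_group" "continuous_on UNIV coshift_group" "continuous_on UNIV rotation_group"
    using one_parameter_groups by (auto simp: one_parameter_subgroup_def)
  have tan: "continuous_on {-pi<..<pi} (\<lambda>t. shift_group (tan (t / 2)))"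
    by (rule continuous_on_compose2[OF c(1)]) (use cosnz in \<open>auto intro!: continuous_intros\<close>)
  have sin: "continuous_on {-pi<..<pi} (\<lambda>t. coshift_group (- sin t))"
    by (rule continuous_on_compose2[OF c(2)]) (auto intro!: continuous_intros)
  show "continuous_on {-pi<..<pi} (\<lambda>t. shift_group (tan (t / 2)) \<otimes>\<^bsub>H\<^esub> (coshift_group (- sin t) \<otimes>\<^bsub>H\<^esub> shift_group (tan (t / 2))))"
    by (intro topological_group_continuous_mult[OF H] tan sin) (auto simp: groups_closed)
  show "continuous_on {-pi<..<pi} rotation_group" using c(3) continuous_on_subset by blast
  fix s :: real assume s: "s \<in> {-pi<..<pi}"
  show "q (rotation_group s) = q (shift_group (tan (s / 2)) \<otimes>\<^bsub>H\<^esub> (coshift_group (- sin s) \<otimes>\<^bsub>H\<^esub> shift_group (tan (s / 2))))"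
  proof
    fix Y :: "'a conf"
    have q: "q (shift_group t) = moebius_map 1 t 0 1" "q (coshift_group t) = moebius_map 1 0 t 1"
      "q (rotation_group t) = moebius_map (cos t) (sin t) (- sin t) (cos t)" for t
      using one_parameter_unique[OF shift_curve one_parameter_groups(1)]
        one_parameter_unique[OF coshift_curve one_parameter_groups(2)]
        one_parameter_unique[OF rotation_curve one_parameter_groups(3)]
      by (simp_all add: sl2_curve.path_def[OF shift_curve] sl2_curve.path_def[OF coshift_curve]
          sl2_curve.path_def[OF rotation_curve])
    have half: "sin s = 2 * sin (s / 2) * cos (s / 2)" "cos s = 1 - 2 * (sin (s / 2))\<^sup>2" "cos s = 2 * (cos (s / 2))\<^sup>2 - 1"
      using sin_double[of "s / 2"] cos_double_sin[of "s / 2"] cos_double_cos[of "s / 2"] by simp_all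
    have e1: "1 - tan (s / 2) * sin s = cos s"
      unfolding half(2) unfolding half(1) tan_def using cosnz[OF s] by (simp add: power2_eq_square)
    have e2: "cos s * tan (s / 2) + tan (s / 2) = sin s"
      unfolding half(3) unfolding half(1) tan_def using cosnz[OF s] by (simp add: power2_eq_square field_simps)
    show "q (rotation_group s) Y = q (shift_group (tan (s / 2)) \<otimes>\<^bsub>H\<^esub> (coshift_group (- sin s) \<otimes>\<^bsub>H\<^esub> shift_group (tan (s / 2)))) Y"
    proof (cases "Y \<in> co_alg")
      case True
      have "moebius_conf (1 - tan (s / 2) * sin s) (tan (s / 2) + (1 - tan (s / 2) * sin s) * tan (s / 2))
          (- sin s) (1 - tan (s / 2) * sin s) Y = moebius_conf (cos s) (sin s) (- sin s) (cos s) Y"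
        unfolding e1 using e2 by (simp add: add.commute)
      then show ?thesis using True
        by (simp add: q_mult groups_closed q compose_eq moebius_map_def moebius_conf_co_alg moebius_conf_compose algebra_simps)
    next
      case False
      then show ?thesis by (simp add: q_mult groups_closed q compose_def moebius_map_def)
    qed
  qed
qed (use assms in \<open>auto simp: groups_closed groups_0\<close>)

end

section \<open>Square-integrable functions\<close>

lemma L2_measurable: "f \<in> L2 M \<Longrightarrow> f \<in> borel_measurable M"
  and L2_integrable_sq: "f \<in> L2 M \<Longrightarrow> integrable M (\<lambda>x. (cmod (f x))\<^sup>2)"
  by (simp_all add: L2_def)

lemma L2_I: "f \<in> borel_measurable M \<Longrightarrow> integrable M (\<lambda>x. (cmod (f x))\<^sup>2) \<Longrightarrow> f \<in> L2 M"
  by (simp add: L2_def)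

lemma L2_bound:
  assumes "f \<in> borel_measurable M" "integrable M g" "AE x in M. (cmod (f x))\<^sup>2 \<le> g x"
  shows "f \<in> L2 M"
proof (rule L2_I[OF assms(1)])
  show "integrable M (\<lambda>x. (cmod (f x))\<^sup>2)"
    using assms by (intro Bochner_Integration.integrable_bound[OF assms(2)]) auto
qed

lemma borel_measurable_cnj:
  assumes "f \<in> borel_measurable M"
  shows "(\<lambda>x. cnj (f x)) \<in> borel_measurable M"
  by (rule measurable_compose[OF assms borel_measurable_continuous_onI])
     (intro continuous_intros)

lemma L2_add: assumes "f \<in> L2 M" "g \<in> L2 M" shows "(\<lambda>x. f x + g x) \<in> L2 M"
proof (rule L2_bound)
  show "(\<lambda>x. f x + g x) \<in> borel_measurable M" using assms L2_measurable by measurable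
  show "integrable M (\<lambda>x. 2 * (cmod (f x))\<^sup>2 + 2 * (cmod (g x))\<^sup>2)"
    using assms L2_integrable_sq by (intro Bochner_Integration.integrable_add integrable_mult_right) auto
  have "(cmod (f x + g x))\<^sup>2 \<le> 2 * (cmod (f x))\<^sup>2 + 2 * (cmod (g x))\<^sup>2" for x
  proof -
    have "(cmod (f x + g x))\<^sup>2 \<le> (cmod (f x) + cmod (g x))\<^sup>2"
      by (intro power_mono norm_triangle_ineq) auto
    moreover have "0 \<le> (cmod (f x) - cmod (g x))\<^sup>2" by simp
    ultimately show ?thesis by (simp add: power2_eq_square algebra_simps)
  qed
  then show "AE x in M. (cmod (f x + g x))\<^sup>2 \<le> 2 * (cmod (f x))\<^sup>2 + 2 * (cmod (g x))\<^sup>2" by simp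
qed

lemma L2_scale: assumes "f \<in> L2 M" shows "(\<lambda>x. a * f x) \<in> L2 M"
proof (rule L2_I)
  show "(\<lambda>x. a * f x) \<in> borel_measurable M" using assms L2_measurable by measurable
  show "integrable M (\<lambda>x. (cmod (a * f x))\<^sup>2)"
    using L2_integrable_sq[OF assms] by (simp add: norm_mult power_mult_distrib)
qed

lemma L2_lin: "f \<in> L2 M \<Longrightarrow> g \<in> L2 M \<Longrightarrow> (\<lambda>x. a * f x + b * g x) \<in> L2 M"
  by (intro L2_add L2_scale)

lemma L2_diff: "f \<in> L2 M \<Longrightarrow> g \<in> L2 M \<Longrightarrow> (\<lambda>x. f x - g x) \<in> L2 M"
  using L2_lin[of f M g 1 "-1"] by simp

lemma L2_cong_AE:
  assumes "f \<in> L2 M" "g \<in> borel_measurable M" "AE x in M. f x = g x"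
  shows "g \<in> L2 M"
  by (rule L2_bound[OF assms(2) L2_integrable_sq[OF assms(1)]]) (use assms(3) in auto)

lemma L2_prod_integrable:
  assumes "f \<in> L2 M" "g \<in> L2 M"
  shows "integrable M (\<lambda>x. f x * cnj (g x))"
proof (rule Bochner_Integration.integrable_bound)
  show "integrable M (\<lambda>x. (cmod (f x))\<^sup>2 + (cmod (g x))\<^sup>2)"
    using assms L2_integrable_sq by (intro Bochner_Integration.integrable_add) auto
  show "(\<lambda>x. f x * cnj (g x)) \<in> borel_measurable M"
    using assms by (intro borel_measurable_times borel_measurable_cnj L2_measurable)
  have "cmod (f x * cnj (g x)) \<le> (cmod (f x))\<^sup>2 + (cmod (g x))\<^sup>2" for x
  proof -
    have "2 * (cmod (f x) * cmod (g x)) \<le> (cmod (f x))\<^sup>2 + (cmod (g x))\<^sup>2"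
      using sum_squares_bound[of "cmod (f x)" "cmod (g x)"] by (simp add: mult.assoc)
    moreover have "0 \<le> cmod (f x) * cmod (g x)" by simp
    ultimately show ?thesis unfolding norm_mult complex_mod_cnj by linarith
  qed
  then show "AE x in M. norm (f x * cnj (g x)) \<le> norm ((cmod (f x))\<^sup>2 + (cmod (g x))\<^sup>2)" by simp
qed

lemma L2_norm_nonneg [simp]: "0 \<le> L2_norm M f" by (simp add: L2_norm_def)

lemma L2_norm_sq: "(L2_norm M f)\<^sup>2 = (LINT x|M. (cmod (f x))\<^sup>2)"
  by (simp add: L2_norm_def)

lemma L2_inner_self: "L2_inner M f f = complex_of_real ((L2_norm M f)\<^sup>2)"
  unfolding L2_norm_sq L2_inner_def integral_complex_of_real[symmetric] complex_norm_square ..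

lemma L2_norm_cong_AE:
  assumes "AE x in M. f x = g x" "f \<in> borel_measurable M" "g \<in> borel_measurable M"
  shows "L2_norm M f = L2_norm M g"
  unfolding L2_norm_def
  by (intro arg_cong[of _ _ sqrt] integral_cong_AE) (use assms in auto)

lemma L2_inner_cong_AE:
  assumes "AE x in M. f x = f' x" "AE x in M. g x = g' x" "f \<in> L2 M" "f' \<in> L2 M" "g \<in> L2 M" "g' \<in> L2 M"
  shows "L2_inner M f g = L2_inner M f' g'"
proof -
  have "AE x in M. f x * cnj (g x) = f' x * cnj (g' x)" using assms(1,2) by eventually_elim simp
  then show ?thesis unfolding L2_inner_def
    using assms(3-) by (intro integral_cong_AE borel_measurable_times borel_measurable_cnj L2_measurable)
qed

lemma L2_inner_lin_left:
  assumes "f \<in> L2 M" "g \<in> L2 M" "h \<in> L2 M"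
  shows "L2_inner M (\<lambda>x. a * f x + b * g x) h = a * L2_inner M f h + b * L2_inner M g h"
  using L2_prod_integrable[OF assms(1,3)] L2_prod_integrable[OF assms(2,3)]
  by (simp add: L2_inner_def distrib_right mult.assoc)

lemma L2_inner_commute: "L2_inner M f g = cnj (L2_inner M g f)"
  unfolding L2_inner_def Bochner_Integration.integral_cnj[symmetric] by (simp add: mult.commute)

lemma L2_inner_diff_left:
  "f \<in> L2 M \<Longrightarrow> g \<in> L2 M \<Longrightarrow> h \<in> L2 M \<Longrightarrow> L2_inner M (\<lambda>x. f x - g x) h = L2_inner M f h - L2_inner M g h"
  using L2_inner_lin_left[of f M g h 1 "-1"] by simp

lemma L2_inner_diff_right:
  "f \<in> L2 M \<Longrightarrow> g \<in> L2 M \<Longrightarrow> h \<in> L2 M \<Longrightarrow> L2_inner M h (\<lambda>x. f x - g x) = L2_inner M h f - L2_inner M h g"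
  by (subst (1 2 3) L2_inner_commute) (simp add: L2_inner_diff_left)

lemma L2_inner_scale_left:
  "f \<in> L2 M \<Longrightarrow> g \<in> L2 M \<Longrightarrow> L2_inner M (\<lambda>x. a * f x) g = a * L2_inner M f g"
  using L2_inner_lin_left[of f M f g a 0] by simp

lemma L2_inner_scale_right:
  "f \<in> L2 M \<Longrightarrow> g \<in> L2 M \<Longrightarrow> L2_inner M g (\<lambda>x. a * f x) = cnj a * L2_inner M g f"
  by (subst (1 2) L2_inner_commute) (simp add: L2_inner_scale_left)

text \<open>The arithmetic-geometric mean inequality is integrated with a weight \<open>s\<close>.
  The best weight is the quotient of the norms; if a norm vanishes, extreme weights force the inner
  product to be 0.\<close>

lemma L2_cauchy_schwarz:
  assumes f: "f \<in> L2 M" and g: "g \<in> L2 M"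
  shows "cmod (L2_inner M f g) \<le> L2_norm M f * L2_norm M g"
proof -
  define A B where "A = L2_norm M f" and "B = L2_norm M g"
  have AB: "A \<ge> 0" "B \<ge> 0" by (simp_all add: A_def B_def)
  have bound: "2 * cmod (L2_inner M f g) \<le> s * A\<^sup>2 + (1 / s) * B\<^sup>2" if s: "s > 0" for s
  proof -
    have "cmod (L2_inner M f g) \<le> (LINT x|M. cmod (f x * cnj (g x)))"
      unfolding L2_inner_def by (rule integral_norm_bound)
    also have "\<dots> \<le> (LINT x|M. (s * (cmod (f x))\<^sup>2 + (1 / s) * (cmod (g x))\<^sup>2) / 2)"
    proof (rule integral_mono)
      show "integrable M (\<lambda>x. cmod (f x * cnj (g x)))" using L2_prod_integrable[OF f g] by (rule integrable_norm)
      show "integrable M (\<lambda>x. (s * (cmod (f x))\<^sup>2 + (1 / s) * (cmod (g x))\<^sup>2) / 2)"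
        using f g L2_integrable_sq by (intro integrable_divide Bochner_Integration.integrable_add integrable_mult_right) auto
      fix x
      have "0 \<le> (s * cmod (f x) - cmod (g x))\<^sup>2 / s" using s by simp
      also have "\<dots> = s * (cmod (f x))\<^sup>2 + (1 / s) * (cmod (g x))\<^sup>2 - 2 * (cmod (f x) * cmod (g x))"
        using s by (simp add: power2_eq_square field_simps)
      finally show "cmod (f x * cnj (g x)) \<le> (s * (cmod (f x))\<^sup>2 + (1 / s) * (cmod (g x))\<^sup>2) / 2"
        by (simp add: norm_mult)
    qed
    also have "\<dots> = (s * A\<^sup>2 + (1 / s) * B\<^sup>2) / 2"
      using L2_integrable_sq[OF f] L2_integrable_sq[OF g] by (simp add: A_def B_def L2_norm_sq)
    finally show ?thesis by simp
  qed
  consider "A > 0" "B > 0" | "A = 0" | "B = 0" using AB by fastforce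
  then show ?thesis
  proof cases
    case 1
    then show ?thesis using bound[of "B / A"] by (simp add: A_def B_def power2_eq_square)
  next
    case 2
    have "cmod (L2_inner M f g) \<le> 0"
    proof (rule field_le_epsilon)
      fix e :: real assume e: "e > 0"
      have "2 * cmod (L2_inner M f g) \<le> (1 / ((B\<^sup>2 + 1) / e)) * B\<^sup>2"
        using bound[of "(B\<^sup>2 + 1) / e"] 2 e by (simp add: add_nonneg_pos)
      also have "\<dots> = e * (B\<^sup>2 / (B\<^sup>2 + 1))" by simp
      also have "\<dots> \<le> e * 1" using e by (intro mult_left_mono) (auto simp: divide_le_eq add_nonneg_pos)
      finally show "cmod (L2_inner M f g) \<le> 0 + e" using e by simp
    qed
    then show ?thesis using AB by (simp add: A_def B_def)
  next
    case 3
    have "cmod (L2_inner M f g) \<le> 0"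
    proof (rule field_le_epsilon)
      fix e :: real assume e: "e > 0"
      have "2 * cmod (L2_inner M f g) \<le> (e / (A\<^sup>2 + 1)) * A\<^sup>2"
        using bound[of "e / (A\<^sup>2 + 1)"] 3 e by (simp add: add_nonneg_pos)
      also have "\<dots> = e * (A\<^sup>2 / (A\<^sup>2 + 1))" by simp
      also have "\<dots> \<le> e * 1" using e by (intro mult_left_mono) (auto simp: divide_le_eq add_nonneg_pos)
      finally show "cmod (L2_inner M f g) \<le> 0 + e" using e by simp
    qed
    then show ?thesis using AB by (simp add: A_def B_def)
  qed
qed

lemma L2_norm_triangle:
  assumes f: "f \<in> L2 M" and g: "g \<in> L2 M"
  shows "L2_norm M (\<lambda>x. f x + g x) \<le> L2_norm M f + L2_norm M g"
proof -
  have "complex_of_real ((L2_norm M (\<lambda>x. f x + g x))\<^sup>2) = L2_inner M (\<lambda>x. 1 * f x + 1 * g x) (\<lambda>x. f x + g x)"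
    unfolding L2_inner_self[symmetric] by simp
  also have "\<dots> = L2_inner M f (\<lambda>x. f x + g x) + L2_inner M g (\<lambda>x. f x + g x)"
    using f g L2_add by (subst L2_inner_lin_left) auto
  finally have "cmod (complex_of_real ((L2_norm M (\<lambda>x. f x + g x))\<^sup>2)) \<le> cmod (L2_inner M f (\<lambda>x. f x + g x)) + cmod (L2_inner M g (\<lambda>x. f x + g x))"
    by (simp only: norm_triangle_ineq)
  then have "(L2_norm M (\<lambda>x. f x + g x))\<^sup>2 \<le> cmod (L2_inner M f (\<lambda>x. f x + g x)) + cmod (L2_inner M g (\<lambda>x. f x + g x))"
    by (simp only: norm_of_real abs_power2)
  also have "\<dots> \<le> L2_norm M f * L2_norm M (\<lambda>x. f x + g x) + L2_norm M g * L2_norm M (\<lambda>x. f x + g x)"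
    using f g L2_add by (intro add_mono L2_cauchy_schwarz) auto
  finally have "L2_norm M (\<lambda>x. f x + g x) * L2_norm M (\<lambda>x. f x + g x) \<le> (L2_norm M f + L2_norm M g) * L2_norm M (\<lambda>x. f x + g x)"
    by (simp add: power2_eq_square algebra_simps)
  then have *: "0 < L2_norm M (\<lambda>x. f x + g x) \<Longrightarrow> ?thesis" by (rule mult_right_le_imp_le)
  have "0 \<le> L2_norm M f + L2_norm M g" by simp
  then show ?thesis using * L2_norm_nonneg[of M "\<lambda>x. f x + g x"] by linarith
qed

lemma L2_norm_scale: "L2_norm M (\<lambda>x. a * f x) = cmod a * L2_norm M f"
  by (simp add: L2_norm_def norm_mult power_mult_distrib real_sqrt_mult)

lemma L2_norm_minus: "L2_norm M (\<lambda>x. f x - g x) = L2_norm M (\<lambda>x. g x - f x)"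
  by (simp add: L2_norm_def norm_minus_commute)

lemma L2_norm_triangle_diff:
  assumes "f \<in> L2 M" "g \<in> L2 M" "h \<in> L2 M"
  shows "L2_norm M (\<lambda>x. f x - h x) \<le> L2_norm M (\<lambda>x. f x - g x) + L2_norm M (\<lambda>x. g x - h x)"
  using L2_norm_triangle[OF L2_diff[OF assms(1,2)] L2_diff[OF assms(2,3)]] by simp

lemma L2_norm_eq_0:
  assumes "f \<in> L2 M" "L2_norm M f = 0"
  shows "AE x in M. f x = 0"
proof -
  have "(LINT x|M. (cmod (f x))\<^sup>2) = 0" using assms(2) by (simp add: L2_norm_def)
  then have "AE x in M. (cmod (f x))\<^sup>2 = 0"
    using L2_integrable_sq[OF assms(1)] by (subst (asm) integral_nonneg_eq_0_iff_AE) auto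
  then show ?thesis by simp
qed

lemma L2_norm_0_AE: "AE x in M. f x = 0 \<Longrightarrow> f \<in> borel_measurable M \<Longrightarrow> L2_norm M f = 0"
  using L2_norm_cong_AE[of f "\<lambda>x. 0" M] by (simp add: L2_norm_def)

section \<open>Convergence in L2 and generators of unitary groups\<close>

definition L2_lim :: "'a measure \<Rightarrow> ('t \<Rightarrow> 'a \<Rightarrow> complex) \<Rightarrow> ('a \<Rightarrow> complex) \<Rightarrow> 't filter \<Rightarrow> bool" where
  "L2_lim M F f G \<longleftrightarrow> f \<in> L2 M \<and> (\<forall>t. F t \<in> L2 M) \<and> ((\<lambda>t. L2_norm M (\<lambda>x. F t x - f x)) \<longlongrightarrow> 0) G"

lemma L2_lim_const: "f \<in> L2 M \<Longrightarrow> L2_lim M (\<lambda>t. f) f G"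
  by (simp add: L2_lim_def L2_norm_def)

lemma L2_lim_dominated:
  assumes "f \<in> L2 M" "\<And>t. F t \<in> L2 M" "(g \<longlongrightarrow> 0) G"
    "eventually (\<lambda>t. L2_norm M (\<lambda>x. F t x - f x) \<le> g t) G"
  shows "L2_lim M F f G"
  unfolding L2_lim_def
  using assms(1,2) tendsto_sandwich[of "\<lambda>t. 0" _ G g 0] assms(3,4) by auto

lemma L2_lim_add:
  assumes "L2_lim M F f G" "L2_lim M F' f' G"
  shows "L2_lim M (\<lambda>t x. F t x + F' t x) (\<lambda>x. f x + f' x) G"
proof (rule L2_lim_dominated)
  show "((\<lambda>t. L2_norm M (\<lambda>x. F t x - f x) + L2_norm M (\<lambda>x. F' t x - f' x)) \<longlongrightarrow> 0) G"
    using assms by (auto simp: L2_lim_def intro: tendsto_add_zero)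
  have "L2_norm M (\<lambda>x. (F t x + F' t x) - (f x + f' x)) \<le> L2_norm M (\<lambda>x. F t x - f x) + L2_norm M (\<lambda>x. F' t x - f' x)" for t
  proof -
    have "(\<lambda>x. F t x - f x) \<in> L2 M" "(\<lambda>x. F' t x - f' x) \<in> L2 M"
      using assms by (auto simp: L2_lim_def intro: L2_diff)
    from L2_norm_triangle[OF this] show ?thesis by (simp add: algebra_simps)
  qed
  then show "\<forall>\<^sub>F t in G. L2_norm M (\<lambda>x. (F t x + F' t x) - (f x + f' x)) \<le> L2_norm M (\<lambda>x. F t x - f x) + L2_norm M (\<lambda>x. F' t x - f' x)"
    by simp
qed (use assms in \<open>auto simp: L2_lim_def intro: L2_add\<close>)

lemma L2_lim_scale:
  assumes F: "L2_lim M F f G" and c: "(c \<longlongrightarrow> c0) G"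
  shows "L2_lim M (\<lambda>t x. c t * F t x) (\<lambda>x. c0 * f x) G"
proof (rule L2_lim_dominated)
  show "((\<lambda>t. cmod (c t) * L2_norm M (\<lambda>x. F t x - f x) + cmod (c t - c0) * L2_norm M f) \<longlongrightarrow> 0) G"
  proof -
    have "((\<lambda>t. cmod (c t) * L2_norm M (\<lambda>x. F t x - f x) + cmod (c t - c0) * L2_norm M f) \<longlongrightarrow> cmod c0 * 0 + cmod (c0 - c0) * L2_norm M f) G"
      using F c unfolding L2_lim_def by (intro tendsto_intros) auto
    then show ?thesis by simp
  qed
  have "L2_norm M (\<lambda>x. c t * F t x - c0 * f x) \<le> cmod (c t) * L2_norm M (\<lambda>x. F t x - f x) + cmod (c t - c0) * L2_norm M f" for t
  proof -
    have "F t \<in> L2 M" "f \<in> L2 M" using F by (simp_all add: L2_lim_def)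
    then have "(\<lambda>x. c t * (F t x - f x)) \<in> L2 M" "(\<lambda>x. (c t - c0) * f x) \<in> L2 M"
      by (auto intro!: L2_scale L2_diff simp del: mult_eq_0_iff)
    note L2_norm_triangle[OF this]
    moreover have "(\<lambda>x. c t * (F t x - f x) + (c t - c0) * f x) = (\<lambda>x. c t * F t x - c0 * f x)"
      by (simp add: fun_eq_iff algebra_simps)
    ultimately show ?thesis unfolding L2_norm_scale by (simp only:)
  qed
  then show "\<forall>\<^sub>F t in G. L2_norm M (\<lambda>x. c t * F t x - c0 * f x) \<le> cmod (c t) * L2_norm M (\<lambda>x. F t x - f x) + cmod (c t - c0) * L2_norm M f"
    by simp
qed (use F in \<open>auto simp: L2_lim_def intro: L2_scale\<close>)

lemma L2_lim_inner:
  assumes F: "L2_lim M F f G" and F': "L2_lim M F' f' G"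
  shows "((\<lambda>t. L2_inner M (F t) (F' t)) \<longlongrightarrow> L2_inner M f f') G"
proof (rule Lim_null[THEN iffD2], rule Lim_null_comparison)
  let ?d = "\<lambda>t. L2_norm M (\<lambda>x. F t x - f x)" and ?d' = "\<lambda>t. L2_norm M (\<lambda>x. F' t x - f' x)"
  have L: "F t \<in> L2 M" "F' t \<in> L2 M" "f \<in> L2 M" "f' \<in> L2 M" for t using F F' by (auto simp: L2_lim_def)
  have "norm (L2_inner M (F t) (F' t) - L2_inner M f f') \<le> ?d t * (?d' t + L2_norm M f') + L2_norm M f * ?d' t" for t
  proof -
    have "L2_inner M (F t) (F' t) - L2_inner M f f' = L2_inner M (\<lambda>x. F t x - f x) (F' t) + L2_inner M f (\<lambda>x. F' t x - f' x)"
      using L by (simp add: L2_inner_diff_left L2_inner_diff_right)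
    then have "norm (L2_inner M (F t) (F' t) - L2_inner M f f') \<le> ?d t * L2_norm M (F' t) + L2_norm M f * ?d' t"
      using L2_cauchy_schwarz[OF L2_diff[OF L(1)[of t] L(3)] L(2)[of t]] L2_cauchy_schwarz[OF L(3) L2_diff[OF L(2)[of t] L(4)]]
        norm_triangle_ineq[of "L2_inner M (\<lambda>x. F t x - f x) (F' t)" "L2_inner M f (\<lambda>x. F' t x - f' x)"]
      by simp
    also have "L2_norm M (F' t) \<le> ?d' t + L2_norm M f'"
      using L2_norm_triangle[OF L2_diff[OF L(2)[of t] L(4)] L(4)] by simp
    finally show ?thesis by (simp add: mult_left_mono)
  qed
  then show "\<forall>\<^sub>F t in G. norm (L2_inner M (F t) (F' t) - L2_inner M f f') \<le> ?d t * (?d' t + L2_norm M f') + L2_norm M f * ?d' t"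
    by simp
  have "((\<lambda>t. ?d t * (?d' t + L2_norm M f') + L2_norm M f * ?d' t) \<longlongrightarrow> 0 * (0 + L2_norm M f') + L2_norm M f * 0) G"
    using F F' unfolding L2_lim_def by (intro tendsto_intros) auto
  then show "((\<lambda>t. ?d t * (?d' t + L2_norm M f') + L2_norm M f * ?d' t) \<longlongrightarrow> 0) G" by simp
qed

context
  fixes M :: "'a measure" and U
  assumes U: "L2_unitary M U"
begin

lemma unitary_L2: "f \<in> L2 M \<Longrightarrow> U f \<in> L2 M"
  and unitary_lin: "f \<in> L2 M \<Longrightarrow> g \<in> L2 M \<Longrightarrow> AE x in M. U (\<lambda>y. a * f y + b * g y) x = a * U f x + b * U g x"
  and unitary_inner: "f \<in> L2 M \<Longrightarrow> g \<in> L2 M \<Longrightarrow> L2_inner M (U f) (U g) = L2_inner M f g"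
  using U by (simp_all add: L2_unitary_def)

lemma unitary_norm: "f \<in> L2 M \<Longrightarrow> L2_norm M (U f) = L2_norm M f"
  using unitary_inner[of f f] unfolding L2_inner_self of_real_eq_iff
  by (simp add: power2_eq_iff_nonneg)

lemma unitary_norm_diff:
  assumes f: "f \<in> L2 M" and g: "g \<in> L2 M"
  shows "L2_norm M (\<lambda>x. U f x - U g x) = L2_norm M (\<lambda>x. f x - g x)"
proof -
  have d: "(\<lambda>x. 1 * f x + (-1) * g x) \<in> L2 M" by (rule L2_lin[OF f g])
  have "L2_norm M (\<lambda>x. U f x - U g x) = L2_norm M (U (\<lambda>x. 1 * f x + (-1) * g x))"
    using unitary_lin[OF f g, of 1 "-1"]
    by (intro L2_norm_cong_AE) (auto intro: L2_measurable unitary_L2 L2_diff f g d simp: eq_commute)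
  also have "\<dots> = L2_norm M (\<lambda>x. 1 * f x + (-1) * g x)" by (rule unitary_norm[OF d])
  finally show ?thesis by simp
qed

lemma unitary_cong_AE:
  assumes "f \<in> L2 M" "g \<in> L2 M" "AE x in M. f x = g x"
  shows "AE x in M. U f x = U g x"
proof -
  have "L2_norm M (\<lambda>x. f x - g x) = 0"
    using assms by (intro L2_norm_0_AE) (auto intro: L2_measurable L2_diff)
  then have "AE x in M. U f x - U g x = 0"
    using assms by (intro L2_norm_eq_0) (auto intro: L2_diff unitary_L2 simp: unitary_norm_diff)
  then show ?thesis by simp
qed

end

text \<open>The operators need to converge only at the limit function, because they are isometries.
  It is applied to a varying operator acting on a varying difference quotient.\<close>

lemma L2_lim_unitary:
  assumes W: "\<And>t. L2_unitary M (W t)" and F: "L2_lim M F f G" and Wf: "L2_lim M (\<lambda>t. W t f) f G"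
  shows "L2_lim M (\<lambda>t. W t (F t)) f G"
proof (rule L2_lim_dominated)
  have L: "F t \<in> L2 M" "f \<in> L2 M" for t using F by (auto simp: L2_lim_def)
  show "f \<in> L2 M" "\<And>t. W t (F t) \<in> L2 M" using L W unitary_L2 by blast+
  show "((\<lambda>t. L2_norm M (\<lambda>x. F t x - f x) + L2_norm M (\<lambda>x. W t f x - f x)) \<longlongrightarrow> 0) G"
    using F Wf by (auto simp: L2_lim_def intro: tendsto_add_zero)
  have "L2_norm M (\<lambda>x. W t (F t) x - f x) \<le> L2_norm M (\<lambda>x. F t x - f x) + L2_norm M (\<lambda>x. W t f x - f x)" for t
    using L2_norm_triangle_diff[OF unitary_L2[OF W L(1)] unitary_L2[OF W L(2)] L(2), of t t]
      unitary_norm_diff[OF W L(1) L(2)] by metis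
  then show "\<forall>\<^sub>F t in G. L2_norm M (\<lambda>x. W t (F t) x - f x) \<le> L2_norm M (\<lambda>x. F t x - f x) + L2_norm M (\<lambda>x. W t f x - f x)"
    by simp
qed

text \<open>By unitarity the identity holds exactly for difference quotients, with
  \<open>V t f\<close> in place of \<open>f\<close> on the right; strong continuity at
  \<open>f\<close> removes this discrepancy in the limit.\<close>

lemma skew_adjoint_generator:
  fixes V :: "real \<Rightarrow> ('a \<Rightarrow> complex) \<Rightarrow> 'a \<Rightarrow> complex"
  assumes V: "\<And>t. L2_unitary M (V t)" and f: "f \<in> L2 M" and g: "g \<in> L2 M"
    and df: "L2_lim M (\<lambda>t x. (V t f x - f x) / complex_of_real t) h (at 0)"
    and dg: "L2_lim M (\<lambda>t x. (V t g x - g x) / complex_of_real t) k (at 0)"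
    and cf: "L2_lim M (\<lambda>t. V t f) f (at 0)"
  shows "L2_inner M h g = - L2_inner M f k"
proof -
  have Vf: "V t f \<in> L2 M" "V t g \<in> L2 M" for t using V f g unitary_L2 by blast+
  have "L2_inner M (\<lambda>x. (V t f x - f x) / complex_of_real t) g = - L2_inner M (V t f) (\<lambda>x. (V t g x - g x) / complex_of_real t)" for t
  proof -
    have "L2_inner M (\<lambda>x. (V t f x - f x) / complex_of_real t) g = (1 / complex_of_real t) * (L2_inner M (V t f) g - L2_inner M f g)"
      using L2_inner_scale_left[OF L2_diff[OF Vf(1)[of t] f] g, where a = "1 / complex_of_real t"] by (simp add: L2_inner_diff_left Vf f g)
    moreover have "L2_inner M (V t f) (\<lambda>x. (V t g x - g x) / complex_of_real t) = (1 / complex_of_real t) * (L2_inner M (V t f) (V t g) - L2_inner M (V t f) g)"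
      using L2_inner_scale_right[OF L2_diff[OF Vf(2)[of t] g] Vf(1)[of t], where a = "1 / complex_of_real t"] by (simp add: L2_inner_diff_right Vf f g)
    moreover have "L2_inner M (V t f) (V t g) = L2_inner M f g" by (rule unitary_inner[OF V f g])
    ultimately show ?thesis by (simp only:) (simp add: algebra_simps)
  qed
  moreover have "((\<lambda>t. L2_inner M (\<lambda>x. (V t f x - f x) / complex_of_real t) g) \<longlongrightarrow> L2_inner M h g) (at 0)"
    by (rule L2_lim_inner[OF df L2_lim_const[OF g]])
  moreover have "((\<lambda>t. - L2_inner M (V t f) (\<lambda>x. (V t g x - g x) / complex_of_real t)) \<longlongrightarrow> - L2_inner M f k) (at 0)"
    by (intro tendsto_minus L2_lim_inner[OF cf dg])
  ultimately show ?thesis using tendsto_unique[OF trivial_limit_at] by force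
qed

text \<open>The inner product with \<open>f\<close> of the orbit of \<open>f\<close> solves a scalar differential equation, and
  equality in the Cauchy-Schwarz inequality forces the orbit to be \<open>exp (i \<omega> t) f\<close>.\<close>

lemma eigenvector_of_generator:
  fixes V :: "real \<Rightarrow> ('a \<Rightarrow> complex) \<Rightarrow> 'a \<Rightarrow> complex"
  assumes V: "\<And>t. L2_unitary M (V t)" and f: "f \<in> L2 M"
    and add: "\<And>s t. AE x in M. V (t + s) f x = V t (V s f) x"
    and zero: "AE x in M. V 0 f x = f x"
    and df: "L2_lim M (\<lambda>t x. (V t f x - f x) / complex_of_real t) (\<lambda>x. \<i> * complex_of_real \<omega> * f x) (at 0)"
  shows "AE x in M. V t f x = exp (\<i> * complex_of_real (\<omega> * t)) * f x"
proof -
  have Vf: "V t f \<in> L2 M" for t using V f unitary_L2 by blast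
  define \<psi> where "\<psi> t = L2_inner M (V t f) f" for t
  have der: "(\<psi> has_vector_derivative \<i> * complex_of_real \<omega> * \<psi> t) (at t)" for t
  proof (rule has_vector_derivative_at_shift)
    let ?q = "\<lambda>s x. (V s f x - f x) / complex_of_real s"
    have q: "?q s \<in> L2 M" for s using df by (simp add: L2_lim_def)
    have inn: "L2_inner M (V t (?q s)) f = (\<psi> (t + s) - \<psi> t) / complex_of_real s" for s
    proof -
      have "AE x in M. V t (\<lambda>x. (1 / complex_of_real s) * V s f x + (- 1 / complex_of_real s) * f x) x
          = (1 / complex_of_real s) * V t (V s f) x + (- 1 / complex_of_real s) * V t f x"
        by (rule unitary_lin[OF V Vf f])
      then have "AE x in M. V t (?q s) x = (1 / complex_of_real s) * V (t + s) f x + (- 1 / complex_of_real s) * V t f x"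
        using add[of t s] by eventually_elim (simp add: diff_divide_distrib)
      then have "L2_inner M (V t (?q s)) f = L2_inner M (\<lambda>x. (1 / complex_of_real s) * V (t + s) f x + (- 1 / complex_of_real s) * V t f x) f"
        by (intro L2_inner_cong_AE unitary_L2[OF V] q L2_lin Vf f) auto
      also have "\<dots> = (\<psi> (t + s) - \<psi> t) / complex_of_real s"
        by (subst L2_inner_lin_left) (auto simp: Vf f \<psi>_def diff_divide_distrib)
      finally show ?thesis .
    qed
    have lim: "L2_inner M (V t (\<lambda>x. \<i> * complex_of_real \<omega> * f x)) f = \<i> * complex_of_real \<omega> * \<psi> t"
    proof -
      have "AE x in M. V t (\<lambda>x. (\<i> * complex_of_real \<omega>) * f x + 0 * f x) x = (\<i> * complex_of_real \<omega>) * V t f x + 0 * V t f x"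
        by (rule unitary_lin[OF V f f])
      then have "L2_inner M (V t (\<lambda>x. \<i> * complex_of_real \<omega> * f x)) f = L2_inner M (\<lambda>x. \<i> * complex_of_real \<omega> * V t f x) f"
        by (intro L2_inner_cong_AE) (auto intro: unitary_L2[OF V] L2_scale Vf f)
      then show ?thesis using L2_inner_scale_left[OF Vf f] by (simp add: \<psi>_def)
    qed
    have "L2_lim M (\<lambda>s. V t (?q s)) (V t (\<lambda>x. \<i> * complex_of_real \<omega> * f x)) (at 0)"
    proof (rule L2_lim_dominated)
      show "((\<lambda>s. L2_norm M (\<lambda>x. ?q s x - \<i> * complex_of_real \<omega> * f x)) \<longlongrightarrow> 0) (at 0)" using df by (simp add: L2_lim_def)
      show "\<forall>\<^sub>F s in at 0. L2_norm M (\<lambda>x. V t (?q s) x - V t (\<lambda>x. \<i> * complex_of_real \<omega> * f x) x)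
          \<le> L2_norm M (\<lambda>x. ?q s x - \<i> * complex_of_real \<omega> * f x)"
        using unitary_norm_diff[OF V q L2_scale[OF f]] by simp
    qed (auto intro: unitary_L2[OF V] q L2_scale f)
    from L2_lim_inner[OF this L2_lim_const[OF f]]
    have 1: "((\<lambda>s. (\<psi> (t + s) - \<psi> t) / complex_of_real s) \<longlongrightarrow> \<i> * complex_of_real \<omega> * \<psi> t) (at 0)"
      unfolding inn lim .
    have "((\<lambda>s. norm ((\<psi> (t + s) - \<psi> t) / complex_of_real s - \<i> * complex_of_real \<omega> * \<psi> t)) \<longlongrightarrow> 0) (at 0)"
      using 1 by (intro tendsto_norm_zero) (simp add: LIM_zero)
    moreover have "\<forall>\<^sub>F s in at 0. norm ((\<psi> (t + s) - \<psi> t) / complex_of_real s - \<i> * complex_of_real \<omega> * \<psi> t)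
        = norm (\<psi> (t + s) - \<psi> t - s *\<^sub>R (\<i> * complex_of_real \<omega> * \<psi> t)) / norm s"
    proof (rule eventually_at_filter[THEN iffD2], rule always_eventually, intro allI impI)
      fix s :: real assume "s \<noteq> 0"
      then have "(\<psi> (t + s) - \<psi> t) / complex_of_real s - \<i> * complex_of_real \<omega> * \<psi> t
          = (\<psi> (t + s) - \<psi> t - s *\<^sub>R (\<i> * complex_of_real \<omega> * \<psi> t)) / complex_of_real s"
        by (simp add: scaleR_conv_of_real diff_divide_distrib)
      then show "norm ((\<psi> (t + s) - \<psi> t) / complex_of_real s - \<i> * complex_of_real \<omega> * \<psi> t)
        = norm (\<psi> (t + s) - \<psi> t - s *\<^sub>R (\<i> * complex_of_real \<omega> * \<psi> t)) / norm s"
        by (simp add: norm_divide)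
    qed
    ultimately have "((\<lambda>s. norm (\<psi> (t + s) - \<psi> t - s *\<^sub>R (\<i> * complex_of_real \<omega> * \<psi> t)) / norm s) \<longlongrightarrow> 0) (at 0)"
      by (rule Lim_transform_eventually)
    then show "((\<lambda>s. \<psi> (t + s)) has_vector_derivative \<i> * complex_of_real \<omega> * \<psi> t) (at 0)"
      unfolding has_vector_derivative_def has_derivative_at by (auto intro: bounded_linear_scaleR_left)
  qed
  have const: "exp (- \<i> * complex_of_real (\<omega> * t)) * \<psi> t = \<psi> 0" for t
  proof -
    have e: "((\<lambda>t. exp (- \<i> * complex_of_real (\<omega> * t))) has_vector_derivative (- \<i> * complex_of_real \<omega>) * exp (- \<i> * complex_of_real (\<omega> * t))) (at t)" for t
    proof -
      have "((\<lambda>z. exp (- \<i> * complex_of_real \<omega> * z)) has_field_derivative (- \<i> * complex_of_real \<omega>) * exp (- \<i> * complex_of_real \<omega> * complex_of_real t)) (at (complex_of_real t))"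
        by (auto intro!: derivative_eq_intros)
      from has_vector_derivative_real_field[OF this] show ?thesis by (simp add: mult.assoc)
    qed
    have *: "((\<lambda>t. exp (- \<i> * complex_of_real (\<omega> * t)) * \<psi> t) has_vector_derivative 0) (at t within UNIV)" for t
      using has_vector_derivative_mult[OF e der, of t] by (simp add: algebra_simps)
    obtain c where "\<And>t. t \<in> UNIV \<Longrightarrow> exp (- \<i> * complex_of_real (\<omega> * t)) * \<psi> t = c"
      using has_vector_derivative_zero_constant[OF convex_UNIV *] by blast
    from this[of t] this[of 0] show ?thesis by simp
  qed
  have \<psi>0: "\<psi> 0 = complex_of_real ((L2_norm M f)\<^sup>2)"
    unfolding \<psi>_def L2_inner_self[symmetric] by (rule L2_inner_cong_AE) (use zero Vf f in auto)
  define e where "e = exp (\<i> * complex_of_real (\<omega> * t))"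
  have ee: "e * cnj e = 1" "cnj e = exp (- \<i> * complex_of_real (\<omega> * t))"
    by (simp_all add: e_def exp_cnj flip: exp_add)
  have \<psi>t: "cnj e * \<psi> t = complex_of_real ((L2_norm M f)\<^sup>2)" using const[of t] \<psi>0 ee by simp
  have ef: "(\<lambda>x. e * f x) \<in> L2 M" by (rule L2_scale[OF f])
  have "complex_of_real ((L2_norm M (\<lambda>x. V t f x - e * f x))\<^sup>2) = L2_inner M (\<lambda>x. V t f x - e * f x) (\<lambda>x. V t f x - e * f x)"
    by (simp only: L2_inner_self)
  also have "\<dots> = L2_inner M (V t f) (V t f) - cnj e * \<psi> t - (e * L2_inner M f (V t f) - e * cnj e * L2_inner M f f)"
    by (simp add: L2_inner_diff_left L2_inner_diff_right L2_inner_scale_left L2_inner_scale_right L2_diff Vf f ef \<psi>_def algebra_simps)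
  also have "L2_inner M f (V t f) = cnj (\<psi> t)" unfolding \<psi>_def by (rule L2_inner_commute)
  also have "e * cnj (\<psi> t) = cnj (cnj e * \<psi> t)" by simp
  also have "L2_inner M (V t f) (V t f) = L2_inner M f f" by (rule unitary_inner[OF V f f])
  finally have "complex_of_real ((L2_norm M (\<lambda>x. V t f x - e * f x))\<^sup>2) = 0"
    by (simp only: \<psi>t ee(1) L2_inner_self) simp
  then have "L2_norm M (\<lambda>x. V t f x - e * f x) = 0" by simp
  from L2_norm_eq_0[OF L2_diff[OF Vf ef] this] show ?thesis by (simp add: e_def)
qed

section \<open>The Bessel operator on polynomials\<close>

definition ridge :: "nat \<Rightarrow> 'a::euclidean_space \<Rightarrow> 'a \<Rightarrow> complex" where
  "ridge k w x = complex_of_real (inner w x) ^ k"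

text \<open>Polynomials of degree at most \<open>n\<close> as combinations of powers of linear
  forms. On such powers the operators below have explicit formulas, so no monomials in coordinates
  are needed.\<close>

inductive_set rpoly :: "nat \<Rightarrow> ('a::euclidean_space \<Rightarrow> complex) set" for n where
  zero: "(\<lambda>x. 0) \<in> rpoly n"
| step: "F \<in> rpoly n \<Longrightarrow> k \<le> n \<Longrightarrow> (\<lambda>x. a * ridge k w x + F x) \<in> rpoly n"

lemma rpoly_add: "F \<in> rpoly n \<Longrightarrow> G \<in> rpoly n \<Longrightarrow> (\<lambda>x. F x + G x) \<in> rpoly n"
  by (induction rule: rpoly.induct) (auto simp: add.assoc intro: rpoly.step)

lemma rpoly_scale: "F \<in> rpoly n \<Longrightarrow> (\<lambda>x. a * F x) \<in> rpoly n"
proof (induction rule: rpoly.induct)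
  case zero
  then show ?case by (simp add: rpoly.zero)
next
  case (step F k b w)
  then show ?case using rpoly.step[of "\<lambda>x. a * F x" n k "a * b" w] by (simp add: algebra_simps)
qed

lemma rpoly_diff: "F \<in> rpoly n \<Longrightarrow> G \<in> rpoly n \<Longrightarrow> (\<lambda>x. F x - G x) \<in> rpoly n"
  using rpoly_add[of F n "\<lambda>x. (-1) * G x"] rpoly_scale[of G n "-1"] by simp

lemma rpoly_sum: "(\<And>i. i \<in> I \<Longrightarrow> F i \<in> rpoly n) \<Longrightarrow> (\<lambda>x. \<Sum>i\<in>I. F i x) \<in> rpoly n"
  by (induction I rule: infinite_finite_induct) (auto intro: rpoly.zero rpoly_add)

lemma rpoly_mono: "F \<in> rpoly m \<Longrightarrow> m \<le> n \<Longrightarrow> F \<in> rpoly n"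
  by (induction rule: rpoly.induct) (auto intro: rpoly.intros)

lemma rpoly_ridge: "k \<le> n \<Longrightarrow> (\<lambda>x. a * ridge k w x) \<in> rpoly n"
  using rpoly.step[OF rpoly.zero, of k n a w] by simp

lemma rpoly_const: "(\<lambda>x. a) \<in> rpoly n"
  using rpoly_ridge[of 0 n a 0] by (simp add: ridge_def)

text \<open>The weights are the linear coefficients of the Lagrange basis polynomials at 0, ..., n,
  so the combination of values computes the derivative at 0 exactly up to degree
  \<open>n\<close>.\<close>

lemma interpolation_derivative:
  obtains \<alpha> :: "nat \<Rightarrow> real" where "\<And>j. j \<le> n \<Longrightarrow> (\<Sum>i\<le>n. \<alpha> i * real i ^ j) = (if j = 1 then 1 else 0)"
proof -
  define L :: "nat \<Rightarrow> real poly" where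
    "L i = (\<Prod>k\<in>{..n} - {i}. smult (1 / (real i - real k)) [:- real k, 1:])" for i
  have Lval: "poly (L i) (real k) = (if k = i then 1 else 0)" if "i \<le> n" "k \<le> n" for i k
  proof (cases "k = i")
    case True
    have "poly (L i) (real i) = 1" unfolding L_def poly_prod by (intro prod.neutral) (auto simp flip: diff_divide_distrib)
    then show ?thesis using True by simp
  next
    case False
    then have "poly (L i) (real k) = 0"
      unfolding L_def poly_prod using that by (intro prod_zero) auto
    then show ?thesis using False by simp
  qed
  have Ldeg: "degree (L i) \<le> n" if "i \<le> n" for i
  proof -
    have "degree (L i) \<le> sum (degree \<circ> (\<lambda>k. smult (1 / (real i - real k)) [:- real k, 1:])) ({..n} - {i})"
      unfolding L_def by (rule degree_prod_sum_le) simp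
    also have "\<dots> \<le> (\<Sum>k\<in>{..n} - {i}. 1)" by (intro sum_mono) (auto intro: order_trans[OF degree_smult_le])
    also have "\<dots> = n" using that by simp
    finally show ?thesis .
  qed
  show ?thesis
  proof (rule that)
    fix j assume j: "j \<le> n"
    define p where "p = monom 1 j - (\<Sum>i\<le>n. smult (real i ^ j) (L i))"
    have "degree p \<le> n" unfolding p_def
      using j Ldeg by (intro degree_diff_le degree_sum_le) (auto simp: degree_monom_le intro: order_trans[OF degree_smult_le] order_trans[OF degree_monom_le])
    moreover have "poly p (real k) = 0" if "k \<le> n" for k
    proof -
      have "poly (\<Sum>i\<le>n. smult (real i ^ j) (L i)) (real k) = (\<Sum>i\<le>n. if i = k then real k ^ j else 0)"
        unfolding poly_sum using that Lval by (intro sum.cong) auto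
      then show ?thesis using that by (simp add: p_def poly_monom)
    qed
    then have sub: "real ` {..n} \<subseteq> {x. poly p x = 0}" by auto
    ultimately have "p = 0"
    proof (rule_tac ccontr)
      assume "p \<noteq> 0"
      have "card (real ` {..n}) \<le> card {x. poly p x = 0}"
        by (intro card_mono poly_roots_finite \<open>p \<noteq> 0\<close> sub)
      also have "\<dots> \<le> degree p" by (rule card_poly_roots_bound[OF \<open>p \<noteq> 0\<close>])
      finally have "Suc n \<le> degree p" by (simp add: card_image)
      then show False using \<open>degree p \<le> n\<close> by simp
    qed
    then have "coeff (monom 1 j) 1 = coeff (\<Sum>i\<le>n. smult (real i ^ j) (L i)) 1" by (simp add: p_def)
    then show "(\<Sum>i\<le>n. coeff (L i) 1 * real i ^ j) = (if j = 1 then 1 else 0)"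
      by (simp add: coeff_sum mult.commute)
  qed
qed

lemma rpoly_mult_linear:
  assumes "F \<in> rpoly n"
  shows "(\<lambda>x. complex_of_real (inner v x) * F x) \<in> rpoly (Suc n)"
  using assms
proof (induction rule: rpoly.induct)
  case zero
  then show ?case by (simp add: rpoly.zero)
next
  case (step F k a w)
  obtain \<alpha> :: "nat \<Rightarrow> real" where \<alpha>: "\<And>j. j \<le> Suc k \<Longrightarrow> (\<Sum>i\<le>Suc k. \<alpha> i * real i ^ j) = (if j = 1 then 1 else 0)"
    using interpolation_derivative[of "Suc k"] by blast
  \<comment> \<open>The product s t^k is the derivative at 0 of (t + i s)^(k+1) / (k+1) in the
    variable i; the interpolation formula writes it through powers of linear forms.\<close>
  have "complex_of_real (inner v x) * ridge k w x = (\<Sum>i\<le>Suc k. complex_of_real (\<alpha> i / real (Suc k)) * ridge (Suc k) (w + real i *\<^sub>R v) x)" for x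
  proof -
    define s t where "s = inner v x" and "t = inner w x"
    have "(\<Sum>i\<le>Suc k. \<alpha> i / real (Suc k) * (t + real i * s) ^ Suc k)
        = (\<Sum>i\<le>Suc k. \<Sum>j\<le>Suc k. (\<alpha> i * real i ^ j) * (real (Suc k choose j) * s ^ j * t ^ (Suc k - j) / real (Suc k)))"
      by (intro sum.cong refl)
         (simp only: add.commute[of t] binomial_ring sum_distrib_left power_mult_distrib, simp add: mult_ac divide_simps)
    also have "\<dots> = (\<Sum>j\<le>Suc k. (\<Sum>i\<le>Suc k. \<alpha> i * real i ^ j) * (real (Suc k choose j) * s ^ j * t ^ (Suc k - j) / real (Suc k)))"
      by (subst sum.swap) (simp only: sum_distrib_right)
    also have "\<dots> = (\<Sum>j\<le>Suc k. if j = 1 then s * t ^ k else 0)"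
      by (intro sum.cong refl) (use \<alpha> in auto)
    also have "\<dots> = s * t ^ k" by simp
    finally have "complex_of_real (\<Sum>i\<le>Suc k. \<alpha> i / real (Suc k) * (t + real i * s) ^ Suc k) = complex_of_real (s * t ^ k)" by simp
    then show ?thesis by (simp only: ridge_def inner_add_left inner_scaleR_left s_def[symmetric] t_def[symmetric]
          of_real_sum of_real_mult of_real_power)
  qed
  then have "(\<lambda>x. complex_of_real (inner v x) * (a * ridge k w x + F x))
      = (\<lambda>x. a * (\<Sum>i\<le>Suc k. complex_of_real (\<alpha> i / real (Suc k)) * ridge (Suc k) (w + real i *\<^sub>R v) x) + complex_of_real (inner v x) * F x)"
    by (simp add: fun_eq_iff algebra_simps)
  moreover have "(\<lambda>x. a * (\<Sum>i\<le>Suc k. complex_of_real (\<alpha> i / real (Suc k)) * ridge (Suc k) (w + real i *\<^sub>R v) x) + complex_of_real (inner v x) * F x) \<in> rpoly (Suc n)"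
    using step by (intro rpoly_add rpoly_scale rpoly_sum rpoly_ridge) auto
  ultimately show ?case by simp
qed

lemma rpoly_mult_ridge:
  assumes "F \<in> rpoly n"
  shows "(\<lambda>x. ridge k w x * F x) \<in> rpoly (k + n)"
proof (induction k)
  case (Suc k)
  then show ?case using rpoly_mult_linear[OF Suc, of w] by (simp add: ridge_def mult.assoc)
qed (use assms in \<open>simp add: ridge_def\<close>)

lemma rpoly_mult:
  assumes F: "F \<in> rpoly m" and G: "G \<in> rpoly n"
  shows "(\<lambda>x. F x * G x) \<in> rpoly (m + n)"
  using F
proof (induction rule: rpoly.induct)
  case zero
  then show ?case by (simp add: rpoly.zero)
next
  case (step F k a w)
  have "(\<lambda>x. a * (ridge k w x * G x) + F x * G x) \<in> rpoly (m + n)"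
    using step by (intro rpoly_add rpoly_scale rpoly_mono[OF rpoly_mult_ridge[OF G]]) auto
  then show ?case by (simp add: algebra_simps)
qed

lemma rpoly_of_real_polynomial:
  fixes f :: "'a::euclidean_space \<Rightarrow> real"
  assumes "real_polynomial_function f"
  shows "\<exists>n. (\<lambda>x. complex_of_real (f x)) \<in> rpoly n"
  using assms
proof (induction rule: real_polynomial_function.induct)
  case (linear f)
  define w where "w = (\<Sum>b\<in>Basis. f b *\<^sub>R b)"
  have "f x = inner w x" for x
  proof -
    have "f x = f (\<Sum>b\<in>Basis. inner x b *\<^sub>R b)" by (simp add: euclidean_representation)
    also have "\<dots> = (\<Sum>b\<in>Basis. inner x b * f b)"
      using linear by (simp add: linear_sum[OF bounded_linear.linear] linear_scale[OF bounded_linear.linear])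
    also have "\<dots> = inner w x" by (simp add: w_def inner_sum_left inner_commute[of x] mult.commute)
    finally show ?thesis .
  qed
  then have eq: "(\<lambda>x. complex_of_real (f x)) = (\<lambda>x. 1 * ridge 1 w x)" by (simp add: ridge_def)
  show ?case unfolding eq by (rule exI[of _ 1], rule rpoly_ridge) simp
next
  case (const c)
  then show ?case using rpoly_const by blast
next
  case (add f g)
  then obtain m n where "(\<lambda>x. complex_of_real (f x)) \<in> rpoly m" "(\<lambda>x. complex_of_real (g x)) \<in> rpoly n" by blast
  then have "(\<lambda>x. complex_of_real (f x) + complex_of_real (g x)) \<in> rpoly (max m n)"
    by (intro rpoly_add) (auto intro: rpoly_mono)
  then show ?case by auto
next
  case (mult f g)
  then obtain m n where "(\<lambda>x. complex_of_real (f x)) \<in> rpoly m" "(\<lambda>x. complex_of_real (g x)) \<in> rpoly n" by blast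
  then have "(\<lambda>x. complex_of_real (f x) * complex_of_real (g x)) \<in> rpoly (m + n)" by (rule rpoly_mult)
  then show ?case by auto
qed

lemma rpoly_of_polynomial:
  fixes F :: "'a::euclidean_space \<Rightarrow> complex"
  assumes "polynomial_function F"
  shows "\<exists>n. F \<in> rpoly n"
proof -
  have "real_polynomial_function (Re \<circ> F)" "real_polynomial_function (Im \<circ> F)"
    using assms bounded_linear_Re bounded_linear_Im by (auto simp: polynomial_function_def)
  from this[THEN rpoly_of_real_polynomial] obtain m n
    where "(\<lambda>x. complex_of_real (Re (F x))) \<in> rpoly m" "(\<lambda>x. complex_of_real (Im (F x))) \<in> rpoly n" by auto
  then have "(\<lambda>x. complex_of_real (Re (F x)) + \<i> * complex_of_real (Im (F x))) \<in> rpoly (max m n)"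
    by (intro rpoly_add rpoly_scale) (auto intro: rpoly_mono)
  then show ?thesis by (auto simp flip: complex_eq)
qed

lemma polynomial_of_rpoly: "F \<in> rpoly n \<Longrightarrow> polynomial_function F"
proof (induction rule: rpoly.induct)
  case (step F k a w)
  have "polynomial_function (\<lambda>x. inner w x)"
    by (rule polynomial_function_bounded_linear) (rule bounded_linear_inner_right)
  then have "real_polynomial_function (\<lambda>x. inner w x ^ k)"
    by (intro real_polynomial_function_power) (simp add: real_polynomial_function_eq)
  then have "polynomial_function (\<lambda>x. inner w x ^ k)" by (simp add: real_polynomial_function_eq)
  from polynomial_function_mult[OF this polynomial_function_const[of a]]
  have "polynomial_function (\<lambda>x. a * ridge k w x)"
    by (simp add: ridge_def scaleR_conv_of_real mult.commute)
  then show ?case using step by (intro polynomial_function_add) auto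
qed simp

text \<open>A chain \<open>\<phi> 0, \<phi> 1, \<dots>\<close> of successive derivatives; composing with a linear form gives
  functions on which the differential operators below act by shifting the chain.\<close>

definition chain :: "(nat \<Rightarrow> real \<Rightarrow> complex) \<Rightarrow> bool" where
  "chain \<phi> \<longleftrightarrow> (\<forall>k s. (\<phi> k has_vector_derivative \<phi> (Suc k) s) (at s))"

lemma chain_power: "\<exists>\<phi>. chain \<phi> \<and> \<phi> 0 = (\<lambda>s. complex_of_real s ^ n)"
proof -
  \<comment> \<open>The truncated subtraction produces a factor 0 as soon as \<open>k\<close>
    exceeds \<open>n\<close>, so the chain ends in zero functions.\<close>
  define \<phi> where "\<phi> k s = complex_of_real (of_nat (\<Prod>i<k. n - i) * s ^ (n - k))" for k s
  have "(\<phi> k has_vector_derivative \<phi> (Suc k) s) (at s)" for k s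
  proof -
    have "((\<lambda>s. of_nat (\<Prod>i<k. n - i) * s ^ (n - k)) has_real_derivative of_nat (\<Prod>i<Suc k. n - i) * s ^ (n - Suc k)) (at s)"
      using DERIV_cmult[OF DERIV_pow[of "n - k" s], of "of_nat (\<Prod>i<k. n - i)"] by (simp add: mult.assoc)
    from has_vector_derivative_of_real[OF this] show ?thesis unfolding \<phi>_def .
  qed
  then have "chain \<phi>" by (simp add: chain_def)
  moreover have "\<phi> 0 = (\<lambda>s. complex_of_real s ^ n)" by (simp add: \<phi>_def fun_eq_iff)
  ultimately show ?thesis by blast
qed

lemma chain_has_derivative:
  assumes "chain \<phi>"
  shows "((\<lambda>x. \<phi> k (inner w x)) has_derivative (\<lambda>h. complex_of_real (inner w h) * \<phi> (Suc k) (inner w x))) (at x)"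
proof -
  have "(\<phi> k has_derivative (\<lambda>s. s *\<^sub>R \<phi> (Suc k) (inner w x))) (at (inner w x))"
    using assms by (simp add: chain_def has_vector_derivative_def)
  moreover have "((\<lambda>x. inner w x) has_derivative (\<lambda>h. inner w h)) (at x)" by (auto intro!: derivative_eq_intros)
  ultimately show ?thesis
    using has_derivative_compose by (fastforce simp: scaleR_conv_of_real)
qed

section \<open>The differential operators on functions of a linear form\<close>

definition nice :: "('a::euclidean_space \<Rightarrow> complex) \<Rightarrow> bool" where
  "nice F \<longleftrightarrow> (\<forall>x. F differentiable (at x)) \<and> (\<forall>u x. dir_deriv u F differentiable (at x))"

lemma dir_deriv_eqI: "(F has_derivative F') (at x) \<Longrightarrow> dir_deriv u F x = F' u"
  unfolding dir_deriv_def by (metis frechet_derivative_at)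

lemma nice_has_derivative: "nice F \<Longrightarrow> (F has_derivative (\<lambda>u. dir_deriv u F x)) (at x)"
  unfolding nice_def dir_deriv_def by (simp add: frechet_derivative_works[symmetric] eta_contract_eq)

lemma nice_has_derivative2:
  "nice F \<Longrightarrow> (dir_deriv v F has_derivative (\<lambda>u. dir_deriv u (dir_deriv v F) x)) (at x)"
  unfolding nice_def dir_deriv_def by (simp add: frechet_derivative_works[symmetric] eta_contract_eq)

lemma linear_dir_deriv: "nice F \<Longrightarrow> linear (\<lambda>u. dir_deriv u F x)"
  using nice_has_derivative has_derivative_linear by blast

lemma chain_dir_deriv: "chain \<phi> \<Longrightarrow> dir_deriv u (\<lambda>x. \<phi> k (inner w x)) = (\<lambda>x. complex_of_real (inner w u) * \<phi> (Suc k) (inner w x))"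
  using dir_deriv_eqI[OF chain_has_derivative] by blast

lemma nice_chain: assumes "chain \<phi>" shows "nice (\<lambda>x. \<phi> k (inner w x))"
  unfolding nice_def chain_dir_deriv[OF assms]
proof (intro conjI allI)
  show "(\<lambda>x. \<phi> k (inner w x)) differentiable at x" for x
    by (rule differentiableI[OF chain_has_derivative[OF assms]])
  show "(\<lambda>x. complex_of_real (inner w u) * \<phi> (Suc k) (inner w x)) differentiable at x" for u x
    by (intro differentiable_mult differentiable_const differentiableI[OF chain_has_derivative[OF assms]])
qed

lemma dir_deriv_lin:
  assumes "nice F" "nice G"
  shows "dir_deriv u (\<lambda>x. a * F x + b * G x) = (\<lambda>x. a * dir_deriv u F x + b * dir_deriv u G x)"
proof
  fix x
  have "((\<lambda>x. a * F x + b * G x) has_derivative (\<lambda>h. a * dir_deriv h F x + b * dir_deriv h G x)) (at x)"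
    using assms[THEN nice_has_derivative, of x] by (auto intro!: derivative_eq_intros)
  then show "dir_deriv u (\<lambda>x. a * F x + b * G x) x = a * dir_deriv u F x + b * dir_deriv u G x"
    by (rule dir_deriv_eqI)
qed

lemma nice_lin: assumes "nice F" "nice G" shows "nice (\<lambda>x. a * F x + b * G x)"
  unfolding nice_def dir_deriv_lin[OF assms]
  using assms unfolding nice_def by (auto intro!: differentiable_add differentiable_mult)

lemma dir_deriv_mult_linear:
  assumes "nice F"
  shows "dir_deriv u (\<lambda>x. complex_of_real (inner v x) * F x)
    = (\<lambda>x. complex_of_real (inner v u) * F x + complex_of_real (inner v x) * dir_deriv u F x)"
proof
  fix x
  have "((\<lambda>x. complex_of_real (inner v x) * F x) has_derivative
      (\<lambda>h. complex_of_real (inner v x) * dir_deriv h F x + complex_of_real (inner v h) * F x)) (at x)"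
    using nice_has_derivative[OF assms, of x] by (auto intro!: derivative_eq_intros)
  from dir_deriv_eqI[OF this] show "dir_deriv u (\<lambda>x. complex_of_real (inner v x) * F x) x
      = complex_of_real (inner v u) * F x + complex_of_real (inner v x) * dir_deriv u F x"
    by (simp add: add.commute)
qed

lemma differentiable_linear_form: "(\<lambda>x. complex_of_real (inner v x)) differentiable (at x)"
proof -
  have "((\<lambda>x. complex_of_real (inner v x)) has_derivative (\<lambda>h. complex_of_real (inner v h))) (at x)"
    by (auto intro!: derivative_eq_intros)
  then show ?thesis by (rule differentiableI)
qed

lemma nice_mult_linear: assumes "nice F" shows "nice (\<lambda>x. complex_of_real (inner v x) * F x)"
  unfolding nice_def dir_deriv_mult_linear[OF assms]
  using assms unfolding nice_def
  by (auto intro!: differentiable_add differentiable_mult differentiable_linear_form)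

lemma dir_deriv_const: "dir_deriv u (\<lambda>x. c) = (\<lambda>x. 0)"
  using dir_deriv_eqI[OF has_derivative_const] by blast

lemma nice_rpoly: "F \<in> rpoly n \<Longrightarrow> nice F"
proof (induction rule: rpoly.induct)
  case zero
  show ?case by (simp add: nice_def dir_deriv_const)
next
  case (step F k a w)
  obtain \<phi> where \<phi>: "chain \<phi>" "\<phi> 0 = (\<lambda>s. complex_of_real s ^ k)" using chain_power by blast
  have "nice (ridge k w)" using nice_chain[OF \<phi>(1), of 0 w] by (simp add: \<phi>(2) ridge_def[abs_def])
  then show ?case using nice_lin[of "ridge k w" F a 1] step by simp
qed

definition op_M :: "'a::euclidean_space \<Rightarrow> ('a \<Rightarrow> complex) \<Rightarrow> 'a \<Rightarrow> complex" where
  "op_M v F x = complex_of_real (inner v x) * F x"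

text \<open>This is the commutator of the unit component of the Bessel operator with multiplication
  by \<open>(v|x)\<close>, see \<open>bessel_M\<close>.\<close>

definition op_H :: "'a::euclidean_jordan_algebra \<Rightarrow> ('a \<Rightarrow> complex) \<Rightarrow> 'a \<Rightarrow> complex" where
  "op_H v F x = 2 * dir_deriv (v \<star> x) F x + complex_of_real (jlambda TYPE('a) * inner junit v) * F x"

definition op_E :: "('a::euclidean_space \<Rightarrow> complex) \<Rightarrow> 'a \<Rightarrow> complex" where
  "op_E F x = dir_deriv x F x"

lemma linear_sum_Basis:
  fixes f :: "'a::euclidean_space \<Rightarrow> complex"
  assumes "linear f"
  shows "(\<Sum>b\<in>Basis. complex_of_real (inner u b) * f b) = f u"
proof -
  have "f u = f (\<Sum>b\<in>Basis. inner u b *\<^sub>R b)" by (simp add: euclidean_representation)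
  also have "\<dots> = (\<Sum>b\<in>Basis. complex_of_real (inner u b) * f b)"
    using assms by (simp add: linear_sum linear_scale scaleR_conv_of_real)
  finally show ?thesis ..
qed

lemma jP2_sym: "blinfun_apply (jP2 a b) x = blinfun_apply (jP2 b a) x"
  by (simp add: jP2_apply jmult_commute[of b a])

lemma linear_jP2: "linear (\<lambda>a. complex_of_real (inner v (blinfun_apply (jP2 a b) x)))"
  "linear (\<lambda>b. complex_of_real (inner v (blinfun_apply (jP2 a b) x)))"
  by (auto intro!: linearI simp: jP2_apply jmult_simps inner_add_right inner_diff_right scaleR_conv_of_real algebra_simps)

lemma linear_inner_complex: "linear (\<lambda>a. complex_of_real (inner v a))"
  by (auto intro!: linearI simp: inner_add_right scaleR_conv_of_real)

lemma bessel_lin: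
  assumes "nice F" "nice G"
  shows "bessel_component v (\<lambda>x. a * F x + b * G x) = (\<lambda>x. a * bessel_component v F x + b * bessel_component v G x)"
proof
  fix x
  have 2: "dir_deriv p (dir_deriv q (\<lambda>x. a * F x + b * G x)) x = a * dir_deriv p (dir_deriv q F) x + b * dir_deriv p (dir_deriv q G) x" for p q
    unfolding dir_deriv_lin[OF assms]
    by (rule dir_deriv_eqI) (use assms[THEN nice_has_derivative2, of q x] in \<open>auto intro!: derivative_eq_intros\<close>)
  show "bessel_component v (\<lambda>x. a * F x + b * G x) x = a * bessel_component v F x + b * bessel_component v G x"
    unfolding bessel_component_def 2 unfolding dir_deriv_lin[OF assms]
    by (simp add: sum.distrib sum_distrib_left algebra_simps)
qed

lemma bessel_chain:
  fixes w :: "'a::euclidean_jordan_algebra"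
  assumes "chain \<phi>"
  shows "bessel_component v (\<lambda>x. \<phi> k (inner w x)) =
    (\<lambda>x. complex_of_real (inner (blinfun_apply (jP w) v) x) * \<phi> (Suc (Suc k)) (inner w x)
      + complex_of_real (jlambda TYPE('a) * inner w v) * \<phi> (Suc k) (inner w x))"
proof
  fix x :: 'a
  have d1: "dir_deriv b (\<lambda>x. \<phi> k (inner w x)) = (\<lambda>x. complex_of_real (inner w b) * \<phi> (Suc k) (inner w x))" for b
    by (rule chain_dir_deriv[OF assms])
  have d2: "dir_deriv a (dir_deriv b (\<lambda>x. \<phi> k (inner w x))) x
      = complex_of_real (inner w b) * (complex_of_real (inner w a) * \<phi> (Suc (Suc k)) (inner w x))" for a b
    unfolding d1 by (rule dir_deriv_eqI)
      (use chain_has_derivative[OF assms, of "Suc k" w x] in \<open>auto intro!: derivative_eq_intros\<close>)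
  have "(\<Sum>a\<in>Basis. \<Sum>b\<in>Basis. dir_deriv a (dir_deriv b (\<lambda>x. \<phi> k (inner w x))) x
      * complex_of_real (inner v (blinfun_apply (jP2 a b) x)))
    = (\<Sum>a\<in>Basis. complex_of_real (inner w a) * (\<Sum>b\<in>Basis. complex_of_real (inner w b)
        * complex_of_real (inner v (blinfun_apply (jP2 a b) x)))) * \<phi> (Suc (Suc k)) (inner w x)"
    unfolding d2 by (simp add: sum_distrib_left sum_distrib_right mult_ac)
  also have "\<dots> = complex_of_real (inner v (blinfun_apply (jP2 w w) x)) * \<phi> (Suc (Suc k)) (inner w x)"
    by (simp only: linear_sum_Basis[OF linear_jP2(2)] linear_sum_Basis[OF linear_jP2(1)])
  also have "inner v (blinfun_apply (jP2 w w) x) = inner (blinfun_apply (jP w) v) x"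
    by (simp add: jP2_apply jP_apply inner_diff_right inner_diff_left inner_add_right scaleR_2 inner_add_left)
      (metis inner_commute inner_jmult)
  finally have 1: "(\<Sum>a\<in>Basis. \<Sum>b\<in>Basis. dir_deriv a (dir_deriv b (\<lambda>x. \<phi> k (inner w x))) x
      * complex_of_real (inner v (blinfun_apply (jP2 a b) x)))
    = complex_of_real (inner (blinfun_apply (jP w) v) x) * \<phi> (Suc (Suc k)) (inner w x)" .
  have 2: "(\<Sum>a\<in>Basis. dir_deriv a (\<lambda>x. \<phi> k (inner w x)) x * complex_of_real (inner v a))
      = complex_of_real (inner w v) * \<phi> (Suc k) (inner w x)"
    unfolding d1 using linear_sum_Basis[OF linear_inner_complex, of w v]
    by (simp add: mult.assoc mult.left_commute[of _ "\<phi> (Suc k) (inner w x)"] inner_commute[of v w] flip: sum_distrib_left)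
  show "bessel_component v (\<lambda>x. \<phi> k (inner w x)) x =
    complex_of_real (inner (blinfun_apply (jP w) v) x) * \<phi> (Suc (Suc k)) (inner w x)
      + complex_of_real (jlambda TYPE('a) * inner w v) * \<phi> (Suc k) (inner w x)"
    unfolding bessel_component_def 1 2 by simp
qed

text \<open>The vector that represents the linear form a |-> (v | P(a, u) x); it is the direction of
  the first-order term when a linear factor is pulled out of the Bessel operator.\<close>

definition bessel_shift :: "'a::euclidean_jordan_algebra \<Rightarrow> 'a \<Rightarrow> 'a \<Rightarrow> 'a" where
  "bessel_shift v u x = x \<star> (u \<star> v) + v \<star> (u \<star> x) - u \<star> (v \<star> x)"

lemma inner_jP2_bessel_shift: "inner v (blinfun_apply (jP2 a u) x) = inner (bessel_shift v u x) a"
proof -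
  have "inner v (a \<star> (u \<star> x)) = inner (v \<star> (u \<star> x)) a" by (metis inner_commute inner_jmult jmult_commute)
  moreover have "inner v (u \<star> (a \<star> x)) = inner (x \<star> (u \<star> v)) a" by (metis inner_commute inner_jmult jmult_commute)
  moreover have "inner v ((a \<star> u) \<star> x) = inner (u \<star> (v \<star> x)) a" by (metis inner_commute inner_jmult jmult_commute)
  ultimately show ?thesis
    by (simp add: jP2_apply bessel_shift_def inner_diff_right inner_diff_left inner_add_right inner_add_left)
qed

lemma inner_bessel_shift: "inner w (bessel_shift v u x) = inner (blinfun_apply (jP2 w u) v) x"
proof -
  have "inner w (x \<star> (u \<star> v)) = inner (w \<star> (u \<star> v)) x" by (metis inner_commute inner_jmult jmult_commute)
  moreover have "inner w (v \<star> (u \<star> x)) = inner (u \<star> (w \<star> v)) x" by (metis inner_commute inner_jmult jmult_commute)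
  moreover have "inner w (u \<star> (v \<star> x)) = inner ((w \<star> u) \<star> v) x" by (metis inner_commute inner_jmult jmult_commute)
  ultimately show ?thesis
    by (simp add: jP2_apply bessel_shift_def inner_diff_right inner_diff_left inner_add_right inner_add_left)
qed

text \<open>In the Leibniz rule the two mixed second-order terms agree by symmetry of P(a, b), which
  gives the factor 2.\<close>

lemma bessel_mult_linear:
  fixes u :: "'a::euclidean_jordan_algebra"
  assumes "nice F"
  shows "bessel_component v (op_M u F) = (\<lambda>x. complex_of_real (inner u x) * bessel_component v F x
    + 2 * dir_deriv (bessel_shift v u x) F x + complex_of_real (jlambda TYPE('a) * inner u v) * F x)"
proof
  fix x :: 'a
  let ?u = "\<lambda>x. complex_of_real (inner u x)" and ?P = "\<lambda>a b. complex_of_real (inner v (blinfun_apply (jP2 a b) x))"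
  have M: "op_M u F = (\<lambda>x. ?u x * F x)" by (simp add: op_M_def fun_eq_iff)
  have d1: "dir_deriv b (op_M u F) = (\<lambda>x. ?u b * F x + ?u x * dir_deriv b F x)" for b
    unfolding M by (rule dir_deriv_mult_linear[OF assms])
  have d2: "dir_deriv a (dir_deriv b (op_M u F)) x
      = ?u b * dir_deriv a F x + ?u a * dir_deriv b F x + ?u x * dir_deriv a (dir_deriv b F) x" for a b
    unfolding d1
    by (rule dir_deriv_eqI) (use nice_has_derivative[OF assms, of x] nice_has_derivative2[OF assms, of b x]
        in \<open>auto intro!: derivative_eq_intros simp: algebra_simps\<close>)
  have S: "(\<Sum>a\<in>Basis. dir_deriv a F x * ?P a u) = dir_deriv (bessel_shift v u x) F x"
    unfolding inner_jP2_bessel_shift using linear_sum_Basis[OF linear_dir_deriv[OF assms], of "bessel_shift v u x" x]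
    by (simp add: mult.commute)
  have S1: "(\<Sum>a\<in>Basis. \<Sum>b\<in>Basis. ?u b * dir_deriv a F x * ?P a b) = dir_deriv (bessel_shift v u x) F x"
  proof -
    have "(\<Sum>a\<in>Basis. \<Sum>b\<in>Basis. ?u b * dir_deriv a F x * ?P a b) = (\<Sum>a\<in>Basis. dir_deriv a F x * (\<Sum>b\<in>Basis. ?u b * ?P a b))"
      by (simp add: sum_distrib_left mult_ac)
    also have "\<dots> = (\<Sum>a\<in>Basis. dir_deriv a F x * ?P a u)" by (simp only: linear_sum_Basis[OF linear_jP2(2)])
    finally show ?thesis using S by simp
  qed
  have S2: "(\<Sum>a\<in>Basis. \<Sum>b\<in>Basis. ?u a * dir_deriv b F x * ?P a b) = dir_deriv (bessel_shift v u x) F x"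
    by (subst sum.swap) (use S1 in \<open>simp only: jP2_sym[of _ _ x]\<close>)
  have "(\<Sum>a\<in>Basis. \<Sum>b\<in>Basis. dir_deriv a (dir_deriv b (op_M u F)) x * ?P a b)
      = (\<Sum>a\<in>Basis. \<Sum>b\<in>Basis. ?u b * dir_deriv a F x * ?P a b) + (\<Sum>a\<in>Basis. \<Sum>b\<in>Basis. ?u a * dir_deriv b F x * ?P a b)
       + ?u x * (\<Sum>a\<in>Basis. \<Sum>b\<in>Basis. dir_deriv a (dir_deriv b F) x * ?P a b)"
    unfolding d2 by (simp add: distrib_right sum.distrib sum_distrib_left mult.assoc)
  moreover have "(\<Sum>a\<in>Basis. dir_deriv a (op_M u F) x * complex_of_real (inner v a))
      = complex_of_real (inner u v) * F x + ?u x * (\<Sum>a\<in>Basis. dir_deriv a F x * complex_of_real (inner v a))"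
  proof -
    have "(\<Sum>a\<in>Basis. dir_deriv a (op_M u F) x * complex_of_real (inner v a))
        = (\<Sum>a\<in>Basis. ?u a * complex_of_real (inner v a)) * F x + ?u x * (\<Sum>a\<in>Basis. dir_deriv a F x * complex_of_real (inner v a))"
      unfolding d1 by (simp add: algebra_simps sum.distrib sum_distrib_left)
    then show ?thesis by (simp only: linear_sum_Basis[OF linear_inner_complex] inner_commute[of v u])
  qed
  ultimately show "bessel_component v (op_M u F) x = ?u x * bessel_component v F x
    + 2 * dir_deriv (bessel_shift v u x) F x + complex_of_real (jlambda TYPE('a) * inner u v) * F x"
    unfolding bessel_component_def S1 S2 by (simp add: algebra_simps)
qed

lemma op_H_chain:
  fixes w :: "'a::euclidean_jordan_algebra"
  assumes "chain \<phi>"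
  shows "op_H v (\<lambda>x. \<phi> k (inner w x)) x = 2 * (complex_of_real (inner (v \<star> w) x) * \<phi> (Suc k) (inner w x))
    + complex_of_real (jlambda TYPE('a) * inner junit v) * \<phi> k (inner w x)"
proof -
  have "inner w (v \<star> x) = inner (v \<star> w) x" by (simp add: inner_jmult)
  then show ?thesis by (simp add: op_H_def chain_dir_deriv[OF assms])
qed

lemma op_H_lin:
  assumes "nice F" "nice G"
  shows "op_H v (\<lambda>x. a * F x + b * G x) = (\<lambda>x. a * op_H v F x + b * op_H v G x)"
  by (simp add: fun_eq_iff op_H_def dir_deriv_lin[OF assms] algebra_simps)

lemma op_H_mult_linear:
  assumes "nice F"
  shows "op_H v (op_M u F) x = complex_of_real (inner u x) * op_H v F x + 2 * (complex_of_real (inner (v \<star> u) x) * F x)"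
proof -
  have M: "op_M u F = (\<lambda>x. complex_of_real (inner u x) * F x)" by (simp add: op_M_def fun_eq_iff)
  have "inner u (v \<star> x) = inner (v \<star> u) x" by (simp add: inner_jmult)
  then show ?thesis unfolding op_H_def M dir_deriv_mult_linear[OF assms] by (simp add: algebra_simps)
qed

lemma bessel_mult_linear_junit:
  assumes "nice F"
  shows "bessel_component junit (op_M u F) = (\<lambda>x. complex_of_real (inner u x) * bessel_component junit F x + op_H u F x)"
proof -
  have "bessel_shift junit u x = u \<star> x" for x by (simp add: bessel_shift_def jmult_commute[of x u])
  then show ?thesis by (simp add: bessel_mult_linear[OF assms] op_H_def inner_commute[of u junit] add.assoc)
qed

lemma bessel_mult_linear_chain:
  fixes w :: "'a::euclidean_jordan_algebra"
  assumes "chain \<phi>"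
  shows "bessel_component v (op_M u (\<lambda>x. \<phi> k (inner w x))) x =
     complex_of_real (inner u x) * bessel_component v (\<lambda>x. \<phi> k (inner w x)) x
    + 2 * (complex_of_real (inner (blinfun_apply (jP2 w u) v) x) * \<phi> (Suc k) (inner w x))
    + complex_of_real (jlambda TYPE('a) * inner u v) * \<phi> k (inner w x)"
  by (simp add: bessel_mult_linear[OF nice_chain[OF assms]] chain_dir_deriv[OF assms] inner_bessel_shift)

lemma nice_op_M: "nice F \<Longrightarrow> nice (op_M u F)"
  using nice_mult_linear[of F u] by (simp add: op_M_def[abs_def])

lemma bessel_H_chain:
  fixes w :: "'a::euclidean_jordan_algebra"
  assumes c: "chain \<phi>"
  shows "bessel_component junit (op_H v (\<lambda>x. \<phi> 0 (inner w x))) x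
    = op_H v (bessel_component junit (\<lambda>x. \<phi> 0 (inner w x))) x + 2 * bessel_component v (\<lambda>x. \<phi> 0 (inner w x)) x"
proof -
  let ?R = "\<lambda>k x. \<phi> k (inner w x)"
  note n = nice_chain[OF c] nice_op_M[OF nice_chain[OF c]]
  have 1: "op_H v (?R 0) = (\<lambda>x. 2 * op_M (v \<star> w) (?R 1) x + complex_of_real (jlambda TYPE('a) * inner junit v) * ?R 0 x)"
    by (simp add: fun_eq_iff op_H_chain[OF c] op_M_def)
  have 2: "bessel_component junit (?R 0) = (\<lambda>x. 1 * op_M (w \<star> w) (?R 2) x + complex_of_real (jlambda TYPE('a) * inner w junit) * ?R 1 x)"
    by (simp add: fun_eq_iff bessel_chain[OF c] op_M_def jP_apply numeral_2_eq_2 scaleR_2)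
  have jP2: "blinfun_apply (jP2 w (v \<star> w)) junit = w \<star> (v \<star> w)" by (simp add: jP2_apply jmult_commute)
  have P: "inner (blinfun_apply (jP w) v) x = 2 * inner (w \<star> (v \<star> w)) x - inner (v \<star> (w \<star> w)) x"
    by (simp add: jP_apply inner_diff_left jmult_commute[of v])
  have v: "inner (v \<star> w) junit = inner w v" by (metis inner_commute inner_jmult jmult_commute junit_right)
  have P1: "blinfun_apply (jP w) junit = w \<star> w" by (simp add: jP_apply scaleR_2)
  show ?thesis
    unfolding 1 2 bessel_lin[OF n(2) n(1)] op_H_lin[OF n(2) n(1)] op_H_mult_linear[OF n(1)]
      bessel_mult_linear_chain[OF c] jP2 v
    by (simp add: bessel_chain[OF c] op_H_chain[OF c] op_M_def P P1 numeral_2_eq_2 inner_commute[of junit w] algebra_simps)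
qed

text \<open>This makes the terms with the third derivative of the chain agree when two Bessel
  components are composed in either order.\<close>

lemma jP_identity: "blinfun_apply (jP2 w (w \<star> w)) v = w \<star> blinfun_apply (jP w) v"
proof -
  have "(w \<star> (w \<star> w)) \<star> v = 2 *\<^sub>R ((w \<star> w) \<star> (w \<star> v)) + (w \<star> w) \<star> (w \<star> v) - 2 *\<^sub>R (w \<star> (w \<star> (w \<star> v)))"
    using jordan_triple_op[of w w v] by (simp add: jmult_commute[of "w \<star> w" w])
  then show ?thesis
    by (simp add: jP2_apply jP_apply jordan_identity[of w v] jmult_simps scaleR_2 algebra_simps)
qed

lemma bessel_commute_chain:
  fixes w :: "'a::euclidean_jordan_algebra"
  assumes c: "chain \<phi>"
  shows "bessel_component junit (bessel_component v (\<lambda>x. \<phi> 0 (inner w x))) x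
    = bessel_component v (bessel_component junit (\<lambda>x. \<phi> 0 (inner w x))) x"
proof -
  let ?R = "\<lambda>k x. \<phi> k (inner w x)"
  note n = nice_chain[OF c] nice_op_M[OF nice_chain[OF c]]
  have 1: "bessel_component v (?R 0) = (\<lambda>x. 1 * op_M (blinfun_apply (jP w) v) (?R 2) x + complex_of_real (jlambda TYPE('a) * inner w v) * ?R 1 x)" for v
    by (simp add: fun_eq_iff bessel_chain[OF c] op_M_def numeral_2_eq_2)
  have P1: "blinfun_apply (jP w) junit = w \<star> w" by (simp add: jP_apply scaleR_2)
  have J: "blinfun_apply (jP2 w (blinfun_apply (jP w) v)) junit = w \<star> blinfun_apply (jP w) v"
    by (simp add: jP2_apply jmult_commute)
  have "inner (w \<star> (w \<star> v)) junit = inner ((w \<star> w) \<star> v) junit"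
    by (metis inner_commute inner_jmult jmult_commute junit_right)
  moreover have "inner ((w \<star> w) \<star> v) junit = inner (w \<star> w) v" by (simp add: inner_jmult')
  ultimately have e: "inner (blinfun_apply (jP w) v) junit = inner (w \<star> w) v"
    by (simp add: jP_apply inner_diff_left)
  show ?thesis
    unfolding 1 bessel_lin[OF n(2) n(1)] bessel_mult_linear_chain[OF c] J P1 jP_identity e
    by (simp add: bessel_chain[OF c] op_M_def P1 numeral_2_eq_2 algebra_simps)
qed

lemma chain_power':
  obtains \<phi> where "chain \<phi>" "\<And>x w. \<phi> 0 (inner w x) = ridge n w x"
    "\<And>x w. \<phi> (Suc 0) (inner w x) = of_nat n * ridge (n - 1) w x"
    "\<And>x w. \<phi> (Suc (Suc 0)) (inner w x) = of_nat (n * (n - 1)) * ridge (n - 2) w x"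
proof -
  obtain \<phi> where \<phi>: "chain \<phi>" "\<phi> 0 = (\<lambda>s. complex_of_real s ^ n)" using chain_power by blast
  have der: "(\<phi> k has_vector_derivative \<phi> (Suc k) s) (at s)" for k s using \<phi>(1) by (simp add: chain_def)
  have pow: "((\<lambda>s. a * complex_of_real s ^ m) has_vector_derivative a * (of_nat m * complex_of_real s ^ (m - 1))) (at s)" for a m s
  proof -
    have "((\<lambda>z. a * z ^ m) has_field_derivative a * (of_nat m * complex_of_real s ^ (m - 1))) (at (complex_of_real s))"
      by (auto intro!: derivative_eq_intros)
    from has_vector_derivative_real_field[OF this] show ?thesis .
  qed
  have 1: "\<phi> (Suc 0) s = of_nat n * complex_of_real s ^ (n - 1)" for s
    using vector_derivative_unique_at[OF der[of 0 s]] pow[of 1 n s] by (simp add: \<phi>(2))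
  have "\<phi> (Suc 0) = (\<lambda>s. of_nat n * complex_of_real s ^ (n - 1))" using 1 by blast
  then have "\<phi> (Suc (Suc 0)) s = of_nat n * (of_nat (n - 1) * complex_of_real s ^ (n - 1 - 1))" for s
    using vector_derivative_unique_at[OF der[of "Suc 0" s]] pow[of "of_nat n" "n - 1" s] by simp
  then show ?thesis using that[OF \<phi>(1)] \<phi>(2) 1 by (simp add: ridge_def numeral_2_eq_2)
qed

lemma ridge_chain_eq:
  fixes w :: "'a::euclidean_space"
  shows "(\<And>x w. \<phi> 0 (inner w x) = ridge n w (x :: 'a)) \<Longrightarrow> ridge n w = (\<lambda>x. \<phi> 0 (inner w x))"
  by (simp add: fun_eq_iff)

lemma bessel_ridge:
  fixes w :: "'a::euclidean_jordan_algebra"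
  shows "bessel_component v (ridge n w) x = of_nat (n * (n - 1)) * complex_of_real (inner (blinfun_apply (jP w) v) x) * ridge (n - 2) w x
    + of_nat n * complex_of_real (jlambda TYPE('a) * inner w v) * ridge (n - 1) w x"
proof -
  obtain \<phi> where \<phi>: "chain \<phi>" "\<And>x w. \<phi> 0 (inner w x) = ridge n w (x :: 'a)"
    "\<And>x w. \<phi> (Suc 0) (inner w x) = of_nat n * ridge (n - 1) w (x :: 'a)"
    "\<And>x w. \<phi> (Suc (Suc 0)) (inner w x) = of_nat (n * (n - 1)) * ridge (n - 2) w (x :: 'a)"
    using chain_power'[of n] by metis
  show ?thesis unfolding ridge_chain_eq[of \<phi>, OF \<phi>(2)]
    by (simp only: bessel_chain[OF \<phi>(1)] \<phi>(3,4)) (simp add: mult_ac)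
qed

lemma op_H_ridge:
  fixes w :: "'a::euclidean_jordan_algebra"
  shows "op_H v (ridge n w) x = of_nat (2 * n) * complex_of_real (inner (v \<star> w) x) * ridge (n - 1) w x
    + complex_of_real (jlambda TYPE('a) * inner junit v) * ridge n w x"
proof -
  obtain \<phi> where \<phi>: "chain \<phi>" "\<And>x w. \<phi> 0 (inner w x) = ridge n w (x :: 'a)"
    "\<And>x w. \<phi> (Suc 0) (inner w x) = of_nat n * ridge (n - 1) w (x :: 'a)"
    using chain_power'[of n] by metis
  show ?thesis unfolding ridge_chain_eq[of \<phi>, OF \<phi>(2)]
    unfolding op_H_chain[OF \<phi>(1)] \<phi>(3) by (simp add: mult_ac)
qed

lemma op_E_ridge:
  fixes w :: "'a::euclidean_space"
  shows "op_E (ridge n w) x = of_nat n * ridge n w x"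
proof -
  obtain \<phi> where \<phi>: "chain \<phi>" "\<And>x w. \<phi> 0 (inner w x) = ridge n w (x :: 'a)"
    "\<And>x w. \<phi> (Suc 0) (inner w x) = of_nat n * ridge (n - 1) w (x :: 'a)"
    using chain_power'[of n] by metis
  have "op_E (ridge n w) x = complex_of_real (inner w x) * (of_nat n * ridge (n - 1) w x)"
    unfolding op_E_def ridge_chain_eq[of \<phi>, OF \<phi>(2)] chain_dir_deriv[OF \<phi>(1)] \<phi>(3) ..
  also have "\<dots> = of_nat n * ridge n w x" by (cases n) (simp_all add: ridge_def)
  finally show ?thesis .
qed

lemma op_E_lin:
  assumes "nice F" "nice G"
  shows "op_E (\<lambda>x. a * F x + b * G x) = (\<lambda>x. a * op_E F x + b * op_E G x)"
  by (simp add: fun_eq_iff op_E_def dir_deriv_lin[OF assms])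

lemma rpoly_mult_ridge_le:
  "(\<lambda>x. of_nat k * complex_of_real (inner v x) * ridge (k - 1) w x) \<in> rpoly n" if "k \<le> n"
proof (cases k)
  case 0
  then show ?thesis by (simp add: rpoly.zero)
next
  case (Suc j)
  have "(\<lambda>x. complex_of_real (inner v x) * (of_nat k * ridge j w x)) \<in> rpoly (Suc j)"
    by (intro rpoly_mult_linear rpoly_ridge) simp
  then show ?thesis using rpoly_mono[of _ "Suc j" n] that Suc by (simp add: mult_ac)
qed

section \<open>Commutation relations on polynomials\<close>

definition poly_op :: "(('a::euclidean_space \<Rightarrow> complex) \<Rightarrow> 'a \<Rightarrow> complex) \<Rightarrow> nat \<Rightarrow> bool" where
  "poly_op T d \<longleftrightarrow> (\<forall>n. \<forall>F\<in>rpoly n. T F \<in> rpoly (n + d)) \<and>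
     (\<forall>n. \<forall>F\<in>rpoly n. \<forall>G\<in>rpoly n. \<forall>a b. T (\<lambda>x. a * F x + b * G x) = (\<lambda>x. a * T F x + b * T G x))"

lemma poly_opI:
  fixes T :: "('a::euclidean_space \<Rightarrow> complex) \<Rightarrow> 'a \<Rightarrow> complex"
  assumes lin: "\<And>F G a b. nice F \<Longrightarrow> nice G \<Longrightarrow> T (\<lambda>x. a * F x + b * G x) = (\<lambda>x. a * T F x + b * T G x)"
    and ridge: "\<And>k w. T (ridge k w) \<in> rpoly (k + d)"
  shows "poly_op T d"
  unfolding poly_op_def
proof (intro conjI allI ballI)
  fix n and F :: "'a \<Rightarrow> complex" assume "F \<in> rpoly n"
  then show "T F \<in> rpoly (n + d)"
  proof (induction rule: rpoly.induct)
    case zero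
    have "nice (ridge 0 0)" using rpoly_ridge[of 0 0 1 0] nice_rpoly by force
    from lin[OF this this, of 0 0] show ?case by (simp add: rpoly.zero)
  next
    case (step F k a w)
    have "nice (ridge k w)" using rpoly_ridge[of k k 1 w] nice_rpoly by force
    from lin[OF this nice_rpoly[OF step.hyps(1)], of a 1]
    have "T (\<lambda>x. a * ridge k w x + F x) = (\<lambda>x. a * T (ridge k w) x + T F x)" by simp
    moreover have "(\<lambda>x. a * T (ridge k w) x + T F x) \<in> rpoly (n + d)"
      using step by (intro rpoly_add rpoly_scale rpoly_mono[OF ridge]) auto
    ultimately show ?case by simp
  qed
qed (use lin nice_rpoly in blast)

lemma poly_op_bessel: "poly_op (bessel_component v) 0"
proof (rule poly_opI[OF bessel_lin])
  fix k w
  have "(\<lambda>x. of_nat (k - 1 + 1 - 1) * 0 + 0 :: complex) = (\<lambda>x. 0)" by simp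
  have 1: "(\<lambda>x. of_nat k * (of_nat (k - 1) * complex_of_real (inner (blinfun_apply (jP w) v) x) * ridge (k - 1 - 1) w x)) \<in> rpoly k"
    by (intro rpoly_scale rpoly_mult_ridge_le) simp
  have 2: "(\<lambda>x. (of_nat k * complex_of_real (jlambda TYPE('a) * inner w v)) * ridge (k - 1) w x) \<in> rpoly k"
    by (intro rpoly_ridge) simp
  have "bessel_component v (ridge k w) = (\<lambda>x. of_nat k * (of_nat (k - 1) * complex_of_real (inner (blinfun_apply (jP w) v) x) * ridge (k - 1 - 1) w x)
      + (of_nat k * complex_of_real (jlambda TYPE('a) * inner w v)) * ridge (k - 1) w x)"
    by (simp add: fun_eq_iff bessel_ridge numeral_2_eq_2 mult_ac)
  then show "bessel_component v (ridge k w) \<in> rpoly (k + 0)" using rpoly_add[OF 1 2] by simp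
qed

lemma poly_op_H: "poly_op (op_H v) 0"
proof (rule poly_opI[OF op_H_lin])
  fix k w
  have 1: "(\<lambda>x. 2 * (of_nat k * complex_of_real (inner (v \<star> w) x) * ridge (k - 1) w x)) \<in> rpoly k"
    by (intro rpoly_scale rpoly_mult_ridge_le) simp
  have 2: "(\<lambda>x. complex_of_real (jlambda TYPE('a) * inner junit v) * ridge k w x) \<in> rpoly k"
    by (intro rpoly_ridge) simp
  have "op_H v (ridge k w) = (\<lambda>x. 2 * (of_nat k * complex_of_real (inner (v \<star> w) x) * ridge (k - 1) w x)
      + complex_of_real (jlambda TYPE('a) * inner junit v) * ridge k w x)"
    by (simp add: fun_eq_iff op_H_ridge mult_ac)
  then show "op_H v (ridge k w) \<in> rpoly (k + 0)" using rpoly_add[OF 1 2] by simp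
qed

lemma poly_op_E: "poly_op op_E 0"
proof (rule poly_opI[OF op_E_lin])
  fix k :: nat and w :: 'a
  have "op_E (ridge k w) = (\<lambda>x. of_nat k * ridge k w x)" by (simp add: fun_eq_iff op_E_ridge)
  then show "op_E (ridge k w) \<in> rpoly (k + 0)" using rpoly_ridge[of k k "of_nat k" w] by simp
qed

lemma poly_op_M: "poly_op (op_M v) 1"
proof (rule poly_opI)
  show "op_M v (\<lambda>x. a * F x + b * G x) = (\<lambda>x. a * op_M v F x + b * op_M v G x)" for F G :: "'a \<Rightarrow> complex" and a b
    by (simp add: op_M_def fun_eq_iff algebra_simps)
  fix k w
  have "(\<lambda>x. complex_of_real (inner v x) * (1 * ridge k w x)) \<in> rpoly (Suc k)"
    by (intro rpoly_mult_linear rpoly_ridge) simp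
  then show "op_M v (ridge k w) \<in> rpoly (k + 1)" by (simp add: op_M_def[abs_def])
qed

lemma poly_op_in: "poly_op T d \<Longrightarrow> F \<in> rpoly n \<Longrightarrow> T F \<in> rpoly (n + d)"
  by (simp add: poly_op_def)

lemma poly_op_lin: "poly_op T d \<Longrightarrow> F \<in> rpoly n \<Longrightarrow> G \<in> rpoly n \<Longrightarrow> T (\<lambda>x. a * F x + b * G x) = (\<lambda>x. a * T F x + b * T G x)"
  by (simp add: poly_op_def)

lemma poly_op_compose:
  fixes S T :: "('a::euclidean_space \<Rightarrow> complex) \<Rightarrow> 'a \<Rightarrow> complex"
  assumes S: "poly_op S d" and T: "poly_op T e"
  shows "poly_op (\<lambda>F. S (T F)) (e + d)"
  unfolding poly_op_def
proof (intro conjI allI ballI)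
  fix n and F :: "'a \<Rightarrow> complex" assume F: "F \<in> rpoly n"
  show "S (T F) \<in> rpoly (n + (e + d))" using poly_op_in[OF S poly_op_in[OF T F]] by (simp add: add.assoc)
  fix G :: "'a \<Rightarrow> complex" and a b assume G: "G \<in> rpoly n"
  show "S (T (\<lambda>x. a * F x + b * G x)) = (\<lambda>x. a * S (T F) x + b * S (T G) x)"
    unfolding poly_op_lin[OF T F G] by (rule poly_op_lin[OF S poly_op_in[OF T F] poly_op_in[OF T G]])
qed

lemma poly_op_comb: assumes "poly_op S d" "poly_op T d" shows "poly_op (\<lambda>F x. p * S F x + q * T F x) d"
  using assms unfolding poly_op_def
  by (auto simp: algebra_simps intro!: rpoly_add rpoly_scale)

text \<open>Linearity reduces operator identities on polynomials to powers of linear forms, where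
  the chain computations apply.\<close>

lemma poly_op_eqI:
  assumes S: "poly_op S d" and T: "poly_op T e" and eq: "\<And>k w. S (ridge k w) = T (ridge k w)" and F: "F \<in> rpoly n"
  shows "S F = T F"
  using F
proof (induction rule: rpoly.induct)
  case zero
  show ?case using poly_op_lin[OF S rpoly.zero rpoly.zero, of 0 0] poly_op_lin[OF T rpoly.zero rpoly.zero, of 0 0] by simp
next
  case (step F k a w)
  have r: "ridge k w \<in> rpoly n" using rpoly_ridge[OF step.hyps(2), of 1 w] by (simp add: ridge_def[abs_def])
  show ?case
    using poly_op_lin[OF S r step.hyps(1), of a 1] poly_op_lin[OF T r step.hyps(1), of a 1] eq step.IH by simp
qed

lemma bessel_M:
  assumes "F \<in> rpoly n"
  shows "bessel_component junit (op_M v F) = (\<lambda>x. op_M v (bessel_component junit F) x + op_H v F x)"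
  by (simp add: bessel_mult_linear_junit[OF nice_rpoly[OF assms]] op_M_def)

lemma bessel_H:
  fixes v :: "'a::euclidean_jordan_algebra"
  assumes "F \<in> rpoly n"
  shows "bessel_component junit (op_H v F) = (\<lambda>x. op_H v (bessel_component junit F) x + 2 * bessel_component v F x)"
proof -
  have "bessel_component junit (op_H v F) = (\<lambda>x. 1 * op_H v (bessel_component junit F) x + 2 * bessel_component v F x)"
  proof (rule poly_op_eqI[OF _ _ _ assms])
    show "poly_op (\<lambda>F. bessel_component junit (op_H v F)) (0 + 0)"
      by (intro poly_op_compose poly_op_bessel poly_op_H)
    have "poly_op (\<lambda>F. op_H v (bessel_component junit F)) (0 + 0)"
      by (intro poly_op_compose poly_op_bessel poly_op_H)
    then show "poly_op (\<lambda>F x. 1 * op_H v (bessel_component junit F) x + 2 * bessel_component v F x) 0"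
      by (intro poly_op_comb) (simp_all add: poly_op_bessel)
    fix k and w :: 'a
    obtain \<phi> where \<phi>: "chain \<phi>" "\<And>x w. \<phi> 0 (inner w x) = ridge k w (x :: 'a)"
      using chain_power'[of k] by metis
    show "bessel_component junit (op_H v (ridge k w)) = (\<lambda>x. 1 * op_H v (bessel_component junit (ridge k w)) x + 2 * bessel_component v (ridge k w) x)"
      using bessel_H_chain[OF \<phi>(1), of v w] by (simp add: fun_eq_iff \<phi>(2))
  qed
  then show ?thesis by simp
qed

lemma bessel_commute:
  fixes v :: "'a::euclidean_jordan_algebra"
  assumes "F \<in> rpoly n"
  shows "bessel_component junit (bessel_component v F) = bessel_component v (bessel_component junit F)"
proof (rule poly_op_eqI[OF _ _ _ assms])
  show "poly_op (\<lambda>F. bessel_component junit (bessel_component v F)) (0 + 0)"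
    "poly_op (\<lambda>F. bessel_component v (bessel_component junit F)) (0 + 0)"
    by (intro poly_op_compose poly_op_bessel)+
  fix k and w :: 'a
  obtain \<phi> where \<phi>: "chain \<phi>" "\<And>x w. \<phi> 0 (inner w x) = ridge k w (x :: 'a)"
    using chain_power'[of k] by metis
  show "bessel_component junit (bessel_component v (ridge k w)) = bessel_component v (bessel_component junit (ridge k w))"
    using bessel_commute_chain[OF \<phi>(1), of v w] by (simp add: fun_eq_iff \<phi>(2))
qed

abbreviation op_D :: "('a::euclidean_jordan_algebra \<Rightarrow> complex) \<Rightarrow> 'a \<Rightarrow> complex" where
  "op_D \<equiv> bessel_component junit"

lemma op_E_mult_linear: "nice F \<Longrightarrow> op_E (op_M v F) = (\<lambda>x. op_M v (op_E F) x + op_M v F x)"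
proof -
  assume F: "nice F"
  have M: "op_M v F = (\<lambda>x. complex_of_real (inner v x) * F x)" by (simp add: op_M_def fun_eq_iff)
  show ?thesis unfolding op_E_def[abs_def] M dir_deriv_mult_linear[OF F] by (simp add: op_M_def fun_eq_iff)
qed

lemma nice_ridge: "nice (ridge k w)"
  using nice_rpoly[OF rpoly_ridge[of k k 1 w]] by (simp add: ridge_def[abs_def])

lemma rpoly_ridge1: "k \<le> n \<Longrightarrow> ridge k w \<in> rpoly n"
  using rpoly_ridge[of k n 1 w] by (simp add: ridge_def[abs_def])

lemma op_E_H:
  fixes v :: "'a::euclidean_jordan_algebra"
  assumes "F \<in> rpoly n"
  shows "op_E (op_H v F) = op_H v (op_E F)"
proof (rule poly_op_eqI[OF _ _ _ assms])
  show "poly_op (\<lambda>F. op_E (op_H v F)) (0 + 0)" "poly_op (\<lambda>F. op_H v (op_E F)) (0 + 0)"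
    by (intro poly_op_compose poly_op_H poly_op_E)+
  fix k and w :: 'a
  have eE: "op_E (ridge k w) = (\<lambda>x. of_nat k * ridge k w x + 0 * ridge k w x)" for k
    by (simp add: fun_eq_iff op_E_ridge)
  have eH: "op_H v (ridge k w) = (\<lambda>x. of_nat (2 * k) * op_M (v \<star> w) (ridge (k - 1) w) x + complex_of_real (jlambda TYPE('a) * inner junit v) * ridge k w x)"
    by (simp add: fun_eq_iff op_H_ridge op_M_def mult_ac)
  show "op_E (op_H v (ridge k w)) = op_H v (op_E (ridge k w))"
    unfolding eE op_H_lin[OF nice_ridge nice_ridge] eH op_E_lin[OF nice_op_M[OF nice_ridge] nice_ridge]
      op_E_mult_linear[OF nice_ridge]
    by (cases k) (simp_all add: fun_eq_iff op_E_ridge op_M_def algebra_simps)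
qed

lemma op_E_bessel:
  fixes v :: "'a::euclidean_jordan_algebra"
  assumes "F \<in> rpoly n"
  shows "op_E (bessel_component v F) = (\<lambda>x. bessel_component v (op_E F) x - bessel_component v F x)"
proof -
  have "op_E (bessel_component v F) = (\<lambda>x. 1 * bessel_component v (op_E F) x + (-1) * bessel_component v F x)"
  proof (rule poly_op_eqI[OF _ _ _ assms])
    show "poly_op (\<lambda>F. op_E (bessel_component v F)) (0 + 0)"
      by (intro poly_op_compose poly_op_bessel poly_op_E)
    have "poly_op (\<lambda>F. bessel_component v (op_E F)) (0 + 0)"
      by (intro poly_op_compose poly_op_bessel poly_op_E)
    then show "poly_op (\<lambda>F x. 1 * bessel_component v (op_E F) x + (-1) * bessel_component v F x) 0"
      by (intro poly_op_comb) (simp_all add: poly_op_bessel)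
    fix k and w :: 'a
    have eE: "op_E (ridge k w) = (\<lambda>x. of_nat k * ridge k w x + 0 * ridge k w x)" for k
      by (simp add: fun_eq_iff op_E_ridge)
    have eB: "bessel_component v (ridge k w) = (\<lambda>x. of_nat (k * (k - 1)) * op_M (blinfun_apply (jP w) v) (ridge (k - 2) w) x
        + (of_nat k * complex_of_real (jlambda TYPE('a) * inner w v)) * ridge (k - 1) w x)"
      by (simp add: fun_eq_iff bessel_ridge op_M_def mult_ac)
    consider "k = 0" | "k = 1" | j where "k = Suc (Suc j)" by (metis One_nat_def not0_implies_Suc)
    then show "op_E (bessel_component v (ridge k w)) = (\<lambda>x. 1 * bessel_component v (op_E (ridge k w)) x + (-1) * bessel_component v (ridge k w) x)"
      unfolding eE bessel_lin[OF nice_ridge nice_ridge] eB op_E_lin[OF nice_op_M[OF nice_ridge] nice_ridge]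
        op_E_mult_linear[OF nice_ridge]
      by cases (simp_all add: fun_eq_iff op_E_ridge op_M_def algebra_simps)
  qed
  then show ?thesis by simp
qed

section \<open>Eigenvectors of the infinitesimal rotation\<close>

definition op_A :: "('a::euclidean_jordan_algebra \<Rightarrow> complex) \<Rightarrow> 'a \<Rightarrow> complex" where
  "op_A F x = 2 * op_E F x - op_D F x"

text \<open>Formally \<open>W\<^sub>v = exp (- D) M\<^sub>v exp D\<close>; the series of iterated commutators stops after
  \<open>[D, [D, M\<^sub>v]]\<close>. The operator \<open>Z\<^sub>v\<close> is the common part of \<open>W\<^sub>v\<close> and \<open>M\<^sub>v\<close> that raises
  the eigenvalues of \<open>A\<close> by \<open>2\<close>; the other parts keep them or lower them by \<open>2\<close>.\<close>

definition op_W :: "'a::euclidean_jordan_algebra \<Rightarrow> ('a \<Rightarrow> complex) \<Rightarrow> 'a \<Rightarrow> complex" where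
  "op_W v F x = op_M v F x - op_H v F x + bessel_component v F x"

definition op_Z :: "'a::euclidean_jordan_algebra \<Rightarrow> ('a \<Rightarrow> complex) \<Rightarrow> 'a \<Rightarrow> complex" where
  "op_Z v F x = op_M v F x - op_H v F x / 2 + bessel_component v F x / 4"

lemma poly_op_A: "poly_op (op_A :: ('a::euclidean_jordan_algebra \<Rightarrow> complex) \<Rightarrow> _) 0"
  using poly_op_comb[OF poly_op_E poly_op_bessel[of "junit :: 'a"], of 2 "-1"] by (simp add: op_A_def[abs_def])

lemma in_rpoly:
  assumes "F \<in> rpoly n"
  shows "op_M v F \<in> rpoly (Suc n)" "op_H v F \<in> rpoly n" "bessel_component v F \<in> rpoly n" "op_E F \<in> rpoly n" "op_A F \<in> rpoly n"
  using poly_op_in[OF poly_op_M assms, of v] poly_op_in[OF poly_op_H assms, of v] poly_op_in[OF poly_op_bessel assms, of v]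
    poly_op_in[OF poly_op_E assms] poly_op_in[OF poly_op_A assms] by simp_all

lemma in_rpoly_Suc:
  assumes "F \<in> rpoly n"
  shows "F \<in> rpoly (Suc n)" "op_H v F \<in> rpoly (Suc n)" "bessel_component v F \<in> rpoly (Suc n)" "op_E F \<in> rpoly (Suc n)"
  using assms in_rpoly[OF assms] by (auto intro: rpoly_mono[of _ n "Suc n"])

lemma rpoly_mult_le: "F \<in> rpoly a \<Longrightarrow> G \<in> rpoly b \<Longrightarrow> a + b \<le> n \<Longrightarrow> (\<lambda>x. F x * G x) \<in> rpoly n"
  using rpoly_mono[OF rpoly_mult] by blast

lemma op_W_in: "F \<in> rpoly n \<Longrightarrow> op_W v F \<in> rpoly (Suc n)"
  unfolding op_W_def[abs_def] by (intro rpoly_add rpoly_diff in_rpoly(1) in_rpoly_Suc)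

lemma op_Z_in: "F \<in> rpoly n \<Longrightarrow> op_Z v F \<in> rpoly (Suc n)"
proof -
  assume F: "F \<in> rpoly n"
  have "(\<lambda>x. op_M v F x - (1/2) * op_H v F x + (1/4) * bessel_component v F x) \<in> rpoly (Suc n)"
    by (intro rpoly_add rpoly_diff rpoly_scale in_rpoly(1) in_rpoly_Suc F)
  then show ?thesis by (simp add: op_Z_def[abs_def])
qed

lemma op_A_M: "F \<in> rpoly n \<Longrightarrow> op_A (op_M v F) x = op_M v (op_A F) x + 2 * op_M v F x - op_H v F x"
  by (simp add: op_A_def bessel_M op_E_mult_linear[OF nice_rpoly] op_M_def algebra_simps)

lemma op_lin2:
  assumes "poly_op T d" "F \<in> rpoly n" "G \<in> rpoly n"
  shows "T (\<lambda>x. a * F x + b * G x) x = a * T F x + b * T G x"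
  using poly_op_lin[OF assms] by simp

lemma op_A_H:
  assumes F: "F \<in> rpoly n"
  shows "op_A (op_H v F) x = op_H v (op_A F) x - 2 * bessel_component v F x"
proof -
  have A: "op_A F = (\<lambda>x. 2 * op_E F x + (-1) * op_D F x)" by (simp add: op_A_def fun_eq_iff)
  show ?thesis unfolding A op_lin2[OF poly_op_H in_rpoly(4,3)[OF F]]
    by (simp add: op_A_def bessel_H[OF F] op_E_H[OF F])
qed

lemma op_A_B:
  assumes F: "F \<in> rpoly n"
  shows "op_A (bessel_component v F) x = bessel_component v (op_A F) x - 2 * bessel_component v F x"
proof -
  have A: "op_A F = (\<lambda>x. 2 * op_E F x + (-1) * op_D F x)" by (simp add: op_A_def fun_eq_iff)
  show ?thesis unfolding A op_lin2[OF poly_op_bessel in_rpoly(4,3)[OF F]]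
    by (simp add: op_A_def bessel_commute[OF F] op_E_bessel[OF F] algebra_simps)
qed

text \<open>The operator \<open>A = 2 E - D\<close> is conjugate to the infinitesimal rotation; \<open>F\<close> and \<open>F'\<close> are
  related if \<open>F'\<close> is the image of \<open>F\<close> under the rotation by \<open>\<pi>/2\<close>, up to normalisation.\<close>

inductive T_rel :: "('a::euclidean_jordan_algebra \<Rightarrow> complex) \<Rightarrow> ('a \<Rightarrow> complex) \<Rightarrow> bool" where
  eig: "F \<in> rpoly n \<Longrightarrow> (\<And>x. op_A F x = 2 * of_int k * F x) \<Longrightarrow> T_rel F (\<lambda>x. (if even k then 1 else - 1) * F x)"
| add: "T_rel F F' \<Longrightarrow> T_rel G G' \<Longrightarrow> T_rel (\<lambda>x. F x + G x) (\<lambda>x. F' x + G' x)"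

lemma T_rel_rpoly: "T_rel F F' \<Longrightarrow> \<exists>n. F \<in> rpoly n \<and> F' \<in> rpoly n"
proof (induction rule: T_rel.induct)
  case (eig F n k)
  then show ?case using rpoly_scale by blast
next
  case (add F F' G G')
  then obtain m n where "F \<in> rpoly m" "F' \<in> rpoly m" "G \<in> rpoly n" "G' \<in> rpoly n" by blast
  then have "F \<in> rpoly (max m n)" "F' \<in> rpoly (max m n)" "G \<in> rpoly (max m n)" "G' \<in> rpoly (max m n)"
    by (auto intro: rpoly_mono)
  then show ?case using rpoly_add by blast
qed

lemma T_rel_W: "T_rel F F' \<Longrightarrow> T_rel (op_W v F) (\<lambda>x. - op_M v F' x)"
proof (induction rule: T_rel.induct)
  case (eig F n k)
  note F = eig.hyps(1)
  have AF: "op_A F = (\<lambda>x. (2 * of_int k) * F x + 0 * F x)" using eig.hyps(2) by (simp add: fun_eq_iff)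
  have L: "op_M v (op_A F) x = 2 * of_int k * op_M v F x" "op_H v (op_A F) x = 2 * of_int k * op_H v F x"
    "bessel_component v (op_A F) x = 2 * of_int k * bessel_component v F x" for x
    unfolding AF op_lin2[OF poly_op_H F F] op_lin2[OF poly_op_bessel F F] by (simp_all add: op_M_def)
  have mem: "op_M v F \<in> rpoly (Suc n)" "op_H v F \<in> rpoly (Suc n)" "bessel_component v F \<in> rpoly (Suc n)"
    by (intro in_rpoly(1) in_rpoly_Suc F)+
  define s :: complex where "s = (if even k then 1 else - 1)"
  \<comment> \<open>The part that raises the eigenvalue by 2, so the sign of the rotated function
    flips.\<close>
  have Z: "T_rel (op_Z v F) (\<lambda>x. (if even (k + 1) then 1 else - 1) * op_Z v F x)"
  proof (rule T_rel.eig[OF op_Z_in[OF F]])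
    fix x
    have eq: "op_Z v F = (\<lambda>x. 1 * op_M v F x + 1 * ((-1/2) * op_H v F x + (1/4) * bessel_component v F x))"
      by (simp add: op_Z_def fun_eq_iff)
    have mem2: "(\<lambda>x. (-1/2) * op_H v F x + (1/4) * bessel_component v F x) \<in> rpoly (Suc n)"
      using mem by (intro rpoly_add rpoly_scale)
    show "op_A (op_Z v F) x = 2 * of_int (k + 1) * op_Z v F x"
      unfolding eq op_lin2[OF poly_op_A mem(1) mem2] op_lin2[OF poly_op_A mem(2,3)]
      unfolding op_A_M[OF F] op_A_H[OF F] op_A_B[OF F] L by (simp add: algebra_simps)
  qed
  \<comment> \<open>The part that preserves the eigenvalue, hence the sign.\<close>
  have Hh: "T_rel (\<lambda>x. (-1/2) * op_H v F x + (1/2) * bessel_component v F x)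
      (\<lambda>x. (if even k then 1 else - 1) * ((-1/2) * op_H v F x + (1/2) * bessel_component v F x))"
  proof (rule T_rel.eig)
    show "(\<lambda>x. (-1/2) * op_H v F x + (1/2) * bessel_component v F x) \<in> rpoly (Suc n)"
      using mem by (intro rpoly_add rpoly_scale)
    show "op_A (\<lambda>x. (-1/2) * op_H v F x + (1/2) * bessel_component v F x) x = 2 * of_int k * ((-1/2) * op_H v F x + (1/2) * bessel_component v F x)" for x
      unfolding op_lin2[OF poly_op_A mem(2,3)] op_A_H[OF F] op_A_B[OF F] L by (simp add: algebra_simps)
  qed
  have Bb: "T_rel (\<lambda>x. (1/4) * bessel_component v F x + 0 * bessel_component v F x)
      (\<lambda>x. (if even (k - 1) then 1 else - 1) * ((1/4) * bessel_component v F x + 0 * bessel_component v F x))"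
  proof (rule T_rel.eig)
    show "(\<lambda>x. (1/4) * bessel_component v F x + 0 * bessel_component v F x) \<in> rpoly (Suc n)"
      using mem by (intro rpoly_add rpoly_scale)
    show "op_A (\<lambda>x. (1/4) * bessel_component v F x + 0 * bessel_component v F x) x
        = 2 * of_int (k - 1) * ((1/4) * bessel_component v F x + 0 * bessel_component v F x)" for x
      unfolding op_lin2[OF poly_op_A mem(3,3)] op_A_B[OF F] L by (simp add: algebra_simps)
  qed
  \<comment> \<open>With signs -, +, - relative to that of \<open>F\<close>, the three parts of W_v
    add up to - M_v.\<close>
  note T_rel.add[OF T_rel.add[OF Z Hh] Bb]
  moreover have "(\<lambda>x. op_Z v F x + ((-1/2) * op_H v F x + (1/2) * bessel_component v F x)
      + ((1/4) * bessel_component v F x + 0 * bessel_component v F x)) = op_W v F"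
    by (simp add: fun_eq_iff op_Z_def op_W_def)
  moreover have "(\<lambda>x. (if even (k + 1) then 1 else - 1) * op_Z v F x
      + (if even k then 1 else - 1) * ((-1/2) * op_H v F x + (1/2) * bessel_component v F x)
      + (if even (k - 1) then 1 else - 1) * ((1/4) * bessel_component v F x + 0 * bessel_component v F x))
    = (\<lambda>x. - op_M v (\<lambda>x. (if even k then 1 else - 1) * F x) x)"
    by (cases "even k") (simp_all add: fun_eq_iff op_Z_def op_M_def)
  ultimately show ?case by simp
next
  case (add F F' G G')
  obtain m n where "F \<in> rpoly m" "G \<in> rpoly n" using T_rel_rpoly add.hyps by metis
  then have mem: "F \<in> rpoly (max m n)" "G \<in> rpoly (max m n)" by (auto intro: rpoly_mono)
  have eq: "(\<lambda>x. F x + G x) = (\<lambda>x. 1 * F x + 1 * G x)" by simp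
  have "op_W v (\<lambda>x. F x + G x) = (\<lambda>x. op_W v F x + op_W v G x)"
    unfolding eq op_W_def[abs_def] poly_op_lin[OF poly_op_H mem] poly_op_lin[OF poly_op_bessel mem]
    by (simp add: op_M_def fun_eq_iff algebra_simps)
  moreover have "(\<lambda>x. - op_M v (\<lambda>x. F' x + G' x) x) = (\<lambda>x. - op_M v F' x + - op_M v G' x)"
    by (simp add: op_M_def fun_eq_iff algebra_simps)
  ultimately show ?case using T_rel.add[OF add.IH] by simp
qed

primrec Gp :: "'a::euclidean_jordan_algebra list \<Rightarrow> 'a \<Rightarrow> complex" where
  "Gp [] = (\<lambda>x. 1)"
| "Gp (v # vs) = op_W v (Gp vs)"

primrec Fp :: "'a::euclidean_space list \<Rightarrow> 'a \<Rightarrow> complex" where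
  "Fp [] = (\<lambda>x. 1)"
| "Fp (v # vs) = op_M v (Fp vs)"

lemma one_ridge: "(\<lambda>x. 1) = ridge 0 0" by (simp add: ridge_def fun_eq_iff)

lemma T_rel_Gp: "T_rel (Gp vs) (\<lambda>x. (- 1) ^ length vs * Fp vs x)"
proof (induction vs)
  case Nil
  have "T_rel (\<lambda>x::'a. 1) (\<lambda>x. (if even (0::int) then 1 else - 1) * 1)"
  proof (rule T_rel.eig[of _ 0])
    show "(\<lambda>x::'a. 1 :: complex) \<in> rpoly 0" by (rule rpoly_const)
    show "op_A (\<lambda>x::'a. 1) x = 2 * of_int 0 * 1" for x
      unfolding one_ridge op_A_def op_E_ridge bessel_ridge by simp
  qed
  then show ?case by simp
next
  case (Cons v vs)
  have "(\<lambda>x. - op_M v (\<lambda>x. (- 1) ^ length vs * Fp vs x) x) = (\<lambda>x. (- 1) ^ length (v # vs) * Fp (v # vs) x)"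
    by (simp add: op_M_def fun_eq_iff)
  then show ?case using T_rel_W[OF Cons, of v] by simp
qed

lemma Gp_in: "Gp vs \<in> rpoly (length vs)"
  by (induction vs) (simp_all add: rpoly_const op_W_in)

text \<open>The terms by which \<open>op_W\<close> differs from \<open>op_M\<close> do not raise the
  degree. For the empty list the difference is 0, so the truncated subtraction in the bound is
  harmless.\<close>

lemma Gp_Fp:
  "(\<lambda>x. Gp vs x - Fp vs x) \<in> rpoly (length vs - 1)"
proof (induction vs)
  case Nil
  then show ?case by (simp add: rpoly.zero)
next
  case (Cons v vs)
  have 1: "op_M v (\<lambda>x. Gp vs x - Fp vs x) \<in> rpoly (length vs)"
  proof (cases "vs = []")
    case True
    then show ?thesis by (simp add: op_M_def[abs_def] rpoly.zero)
  next
    case False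
    then show ?thesis using in_rpoly(1)[OF Cons.IH, of v] by simp
  qed
  have "(\<lambda>x. op_M v (\<lambda>x. Gp vs x - Fp vs x) x - op_H v (Gp vs) x + bessel_component v (Gp vs) x) \<in> rpoly (length vs)"
    by (intro rpoly_add rpoly_diff 1 in_rpoly Gp_in)
  moreover have "(\<lambda>x. op_M v (\<lambda>x. Gp vs x - Fp vs x) x - op_H v (Gp vs) x + bessel_component v (Gp vs) x)
      = (\<lambda>x. Gp (v # vs) x - Fp (v # vs) x)"
    by (simp add: fun_eq_iff op_W_def op_M_def algebra_simps)
  ultimately show ?case by simp
qed

lemma Fp_replicate: "Fp (replicate k w) = ridge k w"
  by (induction k) (simp_all add: fun_eq_iff ridge_def op_M_def)

text \<open>A power of a linear form differs from \<open>Gp\<close> of a constant list by a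
  polynomial of lower degree, so a triangular induction on the degree reaches every
  polynomial.\<close>

lemma rpoly_Gp_induct [consumes 1, case_names lin Gp]:
  assumes F: "F \<in> rpoly n"
    and lin: "\<And>F G a b n. F \<in> rpoly n \<Longrightarrow> G \<in> rpoly n \<Longrightarrow> P F \<Longrightarrow> P G \<Longrightarrow> P (\<lambda>x. a * F x + b * G x)"
    and Gp: "\<And>vs. P (Gp vs)"
  shows "P F"
  using F
proof (induction n arbitrary: F rule: less_induct)
  case (less n)
  have ridge: "P (ridge k w)" if k: "k \<le> n" for k w
  proof (cases k)
    case 0
    then have "ridge k w = Gp []" by (simp add: ridge_def fun_eq_iff)
    then show ?thesis using Gp by metis
  next
    case (Suc j)
    let ?G = "Gp (replicate k w)"
    let ?d = "\<lambda>x. ?G x - ridge k w x"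
    have d: "?d \<in> rpoly j" using Gp_Fp[of "replicate k w"] unfolding Fp_replicate by (simp only: length_replicate Suc diff_Suc_1)
    moreover have "j < n" using Suc k by simp
    ultimately have "P ?d" by (rule_tac less.IH)
    moreover have "?d \<in> rpoly k" using rpoly_mono[OF d, of k] Suc by simp
    moreover have "?G \<in> rpoly k" using Gp_in[of "replicate k w"] by (simp only: length_replicate)
    ultimately have "P (\<lambda>x. 1 * ?G x + (-1) * ?d x)" by (rule_tac lin[where n = k]) (rule Gp | assumption)+
    moreover have "(\<lambda>x. 1 * ?G x + (-1) * ?d x) = ridge k w" by (simp add: fun_eq_iff del: Gp.simps)
    ultimately show ?thesis by (simp only:)
  qed
  show ?case using less.prems
  proof (induction rule: rpoly.induct)
    case zero
    have "P (\<lambda>x. 0 * Gp [] x + 0 * Gp [] x)" by (rule lin[OF Gp_in Gp_in Gp Gp])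
    then show ?case by simp
  next
    case (step F k a w)
    have "P (\<lambda>x. a * ridge k w x + 1 * F x)"
      by (rule lin[OF rpoly_ridge1[OF step.hyps(2)] step.hyps(1) ridge[OF step.hyps(2)] step.IH])
    then show ?case by simp
  qed
qed

text \<open>The functional \<open>\<phi>\<close> stands for the normalised integral of \<open>F exp (- tr)\<close> over the orbit. Its symmetry
  makes \<open>W\<^sub>v\<close> the transpose of \<open>B\<^sub>v\<close>, the component \<open>v\<close> of the Bessel operator.\<close>

locale poly_functional =
  fixes \<phi> :: "('a::euclidean_jordan_algebra \<Rightarrow> complex) \<Rightarrow> complex" and c :: real
  assumes lin: "F \<in> rpoly n \<Longrightarrow> G \<in> rpoly n \<Longrightarrow> \<phi> (\<lambda>x. a * F x + b * G x) = a * \<phi> F + b * \<phi> G"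
    and sym: "F \<in> rpoly n \<Longrightarrow> G \<in> rpoly n \<Longrightarrow>
      \<phi> (\<lambda>x. op_D G x * F x) - \<phi> (\<lambda>x. G x * op_D F x) = \<phi> (\<lambda>x. op_E G x * F x) - \<phi> (\<lambda>x. G x * op_E F x)"
    and euler: "F \<in> rpoly n \<Longrightarrow> \<phi> (op_E F) = \<phi> (op_M junit F) - complex_of_real c * \<phi> F"
    and one: "\<phi> (\<lambda>x. 1) = 1"
    and c: "c = jlambda TYPE('a) * inner junit (junit :: 'a)"
    and lam: "jlambda TYPE('a) > 0"
begin

text \<open>With the value of \<open>c\<close> this is the operator D conjugated by exp (- tr),
  compare \<open>bessel_exp\<close>; the locale assumptions make it the transpose of D.\<close>

definition op_Dt :: "('a \<Rightarrow> complex) \<Rightarrow> 'a \<Rightarrow> complex" where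
  "op_Dt F x = op_D F x - 2 * op_E F x - complex_of_real c * F x + op_M junit F x"

lemma add: "F \<in> rpoly n \<Longrightarrow> G \<in> rpoly n \<Longrightarrow> \<phi> (\<lambda>x. F x + G x) = \<phi> F + \<phi> G"
  using lin[of F n G 1 1] by simp

lemma diff: "F \<in> rpoly n \<Longrightarrow> G \<in> rpoly n \<Longrightarrow> \<phi> (\<lambda>x. F x - G x) = \<phi> F - \<phi> G"
  using lin[of F n G 1 "-1"] by simp

lemma scale: "F \<in> rpoly n \<Longrightarrow> \<phi> (\<lambda>x. a * F x) = a * \<phi> F"
  using lin[of F n F a 0] by simp

lemma op_Dt_in: "F \<in> rpoly n \<Longrightarrow> op_Dt F \<in> rpoly (Suc n)"
  unfolding op_Dt_def[abs_def]
  by (intro rpoly_add rpoly_diff rpoly_scale in_rpoly(1) in_rpoly_Suc)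

lemma op_E_mult:
  assumes "F \<in> rpoly n" "G \<in> rpoly m"
  shows "op_E (\<lambda>x. F x * G x) = (\<lambda>x. op_E F x * G x + F x * op_E G x)"
proof
  fix x
  have "((\<lambda>x. F x * G x) has_derivative (\<lambda>h. F x * dir_deriv h G x + dir_deriv h F x * G x)) (at x)"
    using assms[THEN nice_rpoly, THEN nice_has_derivative, of x] by (auto intro!: derivative_eq_intros)
  from dir_deriv_eqI[OF this] show "op_E (\<lambda>x. F x * G x) x = op_E F x * G x + F x * op_E G x"
    by (simp add: op_E_def add.commute)
qed

text \<open>The assumed symmetry leaves the Euler operator on \<open>G\<close>; the Euler identity
  for the product of \<open>G\<close> and \<open>F\<close> moves it to \<open>F\<close>.\<close>

lemma adj_D:
  assumes G: "G \<in> rpoly n" and F: "F \<in> rpoly n"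
  shows "\<phi> (\<lambda>x. op_D G x * F x) = \<phi> (\<lambda>x. G x * op_Dt F x)"
proof -
  let ?m = "n + Suc n"
  have mem: "(\<lambda>x. op_E G x * F x) \<in> rpoly ?m" "(\<lambda>x. G x * op_E F x) \<in> rpoly ?m" "(\<lambda>x. G x * F x) \<in> rpoly ?m"
    "(\<lambda>x. G x * op_D F x) \<in> rpoly ?m" "(\<lambda>x. G x * op_M junit F x) \<in> rpoly ?m"
    by (rule rpoly_mult_le[OF in_rpoly(4)[OF G] F] rpoly_mult_le[OF G in_rpoly(4)[OF F]] rpoly_mult_le[OF G F]
        rpoly_mult_le[OF G in_rpoly(3)[OF F]] rpoly_mult_le[OF G in_rpoly(1)[OF F]]; simp)+
  have "\<phi> (\<lambda>x. op_E G x * F x) + \<phi> (\<lambda>x. G x * op_E F x) = \<phi> (op_E (\<lambda>x. G x * F x))"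
    unfolding op_E_mult[OF G F] by (rule add[OF mem(1,2), symmetric])
  also have "\<dots> = \<phi> (\<lambda>x. G x * op_M junit F x) - complex_of_real c * \<phi> (\<lambda>x. G x * F x)"
    using euler[OF mem(3)] by (simp add: op_M_def[abs_def] mult_ac)
  finally have e: "\<phi> (\<lambda>x. op_E G x * F x) = \<phi> (\<lambda>x. G x * op_M junit F x) - complex_of_real c * \<phi> (\<lambda>x. G x * F x) - \<phi> (\<lambda>x. G x * op_E F x)"
    by (simp add: algebra_simps)
  have eq: "(\<lambda>x. G x * op_Dt F x) = (\<lambda>x. (G x * op_D F x - 2 * (G x * op_E F x)) - (complex_of_real c * (G x * F x) - G x * op_M junit F x))"
    by (simp add: op_Dt_def fun_eq_iff algebra_simps)
  have J: "\<phi> (\<lambda>x. G x * op_Dt F x) = (\<phi> (\<lambda>x. G x * op_D F x) - 2 * \<phi> (\<lambda>x. G x * op_E F x)) - (complex_of_real c * \<phi> (\<lambda>x. G x * F x) - \<phi> (\<lambda>x. G x * op_M junit F x))"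
    unfolding eq
    by (simp only: diff[OF rpoly_diff[OF mem(4) rpoly_scale[OF mem(2)]] rpoly_diff[OF rpoly_scale[OF mem(3)] mem(5)]]
        diff[OF mem(4) rpoly_scale[OF mem(2)]] diff[OF rpoly_scale[OF mem(3)] mem(5)] scale[OF mem(2)] scale[OF mem(3)])
  have "\<phi> (\<lambda>x. op_D G x * F x) = \<phi> (\<lambda>x. op_E G x * F x) - \<phi> (\<lambda>x. G x * op_E F x) + \<phi> (\<lambda>x. G x * op_D F x)"
    using sym[OF F G] by (simp add: diff_eq_eq)
  then show ?thesis unfolding J e by simp
qed

lemma op_Dt_M:
  assumes F: "F \<in> rpoly n"
  shows "op_Dt (op_M v F) x = op_M v (op_Dt F) x + op_H v F x - 2 * op_M v F x"
  by (simp add: op_Dt_def bessel_M[OF F] op_E_mult_linear[OF nice_rpoly[OF F]] op_M_def algebra_simps)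

lemma adj_H:
  assumes G: "G \<in> rpoly n" and F: "F \<in> rpoly n"
  shows "\<phi> (\<lambda>x. op_H v G x * F x) = \<phi> (\<lambda>x. G x * (2 * op_M v F x - op_H v F x))"
proof -
  let ?m = "Suc n + Suc (Suc n)"
  have F1: "F \<in> rpoly (Suc n)" "op_M v F \<in> rpoly (Suc n)" "G \<in> rpoly (Suc n)" "op_M v G \<in> rpoly (Suc n)"
    by (intro in_rpoly(1) in_rpoly_Suc F G)+
  have mem: "(\<lambda>x. op_D (op_M v G) x * F x) \<in> rpoly ?m" "(\<lambda>x. op_D G x * op_M v F x) \<in> rpoly ?m"
    "(\<lambda>x. op_M v G x * op_Dt F x) \<in> rpoly ?m" "(\<lambda>x. G x * op_Dt (op_M v F) x) \<in> rpoly ?m"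
    by (rule rpoly_mult_le[OF in_rpoly(3)[OF F1(4)] F] rpoly_mult_le[OF in_rpoly(3)[OF G] F1(2)]
        rpoly_mult_le[OF F1(4) op_Dt_in[OF F]] rpoly_mult_le[OF G op_Dt_in[OF F1(2)]]; simp)+
  have "(\<lambda>x. op_H v G x * F x) = (\<lambda>x. op_D (op_M v G) x * F x - op_D G x * op_M v F x)"
    by (simp add: bessel_M[OF G] op_M_def fun_eq_iff algebra_simps)
  then have "\<phi> (\<lambda>x. op_H v G x * F x) = \<phi> (\<lambda>x. op_D (op_M v G) x * F x) - \<phi> (\<lambda>x. op_D G x * op_M v F x)"
    using diff[OF mem(1,2)] by simp
  also have "\<dots> = \<phi> (\<lambda>x. op_M v G x * op_Dt F x) - \<phi> (\<lambda>x. G x * op_Dt (op_M v F) x)"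
    by (simp only: adj_D[OF F1(4,1)] adj_D[OF F1(3,2)])
  also have "\<dots> = \<phi> (\<lambda>x. op_M v G x * op_Dt F x - G x * op_Dt (op_M v F) x)"
    by (rule diff[OF mem(3,4), symmetric])
  also have "\<phi> (\<lambda>x. op_M v G x * op_Dt F x - G x * op_Dt (op_M v F) x) = \<phi> (\<lambda>x. G x * (2 * op_M v F x - op_H v F x))"
    by (rule arg_cong[of _ _ \<phi>]) (simp add: op_Dt_M[OF F] op_M_def fun_eq_iff algebra_simps)
  finally show ?thesis .
qed

lemma op_Dt_H:
  assumes F: "F \<in> rpoly n"
  shows "op_Dt (op_H v F) x = op_H v (op_Dt F) x + 2 * bessel_component v F x - 2 * op_M v F x"
proof -
  have F1: "F \<in> rpoly (Suc n)" using F by (auto intro: rpoly_mono)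
  have mem: "op_D F \<in> rpoly (Suc n)" "op_E F \<in> rpoly (Suc n)" "op_M junit F \<in> rpoly (Suc n)"
    "(\<lambda>x. 1 * op_D F x + (-2) * op_E F x) \<in> rpoly (Suc n)"
    "(\<lambda>x. (- complex_of_real c) * F x + 1 * op_M junit F x) \<in> rpoly (Suc n)"
    by (intro rpoly_add rpoly_scale in_rpoly(1) in_rpoly_Suc F)+
  have eq: "op_Dt F = (\<lambda>x. 1 * (1 * op_D F x + (-2) * op_E F x) + 1 * ((- complex_of_real c) * F x + 1 * op_M junit F x))"
    by (simp add: op_Dt_def fun_eq_iff)
  have "op_H v (op_Dt F) x = op_H v (op_D F) x - 2 * op_H v (op_E F) x - complex_of_real c * op_H v F x + op_H v (op_M junit F) x"
    unfolding eq op_lin2[OF poly_op_H mem(4,5)] op_lin2[OF poly_op_H mem(1,2)] op_lin2[OF poly_op_H F1 mem(3)] by simp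
  moreover have "op_H v (op_M junit F) x = op_M junit (op_H v F) x + 2 * op_M v F x"
    by (simp add: op_H_mult_linear[OF nice_rpoly[OF F]] op_M_def)
  ultimately show ?thesis
    by (simp add: op_Dt_def bessel_H[OF F] op_E_H[OF F])
qed

text \<open>As 2 B_v = [D, H_v], the transpose of B_v is half the commutator of the transposes of
  H_v and D, and this evaluates to W_v.\<close>

lemma adj_B:
  assumes G: "G \<in> rpoly n" and F: "F \<in> rpoly n"
  shows "\<phi> (\<lambda>x. bessel_component v G x * F x) = \<phi> (\<lambda>x. G x * op_W v F x)"
proof -
  \<comment> \<open>The transpose of H_v found in \<open>adj_H\<close>.\<close>
  let ?N = "\<lambda>F x. 2 * op_M v F x - op_H v F x"
  let ?m = "Suc (Suc n) + Suc (Suc n)"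
  have F1: "F \<in> rpoly (Suc n)" "op_Dt F \<in> rpoly (Suc n)" "G \<in> rpoly (Suc n)" "op_H v G \<in> rpoly (Suc n)" "op_D G \<in> rpoly (Suc n)"
    by (intro in_rpoly_Suc op_Dt_in F G)+
  have N: "?N F \<in> rpoly (Suc n)" if "F \<in> rpoly n" for F n
    using that by (intro rpoly_diff rpoly_scale in_rpoly(1) in_rpoly_Suc)
  have mem: "(\<lambda>x. op_D (op_H v G) x * F x) \<in> rpoly ?m" "(\<lambda>x. op_H v (op_D G) x * F x) \<in> rpoly ?m"
    "(\<lambda>x. G x * ?N (op_Dt F) x) \<in> rpoly ?m" "(\<lambda>x. G x * op_Dt (?N F) x) \<in> rpoly ?m"
    "(\<lambda>x. bessel_component v G x * F x) \<in> rpoly ?m" "(\<lambda>x. G x * op_W v F x) \<in> rpoly ?m"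
    by (rule rpoly_mult_le[OF in_rpoly(3)[OF F1(4)] F] rpoly_mult_le[OF in_rpoly(2)[OF F1(5)] F]
        rpoly_mult_le[OF G N[OF F1(2)]] rpoly_mult_le[OF G op_Dt_in[OF N[OF F]]]
        rpoly_mult_le[OF in_rpoly(3)[OF G] F] rpoly_mult_le[OF G op_W_in[OF F]]; simp)+
  have "(\<lambda>x. 2 * (bessel_component v G x * F x)) = (\<lambda>x. op_D (op_H v G) x * F x - op_H v (op_D G) x * F x)"
    by (simp add: bessel_H[OF G] fun_eq_iff algebra_simps)
  then have "2 * \<phi> (\<lambda>x. bessel_component v G x * F x) = \<phi> (\<lambda>x. op_D (op_H v G) x * F x) - \<phi> (\<lambda>x. op_H v (op_D G) x * F x)"
    using diff[OF mem(1,2)] scale[OF mem(5), of 2] by simp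
  also have "\<phi> (\<lambda>x. op_D (op_H v G) x * F x) = \<phi> (\<lambda>x. G x * ?N (op_Dt F) x)"
    using adj_D[OF F1(4,1)] adj_H[OF F1(3,2), of v] by simp
  also have "\<phi> (\<lambda>x. op_H v (op_D G) x * F x) = \<phi> (\<lambda>x. G x * op_Dt (?N F) x)"
    using adj_H[OF F1(5,1), of v] adj_D[OF F1(3) N[OF F]] by simp
  also have "\<phi> (\<lambda>x. G x * ?N (op_Dt F) x) - \<phi> (\<lambda>x. G x * op_Dt (?N F) x) = \<phi> (\<lambda>x. G x * ?N (op_Dt F) x - G x * op_Dt (?N F) x)"
    by (rule diff[OF mem(3,4), symmetric])
  also have "\<phi> (\<lambda>x. G x * ?N (op_Dt F) x - G x * op_Dt (?N F) x) = \<phi> (\<lambda>x. 2 * (G x * op_W v F x))"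
  proof (rule arg_cong[of _ _ \<phi>], rule ext)
    fix x
    have m: "op_M v F \<in> rpoly (Suc n)" "op_H v F \<in> rpoly (Suc n)" by (intro in_rpoly(1) in_rpoly_Suc F)+
    have Dlin: "op_Dt (?N F) x = 2 * op_Dt (op_M v F) x - op_Dt (op_H v F) x"
    proof -
      have eq: "?N F = (\<lambda>x. 2 * op_M v F x + (-1) * op_H v F x)" by simp
      show ?thesis unfolding eq op_Dt_def op_lin2[OF poly_op_bessel m] op_lin2[OF poly_op_E m] op_lin2[OF poly_op_M m]
        by (simp add: algebra_simps)
    qed
    show "G x * ?N (op_Dt F) x - G x * op_Dt (?N F) x = 2 * (G x * op_W v F x)"
      unfolding Dlin op_Dt_M[OF F] op_Dt_H[OF F] op_W_def by (simp add: algebra_simps)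
  qed
  also have "\<phi> (\<lambda>x. 2 * (G x * op_W v F x)) = 2 * \<phi> (\<lambda>x. G x * op_W v F x)" by (rule scale[OF mem(6)])
  finally show ?thesis by simp
qed

text \<open>Up to the sign (-1)^m, the term of order \<open>m\<close> in the power series of
  \<Gamma>(\<lambda>) times the Bessel kernel, compare \<open>bessel_Jt_sums\<close>.\<close>

definition kern :: "nat \<Rightarrow> 'a \<Rightarrow> 'a \<Rightarrow> complex" where
  "kern m x y = complex_of_real (1 / (fact m * pochhammer (jlambda TYPE('a)) m)) * ridge m x y"

lemma kern_in: "kern m x \<in> rpoly m"
  unfolding kern_def[abs_def] by (rule rpoly_ridge) simp

text \<open>For an element of rank one both terms of the Bessel operator are multiples of the same
  power, with total factor (m + 1) (m + \<lambda>); this is exactly the ratio of consecutive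
  coefficients of the kernel.\<close>

lemma bessel_kern:
  assumes x: "\<And>v. blinfun_apply (jP x) v = inner x v *\<^sub>R x"
  shows "bessel_component v (kern (Suc m) x) = (\<lambda>y. complex_of_real (inner x v) * kern m x y)"
    "bessel_component v (kern 0 x) = (\<lambda>y. 0)"
proof -
  have B: "bessel_component v (kern k x) y = complex_of_real (1 / (fact k * pochhammer (jlambda TYPE('a)) k)) * bessel_component v (ridge k x) y" for k y
    using op_lin2[OF poly_op_bessel rpoly_ridge1[of k k x] rpoly_ridge1[of k k x], of v "complex_of_real (1 / (fact k * pochhammer (jlambda TYPE('a)) k))" 0 y]
    unfolding kern_def[abs_def] by (simp only: mult_zero_left add_0_right order_refl)
  have r: "bessel_component v (ridge (Suc m) x) y = complex_of_real (real (Suc m) * (real m + jlambda TYPE('a)) * inner x v) * ridge m x y" for y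
    by (cases m) (simp_all add: bessel_ridge x ridge_def algebra_simps)
  have p: "pochhammer (jlambda TYPE('a)) m \<noteq> 0" "real m + jlambda TYPE('a) \<noteq> 0"
    using lam pochhammer_pos[OF lam, of m] by auto
  have coef: "1 / (fact (Suc m) * pochhammer (jlambda TYPE('a)) (Suc m)) * (real (Suc m) * (real m + jlambda TYPE('a)) * t)
      = t * (1 / (fact m * pochhammer (jlambda TYPE('a)) m))" for t
    using p by (simp add: pochhammer_Suc add.commute divide_simps)
  show "bessel_component v (kern (Suc m) x) = (\<lambda>y. complex_of_real (inner x v) * kern m x y)"
  proof
    fix y
    show "bessel_component v (kern (Suc m) x) y = complex_of_real (inner x v) * kern m x y"
    proof -
      have "bessel_component v (kern (Suc m) x) y = complex_of_real (1 / (fact (Suc m) * pochhammer (jlambda TYPE('a)) (Suc m))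
          * (real (Suc m) * (real m + jlambda TYPE('a)) * inner x v)) * ridge m x y"
        by (simp only: B r of_real_mult mult.assoc)
      then show ?thesis unfolding coef by (simp only: kern_def of_real_mult mult.assoc)
    qed
  qed
  show "bessel_component v (kern 0 x) = (\<lambda>y. 0)" by (simp add: fun_eq_iff B bessel_ridge)
qed

text \<open>Moving \<open>W\<^sub>v\<close> to the kernel turns it into the multiplication by \<open>- (v|x)\<close>, since
  \<open>B\<^sub>v\<close> lowers the index of the kernel and multiplies it by \<open>(v|x)\<close>.\<close>

lemma kern_sums:
  assumes x: "\<And>v. blinfun_apply (jP x) v = inner x v *\<^sub>R x"
  shows "(\<lambda>m. (- 1) ^ m * \<phi> (\<lambda>y. kern m x y * Gp vs y)) sums ((- 1) ^ length vs * Fp vs x * complex_of_real (exp (- inner junit x)))"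
proof (induction vs)
  case Nil
  \<comment> \<open>Transposing D onto the constant 1 and using the Euler identity gives (m + 1)
    times the value at m + 1 as tr x times the value at m, so the values are those of the
    exponential series.\<close>
  have "\<phi> (kern m x) = complex_of_real (inner junit x ^ m / fact m)" for m
  proof (induction m)
    case 0
    have "kern 0 x = (\<lambda>y. 1)" by (simp add: kern_def ridge_def fun_eq_iff)
    then show ?case using one by simp
  next
    case (Suc m)
    have E: "op_E (kern (Suc m) x) = (\<lambda>y. of_nat (Suc m) * kern (Suc m) x y)"
    proof -
      have "op_E (\<lambda>y. complex_of_real (1 / (fact (Suc m) * pochhammer (jlambda TYPE('a)) (Suc m))) * ridge (Suc m) x y + 0 * ridge (Suc m) x y)
        = (\<lambda>y. of_nat (Suc m) * kern (Suc m) x y)"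
        unfolding op_E_lin[OF nice_ridge nice_ridge] by (simp add: fun_eq_iff op_E_ridge kern_def)
      then show ?thesis by (simp add: kern_def[abs_def])
    qed
    have "op_Dt (\<lambda>x. 1) = (\<lambda>y. op_M junit (\<lambda>x. 1) y - complex_of_real c)"
      unfolding one_ridge by (simp add: op_Dt_def fun_eq_iff bessel_ridge op_E_ridge op_M_def ridge_def)
    moreover have "\<phi> (\<lambda>y. op_D (kern (Suc m) x) y * 1) = \<phi> (\<lambda>y. kern (Suc m) x y * op_Dt (\<lambda>x. 1) y)"
      by (rule adj_D[OF kern_in rpoly_const])
    moreover have "\<phi> (\<lambda>y. kern (Suc m) x y * (op_M junit (\<lambda>x. 1) y - complex_of_real c)) = \<phi> (op_M junit (kern (Suc m) x)) - complex_of_real c * \<phi> (kern (Suc m) x)"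
    proof -
      have m: "op_M junit (kern (Suc m) x) \<in> rpoly (Suc (Suc m))" "kern (Suc m) x \<in> rpoly (Suc (Suc m))"
        by (intro in_rpoly(1) in_rpoly_Suc kern_in)+
      have "(\<lambda>y. kern (Suc m) x y * (op_M junit (\<lambda>x. 1) y - complex_of_real c)) = (\<lambda>y. 1 * op_M junit (kern (Suc m) x) y + (- complex_of_real c) * kern (Suc m) x y)"
        by (simp add: fun_eq_iff op_M_def algebra_simps)
      then show ?thesis using lin[OF m, of 1 "- complex_of_real c"] by simp
    qed
    moreover have "\<phi> (op_E (kern (Suc m) x)) = of_nat (Suc m) * \<phi> (kern (Suc m) x)"
      unfolding E by (rule scale[OF kern_in])
    moreover have "\<phi> (\<lambda>y. complex_of_real (inner x junit) * kern m x y) = complex_of_real (inner x junit) * \<phi> (kern m x)"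
      by (rule scale[OF kern_in])
    ultimately have "of_nat (Suc m) * \<phi> (kern (Suc m) x) = complex_of_real (inner x junit) * \<phi> (kern m x)"
      using euler[OF kern_in, of "Suc m" x] by (simp add: bessel_kern(1)[OF x])
    then have "of_nat (Suc m) * \<phi> (kern (Suc m) x) = of_nat (Suc m) * complex_of_real (inner junit x ^ Suc m / fact (Suc m))"
      unfolding Suc by (simp add: inner_commute[of x junit] divide_simps del: of_nat_Suc)
    then show ?case by (simp only: mult_cancel_left of_nat_eq_0_iff) simp
  qed
  then have "(\<lambda>m. (- 1) ^ m * \<phi> (\<lambda>y. kern m x y * Gp [] y)) = (\<lambda>m. complex_of_real ((- inner junit x) ^ m /\<^sub>R fact m))"
    by (simp add: fun_eq_iff power_minus[of "inner junit x"] divide_inverse mult_ac)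
  moreover have "(\<lambda>m. complex_of_real ((- inner junit x) ^ m /\<^sub>R fact m)) sums complex_of_real (exp (- inner junit x))"
    by (intro sums_of_real exp_converges)
  ultimately show ?case by simp
next
  case (Cons v vs)
  have "\<phi> (\<lambda>y. kern m x y * Gp (v # vs) y) = \<phi> (\<lambda>y. bessel_component v (kern m x) y * Gp vs y)" for m
  proof -
    have "kern m x \<in> rpoly (m + length vs)" "Gp vs \<in> rpoly (m + length vs)"
      by (auto intro: rpoly_mono[OF kern_in] rpoly_mono[OF Gp_in])
    from adj_B[OF this] show ?thesis by simp
  qed
  moreover have "\<phi> (\<lambda>y. bessel_component v (kern (Suc m) x) y * Gp vs y) = complex_of_real (inner x v) * \<phi> (\<lambda>y. kern m x y * Gp vs y)" for m
    using scale[OF rpoly_mult[OF kern_in[of m x] Gp_in[of vs]], where a = "complex_of_real (inner x v)"] by (simp add: bessel_kern(1)[OF x] mult.assoc)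
  moreover have "\<phi> (\<lambda>y. bessel_component v (kern 0 x) y * Gp vs y) = 0"
    using scale[OF rpoly.zero[of 0], where a = 0] by (simp add: bessel_kern(2)[OF x])
  ultimately have eq: "(- 1) ^ Suc m * \<phi> (\<lambda>y. kern (Suc m) x y * Gp (v # vs) y) = - complex_of_real (inner x v) * ((- 1) ^ m * \<phi> (\<lambda>y. kern m x y * Gp vs y))"
    and z: "\<phi> (\<lambda>y. kern 0 x y * Gp (v # vs) y) = 0" for m by (simp_all del: Gp.simps)
  \<comment> \<open>The term of order 0 vanishes, so the series for \<open>v # vs\<close> is the
    shifted series for \<open>vs\<close> with the factor - (x|v).\<close>
  have "(\<lambda>m. (- 1) ^ Suc m * \<phi> (\<lambda>y. kern (Suc m) x y * Gp (v # vs) y)) sums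
      (- complex_of_real (inner x v) * ((- 1) ^ length vs * Fp vs x * complex_of_real (exp (- inner junit x))))"
    unfolding eq by (rule sums_mult[OF Cons])
  then have "(\<lambda>m. (- 1) ^ m * \<phi> (\<lambda>y. kern m x y * Gp (v # vs) y)) sums
      (- complex_of_real (inner x v) * ((- 1) ^ length vs * Fp vs x * complex_of_real (exp (- inner junit x))) + (- 1) ^ 0 * \<phi> (\<lambda>y. kern 0 x y * Gp (v # vs) y))"
    by (subst (asm) sums_Suc_iff) simp
  then show ?case by (simp add: z op_M_def inner_commute[of v x] mult_ac del: Gp.simps)
qed

end

section \<open>Integration over the minimal orbit\<close>

lemma nn_integral_Gamma:
  assumes a: "a > 0" and b: "b > 0"
  shows "(\<integral>\<^sup>+t. ennreal (t powr (a - 1) * exp (- b * t)) * indicator {0<..} t \<partial>lborel) = ennreal (Gamma a / b powr a)"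
proof -
  have "ennreal (Gamma a) = (\<integral>\<^sup>+t. ennreal (indicator {0..} t * t powr (a - 1) / exp t) \<partial>lborel)"
    using Gamma_conv_nn_integral_real[OF a] .
  also have "\<dots> = ennreal b * (\<integral>\<^sup>+t. ennreal (indicator {0..} (0 + b * t) * (0 + b * t) powr (a - 1) / exp (0 + b * t)) \<partial>lborel)"
    using nn_integral_real_affine[where c = b and t = 0 and f = "\<lambda>t. ennreal (indicator {0..} t * t powr (a - 1) / exp t)"] b
    by (simp only: abs_of_pos) simp
  also have "(\<integral>\<^sup>+t. ennreal (indicator {0..} (0 + b * t) * (0 + b * t) powr (a - 1) / exp (0 + b * t)) \<partial>lborel)
     = (\<integral>\<^sup>+t. ennreal (b powr (a - 1)) * (ennreal (t powr (a - 1) * exp (- b * t)) * indicator {0<..} t) \<partial>lborel)"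
    using b by (intro nn_integral_cong)
      (auto simp: indicator_def powr_mult exp_minus zero_le_mult_iff field_simps simp flip: ennreal_mult)
  also have "\<dots> = ennreal (b powr (a - 1)) * (\<integral>\<^sup>+t. ennreal (t powr (a - 1) * exp (- b * t)) * indicator {0<..} t \<partial>lborel)"
    by (intro nn_integral_cmult) auto
  finally have *: "ennreal (Gamma a) = ennreal (b powr a) * (\<integral>\<^sup>+t. ennreal (t powr (a - 1) * exp (- b * t)) * indicator {0<..} t \<partial>lborel)" (is "_ = _ * ?I")
    using b by (simp add: mult.assoc[symmetric] ennreal_mult[symmetric] powr_mult_base)
  have "ennreal (Gamma a / b powr a) = ennreal (1 / b powr a) * ennreal (Gamma a)"
    using a b by (subst ennreal_mult[symmetric]) (auto simp: less_imp_le Gamma_real_pos)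
  also have "\<dots> = ?I"
    unfolding * using b by (simp add: mult.assoc[symmetric] ennreal_mult[symmetric])
  finally show ?thesis by simp
qed

locale orbit_space =
  fixes c :: "'a::euclidean_jordan_algebra" and dk :: "('a \<Rightarrow>\<^sub>L 'a) measure" and \<mu> :: "'a measure" and \<rho> :: real
  assumes simple: "simple_jordan_algebra TYPE('a)"
    and trace_form: "inner_is_trace_form TYPE('a)"
    and primitive: "primitive_idempotent c"
    and haar: "normalized_haar_measure unit_stabilizer dk"
    and orbit_measure: "\<mu> = orbit_measure c dk"
    and rho: "\<rho> = rlambda TYPE('a)"
begin

text \<open>The squared norm of \<open>c\<close> is carried along as a parameter; that it equals 1
  is available only after the representation has been evaluated, see \<open>tau_one\<close>.\<close>

abbreviation \<tau> :: real where "\<tau> \<equiv> inner c c"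

lemma jtr_inner: "jtr (x::'a) = inner junit x"
  using trace_form by (simp add: inner_is_trace_form_def junit_left)

lemma idempotent: "c \<star> c = c" and c_nonzero: "c \<noteq> 0"
  using primitive unfolding primitive_idempotent_def by blast+

lemma tau_pos: "\<tau> > 0" using c_nonzero by simp

lemma inner_junit_c: "inner junit c = \<tau>"
  using inner_jmult[of c junit c] idempotent by (simp add: inner_jmult junit_right)

lemma rho_nonneg: "\<rho> \<ge> 0" by (simp add: rho rlambda_def jlambda_def)

lemma sets_dk: "sets dk = sets (restrict_space borel unit_stabilizer)"
  using haar by (simp add: normalized_haar_measure_def)

lemma space_dk: "space dk = unit_stabilizer"
  using sets_eq_imp_space_eq[OF sets_dk] by (simp add: space_restrict_space)

sublocale dk: finite_measure dk
  using haar by (intro finite_measureI) (simp add: normalized_haar_measure_def)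

lemma sets_\<mu>: "sets \<mu> = sets (restrict_space borel (orbit c))"
  by (simp add: orbit_measure orbit_measure_def)

lemma space_\<mu>: "space \<mu> = orbit c"
  using sets_eq_imp_space_eq[OF sets_\<mu>] by (simp add: space_restrict_space)

lemma measurable_\<mu>: "f \<in> borel_measurable borel \<Longrightarrow> f \<in> borel_measurable \<mu>"
  unfolding measurable_cong_sets[OF sets_\<mu> refl] by (rule measurable_restrict_space1)

lemma measurable_dk:
  "f \<in> borel_measurable borel \<Longrightarrow> (\<lambda>k. f (blinfun_apply k c)) \<in> borel_measurable dk"
  unfolding measurable_cong_sets[OF sets_dk refl]
  by (rule measurable_restrict_space1, rule measurable_compose[of "\<lambda>k. blinfun_apply k c" borel borel f],
      rule borel_measurable_continuous_onI) (intro continuous_intros)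

lemma stabilizer:
  fixes k :: "'a \<Rightarrow>\<^sub>L 'a"
  assumes "k \<in> unit_stabilizer"
  shows stabilizer_junit: "inner junit (k x) = inner junit x"
    and stabilizer_norm: "norm (k x) = norm x"
    and stabilizer_jP: "jP (k x) v = k (jP x (adj k v))"
proof -
  have "k \<in> structure_group"
    using assms connected_component_subset unfolding unit_stabilizer_def structure_group_0_def by blast
  then obtain h where h: "k o\<^sub>L h = id_blinfun" "h o\<^sub>L k = id_blinfun"
    and P: "\<And>x. jP (blinfun_apply k x) = k o\<^sub>L jP x o\<^sub>L adj k"
    unfolding structure_group_def by auto
  have ke: "k junit = junit" using assms by (simp add: unit_stabilizer_def)
  have h': "k (h x) = x" "h (k x) = x" for x
    using arg_cong[OF h(1), of "\<lambda>T. blinfun_apply T x"] arg_cong[OF h(2), of "\<lambda>T. blinfun_apply T x"] by simp_all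
  have jPe: "jP junit x = x" for x :: 'a by (simp add: jP_apply junit_left scaleR_2)
  \<comment> \<open>Since k fixes the unit and P(e) is the identity, the defining relation of the
    structure group at e reads k k^* = 1, so k is orthogonal.\<close>
  have a1: "k (adj k x) = x" for x
  proof -
    have "k (adj k x) = jP (k junit) x" unfolding P by (simp add: jPe)
    then show ?thesis by (simp add: ke jPe)
  qed
  have "adj k x = h x" for x using a1[of x] h'(2)[of "adj k x"] by simp
  then have a2: "adj k (k x) = x" for x by (simp add: h')
  show "inner junit (k x) = inner junit x"
    using inner_adj[of k junit x] a2[of junit] by (simp add: ke)
  show "norm (k x) = norm x"
    using inner_adj[of k "k x" x] by (simp add: a2 norm_eq_sqrt_inner)
  show "jP (k x) v = k (jP x (adj k v))" by (simp add: P)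
qed

text \<open>Closedness makes the exceptional set Borel; the polar integration formula then shows
  that it has measure 0.\<close>

lemma AE_\<mu>I:
  assumes "closed {x. P x}" and P: "\<And>k t. k \<in> unit_stabilizer \<Longrightarrow> t > 0 \<Longrightarrow> P (t *\<^sub>R blinfun_apply k c)"
  shows "AE x in \<mu>. P x"
proof -
  have b: "{x. \<not> P x} \<in> sets borel" using borel_closed[OF assms(1)] by (metis borel_comp Collect_neg_eq)
  have s: "{x \<in> orbit c. \<not> P x} \<in> sets \<mu>"
    using b by (auto simp: sets_\<mu> sets_restrict_space Int_def image_iff intro!: bexI[of _ "{x. \<not> P x}"])
  have "emeasure \<mu> {x \<in> orbit c. \<not> P x} = (\<integral>\<^sup>+x. indicator {x \<in> orbit c. \<not> P x} x \<partial>\<mu>)" using s by simp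
  also have "\<dots> = (\<integral>\<^sup>+x. indicator {x. \<not> P x} x \<partial>\<mu>)"
    by (intro nn_integral_cong) (auto simp: space_\<mu> indicator_def)
  also have "\<dots> = ennreal (2 powr \<rho> / Gamma \<rho>) *
     (\<integral>\<^sup>+k. (\<integral>\<^sup>+t\<in>{0<..}. indicator {x. \<not> P x} (blinfun_apply k (t *\<^sub>R c)) * ennreal (t powr (\<rho> - 1)) \<partial>lborel) \<partial>dk)"
    unfolding orbit_measure using b by (intro nn_integral_orbit_measure[OF haar, folded rho] measurable_restrict_space1) auto
  also have "\<dots> = ennreal (2 powr \<rho> / Gamma \<rho>) * (\<integral>\<^sup>+k. (\<integral>\<^sup>+(t::real). 0 \<partial>lborel) \<partial>dk)"
    using P by (intro arg_cong[of _ _ "\<lambda>z. _ * z"] nn_integral_cong) (auto simp: space_dk blinfun.scaleR_right indicator_def)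
  finally have "emeasure \<mu> {x \<in> orbit c. \<not> P x} = 0" by simp
  then show ?thesis using s by (intro AE_I[where N = "{x \<in> orbit c. \<not> P x}"]) (auto simp: space_\<mu>)
qed

text \<open>The relations hold at \<open>c\<close> by primitivity and persist under stabiliser
  elements and dilations. They are closed conditions, so the previous criterion applies.\<close>

lemma AE_rank_one:
  "AE x in \<mu>. (\<forall>v. \<tau> *\<^sub>R jP x v = inner x v *\<^sub>R x) \<and> \<tau> * (norm x)\<^sup>2 = (inner junit x)\<^sup>2 \<and> inner junit x \<ge> 0"
proof (rule AE_\<mu>I)
  have cont: "continuous_on UNIV (\<lambda>x. jP x v)" for v :: 'a
    unfolding jP_apply by (intro continuous_intros jmult.continuous_on)
  show "closed {x :: 'a. (\<forall>v. \<tau> *\<^sub>R jP x v = inner x v *\<^sub>R x) \<and> \<tau> * (norm x)\<^sup>2 = (inner junit x)\<^sup>2 \<and> inner junit x \<ge> 0}"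
  proof (intro closed_Collect_conj closed_Collect_all)
    show "closed {x. \<tau> *\<^sub>R jP x v = inner x v *\<^sub>R x}" for v :: 'a
    proof (rule closed_Collect_eq)
      show "continuous_on UNIV (\<lambda>x. \<tau> *\<^sub>R jP x v)" by (intro continuous_on_scaleR continuous_on_const cont)
    qed (intro continuous_intros)
  qed (intro closed_Collect_eq closed_Collect_le continuous_intros)+
  fix k :: "'a \<Rightarrow>\<^sub>L 'a" and t :: real assume k: "k \<in> unit_stabilizer" and t: "t > 0"
  have c1: "\<tau> *\<^sub>R jP c w = inner w c *\<^sub>R c" for w
  proof -
    have "jP c w = 2 *\<^sub>R (c \<star> (c \<star> w)) - c \<star> w" by (simp add: jP_apply idempotent)
    then show ?thesis using primitive_jP[OF primitive, of w] tau_pos by simp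
  qed
  have "\<tau> *\<^sub>R jP (t *\<^sub>R k c) v = inner (t *\<^sub>R k c) v *\<^sub>R (t *\<^sub>R k c)" for v
  proof -
    have "\<tau> *\<^sub>R jP (k c) v = k (\<tau> *\<^sub>R jP c (adj k v))" by (simp add: stabilizer_jP[OF k] blinfun.scaleR_right)
    also have "\<dots> = inner (k c) v *\<^sub>R k c"
      unfolding c1 by (simp add: blinfun.scaleR_right inner_adj inner_commute[of v])
    finally have "\<tau> *\<^sub>R jP (k c) v = inner (k c) v *\<^sub>R k c" .
    then have "(t * t) *\<^sub>R (\<tau> *\<^sub>R jP (k c) v) = (t * t) *\<^sub>R (inner (k c) v *\<^sub>R k c)" by simp
    then show ?thesis by (simp add: jP_scaleR blinfun.scaleR_left mult_ac)
  qed
  moreover have "\<tau> * (norm (t *\<^sub>R k c))\<^sup>2 = (inner junit (t *\<^sub>R k c))\<^sup>2"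
    using t by (simp add: stabilizer_norm[OF k] stabilizer_junit[OF k] inner_junit_c power_mult_distrib dot_square_norm)
  moreover have "inner junit (t *\<^sub>R k c) \<ge> 0"
    using t tau_pos by (simp add: stabilizer_junit[OF k] inner_junit_c)
  ultimately show "(\<forall>v. \<tau> *\<^sub>R jP (t *\<^sub>R k c) v = inner (t *\<^sub>R k c) v *\<^sub>R (t *\<^sub>R k c)) \<and>
      \<tau> * (norm (t *\<^sub>R k c))\<^sup>2 = (inner junit (t *\<^sub>R k c))\<^sup>2 \<and> inner junit (t *\<^sub>R k c) \<ge> 0" by blast
qed

text \<open>In polar coordinates the trace depends on the radius only, and homogeneity turns the
  radial part into a Gamma integral; what is left is an average over the stabiliser.\<close>

lemma nn_integral_homogeneous:
  assumes h: "continuous_on UNIV h" "\<And>x. h x \<ge> 0" and hom: "\<And>t x. t > 0 \<Longrightarrow> h (t *\<^sub>R x) = t ^ m * h x"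
    and s: "s > 0" and m: "real m + \<rho> > 0"
  shows "(\<integral>\<^sup>+x. ennreal (h x * exp (- s * inner junit x)) \<partial>\<mu>) =
    ennreal (2 powr \<rho> / Gamma \<rho> * (Gamma (real m + \<rho>) / (s * \<tau>) powr (real m + \<rho>))) * (\<integral>\<^sup>+k. ennreal (h (blinfun_apply k c)) \<partial>dk)"
proof -
  let ?g = "Gamma (real m + \<rho>) / (s * \<tau>) powr (real m + \<rho>)"
  have hm [measurable]: "h \<in> borel_measurable borel" using h by (intro borel_measurable_continuous_onI)
  have radial: "(\<integral>\<^sup>+t\<in>{0<..}. ennreal (h (k (t *\<^sub>R c)) * exp (- s * inner junit (k (t *\<^sub>R c)))) * ennreal (t powr (\<rho> - 1)) \<partial>lborel)
      = ennreal ?g * ennreal (h (blinfun_apply k c))" if k: "k \<in> unit_stabilizer" for k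
  proof -
    have "(\<integral>\<^sup>+t\<in>{0<..}. ennreal (h (k (t *\<^sub>R c)) * exp (- s * inner junit (k (t *\<^sub>R c)))) * ennreal (t powr (\<rho> - 1)) \<partial>lborel)
      = (\<integral>\<^sup>+t. ennreal (h (k c)) * (ennreal (t powr ((real m + \<rho>) - 1) * exp (- (s * \<tau>) * t)) * indicator {0<..} t) \<partial>lborel)"
    proof (intro nn_integral_cong)
      fix t :: real
      have "t powr ((real m + \<rho>) - 1) = t ^ m * t powr (\<rho> - 1)" if "t > 0"
        using that powr_add[of t "real m" "\<rho> - 1"] by (simp add: powr_realpow add_diff_eq)
      then show "ennreal (h (k (t *\<^sub>R c)) * exp (- s * inner junit (k (t *\<^sub>R c)))) * ennreal (t powr (\<rho> - 1)) * indicator {0<..} t =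
         ennreal (h (k c)) * (ennreal (t powr ((real m + \<rho>) - 1) * exp (- (s * \<tau>) * t)) * indicator {0<..} t)"
        using h(2)[of "k c"] by (auto simp: indicator_def blinfun.scaleR_right hom stabilizer_junit[OF k] inner_junit_c mult_ac simp flip: ennreal_mult)
    qed
    also have "\<dots> = ennreal (h (k c)) * ennreal ?g"
      using nn_integral_Gamma[OF m, of "s * \<tau>"] s tau_pos by (subst nn_integral_cmult) (auto simp: mult_ac)
    finally show ?thesis by (simp add: mult.commute)
  qed
  have "(\<integral>\<^sup>+x. ennreal (h x * exp (- s * inner junit x)) \<partial>\<mu>) = ennreal (2 powr \<rho> / Gamma \<rho>) * (\<integral>\<^sup>+k. ennreal ?g * ennreal (h (blinfun_apply k c)) \<partial>dk)"
    unfolding orbit_measure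
  proof (subst nn_integral_orbit_measure[OF haar, folded rho])
    show "(\<lambda>x. ennreal (h x * exp (- s * inner junit x))) \<in> borel_measurable (restrict_space borel (orbit c))"
      by (intro measurable_restrict_space1) measurable
  qed (intro arg_cong[of _ _ "\<lambda>z. _ * z"] nn_integral_cong radial, simp add: space_dk)
  also have "\<dots> = ennreal (2 powr \<rho> / Gamma \<rho>) * (ennreal ?g * (\<integral>\<^sup>+k. ennreal (h (blinfun_apply k c)) \<partial>dk))"
    using measurable_dk[OF hm] by (subst nn_integral_cmult) auto
  also have "\<dots> = ennreal (2 powr \<rho> / Gamma \<rho> * ?g) * (\<integral>\<^sup>+k. ennreal (h (blinfun_apply k c)) \<partial>dk)"
    using m rho_nonneg Gamma_real_pos[OF m] Gamma_real_pos[of \<rho>] tau_pos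
    by (cases "\<rho> = 0") (auto simp: mult.assoc[symmetric] simp flip: ennreal_mult)
  finally show ?thesis .
qed

lemma integrable_dk:
  fixes F :: "'a \<Rightarrow> 'b::{banach, second_countable_topology}"
  assumes "continuous_on UNIV F"
  shows "integrable dk (\<lambda>k. F (blinfun_apply k c))"
proof -
  have "compact (F ` cball 0 (norm c))"
    using assms by (intro compact_continuous_image) (auto intro: continuous_on_subset)
  then obtain B where "\<And>y. y \<in> F ` cball 0 (norm c) \<Longrightarrow> norm y \<le> B"
    using compact_imp_bounded bounded_iff by metis
  then have B: "norm (F (k c)) \<le> B" if "k \<in> unit_stabilizer" for k
    using stabilizer_norm[OF that, of c] by auto
  show ?thesis
    using B assms by (intro dk.integrable_const_bound[of _ B] measurable_dk borel_measurable_continuous_onI AE_I2) (auto simp: space_dk)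
qed

lemma real_integral_homogeneous:
  fixes h :: "'a \<Rightarrow> real"
  assumes h: "continuous_on UNIV h" and hom: "\<And>t x. t > 0 \<Longrightarrow> h (t *\<^sub>R x) = t ^ m * h x"
    and s: "s > 0" and m: "real m + \<rho> > 0"
  shows "has_bochner_integral \<mu> (\<lambda>x. h x * exp (- s * inner junit x))
    (2 powr \<rho> / Gamma \<rho> * (Gamma (real m + \<rho>) / (s * \<tau>) powr (real m + \<rho>)) * (LINT k|dk. h (blinfun_apply k c)))"
proof -
  let ?C = "2 powr \<rho> / Gamma \<rho> * (Gamma (real m + \<rho>) / (s * \<tau>) powr (real m + \<rho>))"
  have C: "?C \<ge> 0" using rho_nonneg Gamma_real_pos[OF m] Gamma_real_pos[of \<rho>] by (cases "\<rho> = 0") auto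
  have pos: "has_bochner_integral \<mu> (\<lambda>x. g x * exp (- s * inner junit x)) (?C * (LINT k|dk. g (blinfun_apply k c)))"
    if g: "continuous_on UNIV g" "\<And>x. g x \<ge> 0" and "\<And>t x. t > 0 \<Longrightarrow> g (t *\<^sub>R x) = t ^ m * g x" for g :: "'a \<Rightarrow> real"
  proof (rule has_bochner_integral_nn_integral)
    have "continuous_on UNIV (\<lambda>x. g x * exp (- s * inner junit x))" by (intro continuous_intros g)
    then show "(\<lambda>x. g x * exp (- s * inner junit x)) \<in> borel_measurable \<mu>"
      by (intro measurable_\<mu> borel_measurable_continuous_onI)
    have "(\<integral>\<^sup>+k. ennreal (g (blinfun_apply k c)) \<partial>dk) = ennreal (LINT k|dk. g (blinfun_apply k c))"
      by (intro nn_integral_eq_integral integrable_dk g AE_I2)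
    then show "(\<integral>\<^sup>+x. ennreal (g x * exp (- s * inner junit x)) \<partial>\<mu>) = ennreal (?C * (LINT k|dk. g (blinfun_apply k c)))"
      unfolding ennreal_mult'[OF C] by (subst nn_integral_homogeneous[OF that(1,2) _ s m]) (auto simp: that(3))
    show "0 \<le> ?C * (LINT k|dk. g (blinfun_apply k c))" using g(2) by (intro mult_nonneg_nonneg[OF C] integral_nonneg) auto
  qed (use g in auto)
  let ?p = "\<lambda>x. max (h x) 0" and ?n = "\<lambda>x. max (- h x) 0"
  have hp: "?p (t *\<^sub>R x) = t ^ m * ?p x" "?n (t *\<^sub>R x) = t ^ m * ?n x" if "t > 0" for t x
    using zero_less_power[OF that, of m] hom[OF that, of x] by (auto simp: max_def zero_le_mult_iff mult_le_0_iff)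
  have cp: "continuous_on UNIV ?p" "continuous_on UNIV ?n" by (intro continuous_intros h)+
  have "has_bochner_integral \<mu> (\<lambda>x. ?p x * exp (- s * inner junit x) - ?n x * exp (- s * inner junit x))
     (?C * (LINT k|dk. ?p (blinfun_apply k c)) - ?C * (LINT k|dk. ?n (blinfun_apply k c)))"
    using cp hp by (intro has_bochner_integral_diff pos) auto
  moreover have "?p x * z - ?n x * z = h x * z" for x z by (simp add: max_def)
  moreover have "(LINT k|dk. ?p (blinfun_apply k c)) - (LINT k|dk. ?n (blinfun_apply k c)) = (LINT k|dk. h (blinfun_apply k c))"
  proof -
    have "?p x - ?n x = h x" for x by (simp add: max_def)
    then show ?thesis
      using Bochner_Integration.integral_diff[OF integrable_dk[OF cp(1)] integrable_dk[OF cp(2)]] by simp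
  qed
  ultimately show ?thesis by (simp only: right_diff_distrib[symmetric])
qed

lemma integral_homogeneous:
  fixes F :: "'a \<Rightarrow> complex"
  assumes F: "continuous_on UNIV F" and hom: "\<And>t x. t > 0 \<Longrightarrow> F (t *\<^sub>R x) = of_real t ^ m * F x"
    and s: "s > 0" and m: "real m + \<rho> > 0"
  shows "has_bochner_integral \<mu> (\<lambda>x. F x * of_real (exp (- s * inner junit x)))
    (of_real (2 powr \<rho> / Gamma \<rho> * (Gamma (real m + \<rho>) / (s * \<tau>) powr (real m + \<rho>))) * (LINT k|dk. F (blinfun_apply k c)))"
proof -
  let ?C = "2 powr \<rho> / Gamma \<rho> * (Gamma (real m + \<rho>) / (s * \<tau>) powr (real m + \<rho>))"
  have cont: "continuous_on UNIV (\<lambda>x. Re (F x))" "continuous_on UNIV (\<lambda>x. Im (F x))" by (intro continuous_intros F)+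
  have homs: "Re (F (t *\<^sub>R x)) = t ^ m * Re (F x)" "Im (F (t *\<^sub>R x)) = t ^ m * Im (F x)" if "t > 0" for t x
    by (simp_all add: hom[OF that] flip: of_real_power)
  have "has_bochner_integral \<mu> (\<lambda>x. of_real (Re (F x) * exp (- s * inner junit x)) + \<i> * of_real (Im (F x) * exp (- s * inner junit x)))
     (complex_of_real (?C * (LINT k|dk. Re (F (blinfun_apply k c)))) + \<i> * of_real (?C * (LINT k|dk. Im (F (blinfun_apply k c)))))"
    by (intro has_bochner_integral_add has_bochner_integral_of_real has_bochner_integral_mult_right
        real_integral_homogeneous cont homs s m)
  also have "(\<lambda>x. of_real (Re (F x) * exp (- s * inner junit x)) + \<i> * of_real (Im (F x) * exp (- s * inner junit x))) =
      (\<lambda>x. F x * of_real (exp (- s * inner junit x)))"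
    by (rule ext) (simp add: complex_eq_iff)
  finally have 1: "has_bochner_integral \<mu> (\<lambda>x. F x * of_real (exp (- s * inner junit x)))
     (complex_of_real (?C * (LINT k|dk. Re (F (blinfun_apply k c)))) + \<i> * of_real (?C * (LINT k|dk. Im (F (blinfun_apply k c)))))" .
  have 2: "(LINT k|dk. F (blinfun_apply k c)) = of_real (LINT k|dk. Re (F (blinfun_apply k c))) + \<i> * of_real (LINT k|dk. Im (F (blinfun_apply k c)))"
    using integrable_dk[OF F] by (simp add: complex_eq_iff)
  show ?thesis using 1 unfolding 2 by (simp only: of_real_mult distrib_left mult.left_commute)
qed

end

section \<open>The representation on polynomials times the exponential\<close>

lemma L2_lim_eventually:
  assumes F: "L2_lim M F f G" and F': "\<And>t. F' t \<in> L2 M" and ev: "\<forall>\<^sub>F t in G. AE x in M. F t x = F' t x"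
  shows "L2_lim M F' f G"
proof (rule L2_lim_dominated[OF _ F'])
  show f: "f \<in> L2 M" and "((\<lambda>t. L2_norm M (\<lambda>x. F t x - f x)) \<longlongrightarrow> 0) G" using F by (simp_all add: L2_lim_def)
  show "\<forall>\<^sub>F t in G. L2_norm M (\<lambda>x. F' t x - f x) \<le> L2_norm M (\<lambda>x. F t x - f x)"
    using ev
  proof eventually_elim
    case (elim t)
    have "F t \<in> L2 M" using F by (simp add: L2_lim_def)
    then have "L2_norm M (\<lambda>x. F' t x - f x) = L2_norm M (\<lambda>x. F t x - f x)"
      using elim f F'[of t] by (intro L2_norm_cong_AE) (auto intro: L2_measurable L2_diff)
    then show ?case by simp
  qed
qed

lemma L2_lim_filterlim: "L2_lim M F f G \<Longrightarrow> filterlim x G K \<Longrightarrow> L2_lim M (\<lambda>t. F (x t)) f K"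
  unfolding L2_lim_def using tendsto_compose_filtermap filterlim_compose[of _ _ G x K] by blast

text \<open>The telescoping V W V - 1 = V W (V - 1) + V (W - 1) + (V - 1), arranged so that each
  summand is a product of unitary operators applied to one difference quotient.\<close>

lemma unitary_product_difference:
  assumes V: "L2_unitary M V" "L2_unitary M W" and f: "f \<in> L2 M" and t: "t \<noteq> 0"
  shows "AE x in M. (V (W (V f)) x - f x) / t =
    V (W (\<lambda>x. (V f x - f x) / t)) x + V (\<lambda>x. (W f x - f x) / t) x + (V f x - f x) / t"
proof -
  define g h where "g x = (V f x - f x) / t" and "h x = (W f x - f x) / t" for x
  have L: "V f \<in> L2 M" "W f \<in> L2 M" using V f unitary_L2 by blast+
  have g: "g \<in> L2 M" and h: "h \<in> L2 M"
    using L2_scale[OF L2_diff[OF L(1) f], of "1 / t"] L2_scale[OF L2_diff[OF L(2) f], of "1 / t"]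
    by (simp_all add: g_def[abs_def] h_def[abs_def])
  have Wg: "W g \<in> L2 M" and VWg: "V (W g) \<in> L2 M" and Vh: "V h \<in> L2 M" using V g h unitary_L2 by blast+
  have Vf: "V f = (\<lambda>x. 1 * f x + t * g x)" using t by (simp add: g_def)
  have "AE x in M. W (V f) x = 1 * W f x + t * W g x" using unitary_lin[OF V(2) f g, of 1 t] Vf by simp
  then have "AE x in M. W (V f) x = 1 * f x + t * (h x + W g x)"
    by eventually_elim (use t in \<open>simp add: h_def distrib_left\<close>)
  then have "AE x in M. V (W (V f)) x = V (\<lambda>x. 1 * f x + t * (h x + W g x)) x"
    by (rule unitary_cong_AE[OF V(1) unitary_L2[OF V(2) L(1)] L2_lin[OF f L2_add[OF h Wg]]])
  moreover have "AE x in M. V (\<lambda>x. 1 * f x + t * (h x + W g x)) x = 1 * V f x + t * V (\<lambda>x. h x + W g x) x"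
    by (rule unitary_lin[OF V(1) f L2_add[OF h Wg]])
  moreover have "AE x in M. V (\<lambda>x. 1 * h x + 1 * W g x) x = 1 * V h x + 1 * V (W g) x"
    by (rule unitary_lin[OF V(1) h Wg])
  ultimately have "AE x in M. (V (W (V f)) x - f x) / t = V (W g) x + V h x + g x"
    by eventually_elim (use t in \<open>simp add: g_def field_simps\<close>)
  then show ?thesis by (simp add: g_def[abs_def] h_def[abs_def])
qed

text \<open>Conjugation by exp (- tr) replaces each derivative along u by itself minus (e|u);
  contracting with P(a, b) produces the Euler operator, the constant and the trace.\<close>

lemma bessel_exp:
  fixes F :: "'a::euclidean_jordan_algebra \<Rightarrow> complex"
  assumes F: "nice F"
  shows "bessel_component junit (\<lambda>x. F x * complex_of_real (exp (- inner junit x))) =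
    (\<lambda>x. (op_D F x - 2 * op_E F x - complex_of_real (jlambda TYPE('a) * inner junit (junit :: 'a)) * F x + op_M junit F x)
        * complex_of_real (exp (- inner junit x)))"
proof
  fix x :: 'a
  define \<psi> where "\<psi> x = complex_of_real (exp (- inner junit x))" for x :: 'a
  define e where "e u = complex_of_real (inner junit u)" for u :: 'a
  have d\<psi>: "(\<psi> has_derivative (\<lambda>u. - e u * \<psi> x)) (at x)" for x
  proof -
    have "((\<lambda>x. exp (- inner junit x)) has_derivative (\<lambda>u. - inner junit u * exp (- inner junit x))) (at x)"
      by (auto intro!: derivative_eq_intros)
    from has_derivative_of_real[OF this] show ?thesis by (simp add: \<psi>_def[abs_def] e_def)
  qed
  have d1: "dir_deriv u (\<lambda>x. G x * \<psi> x) = (\<lambda>x. (G' x - e u * G x) * \<psi> x)"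
    if "\<And>x. \<exists>D. (G has_derivative D) (at x) \<and> D u = G' x" for G G' u
  proof
    fix x
    from that[of x] obtain D where D: "(G has_derivative D) (at x)" "D u = G' x" by blast
    show "dir_deriv u (\<lambda>x. G x * \<psi> x) x = (G' x - e u * G x) * \<psi> x"
      unfolding dir_deriv_eqI[OF has_derivative_mult[OF D(1) d\<psi>]] D(2) by (simp add: algebra_simps)
  qed
  have d1F: "dir_deriv u (\<lambda>x. F x * \<psi> x) = (\<lambda>x. (dir_deriv u F x - e u * F x) * \<psi> x)" for u
    by (rule d1) (use nice_has_derivative[OF F] in blast)
  have d2F: "dir_deriv v (dir_deriv u (\<lambda>x. F x * \<psi> x)) x =
    (dir_deriv v (dir_deriv u F) x - e u * dir_deriv v F x - e v * dir_deriv u F x + e v * e u * F x) * \<psi> x" for u v x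
  proof -
    have "((\<lambda>x. dir_deriv u F x - e u * F x) has_derivative (\<lambda>v. dir_deriv v (dir_deriv u F) x - e u * dir_deriv v F x)) (at x)" for x
      by (intro has_derivative_diff has_derivative_mult_right nice_has_derivative2 nice_has_derivative F)
    then have "dir_deriv v (\<lambda>x. (dir_deriv u F x - e u * F x) * \<psi> x) =
        (\<lambda>x. ((dir_deriv v (dir_deriv u F) x - e u * dir_deriv v F x) - e v * (dir_deriv u F x - e u * F x)) * \<psi> x)"
      by (intro d1) blast
    then show ?thesis unfolding d1F by (simp add: algebra_simps)
  qed
  have lin: "linear (\<lambda>u. dir_deriv u F x)" by (rule linear_dir_deriv[OF F])
  let ?p = "\<lambda>a b. complex_of_real (inner junit (blinfun_apply (jP2 a b) x))"
  \<comment> \<open>P(a, e) acts as multiplication by a, so a derivative of the exponential reduces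
    the second-order coefficient to (x|a).\<close>
  have contract: "(\<Sum>b\<in>Basis. e b * ?p a b) = complex_of_real (inner x a)" for a
  proof -
    have "(\<Sum>b\<in>Basis. complex_of_real (inner junit b) * ?p a b) = ?p a junit"
      by (rule linear_sum_Basis[OF linear_jP2(2)])
    also have "?p a junit = complex_of_real (inner x a)"
      unfolding inner_jP2_bessel_shift by (simp add: bessel_shift_def junit_left junit_right)
    finally show ?thesis by (simp add: e_def)
  qed
  have contract': "(\<Sum>a\<in>Basis. e a * ?p a b) = complex_of_real (inner x b)" for b
    using contract[of b] unfolding jP2_sym[of b] .
  have E: "(\<Sum>a\<in>Basis. dir_deriv a F x * complex_of_real (inner x a)) = op_E F x"
    using linear_sum_Basis[OF lin, of x] by (simp add: op_E_def mult.commute)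
  have ex: "(\<Sum>a\<in>Basis. e a * complex_of_real (inner x a)) = complex_of_real (inner junit x)"
    using linear_sum_Basis[OF linear_inner_complex, of junit x] by (simp add: e_def inner_commute[of x junit])
  have ee: "(\<Sum>a\<in>Basis. e a * e a) = complex_of_real (inner junit (junit :: 'a))"
    using linear_sum_Basis[OF linear_inner_complex, of "junit" "junit :: 'a"] by (simp add: e_def)
  have "(\<Sum>a\<in>Basis. \<Sum>b\<in>Basis. dir_deriv a (dir_deriv b (\<lambda>x. F x * \<psi> x)) x * ?p a b)
      = (\<Sum>a\<in>Basis. \<Sum>b\<in>Basis. (dir_deriv a (dir_deriv b F) x * ?p a b
           - dir_deriv a F x * (e b * ?p a b) - dir_deriv b F x * (e a * ?p a b) + F x * (e a * (e b * ?p a b))) * \<psi> x)"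
    by (intro sum.cong refl) (simp add: d2F algebra_simps)
  also have "\<dots> = ((\<Sum>a\<in>Basis. \<Sum>b\<in>Basis. dir_deriv a (dir_deriv b F) x * ?p a b)
      - (\<Sum>a\<in>Basis. dir_deriv a F x * (\<Sum>b\<in>Basis. e b * ?p a b))
      - (\<Sum>b\<in>Basis. dir_deriv b F x * (\<Sum>a\<in>Basis. e a * ?p a b))
      + F x * (\<Sum>a\<in>Basis. e a * (\<Sum>b\<in>Basis. e b * ?p a b))) * \<psi> x"
    using sum.swap[of "\<lambda>a b. dir_deriv b F x * (e a * ?p a b)" Basis Basis]
    by (simp only: sum_distrib_right[symmetric] sum.distrib sum_subtractf sum_distrib_left)
  also have "\<dots> = ((\<Sum>a\<in>Basis. \<Sum>b\<in>Basis. dir_deriv a (dir_deriv b F) x * ?p a b) - 2 * op_E F x + op_M junit F x) * \<psi> x"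
    unfolding contract contract' E ex by (simp add: op_M_def)
  finally have second: "(\<Sum>a\<in>Basis. \<Sum>b\<in>Basis. dir_deriv a (dir_deriv b (\<lambda>x. F x * \<psi> x)) x * ?p a b) = \<dots>" .
  have "(\<Sum>a\<in>Basis. dir_deriv a (\<lambda>x. F x * \<psi> x) x * e a) = (\<Sum>a\<in>Basis. (dir_deriv a F x * e a - F x * (e a * e a)) * \<psi> x)"
    by (intro sum.cong refl) (simp add: d1F algebra_simps)
  also have "\<dots> = ((\<Sum>a\<in>Basis. dir_deriv a F x * e a) - F x * complex_of_real (inner junit (junit :: 'a))) * \<psi> x"
    by (simp only: sum_distrib_right[symmetric] sum_subtractf sum_distrib_left[symmetric] ee)
  finally have first: "(\<Sum>a\<in>Basis. dir_deriv a (\<lambda>x. F x * \<psi> x) x * e a) = \<dots>" .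
  have "bessel_component junit (\<lambda>x. F x * \<psi> x) x =
    (op_D F x - 2 * op_E F x - complex_of_real (jlambda TYPE('a) * inner junit (junit :: 'a)) * F x + op_M junit F x) * \<psi> x"
    unfolding bessel_component_def second first[unfolded e_def] by (simp add: e_def algebra_simps)
  then show "bessel_component junit (\<lambda>x. F x * complex_of_real (exp (- inner junit x))) x = (op_D F x - 2 * op_E F x
      - complex_of_real (jlambda TYPE('a) * inner junit (junit :: 'a)) * F x + op_M junit F x) * complex_of_real (exp (- inner junit x))"
    by (simp add: \<psi>_def[abs_def])
qed

context orbit_space
begin

lemma poly_exp_eq: "poly_exp F = (\<lambda>x::'a. F x * complex_of_real (exp (- inner junit x)))"
  by (simp add: poly_exp_def jtr_inner fun_eq_iff)

text \<open>The rate \<open>s\<close> is 2 for inner products of polynomials times exp (- tr), and 1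
  for the functional built below.\<close>

definition expint :: "real \<Rightarrow> ('a \<Rightarrow> complex) \<Rightarrow> complex" where
  "expint s F = (LINT x|\<mu>. F x * complex_of_real (exp (- s * inner junit x)))"

lemma continuous_ridge: "continuous_on A (ridge k w)"
  unfolding ridge_def by (intro continuous_intros)

lemma ridge_scale: "ridge k w (t *\<^sub>R x) = of_real t ^ k * ridge k w x"
  by (simp add: ridge_def power_mult_distrib)

end

locale positive_orbit_space = orbit_space +
  assumes rho_pos: "\<rho> > 0"
begin

lemma integrable_expint:
  assumes "F \<in> rpoly n" "s > 0"
  shows "integrable \<mu> (\<lambda>x. F x * complex_of_real (exp (- s * inner junit x)))"
  using assms(1)
proof (induction rule: rpoly.induct)
  case (step F k a w)
  have "has_bochner_integral \<mu> (\<lambda>x. ridge k w x * complex_of_real (exp (- s * inner junit x)))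
     (of_real (2 powr \<rho> / Gamma \<rho> * (Gamma (real k + \<rho>) / (s * \<tau>) powr (real k + \<rho>))) * (LINT l|dk. ridge k w (blinfun_apply l c)))"
    by (rule integral_homogeneous) (use continuous_ridge ridge_scale assms(2) rho_pos in auto)
  then have "integrable \<mu> (\<lambda>x. a * (ridge k w x * complex_of_real (exp (- s * inner junit x))) + F x * complex_of_real (exp (- s * inner junit x)))"
    using step.IH by (intro Bochner_Integration.integrable_add integrable_mult_right) (auto simp: has_bochner_integral_iff)
  then show ?case by (simp only: distrib_right mult.assoc)
qed simp

lemma expint_lin:
  assumes "F \<in> rpoly n" "G \<in> rpoly m" "s > 0"
  shows "expint s (\<lambda>x. a * F x + b * G x) = a * expint s F + b * expint s G"
  using integrable_expint[OF assms(1,3)] integrable_expint[OF assms(2,3)]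
  by (simp add: expint_def distrib_right mult.assoc)

lemma expint_ridge:
  assumes "s > 0"
  shows "expint s (ridge k w) = of_real (2 powr \<rho> / Gamma \<rho> * (Gamma (real k + \<rho>) / (s * \<tau>) powr (real k + \<rho>))) * (LINT l|dk. ridge k w (blinfun_apply l c))"
  unfolding expint_def
  by (rule has_bochner_integral_integral_eq, rule integral_homogeneous) (use continuous_ridge ridge_scale assms rho_pos in auto)

text \<open>The measure is homogeneous of degree \<open>\<rho>\<close>; the dilation by 1/2 brings
  the two rates of decay together. It is read off from the Gamma factors, degree by degree.\<close>

lemma expint_2:
  assumes "F \<in> rpoly n"
  shows "expint 2 F = of_real (2 powr (- \<rho>)) * expint 1 (\<lambda>x. F ((1/2) *\<^sub>R x)) \<and> (\<lambda>x. F ((1/2) *\<^sub>R x)) \<in> rpoly n"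
  using assms
proof (induction rule: rpoly.induct)
  case zero
  show ?case by (simp add: expint_def rpoly.zero)
next
  case (step F k a w)
  have eq: "(\<lambda>x. a * ridge k w ((1/2) *\<^sub>R x) + F ((1/2) *\<^sub>R x)) = (\<lambda>x. (a * of_real (1/2) ^ k) * ridge k w x + 1 * F ((1/2) *\<^sub>R x))"
    by (simp only: ridge_scale mult.assoc mult_1_left)
  have "(2 * \<tau>) powr (real k + \<rho>) = 2 ^ k * 2 powr \<rho> * (1 * \<tau>) powr (real k + \<rho>)"
    using tau_pos by (simp add: powr_mult powr_add powr_realpow)
  then have r: "expint 2 (ridge k w) = of_real (2 powr (- \<rho>)) * (of_real (1/2) ^ k * expint 1 (ridge k w))"
    by (simp only: expint_ridge[of 2] expint_ridge[of 1] zero_less_numeral zero_less_one)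
      (simp add: powr_minus field_simps)
  have in1: "ridge k w \<in> rpoly n" using step.hyps by (intro rpoly_ridge1)
  have "expint 2 (\<lambda>x. a * ridge k w x + 1 * F x) = a * expint 2 (ridge k w) + 1 * expint 2 F"
    using step.hyps in1 by (intro expint_lin) auto
  moreover have "expint 1 (\<lambda>x. (a * of_real (1/2) ^ k) * ridge k w x + 1 * F ((1/2) *\<^sub>R x))
     = (a * of_real (1/2) ^ k) * expint 1 (ridge k w) + 1 * expint 1 (\<lambda>x. F ((1/2) *\<^sub>R x))"
    using step in1 by (intro expint_lin) auto
  ultimately have "expint 2 (\<lambda>x. a * ridge k w x + F x) = of_real (2 powr (- \<rho>)) * expint 1 (\<lambda>x. (a * of_real (1/2) ^ k) * ridge k w x + 1 * F ((1/2) *\<^sub>R x))"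
    using step.IH r by (simp add: algebra_simps)
  then show ?case unfolding eq using step.IH in1
    by (intro conjI rpoly_add rpoly_scale) auto
qed

text \<open>On homogeneous polynomials of degree k the functional equation of Gamma makes
  multiplication by the trace act as k + \<rho>, while the Euler operator acts as k.\<close>

lemma expint_euler:
  assumes F: "F \<in> rpoly n"
  shows "expint 1 (op_E F) = expint 1 (op_M junit F) - of_real \<rho> * expint 1 F"
  using F
proof (induction rule: rpoly.induct)
  case zero
  have "op_E (\<lambda>x::'a. 0) = (\<lambda>x. 0)" "op_M junit (\<lambda>x::'a. 0) = (\<lambda>x. 0)"
    using op_E_lin[OF nice_ridge nice_ridge, of 0 0 "0::'a" 0 0 0] by (simp_all add: op_M_def fun_eq_iff)
  then show ?case by (simp add: expint_def)
next
  case (step F k a w)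
  have in1: "ridge k w \<in> rpoly n" using step.hyps by (intro rpoly_ridge1)
  have "has_bochner_integral \<mu> (\<lambda>x. op_M junit (ridge k w) x * complex_of_real (exp (- 1 * inner junit x)))
     (of_real (2 powr \<rho> / Gamma \<rho> * (Gamma (real (Suc k) + \<rho>) / (1 * \<tau>) powr (real (Suc k) + \<rho>))) * (LINT l|dk. op_M junit (ridge k w) (blinfun_apply l c)))"
    by (rule integral_homogeneous)
       (use rho_pos in \<open>auto simp: op_M_def ridge_scale intro!: continuous_intros continuous_ridge\<close>)
  then have "expint 1 (op_M junit (ridge k w)) = of_real (2 powr \<rho> / Gamma \<rho> * (Gamma (real (Suc k) + \<rho>) / \<tau> powr (real (Suc k) + \<rho>))) * (LINT l|dk. op_M junit (ridge k w) (blinfun_apply l c))"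
    using has_bochner_integral_integral_eq unfolding expint_def by fastforce
  also have "(LINT l|dk. op_M junit (ridge k w) (blinfun_apply l c)) = (LINT l|dk. of_real \<tau> * ridge k w (blinfun_apply l c))"
    by (intro Bochner_Integration.integral_cong refl) (simp add: op_M_def space_dk stabilizer_junit inner_junit_c)
  also have "\<dots> = of_real \<tau> * (LINT l|dk. ridge k w (blinfun_apply l c))" by (rule integral_mult_right_zero)
  also have "Gamma (real (Suc k) + \<rho>) = (real k + \<rho>) * Gamma (real k + \<rho>)"
    using Gamma_plus1[of "real k + \<rho>"] rho_pos by (auto simp: algebra_simps nonpos_Ints_def)
  also have "\<tau> powr (real (Suc k) + \<rho>) = \<tau> * \<tau> powr (real k + \<rho>)"
    using tau_pos powr_add[of \<tau> 1 "real k + \<rho>"] by (simp add: add.assoc)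
  finally have M': "expint 1 (op_M junit (ridge k w)) = of_real (2 powr \<rho> / Gamma \<rho> * ((real k + \<rho>) * Gamma (real k + \<rho>) / (\<tau> * \<tau> powr (real k + \<rho>)))) *
      (of_real \<tau> * (LINT l|dk. ridge k w (blinfun_apply l c)))" .
  have "2 powr \<rho> / Gamma \<rho> * ((real k + \<rho>) * Gamma (real k + \<rho>) / (\<tau> * \<tau> powr (real k + \<rho>))) * \<tau> =
      (real k + \<rho>) * (2 powr \<rho> / Gamma \<rho> * (Gamma (real k + \<rho>) / \<tau> powr (real k + \<rho>)))"
    using tau_pos by (simp del: inner_gt_zero_iff inner_eq_zero_iff)
  then have M: "expint 1 (op_M junit (ridge k w)) = of_real (real k + \<rho>) * expint 1 (ridge k w)"
    unfolding M' expint_ridge[OF zero_less_one] mult.assoc[symmetric] of_real_mult[symmetric] by simp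
  have E: "op_E (ridge k w) = (\<lambda>x. of_nat k * ridge k w x + 0 * ridge k w x)" by (simp add: op_E_ridge fun_eq_iff)
  have r: "expint 1 (op_E (ridge k w)) = expint 1 (op_M junit (ridge k w)) - of_real \<rho> * expint 1 (ridge k w)"
    unfolding E M by (subst expint_lin[OF in1 in1]) (simp_all add: algebra_simps)
  have lE: "op_E (\<lambda>x. a * ridge k w x + F x) = (\<lambda>x. a * op_E (ridge k w) x + 1 * op_E F x)"
    using op_E_lin[OF nice_ridge nice_rpoly[OF step.hyps(1)], of a k w 1] by simp
  have lM: "op_M junit (\<lambda>x. a * ridge k w x + F x) = (\<lambda>x. a * op_M junit (ridge k w) x + 1 * op_M junit F x)"
    by (simp add: op_M_def fun_eq_iff algebra_simps)
  have l: "expint 1 (\<lambda>x. a * ridge k w x + F x) = a * expint 1 (ridge k w) + expint 1 F"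
    using expint_lin[OF in1 step.hyps(1), of 1 a 1] by simp
  show ?case
    unfolding lE lM l
      expint_lin[OF in_rpoly(4)[OF in1] in_rpoly(4)[OF step.hyps(1)] zero_less_one]
      expint_lin[OF in_rpoly(1)[OF in1] in_rpoly(1)[OF step.hyps(1)] zero_less_one]
    by (simp add: r step.IH algebra_simps)
qed

lemma expint_one: "expint 1 (\<lambda>x. 1) = of_real (2 powr \<rho> * \<tau> powr (- \<rho>))"
proof -
  have "(\<lambda>x. 1) = ridge 0 (0::'a)" by (simp add: ridge_def fun_eq_iff)
  then have "expint 1 (\<lambda>x. 1) = of_real (2 powr \<rho> / Gamma \<rho> * (Gamma \<rho> / \<tau> powr \<rho>)) * (LINT l|dk. ridge 0 0 (blinfun_apply l c))"
    using expint_ridge[of 1 0 0] by simp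
  moreover have "(LINT l|dk. ridge 0 0 (blinfun_apply l c)) = 1"
    using haar by (simp add: ridge_def normalized_haar_measure_def measure_def)
  ultimately show ?thesis
    using rho_pos Gamma_real_pos[OF rho_pos] by (simp add: powr_minus field_simps)
qed

end

section \<open>The normalised integral and its symmetry\<close>

locale minimal_inversion = orbit_space c dk \<mu> \<rho> + covering_group H q
  for c :: "'a::euclidean_jordan_algebra" and dk \<mu> \<rho> and H :: "'g::topological_space monoid" and q :: "'g \<Rightarrow> 'a conf \<Rightarrow> 'a conf" +
  fixes \<pi> :: "'g \<Rightarrow> ('a \<Rightarrow> complex) \<Rightarrow> 'a \<Rightarrow> complex"
  assumes rep: "minimal_representation H q c \<mu> \<pi>"
begin

lemma unitary: "unitary_representation H \<mu> \<pi>"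
  and irreducible: "irreducible_representation H \<mu> \<pi>"
  and derived: "polynomial_function F \<Longrightarrow> derived_representation H q \<mu> \<pi> (u, 0, 0) (poly_exp F)
        (\<lambda>x. \<i> * complex_of_real (inner u x) * poly_exp F x)"
    "polynomial_function F \<Longrightarrow> derived_representation H q \<mu> \<pi> (0, 0, v) (poly_exp F) (\<lambda>x. \<i> * bessel_component v (poly_exp F) x)"
  using rep unfolding minimal_representation_def by blast+

lemma rep_unitary: "g \<in> carrier H \<Longrightarrow> L2_unitary \<mu> (\<pi> g)"
  using unitary by (simp add: unitary_representation_def)

lemma rep_mult: "g \<in> carrier H \<Longrightarrow> h \<in> carrier H \<Longrightarrow> f \<in> L2 \<mu> \<Longrightarrow> AE x in \<mu>. \<pi> (g \<otimes>\<^bsub>H\<^esub> h) f x = \<pi> g (\<pi> h f) x"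
  using unitary by (simp add: unitary_representation_def)

text \<open>The operator at the unit is an isometry with U U f = U f, so the distance of U f and f
  equals that of U U f and U f.\<close>

lemma rep_one: assumes f: "f \<in> L2 \<mu>" shows "AE x in \<mu>. \<pi> \<one>\<^bsub>H\<^esub> f x = f x"
proof -
  let ?U = "\<pi> \<one>\<^bsub>H\<^esub>"
  have U: "L2_unitary \<mu> ?U" by (rule rep_unitary) simp
  have L: "?U f \<in> L2 \<mu>" "?U (?U f) \<in> L2 \<mu>" using U f unitary_L2 by blast+
  have "AE x in \<mu>. ?U f x = ?U (?U f) x" using rep_mult[of "\<one>\<^bsub>H\<^esub>" "\<one>\<^bsub>H\<^esub>" f] f by simp
  then have "AE x in \<mu>. ?U (?U f) x - ?U f x = 0" by eventually_elim simp
  then have "L2_norm \<mu> (\<lambda>x. ?U (?U f) x - ?U f x) = 0" using L by (intro L2_norm_0_AE L2_measurable L2_diff)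
  then have "AE x in \<mu>. ?U f x - f x = 0"
    unfolding unitary_norm_diff[OF U L(1) f] using L f by (intro L2_norm_eq_0 L2_diff)
  then show ?thesis by simp
qed

lemma strong_continuity:
  assumes \<gamma>: "(\<gamma> \<longlongrightarrow> \<one>\<^bsub>H\<^esub>) G" "\<And>t. \<gamma> t \<in> carrier H" and f: "f \<in> L2 \<mu>"
  shows "L2_lim \<mu> (\<lambda>t. \<pi> (\<gamma> t) f) f G"
  unfolding L2_lim_def
proof (intro conjI allI f)
  show "\<pi> (\<gamma> t) f \<in> L2 \<mu>" for t using rep_unitary[OF \<gamma>(2)] f unitary_L2 by blast
  have one: "\<pi> \<one>\<^bsub>H\<^esub> f \<in> L2 \<mu>" using rep_unitary[OF H.one_closed] f unitary_L2 by blast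
  have eq: "L2_norm \<mu> (\<lambda>x. \<pi> g f x - f x) = L2_norm \<mu> (\<lambda>x. \<pi> g f x - \<pi> \<one>\<^bsub>H\<^esub> f x)" if "g \<in> carrier H" for g
    using rep_one[OF f] unitary_L2[OF rep_unitary[OF that] f] f one
    by (intro L2_norm_cong_AE L2_measurable L2_diff) auto
  show "((\<lambda>t. L2_norm \<mu> (\<lambda>x. \<pi> (\<gamma> t) f x - f x)) \<longlongrightarrow> 0) G"
  proof (rule tendstoI)
    fix \<epsilon> :: real assume \<epsilon>: "\<epsilon> > 0"
    have "((\<lambda>h. L2_norm \<mu> (\<lambda>x. \<pi> h f x - \<pi> \<one>\<^bsub>H\<^esub> f x)) \<longlongrightarrow> 0) (at \<one>\<^bsub>H\<^esub> within carrier H)"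
      using unitary f by (simp add: unitary_representation_def)
    from tendstoD[OF this \<epsilon>] obtain S where S: "open S" "\<one>\<^bsub>H\<^esub> \<in> S"
      and lt: "\<And>h. h \<in> S \<Longrightarrow> h \<noteq> \<one>\<^bsub>H\<^esub> \<Longrightarrow> h \<in> carrier H \<Longrightarrow> L2_norm \<mu> (\<lambda>x. \<pi> h f x - \<pi> \<one>\<^bsub>H\<^esub> f x) < \<epsilon>"
      unfolding eventually_at_topological by auto
    \<comment> \<open>The continuity assumption concerns a punctured neighbourhood; at the unit
      itself the norm is 0.\<close>
    have lt': "L2_norm \<mu> (\<lambda>x. \<pi> h f x - f x) < \<epsilon>" if "h \<in> S" "h \<in> carrier H" for h
      unfolding eq[OF that(2)] using lt[OF that(1) _ that(2)] \<epsilon> by (cases "h = \<one>\<^bsub>H\<^esub>") (auto simp: L2_norm_def)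
    from topological_tendstoD[OF \<gamma>(1) S] show "\<forall>\<^sub>F t in G. dist (L2_norm \<mu> (\<lambda>x. \<pi> (\<gamma> t) f x - f x)) 0 < \<epsilon>"
      by eventually_elim (use lt' \<gamma>(2) in simp)
  qed
qed

lemma groups_tendsto:
  "(x \<longlongrightarrow> 0) G \<Longrightarrow> ((\<lambda>t. shift_group (x t)) \<longlongrightarrow> \<one>\<^bsub>H\<^esub>) G"
  "(x \<longlongrightarrow> 0) G \<Longrightarrow> ((\<lambda>t. coshift_group (x t)) \<longlongrightarrow> \<one>\<^bsub>H\<^esub>) G"
proof -
  have "continuous_on UNIV shift_group" "continuous_on UNIV coshift_group"
    using one_parameter_groups by (simp_all add: one_parameter_subgroup_def)
  then have "isCont shift_group 0" "isCont coshift_group 0" by (simp_all add: continuous_on_eq_continuous_at)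
  then show "(x \<longlongrightarrow> 0) G \<Longrightarrow> ((\<lambda>t. shift_group (x t)) \<longlongrightarrow> \<one>\<^bsub>H\<^esub>) G"
    "(x \<longlongrightarrow> 0) G \<Longrightarrow> ((\<lambda>t. coshift_group (x t)) \<longlongrightarrow> \<one>\<^bsub>H\<^esub>) G"
    using isCont_tendsto_compose groups_0 by metis+
qed

lemma quotient_L2: "L2_unitary M U \<Longrightarrow> f \<in> L2 M \<Longrightarrow> (\<lambda>x. (U f x - f x) / (t::complex)) \<in> L2 M"
  using L2_scale[OF L2_diff[OF unitary_L2[of M U f]], of f "1 / t"] by simp

lemma derived_lim:
  assumes "derived_representation H q \<mu> \<pi> X f h" "\<And>t. cover_exp H q (t *\<^sub>R X) = \<gamma> t" "\<And>t. \<gamma> t \<in> carrier H"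
  shows "L2_lim \<mu> (\<lambda>t x. (\<pi> (\<gamma> t) f x - f x) / complex_of_real t) h (at 0)"
  using assms quotient_L2[OF rep_unitary] by (simp add: derived_representation_def L2_lim_def)

lemma derived_L2: "derived_representation H q \<mu> \<pi> X f h \<Longrightarrow> f \<in> L2 \<mu>"
  "derived_representation H q \<mu> \<pi> X f h \<Longrightarrow> h \<in> L2 \<mu>"
  by (simp_all add: derived_representation_def)

lemma poly_exp_L2: "F \<in> rpoly n \<Longrightarrow> poly_exp F \<in> L2 \<mu>"
  using derived_L2(1)[OF derived(1)[OF polynomial_of_rpoly]] .

lemma shift_lim:
  assumes "F \<in> rpoly n"
  shows "L2_lim \<mu> (\<lambda>t x. (\<pi> (shift_group t) (poly_exp F) x - poly_exp F x) / complex_of_real t)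
     (\<lambda>x. \<i> * complex_of_real (inner junit x) * poly_exp F x) (at 0)"
  by (rule derived_lim[OF derived(1)[OF polynomial_of_rpoly[OF assms]] cover_exp_shift groups_closed(1)])

definition op_C :: "('a \<Rightarrow> complex) \<Rightarrow> 'a \<Rightarrow> complex" where
  "op_C F x = op_D F x - 2 * op_E F x - complex_of_real (jlambda TYPE('a) * inner junit (junit :: 'a)) * F x + op_M junit F x"

lemma op_C_in: "F \<in> rpoly n \<Longrightarrow> op_C F \<in> rpoly (Suc n)"
  unfolding op_C_def[abs_def] by (intro rpoly_add rpoly_diff rpoly_scale in_rpoly(1) in_rpoly_Suc)

lemma coshift_lim:
  assumes "F \<in> rpoly n"
  shows "L2_lim \<mu> (\<lambda>t x. (\<pi> (coshift_group t) (poly_exp F) x - poly_exp F x) / complex_of_real t)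
     (\<lambda>x. \<i> * poly_exp (op_C F) x) (at 0)"
proof -
  have "bessel_component junit (poly_exp F) = poly_exp (op_C F)"
    by (simp add: poly_exp_eq bessel_exp[OF nice_rpoly[OF assms]] op_C_def fun_eq_iff)
  then show ?thesis
    using derived_lim[OF derived(2)[OF polynomial_of_rpoly[OF assms]] cover_exp_coshift groups_closed(2)] by simp
qed

text \<open>At 0 the constant in front of the orbit measure is 0, because Gamma 0 = 0 and division
  by 0 gives 0. The Hilbert space would then be trivial, contrary to irreducibility.\<close>

lemma rho_pos: "\<rho> > 0"
proof (rule ccontr)
  assume "\<not> \<rho> > 0"
  then have "\<rho> = 0" using rho_nonneg by simp
  then have "emeasure \<mu> A = 0" for A
    by (simp add: orbit_measure orbit_measure_def rho[symmetric])
  then have "AE x in \<mu>. P x" for P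
    by (intro AE_I[where N = "space \<mu>"]) auto
  then show False using irreducible by (auto simp: irreducible_representation_def)
qed

sublocale positive_orbit_space c dk \<mu> \<rho> by unfold_locales (rule rho_pos)

text \<open>The factor is the inverse of the total mass of exp (- tr) when the squared norm of
  \<open>c\<close> is 1.\<close>

definition \<phi> :: "('a \<Rightarrow> complex) \<Rightarrow> complex" where
  "\<phi> F = of_real (2 powr (- \<rho>)) * expint 1 F"

lemma phi_lin: "F \<in> rpoly n \<Longrightarrow> G \<in> rpoly m \<Longrightarrow> \<phi> (\<lambda>x. a * F x + b * G x) = a * \<phi> F + b * \<phi> G"
  by (simp add: \<phi>_def expint_lin algebra_simps)

lemma phi_euler: "F \<in> rpoly n \<Longrightarrow> \<phi> (op_E F) = \<phi> (op_M junit F) - of_real \<rho> * \<phi> F"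
  by (simp add: \<phi>_def expint_euler algebra_simps)

lemma phi_lin': "F \<in> rpoly n \<Longrightarrow> G \<in> rpoly n \<Longrightarrow> A \<in> rpoly n \<Longrightarrow> B \<in> rpoly n \<Longrightarrow>
   \<phi> (\<lambda>x. F x - G x - a * A x + a * B x) = \<phi> F - \<phi> G - a * \<phi> A + a * \<phi> B"
proof -
  assume r: "F \<in> rpoly n" "G \<in> rpoly n" "A \<in> rpoly n" "B \<in> rpoly n"
  have 1: "\<phi> (\<lambda>x. 1 * F x + (-1) * G x) = 1 * \<phi> F + (-1) * \<phi> G" "\<phi> (\<lambda>x. (-a) * A x + a * B x) = (-a) * \<phi> A + a * \<phi> B"
    using r by (blast intro: phi_lin)+
  have "\<phi> (\<lambda>x. 1 * (1 * F x + (-1) * G x) + 1 * ((-a) * A x + a * B x)) = 1 * \<phi> (\<lambda>x. 1 * F x + (-1) * G x) + 1 * \<phi> (\<lambda>x. (-a) * A x + a * B x)"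
    using r by (intro phi_lin rpoly_add rpoly_scale)
  then show ?thesis unfolding 1 by (simp add: algebra_simps)
qed

lemma poly_exp_inner:
  "L2_inner \<mu> (poly_exp F) (poly_exp G) = expint 2 (\<lambda>x. F x * cnj (G x))"
  unfolding L2_inner_def expint_def poly_exp_eq
  by (intro Bochner_Integration.integral_cong refl) (simp flip: of_real_mult exp_add)

lemma op_C_ridge_real: "cnj (op_C (ridge k w) x) = op_C (ridge k w) x"
  by (simp add: op_C_def bessel_ridge op_E_ridge op_M_def ridge_def)

lemma op_D_ridge_scale:
  "op_D (ridge k w) ((1/2) *\<^sub>R x) = 2 * of_real (1/2) ^ k * op_D (ridge k w) (x :: 'a)"
proof (cases k)
  case (Suc j)
  then show ?thesis
    by (cases j) (simp_all add: bessel_ridge ridge_scale field_simps)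
qed (simp add: bessel_ridge)

text \<open>The generator belonging to \<open>(0, 0, junit)\<close> is skew, hence D is symmetric on
  polynomials times exp (- tr). After the dilation by 1/2 this becomes an identity for the rate of
  decay 1; powers of real linear forms are real-valued, so no conjugation remains.\<close>

lemma phi_sym_ridge:
  fixes w v :: 'a and k j :: nat
  defines "F \<equiv> ridge k w" and "G \<equiv> ridge j v"
  shows "\<phi> (\<lambda>x. op_D G x * F x) - \<phi> (\<lambda>x. G x * op_D F x) = \<phi> (\<lambda>x. op_E G x * F x) - \<phi> (\<lambda>x. G x * op_E F x)"
proof -
  define n where "n = k + j"
  have F: "F \<in> rpoly k" and G: "G \<in> rpoly j" by (simp_all add: F_def G_def rpoly_ridge1)
  note C = op_C_in[OF F] op_C_in[OF G]
  have P: "poly_exp F \<in> L2 \<mu>" "poly_exp G \<in> L2 \<mu>" "poly_exp (op_C F) \<in> L2 \<mu>" "poly_exp (op_C G) \<in> L2 \<mu>"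
    using poly_exp_L2 F G C by blast+
  have "L2_inner \<mu> (\<lambda>x. \<i> * poly_exp (op_C G) x) (poly_exp F) = - L2_inner \<mu> (poly_exp G) (\<lambda>x. \<i> * poly_exp (op_C F) x)"
    by (rule skew_adjoint_generator[where V = "\<lambda>t. \<pi> (coshift_group t)"])
       (use P coshift_lim[OF F] coshift_lim[OF G] rep_unitary groups_closed
         strong_continuity[OF groups_tendsto(2)[OF tendsto_ident_at]] in auto)
  then have "expint 2 (\<lambda>x. op_C G x * cnj (F x)) = expint 2 (\<lambda>x. G x * cnj (op_C F x))"
    using P by (simp add: L2_inner_scale_left L2_inner_scale_right poly_exp_inner)
  then have "expint 2 (\<lambda>x. op_C G x * F x) = expint 2 (\<lambda>x. G x * op_C F x)"
    by (simp add: F_def G_def op_C_ridge_real) (simp add: ridge_def)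
  then have "\<phi> (\<lambda>x. op_C G ((1/2) *\<^sub>R x) * F ((1/2) *\<^sub>R x)) = \<phi> (\<lambda>x. G ((1/2) *\<^sub>R x) * op_C F ((1/2) *\<^sub>R x))"
    using expint_2[OF rpoly_mult[OF C(2) F]] expint_2[OF rpoly_mult[OF G C(1)]] by (simp add: \<phi>_def)
  moreover have "(\<lambda>x. G x * op_C F x) \<in> rpoly (Suc n)" "(\<lambda>x. op_C G x * F x) \<in> rpoly (Suc n)"
    by (rule rpoly_mult_le[OF G C(1)] rpoly_mult_le[OF C(2) F]; simp add: n_def)+
  then have "(\<lambda>x. op_C G ((1/2) *\<^sub>R x) * F ((1/2) *\<^sub>R x)) \<in> rpoly (Suc n)" "(\<lambda>x. G ((1/2) *\<^sub>R x) * op_C F ((1/2) *\<^sub>R x)) \<in> rpoly (Suc n)"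
    using expint_2 by auto
  note this[THEN phi_lin]
  ultimately have 0: "\<phi> (\<lambda>x. op_C G ((1/2) *\<^sub>R x) * F ((1/2) *\<^sub>R x) - G ((1/2) *\<^sub>R x) * op_C F ((1/2) *\<^sub>R x)) = 0"
    using \<open>(\<lambda>x. op_C G ((1/2) *\<^sub>R x) * F ((1/2) *\<^sub>R x)) \<in> rpoly (Suc n)\<close> \<open>(\<lambda>x. G ((1/2) *\<^sub>R x) * op_C F ((1/2) *\<^sub>R x)) \<in> rpoly (Suc n)\<close>
      phi_lin[of "\<lambda>x. op_C G ((1/2) *\<^sub>R x) * F ((1/2) *\<^sub>R x)" "Suc n" "\<lambda>x. G ((1/2) *\<^sub>R x) * op_C F ((1/2) *\<^sub>R x)" "Suc n" 1 "-1"] by simp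
  \<comment> \<open>Under the dilation D G F and 2 E G F acquire the same factor 2 h: D lowers the
    degree by one, which supplies the extra 2. The multiplication terms cancel in the
    difference.\<close>
  define h where "h = (of_real (1/2) :: complex) ^ n"
  have "h \<noteq> 0" by (simp add: h_def)
  have "op_C G ((1/2) *\<^sub>R x) * F ((1/2) *\<^sub>R x) - G ((1/2) *\<^sub>R x) * op_C F ((1/2) *\<^sub>R x) =
    (2 * h) * (op_D G x * F x - G x * op_D F x - 1 * (op_E G x * F x) + 1 * (G x * op_E F x))" for x
    unfolding op_C_def unfolding F_def G_def h_def n_def op_D_ridge_scale
    by (simp add: op_E_ridge ridge_scale op_M_def power_add algebra_simps)
  then have "\<phi> (\<lambda>x. (2 * h) * (op_D G x * F x - G x * op_D F x - 1 * (op_E G x * F x) + 1 * (G x * op_E F x))) = 0"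
    using 0 by (simp only:)
  moreover have r: "(\<lambda>x. op_D G x * F x) \<in> rpoly n" "(\<lambda>x. G x * op_D F x) \<in> rpoly n"
    "(\<lambda>x. op_E G x * F x) \<in> rpoly n" "(\<lambda>x. G x * op_E F x) \<in> rpoly n"
    using rpoly_mult_le[OF in_rpoly(3)[OF G] F] rpoly_mult_le[OF G in_rpoly(3)[OF F]]
      rpoly_mult_le[OF in_rpoly(4)[OF G] F] rpoly_mult_le[OF G in_rpoly(4)[OF F]] by (simp_all add: n_def)
  have "(\<lambda>x. op_D G x * F x - G x * op_D F x - 1 * (op_E G x * F x) + 1 * (G x * op_E F x)) \<in> rpoly n"
    using r by (intro rpoly_add rpoly_diff rpoly_scale)
  from phi_lin[OF this this, of "2 * h" 0]
  have "\<phi> (\<lambda>x. (2 * h) * (op_D G x * F x - G x * op_D F x - 1 * (op_E G x * F x) + 1 * (G x * op_E F x))) =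
     (2 * h) * \<phi> (\<lambda>x. op_D G x * F x - G x * op_D F x - 1 * (op_E G x * F x) + 1 * (G x * op_E F x))" by simp
  ultimately have "\<phi> (\<lambda>x. op_D G x * F x - G x * op_D F x - 1 * (op_E G x * F x) + 1 * (G x * op_E F x)) = 0"
    using \<open>h \<noteq> 0\<close> by simp
  then show ?thesis unfolding phi_lin'[OF r] by (simp add: algebra_simps)
qed

lemma bilinear_ridge_induct [consumes 2, case_names add_left add_right ridge]:
  assumes "F \<in> rpoly n" "G \<in> rpoly m"
    and left: "\<And>F F' G a b n m. F \<in> rpoly n \<Longrightarrow> F' \<in> rpoly n \<Longrightarrow> G \<in> rpoly m \<Longrightarrow> P F G \<Longrightarrow> P F' G \<Longrightarrow> P (\<lambda>x. a * F x + b * F' x) G"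
    and right: "\<And>F G G' a b n m. F \<in> rpoly n \<Longrightarrow> G \<in> rpoly m \<Longrightarrow> G' \<in> rpoly m \<Longrightarrow> P F G \<Longrightarrow> P F G' \<Longrightarrow> P F (\<lambda>x. a * G x + b * G' x)"
    and ridge: "\<And>k w j v. P (ridge k w) (ridge j v)"
  shows "P F G"
proof -
  have R: "P (ridge k w) G" if "G \<in> rpoly m" for k w G
    using that
  proof (induction rule: rpoly.induct)
    case zero
    then show ?case using right[OF rpoly_ridge1[OF order_refl] rpoly_ridge1[OF order_refl] rpoly_ridge1[OF order_refl] ridge ridge, of k w 0 0 0 0] by simp
  next
    case (step G j a v)
    then show ?case
      using right[OF rpoly_ridge1[OF order_refl, of k w] rpoly_ridge1[OF step.hyps(2), of v] step.hyps(1) ridge step.IH, of a 1] by simp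
  qed
  show ?thesis using assms(1)
  proof (induction rule: rpoly.induct)
    case zero
    then show ?case using left[OF rpoly_ridge1[OF order_refl] rpoly_ridge1[OF order_refl] assms(2) R[OF assms(2)] R[OF assms(2)], of 0 0 0 0] by simp
  next
    case (step F k a w)
    then show ?case
      using left[OF rpoly_ridge1[OF step.hyps(2), of w] step.hyps(1) assms(2) R[OF assms(2)] step.IH, of a 1] by simp
  qed
qed

lemma phi_sym:
  assumes "F \<in> rpoly n" "G \<in> rpoly m"
  shows "\<phi> (\<lambda>x. op_D G x * F x) - \<phi> (\<lambda>x. G x * op_D F x) = \<phi> (\<lambda>x. op_E G x * F x) - \<phi> (\<lambda>x. G x * op_E F x)"
  using assms
proof (induction rule: bilinear_ridge_induct)
  have c: "a * X + b * X' - (a * Y + b * Y') = a * (X - Y) + b * (X' - Y')" for a b X X' Y Y' :: complex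
    by (simp add: algebra_simps)
  case (add_left F F' G a b n m)
  have l: "\<phi> (\<lambda>x. K x * (a * L x + b * L' x)) = a * \<phi> (\<lambda>x. K x * L x) + b * \<phi> (\<lambda>x. K x * L' x)"
    if "K \<in> rpoly m" "L \<in> rpoly n" "L' \<in> rpoly n" for K L L'
    using phi_lin[OF rpoly_mult[OF that(1,2)] rpoly_mult[OF that(1,3)], of a b] by (simp add: algebra_simps)
  note in' = in_rpoly(3,4)[OF add_left(1)] in_rpoly(3,4)[OF add_left(2)] in_rpoly(3,4)[OF add_left(3)]
  have e: "op_D (\<lambda>x. a * F x + b * F' x) = (\<lambda>x. a * op_D F x + b * op_D F' x)" "op_E (\<lambda>x. a * F x + b * F' x) = (\<lambda>x. a * op_E F x + b * op_E F' x)"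
    using add_left by (auto intro!: bessel_lin op_E_lin nice_rpoly)
  show ?case
    unfolding e l[OF in'(5) add_left(1,2)] l[OF in'(6) add_left(1,2)] l[OF add_left(3) in'(1,3)] l[OF add_left(3) in'(2,4)]
      c add_left(4,5) ..
next
  have c: "a * X + b * X' - (a * Y + b * Y') = a * (X - Y) + b * (X' - Y')" for a b X X' Y Y' :: complex
    by (simp add: algebra_simps)
  case (add_right F G G' a b n m)
  have l: "\<phi> (\<lambda>x. (a * L x + b * L' x) * K x) = a * \<phi> (\<lambda>x. L x * K x) + b * \<phi> (\<lambda>x. L' x * K x)"
    if "K \<in> rpoly n" "L \<in> rpoly m" "L' \<in> rpoly m" for K L L'
    using phi_lin[OF rpoly_mult[OF that(2,1)] rpoly_mult[OF that(3,1)], of a b] by (simp add: algebra_simps)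
  note in' = in_rpoly(3,4)[OF add_right(1)] in_rpoly(3,4)[OF add_right(2)] in_rpoly(3,4)[OF add_right(3)]
  have e: "op_D (\<lambda>x. a * G x + b * G' x) = (\<lambda>x. a * op_D G x + b * op_D G' x)" "op_E (\<lambda>x. a * G x + b * G' x) = (\<lambda>x. a * op_E G x + b * op_E G' x)"
    using add_right by (auto intro!: bessel_lin op_E_lin nice_rpoly)
  show ?case
    unfolding e l[OF add_right(1) in'(3,5)] l[OF add_right(1) in'(4,6)] l[OF in'(1) add_right(2,3)] l[OF in'(2) add_right(2,3)]
      c add_right(4,5) ..
qed (rule phi_sym_ridge)

lemma phi_one_tau: "\<phi> (\<lambda>x. 1) = of_real (\<tau> powr (- \<rho>))"
  unfolding \<phi>_def expint_one of_real_mult[symmetric] by (simp add: powr_minus)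

text \<open>The symmetry is tested on the trace and the constant 1: D of the trace is the right
  side, and the Euler identity gives \<open>\<rho>\<close> as the mean of the trace.\<close>

lemma rho_eq: "\<rho> = jlambda TYPE('a) * inner junit (junit :: 'a)"
proof -
  let ?E = "ridge 1 (junit :: 'a)"
  have one: "(\<lambda>x. 1) = ridge 0 (0 :: 'a)" by (simp add: ridge_def fun_eq_iff)
  have z: "op_D (\<lambda>x. 1) = (\<lambda>x :: 'a. 0)" "op_E (\<lambda>x. 1) = (\<lambda>x :: 'a. 0)"
    unfolding one by (simp_all add: bessel_ridge op_E_ridge fun_eq_iff)
  have r: "(\<lambda>x. 1) \<in> rpoly 1" "?E \<in> rpoly 1" by (simp_all add: rpoly_const rpoly_ridge1)
  have 0: "\<phi> (\<lambda>x. 0) = 0" using phi_lin[OF r(1) r(1), of 0 0] by simp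
  have D: "op_D ?E = (\<lambda>x. complex_of_real (jlambda TYPE('a) * inner junit (junit :: 'a)) * 1 + 0 * 1)"
    by (simp add: bessel_ridge ridge_def fun_eq_iff)
  have "\<phi> (op_D ?E) = complex_of_real (jlambda TYPE('a) * inner junit (junit :: 'a)) * \<phi> (\<lambda>x. 1)"
    unfolding D phi_lin[OF r(1) r(1)] by simp
  moreover have "op_E ?E = ?E" by (simp add: op_E_ridge fun_eq_iff)
  moreover have "\<phi> ?E = of_real \<rho> * \<phi> (\<lambda>x. 1)"
    using phi_euler[OF r(1)] by (simp add: z 0 op_M_def[abs_def] ridge_def[abs_def])
  moreover have "\<phi> (op_D ?E) = \<phi> (op_E ?E)"
    using phi_sym[OF r(2) r(1)] by (simp add: z 0)
  moreover have "\<phi> (\<lambda>x. 1) \<noteq> 0" using tau_pos by (simp add: phi_one_tau)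
  ultimately show ?thesis by simp (metis of_real_eq_iff of_real_mult)
qed

lemma lambda_pos: "jlambda TYPE('a) > 0"
  using rho_pos unfolding rho rlambda_def by (simp add: jlambda_def zero_less_mult_iff)

text \<open>Dividing \<open>rho_eq\<close> by \<lambda> gives (e|e) = r, and r times the squared
  norm of \<open>c\<close> is (e|e) as well.\<close>

lemma tau_one: "\<tau> = 1"
proof -
  have r: "real (jrank TYPE('a)) > 0"
    using rho_pos lambda_pos unfolding rho rlambda_def by (simp add: zero_less_mult_iff)
  have "inner junit (junit :: 'a) = real (jrank TYPE('a))"
    using rho_eq lambda_pos unfolding rho rlambda_def by simp
  then show ?thesis using jrank_times_norm[OF simple primitive] r by simp
qed

sublocale poly_functional \<phi> \<rho>
proof
  show "\<phi> (\<lambda>x. 1) = 1" by (simp add: phi_one_tau tau_one)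
qed (use phi_lin phi_sym phi_euler rho_eq lambda_pos in auto)

end

section \<open>The action of rotations and of the inversion\<close>

context minimal_inversion
begin

text \<open>The two half translations and the reversed third shear combine to the generator of the
  rotation; the multiplication by the trace cancels against that in \<open>op_C\<close>.\<close>

lemma op_C_eq: "2 * (complex_of_real (inner junit x) * F x) / 2 - op_C F x = op_A F x + of_real \<rho> * F x"
  unfolding op_C_def op_A_def rho_eq op_M_def by (simp add: algebra_simps)

lemma rotation_lim:
  assumes F: "F \<in> rpoly n"
  shows "L2_lim \<mu> (\<lambda>t x. (\<pi> (rotation_group t) (poly_exp F) x - poly_exp F x) / complex_of_real t)
     (\<lambda>x. \<i> * (op_A F x + of_real \<rho> * F x) * complex_of_real (exp (- inner junit x))) (at 0)"
proof -
  define f where "f = poly_exp F"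
  \<comment> \<open>The parameters of the three shears whose product is the rotation by t.\<close>
  define X Y where "X t = tan (t / 2)" and "Y t = - sin t" for t :: real
  define V W where "V t = \<pi> (shift_group (X t))" and "W t = \<pi> (coshift_group (Y t))" for t
  have f: "f \<in> L2 \<mu>" unfolding f_def by (rule poly_exp_L2[OF F])
  have UV: "L2_unitary \<mu> (V t)" and UW: "L2_unitary \<mu> (W t)" for t
    by (simp_all add: V_def W_def rep_unitary groups_closed)
  have XY: "(X \<longlongrightarrow> 0) (at 0)" "(Y \<longlongrightarrow> 0) (at 0)"
    unfolding X_def[abs_def] Y_def[abs_def] by (auto intro!: tendsto_eq_intros)
  have Vc: "L2_lim \<mu> (\<lambda>t. V t g) g (at 0)" and Wc: "L2_lim \<mu> (\<lambda>t. W t g) g (at 0)" if "g \<in> L2 \<mu>" for g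
    unfolding V_def W_def by (rule strong_continuity[OF groups_tendsto(1)[OF XY(1)] groups_closed(1) that]
        strong_continuity[OF groups_tendsto(2)[OF XY(2)] groups_closed(2) that])+
  have near: "\<forall>\<^sub>F t in at (0::real). \<bar>t\<bar> < pi \<and> t \<noteq> 0"
    by (auto simp: eventually_at intro!: exI[of _ pi])
  have nz: "X t \<noteq> 0" "Y t \<noteq> 0" if "\<bar>t\<bar> < pi" "t \<noteq> 0" for t
  proof -
    have "sin (t / 2) \<noteq> 0" "sin t \<noteq> 0"
    proof -
      have "- pi < t" "t < pi" "- pi < t / 2" "t / 2 < pi" using that(1) by linarith+
      then show "sin (t / 2) \<noteq> 0" "sin t \<noteq> 0"
        using that(2) sin_eq_0_pi[of t] sin_eq_0_pi[of "t / 2"] by auto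
    qed
    moreover have "cos (t / 2) \<noteq> 0" using cos_gt_zero_pi[of "t / 2"] that(1) by linarith
    ultimately show "X t \<noteq> 0" "Y t \<noteq> 0" by (simp_all add: X_def Y_def tan_def)
  qed
  have X0: "filterlim X (at 0) (at 0)" and Y0: "filterlim Y (at 0) (at 0)"
    unfolding filterlim_at using XY near nz by (auto elim!: eventually_mono)
  have "(X has_real_derivative 1 / 2) (at 0)" "(Y has_real_derivative -1) (at 0)"
    unfolding X_def[abs_def] Y_def[abs_def] by (auto intro!: derivative_eq_intros)
  \<comment> \<open>The slopes 1/2, -1 and again 1/2 of the shears weight their generators in the
    derivative of the product.\<close>
  then have dX: "((\<lambda>t. X t / t) \<longlongrightarrow> 1 / 2) (at 0)" and dY: "((\<lambda>t. Y t / t) \<longlongrightarrow> -1) (at 0)"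
    by (simp_all add: has_field_derivative_iff X_def Y_def)
  define h where "h x = \<i> * complex_of_real (inner junit x) * f x" for x
  define k where "k x = \<i> * poly_exp (op_C F) x" for x
  \<comment> \<open>The chain rule for difference quotients: the quotient at Z t is multiplied by Z
    t / t, and Z t is nonzero near 0.\<close>
  have quot: "L2_lim \<mu> (\<lambda>t x. (\<pi> (\<gamma> (Z t)) f x - f x) / complex_of_real t) (\<lambda>x. complex_of_real z * g x) (at 0)"
    if l: "L2_lim \<mu> (\<lambda>t x. (\<pi> (\<gamma> t) f x - f x) / complex_of_real t) g (at 0)" and Z: "filterlim Z (at 0) (at 0)"
      and z: "((\<lambda>t. Z t / t) \<longlongrightarrow> z) (at 0)" and \<gamma>: "\<And>t. \<gamma> t \<in> carrier H" for \<gamma> Z z and g :: "'a \<Rightarrow> complex"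
  proof (rule L2_lim_eventually[OF L2_lim_scale[OF L2_lim_filterlim[OF l Z] tendsto_of_real[OF z]]])
    show "(\<lambda>x. (\<pi> (\<gamma> (Z t)) f x - f x) / complex_of_real t) \<in> L2 \<mu>" for t
      by (rule quotient_L2[OF rep_unitary[OF \<gamma>] f])
    have "\<forall>\<^sub>F t in at 0. Z t \<noteq> 0" using Z by (simp add: filterlim_at)
    then show "\<forall>\<^sub>F t in at 0. AE x in \<mu>. complex_of_real (Z t / t) * ((\<pi> (\<gamma> (Z t)) f x - f x) / complex_of_real (Z t)) =
        (\<pi> (\<gamma> (Z t)) f x - f x) / complex_of_real t"
      by eventually_elim simp
  qed
  have g1: "L2_lim \<mu> (\<lambda>t x. (V t f x - f x) / complex_of_real t) (\<lambda>x. complex_of_real (1 / 2) * h x) (at 0)"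
    unfolding V_def h_def[abs_def] f_def
    by (rule quot[unfolded f_def, OF shift_lim[OF F] X0 dX groups_closed(1)])
  have g2: "L2_lim \<mu> (\<lambda>t x. (W t f x - f x) / complex_of_real t) (\<lambda>x. complex_of_real (-1) * k x) (at 0)"
    unfolding W_def k_def[abs_def] f_def
    by (rule quot[unfolded f_def, OF coshift_lim[OF F] Y0 dY groups_closed(2)])
  note L = g1[unfolded L2_lim_def, THEN conjunct1] g2[unfolded L2_lim_def, THEN conjunct1]
  have 1: "L2_lim \<mu> (\<lambda>t. V t (W t (\<lambda>x. (V t f x - f x) / complex_of_real t))) (\<lambda>x. complex_of_real (1 / 2) * h x) (at 0)"
    by (rule L2_lim_unitary[OF UV L2_lim_unitary[OF UW g1 Wc[OF L(1)]] Vc[OF L(1)]])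
  have 2: "L2_lim \<mu> (\<lambda>t. V t (\<lambda>x. (W t f x - f x) / complex_of_real t)) (\<lambda>x. complex_of_real (-1) * k x) (at 0)"
    by (rule L2_lim_unitary[OF UV g2 Vc[OF L(2)]])
  have lim: "L2_lim \<mu> (\<lambda>t x. V t (W t (\<lambda>x. (V t f x - f x) / complex_of_real t)) x + V t (\<lambda>x. (W t f x - f x) / complex_of_real t) x
      + (V t f x - f x) / complex_of_real t) (\<lambda>x. complex_of_real (1 / 2) * h x + complex_of_real (-1) * k x + complex_of_real (1 / 2) * h x) (at 0)"
    by (rule L2_lim_add[OF L2_lim_add[OF 1 2] g1])
  have rot: "AE x in \<mu>. \<pi> (rotation_group t) f x = V t (W t (V t f)) x" if "\<bar>t\<bar> < pi" for t
  proof -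
    have "AE x in \<mu>. \<pi> (rotation_group t) f x = V t (\<pi> (coshift_group (Y t) \<otimes>\<^bsub>H\<^esub> shift_group (X t)) f) x"
      unfolding rotation_eq_shears[OF that] V_def X_def Y_def by (intro rep_mult f) (auto simp: groups_closed)
    moreover have "AE x in \<mu>. V t (\<pi> (coshift_group (Y t) \<otimes>\<^bsub>H\<^esub> shift_group (X t)) f) x = V t (W t (V t f)) x"
    proof (rule unitary_cong_AE[OF UV])
      show "AE x in \<mu>. \<pi> (coshift_group (Y t) \<otimes>\<^bsub>H\<^esub> shift_group (X t)) f x = W t (V t f) x"
        unfolding V_def W_def by (intro rep_mult f) (auto simp: groups_closed)
      show "\<pi> (coshift_group (Y t) \<otimes>\<^bsub>H\<^esub> shift_group (X t)) f \<in> L2 \<mu>"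
        by (intro unitary_L2[OF rep_unitary] f) (auto simp: groups_closed)
      show "W t (V t f) \<in> L2 \<mu>" by (intro unitary_L2[OF UW] unitary_L2[OF UV] f)
    qed
    ultimately show ?thesis by eventually_elim simp
  qed
  have "L2_lim \<mu> (\<lambda>t x. (\<pi> (rotation_group t) f x - f x) / complex_of_real t) (\<lambda>x. complex_of_real (1 / 2) * h x + complex_of_real (-1) * k x + complex_of_real (1 / 2) * h x) (at 0)"
  proof (rule L2_lim_eventually[OF lim])
    show "(\<lambda>x. (\<pi> (rotation_group t) f x - f x) / complex_of_real t) \<in> L2 \<mu>" for t
      by (rule quotient_L2[OF rep_unitary[OF groups_closed(3)] f])
    show "\<forall>\<^sub>F t in at 0. AE x in \<mu>. V t (W t (\<lambda>x. (V t f x - f x) / complex_of_real t)) x + V t (\<lambda>x. (W t f x - f x) / complex_of_real t) x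
      + (V t f x - f x) / complex_of_real t = (\<pi> (rotation_group t) f x - f x) / complex_of_real t"
      using near
    proof eventually_elim
      case (elim t)
      then have "AE x in \<mu>. (V t (W t (V t f)) x - f x) / complex_of_real t = V t (W t (\<lambda>x. (V t f x - f x) / complex_of_real t)) x
          + V t (\<lambda>x. (W t f x - f x) / complex_of_real t) x + (V t f x - f x) / complex_of_real t"
        by (intro unitary_product_difference UV UW f) simp
      with rot[of t] elim show ?case by (auto elim!: eventually_elim2)
    qed
  qed
  moreover have "complex_of_real (1 / 2) * h x + complex_of_real (-1) * k x + complex_of_real (1 / 2) * h x =
      \<i> * (op_A F x + of_real \<rho> * F x) * complex_of_real (exp (- inner junit x))" for x
    unfolding op_C_eq[symmetric] h_def k_def f_def poly_exp_eq by (simp add: algebra_simps)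
  ultimately show ?thesis by (simp add: f_def)
qed

lemma rotation_eigenvector:
  assumes F: "F \<in> rpoly n" and A: "\<And>x. op_A F x = 2 * of_int k * F x"
  shows "AE x in \<mu>. \<pi> (rotation_group t) (poly_exp F) x = exp (\<i> * complex_of_real ((2 * of_int k + \<rho>) * t)) * poly_exp F x"
proof (rule eigenvector_of_generator)
  have f: "poly_exp F \<in> L2 \<mu>" by (rule poly_exp_L2[OF F])
  show "L2_unitary \<mu> (\<pi> (rotation_group t))" for t by (rule rep_unitary[OF groups_closed(3)])
  show "AE x in \<mu>. \<pi> (rotation_group (t + s)) (poly_exp F) x = \<pi> (rotation_group t) (\<pi> (rotation_group s) (poly_exp F)) x" for s t
    unfolding groups_add by (rule rep_mult[OF groups_closed(3) groups_closed(3) f])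
  show "AE x in \<mu>. \<pi> (rotation_group 0) (poly_exp F) x = poly_exp F x" unfolding groups_0 by (rule rep_one[OF f])
  have "(\<lambda>x. \<i> * (op_A F x + of_real \<rho> * F x) * complex_of_real (exp (- inner junit x))) =
      (\<lambda>x. \<i> * complex_of_real (2 * of_int k + \<rho>) * poly_exp F x)"
    by (simp add: A poly_exp_eq fun_eq_iff algebra_simps)
  then show "L2_lim \<mu> (\<lambda>t x. (\<pi> (rotation_group t) (poly_exp F) x - poly_exp F x) / complex_of_real t)
      (\<lambda>x. \<i> * complex_of_real (2 * of_int k + \<rho>) * poly_exp F x) (at 0)"
    using rotation_lim[OF F] by simp
  show "poly_exp F \<in> L2 \<mu>" by (rule f)
qed

abbreviation inversion :: "('a \<Rightarrow> complex) \<Rightarrow> 'a \<Rightarrow> complex" where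
  "inversion \<equiv> unitary_inversion H q \<pi>"

lemma inversion_eq: "inversion u x = exp (- (\<i> * complex_of_real (\<rho> * (pi / 2)))) * \<pi> (rotation_group (pi / 2)) u x"
  unfolding unitary_inversion_def cover_exp_rotation rho by (simp add: mult_ac)

lemma L2_unitary_inversion: "L2_unitary \<mu> inversion"
proof -
  define a where "a = exp (- (\<i> * complex_of_real (\<rho> * (pi / 2))))"
  define R where "R = \<pi> (rotation_group (pi / 2))"
  have a: "cmod a = 1" unfolding a_def by (simp add: norm_exp_eq_Re)
  then have aa: "a * cnj a = 1" using complex_norm_square[of a] by simp
  then have a0: "a \<noteq> 0" by auto
  have R: "L2_unitary \<mu> R" unfolding R_def by (rule rep_unitary[OF groups_closed(3)])
  have I: "inversion u = (\<lambda>x. a * R u x)" for u by (simp add: inversion_eq a_def R_def fun_eq_iff)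
  show ?thesis
    unfolding L2_unitary_def I
  proof (intro conjI ballI allI)
    fix f g :: "'a \<Rightarrow> complex" and p r assume f: "f \<in> L2 \<mu>" and g: "g \<in> L2 \<mu>"
    show "(\<lambda>x. a * R f x) \<in> L2 \<mu>" by (rule L2_scale[OF unitary_L2[OF R f]])
    show "AE x in \<mu>. a * R (\<lambda>y. p * f y + r * g y) x = p * (a * R f x) + r * (a * R g x)"
      using unitary_lin[OF R f g, of p r] by eventually_elim (simp add: algebra_simps)
    show "L2_inner \<mu> (\<lambda>x. a * R f x) (\<lambda>x. a * R g x) = L2_inner \<mu> f g"
      using unitary_L2[OF R f] unitary_L2[OF R g] aa
      by (simp add: L2_inner_scale_left L2_inner_scale_right L2_scale unitary_inner[OF R f g] mult.assoc[symmetric])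
    obtain w where w: "w \<in> L2 \<mu>" "AE x in \<mu>. R w x = g x" using R g by (auto simp: L2_unitary_def)
    have "AE x in \<mu>. R (\<lambda>y. (1 / a) * w y + 0 * w y) x = (1 / a) * R w x + 0 * R w x" by (rule unitary_lin[OF R w(1) w(1)])
    then have "AE x in \<mu>. a * R (\<lambda>y. (1 / a) * w y) x = g x"
      using w(2) by eventually_elim (use a0 in simp)
    then show "\<exists>f\<in>L2 \<mu>. AE x in \<mu>. a * R f x = g x" using L2_scale[OF w(1)] by blast
  qed
qed

lemma inversion_T_rel:
  "T_rel F F' \<Longrightarrow> AE x in \<mu>. inversion (poly_exp F) x = poly_exp F' x"
proof (induction rule: T_rel.induct)
  case (eig F n k)
  \<comment> \<open>The phase in front of the inversion removes the lowest weight
    \<open>\<rho>\<close>, so that at pi/2 only the sign (-1)^k remains.\<close>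
  have "exp (- (\<i> * complex_of_real (\<rho> * (pi / 2)))) * exp (\<i> * complex_of_real ((2 * of_int k + \<rho>) * (pi / 2)))
      = exp (\<i> * (of_int k * of_real pi))"
    unfolding exp_add[symmetric] by (rule arg_cong[of _ _ exp]) (simp add: algebra_simps)
  also have "\<dots> = (if even k then 1 else - 1)"
    using cis_conv_exp[of "pi * of_int k"] by (auto simp: cis.ctr complex_eq_iff mult.commute)
  finally have E: "exp (- (\<i> * complex_of_real (\<rho> * (pi / 2)))) * (exp (\<i> * complex_of_real ((2 * of_int k + \<rho>) * (pi / 2))) * z)
      = (if even k then 1 else - 1) * z" for z by (simp only: mult.assoc[symmetric])
  have P: "poly_exp (\<lambda>x. z * F x) x = z * poly_exp F x" for z x by (simp add: poly_exp_def)
  show ?case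
    using rotation_eigenvector[OF eig, of "pi / 2"] by eventually_elim (simp only: inversion_eq P E)
next
  case (add F F' G G')
  obtain n m where r: "F \<in> rpoly n" "G \<in> rpoly m" using T_rel_rpoly add.hyps by blast
  have "AE x in \<mu>. inversion (\<lambda>y. 1 * poly_exp F y + 1 * poly_exp G y) x = 1 * inversion (poly_exp F) x + 1 * inversion (poly_exp G) x"
    by (rule unitary_lin[OF L2_unitary_inversion poly_exp_L2[OF r(1)] poly_exp_L2[OF r(2)]])
  moreover have "(\<lambda>y. 1 * poly_exp F y + 1 * poly_exp G y) = poly_exp (\<lambda>x. F x + G x)" by (simp add: poly_exp_def fun_eq_iff algebra_simps)
  ultimately have "AE x in \<mu>. inversion (poly_exp (\<lambda>x. F x + G x)) x = inversion (poly_exp F) x + inversion (poly_exp G) x" by simp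
  then show ?case using add.IH
  proof eventually_elim
    case (elim x)
    then show ?case by (simp only:) (simp add: poly_exp_def algebra_simps)
  qed
qed

end

section \<open>The Bessel kernel\<close>

lemma fact_le_pochhammer: "a \<ge> 1 \<Longrightarrow> fact m \<le> pochhammer (a :: real) m"
proof (induction m)
  case (Suc m)
  have "fact m * (1 + real m) \<le> pochhammer a m * (a + real m)"
    using Suc by (intro mult_mono) (auto intro: order_trans[OF fact_ge_zero])
  then show ?case by (simp add: pochhammer_Suc mult.commute)
qed simp

text \<open>In HOL the square root is odd, so its square is the absolute value; this is why
  \<open>\<bar>s\<bar>\<close> occurs for arbitrary \<open>s\<close>.\<close>

lemma bessel_Jt_sums:
  assumes "l > 0"
  shows "(\<lambda>m. (- 1) ^ m * (\<bar>s\<bar> ^ m / (fact m * pochhammer l m))) sums (Gamma l * bessel_Jt (l - 1) (2 * sqrt s))"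
proof -
  have "(\<lambda>m. Gamma l * ((- 1) ^ m * rGamma (real m + (l - 1) + 1) / fact m * (2 * sqrt s / 2) ^ (2 * m))) sums (Gamma l * bessel_Jt (l - 1) (2 * sqrt s))"
    unfolding bessel_Jt_def by (intro sums_mult summable_sums summable_bessel_Jt)
  moreover have "Gamma l * ((- 1) ^ m * rGamma (real m + (l - 1) + 1) / fact m * (2 * sqrt s / 2) ^ (2 * m))
     = (- 1) ^ m * (\<bar>s\<bar> ^ m / (fact m * pochhammer l m))" for m
  proof -
    have "l \<notin> \<int>\<^sub>\<le>\<^sub>0" using assms nonpos_Ints_def by auto
    then have "pochhammer l m = Gamma (l + real m) / Gamma l" by (rule pochhammer_Gamma)
    moreover have "Gamma (l + real m) > 0" using assms by (intro Gamma_real_pos) auto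
    ultimately have 1: "Gamma l * rGamma (real m + (l - 1) + 1) = 1 / pochhammer l m"
      using Gamma_real_pos[OF assms] by (simp add: rGamma_inverse_Gamma divide_inverse add.commute)
    have 2: "(2 * sqrt s / 2) ^ (2 * m) = \<bar>s\<bar> ^ m"
      by (simp add: power_mult power2_eq_square)
    have 3: "Gamma l * ((- 1) ^ m * R / fact m * X) = (- 1) ^ m * (X / fact m * (Gamma l * R))" for R X by simp
    show ?thesis unfolding 2 unfolding 3 1 by simp
  qed
  ultimately show ?thesis by simp
qed

text \<open>The second factor in the denominator makes the series grow more slowly than any
  exponential, so half of the decay exp (- tr) can dominate it whatever the size of the other
  variable.\<close>

lemma bessel_Jt_partial_bound:
  fixes l \<epsilon> :: real
  assumes l: "l > 0" and \<epsilon>: "\<epsilon> > 0"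
  obtains C where "C \<ge> 0" "\<And>s N. s \<ge> 0 \<Longrightarrow> (\<Sum>m<N. s ^ m / (fact m * pochhammer l m)) \<le> C * exp (\<epsilon> * s)"
proof -
  \<comment> \<open>The exponential series at 1/\<epsilon> bounds 1/j! by exp (1/\<epsilon>)
    \<epsilon>^j, and l j! is a lower bound for the Pochhammer symbol of order j + 1; the maximum
    with 1 covers order 0.\<close>
  define C where "C = max 1 (exp (1 / \<epsilon>) / (\<epsilon> * l))"
  have C: "C \<ge> 1" unfolding C_def by (rule max.cobounded1)
  have pp: "pochhammer l m > 0" for m by (rule pochhammer_pos[OF l])
  have bound: "1 / pochhammer l m \<le> C * \<epsilon> ^ m" for m
  proof (cases m)
    case (Suc j)
    have "(1 / \<epsilon>) ^ j / fact j \<le> exp (1 / \<epsilon>)"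
    proof -
      have "(\<Sum>i\<in>{j}. (1 / \<epsilon>) ^ i /\<^sub>R fact i) \<le> (\<Sum>i. (1 / \<epsilon>) ^ i /\<^sub>R fact i)"
        using \<epsilon> by (intro sum_le_suminf summable_exp_generic) auto
      then show ?thesis by (simp add: exp_def divide_inverse mult.commute)
    qed
    moreover have "fact j \<le> pochhammer (l + 1) j" using l by (intro fact_le_pochhammer) simp
    then have "1 / pochhammer (l + 1) j \<le> 1 / fact j" by (intro divide_left_mono) (auto intro!: pochhammer_pos mult_pos_pos simp: l add_pos_pos)
    ultimately have "1 / pochhammer (l + 1) j \<le> exp (1 / \<epsilon>) * \<epsilon> ^ j"
    proof -
      assume "(1 / \<epsilon>) ^ j / fact j \<le> exp (1 / \<epsilon>)" and P: "1 / pochhammer (l + 1) j \<le> 1 / fact j"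
      then have "(1 / \<epsilon>) ^ j / fact j * \<epsilon> ^ j \<le> exp (1 / \<epsilon>) * \<epsilon> ^ j" using \<epsilon> by (intro mult_right_mono) auto
      moreover have "(1 / \<epsilon>) ^ j / fact j * \<epsilon> ^ j = 1 / fact j" using \<epsilon> by (simp add: power_divide)
      ultimately show ?thesis using P by linarith
    qed
    then have "1 / l * (1 / pochhammer (l + 1) j) \<le> 1 / l * (exp (1 / \<epsilon>) * \<epsilon> ^ j)" using l by (intro mult_left_mono) auto
    also have "1 / l * (exp (1 / \<epsilon>) * \<epsilon> ^ j) = (exp (1 / \<epsilon>) / (\<epsilon> * l)) * \<epsilon> ^ Suc j" using \<epsilon> by simp
    also have "\<dots> \<le> C * \<epsilon> ^ Suc j" using \<epsilon> by (intro mult_right_mono) (auto simp: C_def)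
    finally show ?thesis by (simp add: Suc pochhammer_rec)
  qed (simp add: C_def)
  show ?thesis
  proof (rule that)
    show "C \<ge> 0" using C by simp
    fix s :: real and N assume s: "s \<ge> 0"
    have "(\<Sum>m<N. s ^ m / (fact m * pochhammer l m)) \<le> (\<Sum>m<N. C * ((\<epsilon> * s) ^ m /\<^sub>R fact m))"
    proof (intro sum_mono)
      fix m
      have "s ^ m / fact m * (1 / pochhammer l m) \<le> s ^ m / fact m * (C * \<epsilon> ^ m)"
        using s by (intro mult_left_mono bound) auto
      then show "s ^ m / (fact m * pochhammer l m) \<le> C * ((\<epsilon> * s) ^ m /\<^sub>R fact m)"
        by (simp add: power_mult_distrib divide_inverse mult_ac)
    qed
    also have "\<dots> = C * (\<Sum>m<N. (\<epsilon> * s) ^ m /\<^sub>R fact m)" by (simp add: sum_distrib_left)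
    also have "\<dots> \<le> C * exp (\<epsilon> * s)"
      unfolding exp_def using C s \<epsilon> by (intro mult_left_mono sum_le_suminf summable_exp_generic) auto
    finally show "(\<Sum>m<N. s ^ m / (fact m * pochhammer l m)) \<le> C * exp (\<epsilon> * s)" .
  qed
qed

context minimal_inversion
begin

abbreviation bessel_kernel :: "'a \<Rightarrow> 'a \<Rightarrow> complex" where
  "bessel_kernel x y \<equiv> complex_of_real (bessel_Jt (jlambda TYPE('a) - 1) (2 * sqrt (inner x y)))"

text \<open>The equations of the orbit that hold almost everywhere; the computations with the kernel
  use these instead of membership in the orbit.\<close>

definition rank_one :: "'a \<Rightarrow> bool" where
  "rank_one x \<longleftrightarrow> (\<forall>v. blinfun_apply (jP x) v = inner x v *\<^sub>R x) \<and> norm x = inner junit x"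

lemma AE_rank_one': "AE x in \<mu>. rank_one x"
  using AE_rank_one unfolding tau_one
  by eventually_elim (auto simp: rank_one_def power2_eq_iff_nonneg)

text \<open>Pairing P(y) x = (y|x) y with x gives |x| |y| (x|y) = 2 |y x|^2 - (x|y)^2, and the
  Cauchy-Schwarz inequality for y x and x bounds |(x|y)| by |y x|.\<close>

lemma rank_one_inner_nonneg:
  assumes x: "rank_one x" and y: "rank_one y"
  shows "inner x y \<ge> 0"
proof (cases "x = 0 \<or> y = 0")
  case False
  have sq: "z \<star> z = norm z *\<^sub>R z" if "rank_one z" for z
  proof -
    have "blinfun_apply (jP z) junit = z \<star> z" by (simp add: jP_apply junit_right scaleR_2)
    then show ?thesis using that by (simp add: rank_one_def inner_commute)
  qed
  have yxx: "inner (y \<star> x) x = norm x * inner x y"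
    using sq[OF x] by (metis inner_jmult inner_scaleR_left inner_commute jmult_commute)
  have "blinfun_apply (jP y) x = inner y x *\<^sub>R y" using y by (simp add: rank_one_def)
  then have "2 *\<^sub>R (y \<star> (y \<star> x)) - norm y *\<^sub>R (y \<star> x) = inner y x *\<^sub>R y"
    unfolding jP_apply sq[OF y] by (simp add: jmult_simps)
  then have "inner (2 *\<^sub>R (y \<star> (y \<star> x)) - norm y *\<^sub>R (y \<star> x)) x = inner (inner y x *\<^sub>R y) x" by simp
  moreover have "inner (y \<star> (y \<star> x)) x = (norm (y \<star> x))\<^sup>2"
    unfolding inner_jmult[of y "y \<star> x" x] by (rule dot_square_norm)
  ultimately have eq: "2 * (norm (y \<star> x))\<^sup>2 - norm y * (norm x * inner x y) = (inner x y)\<^sup>2"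
    by (simp only: inner_diff_left inner_scaleR_left yxx power2_eq_square inner_commute[of y x])
  have "\<bar>norm x * inner x y\<bar> \<le> norm (y \<star> x) * norm x" using Cauchy_Schwarz_ineq2[of "y \<star> x" x] yxx by simp
  then have "\<bar>inner x y\<bar> \<le> norm (y \<star> x)" using False by (simp add: abs_mult mult.commute)
  then have "(inner x y)\<^sup>2 \<le> (norm (y \<star> x))\<^sup>2" using power_mono[of "\<bar>inner x y\<bar>" "norm (y \<star> x)" 2] by simp
  moreover have "0 \<le> (inner x y)\<^sup>2" by simp
  ultimately have "norm y * (norm x * inner x y) \<ge> 0" using eq by linarith
  then show ?thesis using False by (simp add: zero_le_mult_iff)
qed auto

lemma measurable_kernel: "bessel_kernel x \<in> borel_measurable \<mu>"
proof -
  have "(\<lambda>y::'a. bessel_Jt \<alpha> (2 * sqrt (inner x y))) \<in> borel_measurable borel" for \<alpha>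
    unfolding bessel_Jt_def
    by (intro borel_measurable_suminf borel_measurable_times borel_measurable_power borel_measurable_sqrt borel_measurable_const
        borel_measurable_inner borel_measurable_divide) auto
  from measurable_\<mu>[OF measurable_compose[OF this borel_measurable_of_real]] show ?thesis .
qed

lemma kernel_domination:
  fixes x :: 'a
  obtains C where "C \<ge> 0"
    "\<And>y N. (\<Sum>m<N. \<bar>inner x y\<bar> ^ m / (fact m * pochhammer (jlambda TYPE('a)) m)) \<le> C * exp (norm y / 2)"
    "\<And>y. cmod (of_real (Gamma (jlambda TYPE('a))) * bessel_kernel x y) \<le> C * exp (norm y / 2)"
proof -
  let ?l = "jlambda TYPE('a)"
  \<comment> \<open>Chosen so that \<epsilon> |(x|y)| is at most |y|/2, half of the available
    decay.\<close>
  define \<epsilon> where "\<epsilon> = 1 / (2 * (norm x + 1))"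
  have \<epsilon>: "\<epsilon> > 0" unfolding \<epsilon>_def by (simp add: add_nonneg_pos)
  obtain C where C: "C \<ge> 0" "\<And>s N. s \<ge> 0 \<Longrightarrow> (\<Sum>m<N. s ^ m / (fact m * pochhammer ?l m)) \<le> C * exp (\<epsilon> * s)"
    using bessel_Jt_partial_bound[OF lambda_pos \<epsilon>] by blast
  have b: "(\<Sum>m<N. \<bar>inner x y\<bar> ^ m / (fact m * pochhammer ?l m)) \<le> C * exp (norm y / 2)" for y N
  proof -
    have "\<epsilon> * \<bar>inner x y\<bar> \<le> \<epsilon> * ((norm x + 1) * norm y)"
      using \<epsilon> Cauchy_Schwarz_ineq2[of x y] by (intro mult_left_mono order_trans[OF Cauchy_Schwarz_ineq2] mult_right_mono) auto
    also have "\<epsilon> * ((norm x + 1) * norm y) = norm y / 2"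
    proof -
      have "norm x + 1 \<noteq> 0" using norm_ge_zero[of x] by linarith
      moreover have "1 / (2 * a) * (a * b) = b / 2" if "a \<noteq> 0" for a b :: real using that by simp
      ultimately show ?thesis unfolding \<epsilon>_def by blast
    qed
    finally have "C * exp (\<epsilon> * \<bar>inner x y\<bar>) \<le> C * exp (norm y / 2)" using C(1) by (intro mult_left_mono) auto
    then show ?thesis using C(2)[of "\<bar>inner x y\<bar>" N] by simp
  qed
  have "cmod (of_real (Gamma ?l) * bessel_kernel x y) \<le> C * exp (norm y / 2)" for y
  proof -
    have "(\<lambda>m. (- 1) ^ m * (\<bar>inner x y\<bar> ^ m / (fact m * pochhammer ?l m))) sums (Gamma ?l * bessel_Jt (?l - 1) (2 * sqrt (inner x y)))"
      by (rule bessel_Jt_sums[OF lambda_pos])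
    then have L: "(\<lambda>N. \<bar>\<Sum>m<N. (- 1) ^ m * (\<bar>inner x y\<bar> ^ m / (fact m * pochhammer ?l m))\<bar>) \<longlonglongrightarrow> \<bar>Gamma ?l * bessel_Jt (?l - 1) (2 * sqrt (inner x y))\<bar>"
      unfolding sums_def by (rule tendsto_rabs)
    have "\<bar>\<Sum>m<N. (- 1) ^ m * (\<bar>inner x y\<bar> ^ m / (fact m * pochhammer ?l m))\<bar> \<le> C * exp (norm y / 2)" for N
    proof -
      have "\<bar>\<Sum>m<N. (- 1) ^ m * (\<bar>inner x y\<bar> ^ m / (fact m * pochhammer ?l m))\<bar> \<le> (\<Sum>m<N. \<bar>(- 1) ^ m * (\<bar>inner x y\<bar> ^ m / (fact m * pochhammer ?l m))\<bar>)"
        by (rule sum_abs)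
      also have "\<dots> = (\<Sum>m<N. \<bar>inner x y\<bar> ^ m / (fact m * pochhammer ?l m))"
        using pochhammer_pos[OF lambda_pos] by (intro sum.cong refl) (simp add: abs_mult power_abs less_imp_le)
      finally show ?thesis using b[where y = y and N = N] by linarith
    qed
    then have "\<bar>Gamma ?l * bessel_Jt (?l - 1) (2 * sqrt (inner x y))\<bar> \<le> C * exp (norm y / 2)"
      by (intro LIMSEQ_le_const2[OF L]) blast
    then show ?thesis by (simp add: norm_mult abs_mult)
  qed
  then show ?thesis using that C(1) b by blast
qed

text \<open>Almost everywhere |y| = tr y, so the exponential growth uses up one half of exp (- tr)
  and the other half keeps the integral finite.\<close>

lemma integrable_dominating:
  assumes "F \<in> rpoly n"
  shows "integrable \<mu> (\<lambda>y. C * exp (norm y / 2) * cmod (poly_exp F y))"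
proof (rule Bochner_Integration.integrable_bound)
  show "integrable \<mu> (\<lambda>y. C * cmod (F y * complex_of_real (exp (- (1 / 2) * inner junit y))))"
    by (intro integrable_mult_right integrable_norm integrable_expint[OF assms]) simp
  show "(\<lambda>y. C * exp (norm y / 2) * cmod (poly_exp F y)) \<in> borel_measurable \<mu>"
  proof (intro borel_measurable_times)
    show "(\<lambda>y. exp (norm y / 2)) \<in> borel_measurable \<mu>"
      by (intro measurable_\<mu> borel_measurable_continuous_onI continuous_intros) simp
    show "(\<lambda>y. cmod (poly_exp F y)) \<in> borel_measurable \<mu>"
      by (rule measurable_compose[OF L2_measurable[OF poly_exp_L2[OF assms]] borel_measurable_norm])
  qed simp
  show "AE y in \<mu>. norm (C * exp (norm y / 2) * cmod (poly_exp F y)) \<le> norm (C * cmod (F y * complex_of_real (exp (- (1 / 2) * inner junit y))))"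
    using AE_rank_one'
  proof eventually_elim
    case (elim y)
    then have "norm y = inner junit y" by (simp add: rank_one_def)
    moreover have "exp (s / 2) * exp (- s) = exp (- (1 / 2) * s)" for s :: real by (simp flip: exp_add)
    ultimately show ?case by (simp add: poly_exp_eq norm_mult abs_mult mult_ac)
  qed
qed

lemma integrable_kernel:
  assumes F: "F \<in> rpoly n"
  shows "integrable \<mu> (\<lambda>y. bessel_kernel x y * poly_exp F y)"
proof -
  let ?l = "jlambda TYPE('a)"
  have G: "Gamma ?l > 0" by (rule Gamma_real_pos[OF lambda_pos])
  obtain C where C: "\<And>y. cmod (of_real (Gamma ?l) * bessel_kernel x y) \<le> C * exp (norm y / 2)" and C0: "C \<ge> 0"
    using kernel_domination[of x] by metis
  have "integrable \<mu> (\<lambda>y. of_real (Gamma ?l) * (bessel_kernel x y * poly_exp F y))"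
  proof (rule Bochner_Integration.integrable_bound[OF integrable_dominating[OF F, of C]])
    show "(\<lambda>y. of_real (Gamma ?l) * (bessel_kernel x y * poly_exp F y)) \<in> borel_measurable \<mu>"
      using L2_measurable[OF poly_exp_L2[OF F]] measurable_kernel by (intro borel_measurable_times borel_measurable_const)
    show "AE y in \<mu>. cmod (of_real (Gamma ?l) * (bessel_kernel x y * poly_exp F y)) \<le> norm (C * exp (norm y / 2) * cmod (poly_exp F y))"
    proof (rule AE_I2)
      fix y
      have "cmod (of_real (Gamma ?l) * bessel_kernel x y) * cmod (poly_exp F y) \<le> C * exp (norm y / 2) * cmod (poly_exp F y)"
        by (intro mult_right_mono C) simp
      then show "cmod (of_real (Gamma ?l) * (bessel_kernel x y * poly_exp F y)) \<le> norm (C * exp (norm y / 2) * cmod (poly_exp F y))"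
        using C0 by (simp add: norm_mult abs_mult mult.assoc)
    qed
  qed
  from integrable_mult_right[OF this, of "of_real (1 / Gamma ?l)"] show ?thesis using G by simp
qed

definition bessel_transform :: "('a \<Rightarrow> complex) \<Rightarrow> 'a \<Rightarrow> complex" where
  "bessel_transform u x = complex_of_real (2 powr (- \<rho>) * Gamma (jlambda TYPE('a))) * (LINT y|\<mu>. bessel_kernel x y * u y)"

lemma bessel_transform_lin:
  assumes "F \<in> rpoly n" "G \<in> rpoly m"
  shows "bessel_transform (poly_exp (\<lambda>x. a * F x + b * G x)) x = a * bessel_transform (poly_exp F) x + b * bessel_transform (poly_exp G) x"
proof -
  have "(LINT y|\<mu>. a * (bessel_kernel x y * poly_exp F y) + b * (bessel_kernel x y * poly_exp G y)) =
     a * (LINT y|\<mu>. bessel_kernel x y * poly_exp F y) + b * (LINT y|\<mu>. bessel_kernel x y * poly_exp G y)"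
    using integrable_kernel[OF assms(1), of x] integrable_kernel[OF assms(2), of x] by simp
  moreover have "a * (bessel_kernel x y * poly_exp F y) + b * (bessel_kernel x y * poly_exp G y) = bessel_kernel x y * poly_exp (\<lambda>x. a * F x + b * G x) y" for y
    by (simp add: poly_exp_def algebra_simps)
  ultimately show ?thesis by (simp add: bessel_transform_def algebra_simps)
qed

text \<open>Dominated convergence exchanges the kernel series with the integral, after which
  \<open>kern_sums\<close> evaluates the sum. The series has |(x|y)|, which almost everywhere is
  (x|y).\<close>

lemma bessel_transform_Gp:
  assumes x: "rank_one x"
  shows "bessel_transform (poly_exp (Gp vs)) x = poly_exp (\<lambda>x. (- 1) ^ length vs * Fp vs x) x"
proof -
  let ?l = "jlambda TYPE('a)"
  note G = Gp_in[of vs]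
  define f where "f m y = (- 1) ^ m * kern m x y * poly_exp (Gp vs) y" for m y
  have fm: "f m y = (- 1) ^ m * ((kern m x y * Gp vs y) * complex_of_real (exp (- 1 * inner junit y)))" for m y
    by (simp add: f_def poly_exp_eq)
  have fint: "integrable \<mu> (f m)" for m
    unfolding fm[abs_def] by (intro integrable_mult_right integrable_expint[OF rpoly_mult[OF kern_in G]]) simp
  have int_f: "(LINT y|\<mu>. f m y) = of_real (2 powr \<rho>) * ((- 1) ^ m * \<phi> (\<lambda>y. kern m x y * Gp vs y))" for m
    unfolding fm \<phi>_def expint_def by (simp add: powr_minus)
  obtain C where C: "C \<ge> 0" "\<And>y N. (\<Sum>m<N. \<bar>inner x y\<bar> ^ m / (fact m * pochhammer ?l m)) \<le> C * exp (norm y / 2)"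
    using kernel_domination[of x] by metis
  have A: "(\<lambda>N. LINT y|\<mu>. (\<Sum>m<N. f m y)) \<longlonglongrightarrow> (LINT y|\<mu>. of_real (Gamma ?l) * (bessel_kernel x y * poly_exp (Gp vs) y))"
  proof (rule integral_dominated_convergence)
    show "(\<lambda>y. of_real (Gamma ?l) * (bessel_kernel x y * poly_exp (Gp vs) y)) \<in> borel_measurable \<mu>"
      using L2_measurable[OF poly_exp_L2[OF G]] measurable_kernel by (intro borel_measurable_times borel_measurable_const)
    show "(\<lambda>y. \<Sum>m<N. f m y) \<in> borel_measurable \<mu>" for N
      using fint by (intro borel_measurable_sum borel_measurable_integrable)
    show "integrable \<mu> (\<lambda>y. C * exp (norm y / 2) * cmod (poly_exp (Gp vs) y))" by (rule integrable_dominating[OF G])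
    show "AE y in \<mu>. (\<lambda>N. \<Sum>m<N. f m y) \<longlonglongrightarrow> of_real (Gamma ?l) * (bessel_kernel x y * poly_exp (Gp vs) y)"
      using AE_rank_one'
    proof eventually_elim
      case (elim y)
      then have xy: "inner x y \<ge> 0" by (rule rank_one_inner_nonneg[OF x])
      have "(\<lambda>m. complex_of_real ((- 1) ^ m * (\<bar>inner x y\<bar> ^ m / (fact m * pochhammer ?l m))) * poly_exp (Gp vs) y) sums
          (of_real (Gamma ?l * bessel_Jt (?l - 1) (2 * sqrt (inner x y))) * poly_exp (Gp vs) y)"
        by (intro sums_mult2 sums_of_real bessel_Jt_sums[OF lambda_pos])
      moreover have "complex_of_real ((- 1) ^ m * (\<bar>inner x y\<bar> ^ m / (fact m * pochhammer ?l m))) * poly_exp (Gp vs) y = f m y" for m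
        using xy by (simp add: f_def kern_def ridge_def)
      ultimately show ?case by (simp add: sums_def mult.assoc)
    qed
    show "AE y in \<mu>. cmod (\<Sum>m<N. f m y) \<le> C * exp (norm y / 2) * cmod (poly_exp (Gp vs) y)" for N
    proof (rule AE_I2)
      fix y
      have "cmod (\<Sum>m<N. f m y) \<le> (\<Sum>m<N. cmod (f m y))" by (rule norm_sum)
      also have "\<dots> = (\<Sum>m<N. \<bar>inner x y\<bar> ^ m / (fact m * pochhammer ?l m)) * cmod (poly_exp (Gp vs) y)"
        unfolding sum_distrib_right using pochhammer_pos[OF lambda_pos]
        by (intro sum.cong refl) (simp add: f_def kern_def ridge_def norm_mult norm_power norm_divide less_imp_le)
      also have "\<dots> \<le> C * exp (norm y / 2) * cmod (poly_exp (Gp vs) y)" by (intro mult_right_mono C) simp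
      finally show "cmod (\<Sum>m<N. f m y) \<le> C * exp (norm y / 2) * cmod (poly_exp (Gp vs) y)" .
    qed
  qed
  have B: "(LINT y|\<mu>. (\<Sum>m<N. f m y)) = of_real (2 powr \<rho>) * (\<Sum>m<N. (- 1) ^ m * \<phi> (\<lambda>y. kern m x y * Gp vs y))" for N
    using fint by (simp add: int_f sum_distrib_left)
  have D: "(\<lambda>N. of_real (2 powr \<rho>) * (\<Sum>m<N. (- 1) ^ m * \<phi> (\<lambda>y. kern m x y * Gp vs y))) \<longlonglongrightarrow>
      of_real (2 powr \<rho>) * ((- 1) ^ length vs * Fp vs x * complex_of_real (exp (- inner junit x)))"
    using x by (intro tendsto_mult_left kern_sums[unfolded sums_def]) (simp add: rank_one_def)
  have "(LINT y|\<mu>. of_real (Gamma ?l) * (bessel_kernel x y * poly_exp (Gp vs) y)) =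
      of_real (2 powr \<rho>) * ((- 1) ^ length vs * Fp vs x * complex_of_real (exp (- inner junit x)))"
    by (rule LIMSEQ_unique[OF A[unfolded B] D])
  then show ?thesis unfolding integral_mult_right_zero
    by (simp add: bessel_transform_def poly_exp_eq powr_minus field_simps)
qed

lemma inversion_eq_bessel_transform:
  assumes "F \<in> rpoly n"
  shows "AE x in \<mu>. inversion (poly_exp F) x = bessel_transform (poly_exp F) x"
  using assms
proof (induction rule: rpoly_Gp_induct)
  case (lin F G a b n)
  have "AE x in \<mu>. inversion (\<lambda>y. a * poly_exp F y + b * poly_exp G y) x = a * inversion (poly_exp F) x + b * inversion (poly_exp G) x"
    by (rule unitary_lin[OF L2_unitary_inversion poly_exp_L2[OF lin(1)] poly_exp_L2[OF lin(2)]])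
  moreover have "(\<lambda>y. a * poly_exp F y + b * poly_exp G y) = poly_exp (\<lambda>x. a * F x + b * G x)" by (simp add: poly_exp_def fun_eq_iff algebra_simps)
  ultimately have "AE x in \<mu>. inversion (poly_exp (\<lambda>x. a * F x + b * G x)) x = a * inversion (poly_exp F) x + b * inversion (poly_exp G) x" by simp
  then show ?case using lin(3,4)
    by eventually_elim (simp only: bessel_transform_lin[OF lin(1,2)])
next
  case (Gp vs)
  show ?case using inversion_T_rel[OF T_rel_Gp[of vs]] AE_rank_one'
    by eventually_elim (simp only: bessel_transform_Gp)
qed

end

section \<open>Density of the polynomials times the exponential\<close>

lemma rpoly_cnj: "F \<in> rpoly n \<Longrightarrow> (\<lambda>x. cnj (F x)) \<in> rpoly n"
proof (induction rule: rpoly.induct)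
  case (step F k a w)
  then have "(\<lambda>x. cnj a * ridge k w x + cnj (F x)) \<in> rpoly n" by (intro rpoly.step)
  then show ?case by (simp add: ridge_def)
qed (simp add: rpoly.zero)

context minimal_inversion
begin

definition exp_poly :: "real \<Rightarrow> ('a \<Rightarrow> complex) \<Rightarrow> 'a \<Rightarrow> complex" where
  "exp_poly a F y = F y * of_real (exp (- a * inner junit y))"

lemma poly_exp_exp_poly: "poly_exp F = exp_poly 1 F"
  by (simp add: poly_exp_eq exp_poly_def fun_eq_iff)

lemma exp_poly_L2:
  assumes F: "F \<in> rpoly n" and a: "a > 0"
  shows "exp_poly a F \<in> L2 \<mu>"
proof (rule L2_I)
  show "exp_poly a F \<in> borel_measurable \<mu>"
    using borel_measurable_integrable[OF integrable_expint[OF F a]] by (simp add: exp_poly_def[abs_def])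
  have "(cmod (exp_poly a F y))\<^sup>2 = cmod ((F y * cnj (F y)) * of_real (exp (- (2 * a) * inner junit y)))" for y
  proof -
    have "(exp (- a * inner junit y))\<^sup>2 = exp (- (2 * a) * inner junit y)"
      by (simp add: power2_eq_square flip: exp_add)
    then show ?thesis by (simp add: exp_poly_def norm_mult power_mult_distrib) (simp add: power2_eq_square)
  qed
  then show "integrable \<mu> (\<lambda>y. (cmod (exp_poly a F y))\<^sup>2)"
    using integrable_norm[OF integrable_expint[OF rpoly_mult[OF F rpoly_cnj[OF F]], of "2 * a"]] a by simp
qed

definition approx :: "('a \<Rightarrow> complex) \<Rightarrow> bool" where
  "approx f \<longleftrightarrow> f \<in> L2 \<mu> \<and> (\<forall>\<epsilon>>0. \<exists>F n. F \<in> rpoly n \<and> L2_norm \<mu> (\<lambda>x. f x - poly_exp F x) < \<epsilon>)"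

lemma approx_poly_exp: "F \<in> rpoly n \<Longrightarrow> approx (poly_exp F)"
  unfolding approx_def using poly_exp_L2 by (force simp: L2_norm_def)

lemma approx_lim:
  assumes g: "\<And>i. approx (g i)" and f: "f \<in> L2 \<mu>" and lim: "(\<lambda>i. L2_norm \<mu> (\<lambda>x. g i x - f x)) \<longlonglongrightarrow> 0"
  shows "approx f"
  unfolding approx_def
proof (intro conjI f allI impI)
  fix \<epsilon> :: real assume \<epsilon>: "\<epsilon> > 0"
  have "\<forall>\<^sub>F i in sequentially. L2_norm \<mu> (\<lambda>x. g i x - f x) < \<epsilon> / 2"
    using order_tendstoD(2)[OF lim, of "\<epsilon> / 2"] \<epsilon> by simp
  then obtain i where "L2_norm \<mu> (\<lambda>x. g i x - f x) < \<epsilon> / 2"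
    using eventually_happens'[OF sequentially_bot] by blast
  then have 1: "L2_norm \<mu> (\<lambda>x. f x - g i x) < \<epsilon> / 2" by (subst L2_norm_minus)
  from g[of i] \<epsilon> obtain F n where F: "F \<in> rpoly n" "L2_norm \<mu> (\<lambda>x. g i x - poly_exp F x) < \<epsilon> / 2"
    unfolding approx_def by (meson half_gt_zero)
  have "g i \<in> L2 \<mu>" using g[of i] by (simp add: approx_def)
  from L2_norm_triangle_diff[OF f this poly_exp_L2[OF F(1)]] 1 F(2)
  show "\<exists>F n. F \<in> rpoly n \<and> L2_norm \<mu> (\<lambda>x. f x - poly_exp F x) < \<epsilon>" using F(1) by (intro exI[of _ F] exI[of _ n]) simp
qed

text \<open>Dominated convergence for squares: both the approximants and the limit are bounded by
  \<open>h\<close>, so the squared difference is at most 4 |h|^2.\<close>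

lemma approx_dominated:
  assumes g: "\<And>i. approx (g i)" and f: "f \<in> borel_measurable \<mu>"
    and h: "h \<in> L2 \<mu>" and bound: "\<And>i. AE x in \<mu>. cmod (g i x) \<le> cmod (h x)"
    and lim: "AE x in \<mu>. (\<lambda>i. g i x) \<longlonglongrightarrow> f x"
  shows "approx f"
proof (rule approx_lim[OF g])
  have gL: "g i \<in> L2 \<mu>" for i using g[of i] by (simp add: approx_def)
  have b: "AE x in \<mu>. \<forall>i. cmod (g i x) \<le> cmod (h x)" using bound by (simp add: AE_all_countable)
  have fb: "AE x in \<mu>. cmod (f x) \<le> cmod (h x)"
    using b lim
  proof eventually_elim
    case (elim x)
    then show ?case using LIMSEQ_le_const2[OF tendsto_norm[OF elim(2)], of "cmod (h x)"] by auto
  qed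
  show "f \<in> L2 \<mu>"
    by (rule L2_bound[OF f L2_integrable_sq[OF h]]) (use fb in \<open>auto elim!: eventually_mono intro: power_mono\<close>)
  have "(\<lambda>i. LINT x|\<mu>. (cmod (g i x - f x))\<^sup>2) \<longlonglongrightarrow> (LINT x|\<mu>. (0::real))"
  proof (rule integral_dominated_convergence)
    show "(\<lambda>x. (cmod (g i x - f x))\<^sup>2) \<in> borel_measurable \<mu>" for i
      using L2_measurable[OF gL[of i]] f by measurable
    show "integrable \<mu> (\<lambda>x. 4 * (cmod (h x))\<^sup>2)" using L2_integrable_sq[OF h] by simp
    show "AE x in \<mu>. (\<lambda>i. (cmod (g i x - f x))\<^sup>2) \<longlonglongrightarrow> 0"
      using lim
    proof eventually_elim
      case (elim x)
      then have "(\<lambda>i. (cmod (g i x - f x))\<^sup>2) \<longlonglongrightarrow> (cmod (f x - f x))\<^sup>2" by (intro tendsto_intros)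
      then show ?case by simp
    qed
    show "AE x in \<mu>. norm ((cmod (g i x - f x))\<^sup>2) \<le> 4 * (cmod (h x))\<^sup>2" for i
      using b fb
    proof eventually_elim
      case (elim x)
      then have "cmod (g i x - f x) \<le> 2 * cmod (h x)" using norm_triangle_ineq4[of "g i x" "f x"] elim(1)[rule_format, of i] by linarith
      then have "(cmod (g i x - f x))\<^sup>2 \<le> (2 * cmod (h x))\<^sup>2" by (intro power_mono) auto
      then show ?case by (simp add: power_mult_distrib)
    qed
  qed simp
  then show "(\<lambda>i. L2_norm \<mu> (\<lambda>x. g i x - f x)) \<longlonglongrightarrow> 0"
    unfolding L2_norm_def using tendsto_real_sqrt by fastforce
qed

lemma approx_lin:
  assumes f: "approx f" and g: "approx g"
  shows "approx (\<lambda>x. a * f x + b * g x)"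
proof -
  have L: "f \<in> L2 \<mu>" "g \<in> L2 \<mu>" using f g by (auto simp: approx_def)
  have "\<exists>F n. F \<in> rpoly n \<and> L2_norm \<mu> (\<lambda>x. (a * f x + b * g x) - poly_exp F x) < \<epsilon>" if \<epsilon>: "\<epsilon> > 0" for \<epsilon>
  proof -
    define \<delta> where "\<delta> = \<epsilon> / (cmod a + cmod b + 1)"
    have ab: "cmod a + cmod b + 1 > 0" by (simp add: add_nonneg_pos)
    then have \<delta>: "\<delta> > 0" using \<epsilon> by (simp add: \<delta>_def)
    obtain F n G m where F: "F \<in> rpoly n" "L2_norm \<mu> (\<lambda>x. f x - poly_exp F x) < \<delta>"
      and G: "G \<in> rpoly m" "L2_norm \<mu> (\<lambda>x. g x - poly_exp G x) < \<delta>"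
      using f g \<delta> unfolding approx_def by meson
    have FG: "(\<lambda>x. a * F x + b * G x) \<in> rpoly (max n m)"
      using F(1) G(1) by (intro rpoly_add rpoly_scale) (auto intro: rpoly_mono)
    have "L2_norm \<mu> (\<lambda>x. a * (f x - poly_exp F x) + b * (g x - poly_exp G x)) \<le> cmod a * L2_norm \<mu> (\<lambda>x. f x - poly_exp F x) + cmod b * L2_norm \<mu> (\<lambda>x. g x - poly_exp G x)"
      using L2_norm_triangle[OF L2_scale[OF L2_diff[OF L(1) poly_exp_L2[OF F(1)]], of a] L2_scale[OF L2_diff[OF L(2) poly_exp_L2[OF G(1)]], of b]]
      by (simp only: L2_norm_scale)
    also have "\<dots> \<le> cmod a * \<delta> + cmod b * \<delta>" using F G by (intro add_mono mult_left_mono) auto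
    also have "\<dots> < (cmod a + cmod b + 1) * \<delta>" using \<delta> by (simp add: algebra_simps)
    also have "\<dots> = \<epsilon>" using ab by (simp add: \<delta>_def)
    finally have "L2_norm \<mu> (\<lambda>x. a * (f x - poly_exp F x) + b * (g x - poly_exp G x)) < \<epsilon>" .
    moreover have "a * (f x - poly_exp F x) + b * (g x - poly_exp G x) = (a * f x + b * g x) - poly_exp (\<lambda>x. a * F x + b * G x) x" for x
      by (simp add: poly_exp_def algebra_simps)
    ultimately show ?thesis using FG by auto
  qed
  then show ?thesis using L2_lin[OF L] by (simp add: approx_def)
qed

lemma approx_cong:
  assumes f: "approx f" and eq: "\<And>x. x \<in> space \<mu> \<Longrightarrow> f x = g x"
  shows "approx g"
proof -
  have "g \<in> borel_measurable \<mu>"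
    using f eq measurable_cong[of \<mu> f g borel] by (auto simp: approx_def L2_def)
  then show ?thesis
    by (intro approx_dominated[OF f, of g f]) (use f eq in \<open>auto simp: approx_def\<close>)
qed

text \<open>The Taylor series of \<open>exp (- tr / 2)\<close> converges after multiplication by \<open>exp (- tr)\<close>, so the
  decay can be increased in steps of \<open>1/2\<close>.\<close>

lemma approx_exp_poly: "F \<in> rpoly n \<Longrightarrow> approx (exp_poly (1 + real k / 2) F)"
proof (induction k arbitrary: F n)
  case 0
  then show ?case using approx_poly_exp[OF 0] by (simp add: poly_exp_exp_poly)
next
  case (Suc k)
  let ?a = "1 + real k / 2"
  \<comment> \<open>\<open>F\<close> times the Taylor polynomials of exp (- tr/2).\<close>
  define FN where "FN N y = (\<Sum>j<N. (1 / fact j) * (ridge j (- (1/2) *\<^sub>R junit) y * F y))" for N y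
  have FN: "FN N \<in> rpoly (N + n)" for N
    unfolding FN_def[abs_def] by (intro rpoly_sum rpoly_scale rpoly_mult_le[OF rpoly_ridge1[OF order_refl] Suc.prems]) simp
  have ex: "1 / fact j * ridge j (- (1/2) *\<^sub>R junit) y = complex_of_real ((- (inner junit y / 2)) ^ j /\<^sub>R fact j)" for j and y :: 'a
    by (simp add: ridge_def field_simps)
  have FNe: "exp_poly ?a (FN N) y = of_real (\<Sum>j<N. (- (inner junit y / 2)) ^ j /\<^sub>R fact j) * exp_poly ?a F y" for N y
    unfolding FN_def exp_poly_def of_real_sum sum_distrib_right mult.assoc[symmetric] ex ..
  show ?case
  \<comment> \<open>The Taylor polynomials are bounded by exp (tr/2), which costs 1/2 of the rate 1
    + k/2 and leaves a positive rate for the dominating function.\<close>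
  proof (rule approx_dominated[where g = "\<lambda>N. exp_poly ?a (FN N)" and h = "exp_poly (1 / 2 + real k / 2) F"])
    show "approx (exp_poly ?a (FN N))" for N by (rule Suc.IH[OF FN])
    show "exp_poly (1 + real (Suc k) / 2) F \<in> borel_measurable \<mu>"
      by (rule L2_measurable[OF exp_poly_L2[OF Suc.prems]]) (intro add_pos_nonneg, auto)
    show "exp_poly (1 / 2 + real k / 2) F \<in> L2 \<mu>" by (rule exp_poly_L2[OF Suc.prems]) (simp add: add_pos_nonneg)
    have e: "exp (- (inner junit y / 2)) * exp (- ?a * inner junit y) = exp (- (1 + real (Suc k) / 2) * inner junit y)" for y :: 'a
      unfolding exp_add[symmetric] by (rule arg_cong[of _ _ exp]) (simp add: field_simps)
    have "(\<lambda>N. exp_poly ?a (FN N) y) \<longlonglongrightarrow> exp_poly (1 + real (Suc k) / 2) F y" for y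
    proof -
      have "(\<lambda>N. exp_poly ?a (FN N) y) \<longlonglongrightarrow> of_real (exp (- (inner junit y / 2))) * exp_poly ?a F y"
        unfolding FNe using exp_converges[of "- (inner junit y / 2)"] unfolding sums_def by (intro tendsto_intros)
      also have "of_real (exp (- (inner junit y / 2))) * exp_poly ?a F y = exp_poly (1 + real (Suc k) / 2) F y"
        unfolding exp_poly_def e[symmetric] of_real_mult by (simp only: mult_ac)
      finally show ?thesis .
    qed
    then show "AE y in \<mu>. (\<lambda>N. exp_poly ?a (FN N) y) \<longlonglongrightarrow> exp_poly (1 + real (Suc k) / 2) F y" by simp
    show "AE y in \<mu>. cmod (exp_poly ?a (FN N) y) \<le> cmod (exp_poly (1 / 2 + real k / 2) F y)" for N
      using AE_rank_one'
    proof eventually_elim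
      case (elim y)
      then have t: "inner junit y \<ge> 0" unfolding rank_one_def by (metis norm_ge_zero)
      have "\<bar>\<Sum>j<N. (- (inner junit y / 2)) ^ j /\<^sub>R fact j\<bar> \<le> (\<Sum>j<N. \<bar>(- (inner junit y / 2)) ^ j /\<^sub>R fact j\<bar>)" by (rule sum_abs)
      also have "\<dots> = (\<Sum>j<N. (inner junit y / 2) ^ j /\<^sub>R fact j)" using t by (intro sum.cong refl) (simp add: abs_mult power_abs)
      also have "\<dots> \<le> exp (inner junit y / 2)"
        unfolding exp_def using t by (intro sum_le_suminf summable_exp_generic) auto
      finally have "cmod (exp_poly ?a (FN N) y) \<le> exp (inner junit y / 2) * cmod (exp_poly ?a F y)"
        unfolding FNe norm_mult norm_of_real by (rule mult_right_mono) simp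
      also have "\<dots> = cmod (F y) * (exp (inner junit y / 2) * exp (- ?a * inner junit y))"
        unfolding exp_poly_def norm_mult norm_of_real abs_exp_cancel by (simp only: mult_ac)
      also have "exp (inner junit y / 2) * exp (- ?a * inner junit y) = exp (- (1 / 2 + real k / 2) * inner junit y)"
        unfolding exp_add[symmetric] by (rule arg_cong[of _ _ exp]) (simp add: field_simps)
      finally show ?case unfolding exp_poly_def norm_mult norm_of_real abs_exp_cancel .
    qed
  qed
qed

text \<open>The rate 0 is included, so that constants belong to this algebra; square integrability
  is restored later by the factor \<open>exp_trace\<close>.\<close>

inductive_set exp_polys :: "('a \<Rightarrow> complex) set" where
  base: "F \<in> rpoly n \<Longrightarrow> exp_poly (real k / 2) F \<in> exp_polys"
| add: "f \<in> exp_polys \<Longrightarrow> g \<in> exp_polys \<Longrightarrow> (\<lambda>y. f y + g y) \<in> exp_polys"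

lemma exp_polys_mult:
  assumes "f \<in> exp_polys" "g \<in> exp_polys"
  shows "(\<lambda>y. f y * g y) \<in> exp_polys"
proof -
  have 1: "(\<lambda>y. exp_poly (real k / 2) F y * g y) \<in> exp_polys" if "g \<in> exp_polys" "F \<in> rpoly n" for g F n k
    using that
  proof (induction rule: exp_polys.induct)
    case (base G m j)
    have e: "exp (- (real k / 2) * t) * exp (- (real j / 2) * t) = exp (- (real (k + j) / 2) * t)" for t
      unfolding exp_add[symmetric] by (rule arg_cong[of _ _ exp]) (simp add: field_simps)
    have "exp_poly (real k / 2) F y * exp_poly (real j / 2) G y = exp_poly (real (k + j) / 2) (\<lambda>x. F x * G x) y" for y
      unfolding exp_poly_def e[symmetric] of_real_mult by (simp only: mult_ac)
    then show ?case using exp_polys.base[OF rpoly_mult[OF base(2,1)], of "k + j"] by simp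
  next
    case (add f g)
    then show ?case using exp_polys.add by (simp add: distrib_left)
  qed
  show ?thesis using assms(1)
  proof (induction rule: exp_polys.induct)
    case (base F n k)
    then show ?case using 1[OF assms(2)] by simp
  next
    case (add f f')
    then show ?case using exp_polys.add by (simp add: distrib_right)
  qed
qed

text \<open>Polynomials in the coordinates of the bounded map \<open>y \<mapsto> (exp (- tr y / 2), exp (- tr y / 2) y)\<close> are
  combinations of polynomials with exponential factors; as its image is relatively compact, the
  Weierstrass theorem applies.\<close>

definition proj :: "'a \<Rightarrow> real \<times> 'a" where
  "proj y = (exp (- inner junit y / 2), exp (- inner junit y / 2) *\<^sub>R y)"

lemma exp_polys_polynomial:
  fixes Q :: "real \<times> 'a \<Rightarrow> real"
  assumes "real_polynomial_function Q"
  shows "(\<lambda>y. complex_of_real (Q (proj y))) \<in> exp_polys"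
  using assms
proof (induction rule: real_polynomial_function.induct)
  case (linear f)
  interpret f: bounded_linear f by (rule linear)
  define w where "w = (\<Sum>b\<in>Basis. f (0, b) *\<^sub>R b)"
  have w: "f (0, z) = inner w z" for z :: 'a
  proof -
    have lin: "linear (\<lambda>z. f (0, z))"
    proof (rule linearI)
      show "f (0, x + y) = f (0, x) + f (0, y)" for x y :: 'a using f.add[of "(0, x)" "(0, y)"] by simp
      show "f (0, r *\<^sub>R x) = r *\<^sub>R f (0, x)" for r and x :: 'a using f.scaleR[of r "(0, x)"] by simp
    qed
    have "f (0, z) = f (0, \<Sum>b\<in>Basis. inner z b *\<^sub>R b)" by (simp add: euclidean_representation)
    also have "\<dots> = (\<Sum>b\<in>Basis. inner z b *\<^sub>R f (0, b))"
      using linear_sum[OF lin, of "\<lambda>b. inner z b *\<^sub>R b" Basis] by (simp add: linear_cmul[OF lin])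
    finally show ?thesis by (simp add: w_def inner_sum_left inner_commute[of z] mult.commute)
  qed
  have f: "f (s, z) = s * f (1, 0) + inner w z" for s and z :: 'a
    using f.add[of "(s, 0)" "(0, z)"] f.scaleR[of s "(1, 0)"] by (simp add: w)
  have "f (proj y) = (f (1, 0) + inner w y) * exp (- (real 1 / 2) * inner junit y)" for y
    using f[of "exp (- inner junit y / 2)" "exp (- inner junit y / 2) *\<^sub>R y"] by (simp add: proj_def distrib_right)
  then have "complex_of_real (f (proj y)) = exp_poly (real 1 / 2) (\<lambda>y. of_real (f (1, 0)) + ridge 1 w y) y" for y
    by (simp add: exp_poly_def ridge_def)
  moreover have "(\<lambda>y. of_real (f (1, 0)) + ridge 1 w y) \<in> rpoly 1" by (intro rpoly_add rpoly_const rpoly_ridge1 order_refl)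
  ultimately show ?case using exp_polys.base[of _ 1 1] by simp
next
  case (const a)
  then show ?case using exp_polys.base[OF rpoly_const[of "of_real a" 0], of 0] by (simp add: exp_poly_def[abs_def])
qed (simp_all add: exp_polys.add exp_polys_mult)

lemma approx_exp_polys: "f \<in> exp_polys \<Longrightarrow> approx (\<lambda>y. f y * exp_poly 1 (\<lambda>y. 1) y)"
proof (induction rule: exp_polys.induct)
  case (base F n k)
  have e: "exp (- (real k / 2) * t) * exp (- 1 * t) = exp (- (1 + real k / 2) * t)" for t
    unfolding exp_add[symmetric] by (rule arg_cong[of _ _ exp]) (simp add: field_simps)
  have "exp_poly (real k / 2) F y * exp_poly 1 (\<lambda>y. 1) y = exp_poly (1 + real k / 2) F y" for y
    unfolding exp_poly_def e[symmetric] of_real_mult by (simp only: mult_1_left mult.assoc)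
  then show ?case using approx_exp_poly[OF base, of k] by simp
next
  case (add f g)
  then show ?case using approx_lin[OF add.IH, of 1 1] by (simp add: distrib_right)
qed

abbreviation exp_trace :: "'a \<Rightarrow> complex" where "exp_trace \<equiv> exp_poly 1 (\<lambda>y. 1)"

lemma exp_trace_L2: "exp_trace \<in> L2 \<mu>"
  by (rule exp_poly_L2[OF rpoly_const]) simp

lemma approx_exp_trace: "approx exp_trace"
  using approx_poly_exp[OF rpoly_const[of 1 0]] by (simp add: poly_exp_exp_poly)

lemma measurable_proj: "proj \<in> borel_measurable borel"
  unfolding proj_def[abs_def] by (intro borel_measurable_continuous_onI continuous_intros) simp_all

lemma measurable_proj_exp_trace:
  assumes "h \<in> borel_measurable borel"
  shows "(\<lambda>y. complex_of_real (h (proj y)) * exp_trace y) \<in> borel_measurable \<mu>"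
  using measurable_\<mu>[OF measurable_compose[OF measurable_compose[OF measurable_proj assms] borel_measurable_of_real]]
    L2_measurable[OF exp_trace_L2] by (rule borel_measurable_times)

lemma approx_continuous:
  fixes h :: "real \<times> 'a \<Rightarrow> real"
  assumes h: "continuous_on UNIV h" "\<And>p. \<bar>h p\<bar> \<le> 1"
  shows "approx (\<lambda>y. complex_of_real (h (proj y)) * exp_trace y)"
proof -
  \<comment> \<open>Contains almost all values of \<open>proj\<close>: there |y| = tr y = t, and t
    exp (- t/2) is at most 2.\<close>
  let ?K = "{0..1::real} \<times> cball (0::'a) 2"
  have "\<exists>Q. real_polynomial_function Q \<and> (\<forall>p\<in>?K. \<bar>h p - Q p\<bar> < 1 / real (Suc i))" for i
    by (rule Stone_Weierstrass_real_polynomial_function[of ?K h "1 / real (Suc i)"])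
       (use h in \<open>auto intro: continuous_on_subset compact_Times\<close>)
  then obtain Q where Q: "\<And>i. real_polynomial_function (Q i)" "\<And>i p. p \<in> ?K \<Longrightarrow> \<bar>h p - Q i p\<bar> < 1 / real (Suc i)" by metis
  have K: "AE y in \<mu>. proj y \<in> ?K"
    using AE_rank_one'
  proof eventually_elim
    case (elim y)
    then have n: "norm y = inner junit y" by (simp add: rank_one_def)
    then have t: "inner junit y \<ge> 0" by (metis norm_ge_zero)
    have "norm y \<le> 2 * exp (inner junit y / 2)" using exp_ge_add_one_self[of "inner junit y / 2"] n by linarith
    then have "exp (- inner junit y / 2) * norm y \<le> exp (- inner junit y / 2) * (2 * exp (inner junit y / 2))" by (intro mult_left_mono) auto
    moreover have "exp (- s / 2) * (2 * exp (s / 2)) = 2" for s :: real by (simp add: exp_minus)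
    ultimately have "exp (- inner junit y / 2) * norm y \<le> 2" by (simp only:)
    then show ?case using t by (simp add: proj_def)
  qed
  show ?thesis
  proof (rule approx_dominated[where g = "\<lambda>i y. complex_of_real (Q i (proj y)) * exp_trace y" and h = "\<lambda>y. 2 * exp_trace y"])
    show "approx (\<lambda>y. complex_of_real (Q i (proj y)) * exp_trace y)" for i
      by (rule approx_exp_polys[OF exp_polys_polynomial[OF Q(1)]])
    show "(\<lambda>y. complex_of_real (h (proj y)) * exp_trace y) \<in> borel_measurable \<mu>"
      by (intro measurable_proj_exp_trace borel_measurable_continuous_onI h)
    show "(\<lambda>y. 2 * exp_trace y) \<in> L2 \<mu>" by (rule L2_scale[OF exp_trace_L2])
    show "AE y in \<mu>. cmod (complex_of_real (Q i (proj y)) * exp_trace y) \<le> cmod (2 * exp_trace y)" for i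
      using K
    proof eventually_elim
      case (elim y)
      have "1 / real (Suc i) \<le> 1" by simp
      then have "\<bar>Q i (proj y)\<bar> \<le> 2" using Q(2)[OF elim, of i] h(2)[of "proj y"] by linarith
      then show ?case by (simp add: norm_mult mult_right_mono)
    qed
    show "AE y in \<mu>. (\<lambda>i. complex_of_real (Q i (proj y)) * exp_trace y) \<longlonglongrightarrow> complex_of_real (h (proj y)) * exp_trace y"
      using K
    proof eventually_elim
      case (elim y)
      have "(\<lambda>i. 1 / real (Suc i)) \<longlonglongrightarrow> 0" using LIMSEQ_inverse_real_of_nat by (simp add: inverse_eq_divide)
      moreover have "\<forall>\<^sub>F i in sequentially. norm (Q i (proj y) - h (proj y)) \<le> 1 / real (Suc i)"
        using Q(2)[OF elim] by (intro always_eventually allI) (simp add: abs_minus_commute less_imp_le)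
      ultimately have "(\<lambda>i. Q i (proj y) - h (proj y)) \<longlonglongrightarrow> 0" by (rule Lim_null_comparison[rotated])
      then have "(\<lambda>i. Q i (proj y)) \<longlonglongrightarrow> h (proj y)" by (simp add: LIM_zero_iff)
      then show ?case by (intro tendsto_intros)
    qed
  qed
qed

lemma approx_indicator_closed:
  fixes B :: "(real \<times> 'a) set"
  assumes B: "closed B"
  shows "approx (\<lambda>y. complex_of_real (indicator B (proj y)) * exp_trace y)"
proof (cases "B = {}")
  case True
  then show ?thesis using approx_lin[OF approx_exp_trace approx_exp_trace, of 0 0] by simp
next
  case False
  \<comment> \<open>Continuous functions with values in [0, 1] that tend pointwise to the indicator
    of the closed set.\<close>
  define h where "h n p = max 0 (1 - real n * infdist p B)" for n p
  show ?thesis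
  proof (rule approx_dominated[where g = "\<lambda>n y. complex_of_real (h n (proj y)) * exp_trace y" and h = exp_trace])
    have h01: "\<bar>h n p\<bar> \<le> 1" for n p using infdist_nonneg[of p B] by (auto simp: h_def max_def)
    show "approx (\<lambda>y. complex_of_real (h n (proj y)) * exp_trace y)" for n
      by (rule approx_continuous[OF _ h01]) (auto simp: h_def[abs_def] intro!: continuous_intros)
    show "(\<lambda>y. complex_of_real (indicator B (proj y)) * exp_trace y) \<in> borel_measurable \<mu>"
      using borel_closed[OF B] by (intro measurable_proj_exp_trace) simp
    show "exp_trace \<in> L2 \<mu>" by (rule exp_trace_L2)
    show "AE y in \<mu>. cmod (complex_of_real (h n (proj y)) * exp_trace y) \<le> cmod (exp_trace y)" for n
      using h01 by (intro AE_I2) (simp add: norm_mult mult_left_le_one_le)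
    have "(\<lambda>n. h n p) \<longlonglongrightarrow> indicator B p" for p
    proof (cases "p \<in> B")
      case True
      then show ?thesis by (simp add: h_def)
    next
      case False
      then have pos: "infdist p B > 0" using infdist_pos_not_in_closed[OF B \<open>B \<noteq> {}\<close>] by blast
      have "\<forall>\<^sub>F n in sequentially. real n > 1 / infdist p B" using eventually_gt_at_top[of "nat \<lceil>1 / infdist p B\<rceil>"]
        by eventually_elim linarith
      then have "\<forall>\<^sub>F n in sequentially. h n p = 0"
        by eventually_elim (use pos in \<open>simp add: h_def field_simps max_def\<close>)
      then show ?thesis using False by (simp add: tendsto_eventually)
    qed
    then have "(\<lambda>n. complex_of_real (h n (proj y)) * exp_trace y) \<longlonglongrightarrow> complex_of_real (indicator B (proj y)) * exp_trace y" for y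
      by (intro tendsto_intros)
    then show "AE y in \<mu>. (\<lambda>n. complex_of_real (h n (proj y)) * exp_trace y) \<longlonglongrightarrow> complex_of_real (indicator B (proj y)) * exp_trace y" by simp
  qed
qed

text \<open>Closed sets are stable under intersection and generate the Borel sets, so the class of
  approximable sets need only be closed under complements and disjoint unions.\<close>

lemma approx_indicator:
  fixes B :: "(real \<times> 'a) set"
  assumes "B \<in> sets borel"
  shows "approx (\<lambda>y. complex_of_real (indicator B (proj y)) * exp_trace y)"
proof -
  have "Int_stable (Collect closed :: (real \<times> 'a) set set)" by (auto simp: Int_stable_def)
  moreover have "Collect closed \<subseteq> Pow (UNIV :: (real \<times> 'a) set)" by simp
  moreover have "B \<in> sigma_sets UNIV (Collect closed)" using assms by (simp add: borel_eq_closed)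
  ultimately show ?thesis
  proof (induction rule: sigma_sets_induct_disjoint)
    case (basic B)
    then show ?case using approx_indicator_closed by simp
  next
    case empty
    then show ?case using approx_indicator_closed[OF closed_empty] by simp
  next
    case (compl B)
    have "complex_of_real (indicator (UNIV - B) p) * z = 1 * z + (- 1) * (complex_of_real (indicator B p) * z)" for p z
      by (simp add: indicator_def)
    then show ?case using approx_lin[OF approx_exp_trace compl.IH, of 1 "-1"] by simp
  next
    case (union A)
    have m: "A i \<in> sets borel" for i using union by (auto simp: borel_eq_closed)
    have d: "A i \<inter> A j = {}" if "i \<noteq> j" for i j using union(1) that by (auto simp: disjoint_family_on_def)
    define g where "g N y = complex_of_real (\<Sum>i<N. indicator (A i) (proj y)) * exp_trace y" for N y
    have s: "(\<lambda>i. indicator (A i) p :: real) sums indicator (\<Union>i. A i) p" for p by (rule indicator_sums[OF d])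
    show ?case
    proof (rule approx_dominated[where g = g and h = exp_trace])
      show "approx (g N)" for N
      proof (induction N)
        case 0
        then show ?case using approx_lin[OF approx_exp_trace approx_exp_trace, of 0 0] by (simp add: g_def[abs_def])
      next
        case (Suc N)
        then show ?case using approx_lin[OF Suc union.IH[of N], of 1 1] by (simp add: g_def[abs_def] distrib_right)
      qed
      show "(\<lambda>y. complex_of_real (indicator (\<Union>i. A i) (proj y)) * exp_trace y) \<in> borel_measurable \<mu>"
        using m by (intro measurable_proj_exp_trace) simp
      have "\<bar>\<Sum>i<N. indicator (A i) p\<bar> \<le> (1::real)" for N p
      proof -
        have "(\<Sum>i<N. indicator (A i) p :: real) \<le> indicator (\<Union>i. A i) p"
          using sum_le_suminf[OF sums_summable[OF s], of "{..<N}" p] sums_unique[OF s, of p] by simp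
        also have "\<dots> \<le> 1" by (simp add: indicator_def)
        finally show ?thesis by (simp add: sum_nonneg)
      qed
      then show "AE y in \<mu>. cmod (g N y) \<le> cmod (exp_trace y)" for N
        by (intro AE_I2) (simp add: g_def norm_mult mult_left_le_one_le del: of_real_sum)
      have "(\<lambda>N. g N y) \<longlonglongrightarrow> complex_of_real (indicator (\<Union>i. A i) (proj y)) * exp_trace y" for y
        unfolding g_def using s[unfolded sums_def] by (intro tendsto_intros)
      then show "AE y in \<mu>. (\<lambda>N. g N y) \<longlonglongrightarrow> complex_of_real (indicator (\<Union>i. A i) (proj y)) * exp_trace y" by simp
    qed (rule exp_trace_L2)
  qed
qed

lemma approx_nonneg:
  assumes "u \<in> borel_measurable \<mu>" "\<And>x. 0 \<le> u x"
  shows "(\<lambda>y. complex_of_real (u y) * exp_trace y) \<in> L2 \<mu> \<Longrightarrow> approx (\<lambda>y. complex_of_real (u y) * exp_trace y)"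
  using assms
proof (induction rule: borel_measurable_induct_real)
  case (set A)
  then obtain A' where A': "A' \<in> sets borel" "A = orbit c \<inter> A'" by (auto simp: sets_\<mu> sets_restrict_space)
  \<comment> \<open>The point \<open>y\<close> is recovered from \<open>proj y\<close> as the second
    component divided by the first, which is positive. So every measurable subset of the orbit is a
    preimage under \<open>proj\<close>.\<close>
  define B where "B = (\<lambda>p::real \<times> 'a. (1 / fst p) *\<^sub>R snd p) -` A'"
  have "B \<in> sets borel"
  proof -
    have "(fst :: real \<times> 'a \<Rightarrow> real) \<in> borel_measurable borel" "(snd :: real \<times> 'a \<Rightarrow> 'a) \<in> borel_measurable borel"
      by (intro borel_measurable_continuous_onI continuous_on_fst continuous_on_snd continuous_on_id)+
    then have "(\<lambda>p::real \<times> 'a. (1 / fst p) *\<^sub>R snd p) \<in> borel_measurable borel"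
      by (intro borel_measurable_scaleR borel_measurable_divide borel_measurable_const)
    from measurable_sets[OF this A'(1)] show ?thesis by (simp add: B_def)
  qed
  from approx_indicator[OF this] show ?case
    by (rule approx_cong) (simp add: B_def A'(2) space_\<mu> indicator_def proj_def)
next
  case (mult u a)
  show ?case
  proof (cases "a = 0")
    case True
    then show ?thesis using approx_lin[OF approx_exp_trace approx_exp_trace, of 0 0] by simp
  next
    case False
    then have "(\<lambda>y. complex_of_real (u y) * exp_trace y) \<in> L2 \<mu>"
      using L2_scale[OF mult.prems, of "of_real (1 / a)"] by simp
    then have "approx (\<lambda>y. complex_of_real (u y) * exp_trace y)" by (rule mult.IH)
    from approx_lin[OF this this, of "of_real a" 0] show ?thesis by (simp add: mult.assoc)
  qed
next
  case (add u v)
  have m: "(\<lambda>y. complex_of_real (w y) * exp_trace y) \<in> borel_measurable \<mu>" if "w \<in> borel_measurable \<mu>" for w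
    using measurable_compose[OF that borel_measurable_of_real] L2_measurable[OF exp_trace_L2] by (rule borel_measurable_times)
  have "(\<lambda>y. complex_of_real (u y) * exp_trace y) \<in> L2 \<mu>" "(\<lambda>y. complex_of_real (v y) * exp_trace y) \<in> L2 \<mu>"
    using add.hyps by (intro L2_bound[OF m L2_integrable_sq[OF add.prems]] AE_I2 power_mono;
        simp add: norm_mult mult_right_mono del: of_real_add)+
  from approx_lin[OF add.IH(2)[OF this(2)] add.IH(1)[OF this(1)], of 1 1] show ?case by (simp add: distrib_right)
next
  case (seq U)
  have m: "(\<lambda>y. complex_of_real (w y) * exp_trace y) \<in> borel_measurable \<mu>" if "w \<in> borel_measurable \<mu>" for w
    using measurable_compose[OF that borel_measurable_of_real] L2_measurable[OF exp_trace_L2] by (rule borel_measurable_times)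
  have le: "AE x in \<mu>. U i x \<le> u x" for i
  proof (rule AE_I2)
    fix x assume x: "x \<in> space \<mu>"
    have "incseq (\<lambda>i. U i x)" using seq.hyps(3) by (auto simp: incseq_def le_fun_def)
    then show "U i x \<le> u x" by (rule incseq_le[OF _ seq.hyps(4)[OF x]])
  qed
  have b: "AE x in \<mu>. cmod (complex_of_real (U i x) * exp_trace x) \<le> cmod (complex_of_real (u x) * exp_trace x)" for i
    using le[of i]
  proof eventually_elim
    case (elim x)
    have "0 \<le> U i x" by (rule seq(2))
    with elim have "\<bar>U i x\<bar> \<le> \<bar>u x\<bar>" by linarith
    then show ?case unfolding norm_mult norm_of_real by (rule mult_right_mono) simp
  qed
  have L: "(\<lambda>y. complex_of_real (U i y) * exp_trace y) \<in> L2 \<mu>" for i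
    using b[of i] by (intro L2_bound[OF m[OF seq(1)] L2_integrable_sq[OF seq.prems]]) (auto elim!: eventually_mono intro: power_mono)
  show ?case
  proof (rule approx_dominated[where g = "\<lambda>i y. complex_of_real (U i y) * exp_trace y" and h = "\<lambda>y. complex_of_real (u y) * exp_trace y"])
    show "approx (\<lambda>y. complex_of_real (U i y) * exp_trace y)" for i by (rule seq.IH[OF L])
    show "AE x in \<mu>. (\<lambda>i. complex_of_real (U i x) * exp_trace x) \<longlonglongrightarrow> complex_of_real (u x) * exp_trace x"
      by (intro AE_I2 tendsto_intros seq.hyps(4))
  qed (use seq.prems b L2_measurable in auto)
qed

lemma approx_all:
  assumes f: "f \<in> L2 \<mu>"
  shows "approx f"
proof -
  \<comment> \<open>Multiplication by exp tr compensates \<open>exp_trace\<close>, so that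
    \<open>approx_nonneg\<close> applies to the nonnegative parts of \<open>f\<close>
    itself.\<close>
  define E where "E y = exp (inner junit y)" for y :: 'a
  have E: "complex_of_real (E y) * exp_trace y = 1" for y
    by (simp add: E_def exp_poly_def flip: of_real_mult exp_add)
  have Em: "E \<in> borel_measurable \<mu>"
    unfolding E_def[abs_def] by (intro measurable_\<mu> borel_measurable_continuous_onI continuous_intros)
  have part: "approx (\<lambda>y. complex_of_real (w y))" if w: "w \<in> borel_measurable \<mu>" "\<And>y. 0 \<le> w y" "\<And>y. w y \<le> cmod (f y)" for w
  proof -
    have eq: "complex_of_real (w y * E y) * exp_trace y = complex_of_real (w y)" for y
      using E[of y] by (simp add: mult.assoc)
    have "(\<lambda>y. complex_of_real (w y)) \<in> L2 \<mu>"
      using w measurable_compose[OF w(1) borel_measurable_of_real]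
      by (intro L2_bound[OF _ L2_integrable_sq[OF f]] AE_I2) (auto intro: power_mono)
    then have "(\<lambda>y. complex_of_real (w y * E y) * exp_trace y) \<in> L2 \<mu>" unfolding eq .
    moreover have "(\<lambda>y. w y * E y) \<in> borel_measurable \<mu>" using w(1) Em by (rule borel_measurable_times)
    ultimately have "approx (\<lambda>y. complex_of_real (w y * E y) * exp_trace y)"
      by (intro approx_nonneg) (auto simp: w(2) E_def)
    then show ?thesis unfolding eq .
  qed
  have fm: "f \<in> borel_measurable \<mu>" by (rule L2_measurable[OF f])
  have m: "(\<lambda>y. Re (f y)) \<in> borel_measurable \<mu>" "(\<lambda>y. Im (f y)) \<in> borel_measurable \<mu>" using fm by measurable
  have 1: "approx (\<lambda>y. complex_of_real (max 0 (Re (f y))))" "approx (\<lambda>y. complex_of_real (max 0 (- Re (f y))))"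
    "approx (\<lambda>y. complex_of_real (max 0 (Im (f y))))" "approx (\<lambda>y. complex_of_real (max 0 (- Im (f y))))"
    using m abs_Re_le_cmod[of "f _"] abs_Im_le_cmod[of "f _"]
    by (auto intro!: part borel_measurable_max borel_measurable_uminus simp: abs_le_iff)
  have "approx (\<lambda>y. 1 * (1 * complex_of_real (max 0 (Re (f y))) + (- 1) * complex_of_real (max 0 (- Re (f y))))
     + \<i> * (1 * complex_of_real (max 0 (Im (f y))) + (- 1) * complex_of_real (max 0 (- Im (f y)))))"
    by (intro approx_lin 1)
  moreover have "1 * (1 * complex_of_real (max 0 (Re z)) + (- 1) * complex_of_real (max 0 (- Re z)))
     + \<i> * (1 * complex_of_real (max 0 (Im z)) + (- 1) * complex_of_real (max 0 (- Im z))) = z" for z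
    by (simp add: complex_eq_iff max_def)
  ultimately show ?thesis by simp
qed

lemma orbit_poly_expE:
  assumes "u \<in> orbit_poly_exp c"
  obtains F n where "F \<in> rpoly n" "\<And>x. x \<in> space \<mu> \<Longrightarrow> u x = poly_exp F x"
  using assms rpoly_of_polynomial unfolding orbit_poly_exp_def space_\<mu> by blast

lemma orbit_poly_exp_L2:
  assumes "u \<in> orbit_poly_exp c"
  shows "u \<in> L2 \<mu>"
proof -
  obtain F n where F: "F \<in> rpoly n" "\<And>x. x \<in> space \<mu> \<Longrightarrow> u x = poly_exp F x" using orbit_poly_expE[OF assms] by blast
  have "u \<in> borel_measurable \<mu>"
    using L2_measurable[OF poly_exp_L2[OF F(1)]] F(2) measurable_cong[of \<mu> u "poly_exp F" borel] by auto
  then show ?thesis by (rule L2_cong_AE[OF poly_exp_L2[OF F(1)]]) (auto simp: F(2))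
qed

lemma L2_dense_orbit_poly_exp: "L2_dense \<mu> (orbit_poly_exp c)"
  unfolding L2_dense_def
proof (intro conjI ballI allI impI subsetI)
  fix f and \<epsilon> :: real assume "f \<in> L2 \<mu>" "\<epsilon> > 0"
  then obtain F n where F: "F \<in> rpoly n" "L2_norm \<mu> (\<lambda>x. f x - poly_exp F x) < \<epsilon>"
    using approx_all unfolding approx_def by meson
  have "poly_exp F \<in> orbit_poly_exp c" using polynomial_of_rpoly[OF F(1)] by (auto simp: orbit_poly_exp_def)
  then show "\<exists>w\<in>orbit_poly_exp c. L2_norm \<mu> (\<lambda>x. f x - w x) < \<epsilon>" using F(2) by blast
qed (rule orbit_poly_exp_L2)

lemma bessel_transform_orbit:
  assumes u: "u \<in> orbit_poly_exp c"
  shows "integrable \<mu> (\<lambda>y. bessel_kernel x y * u y)" "AE x in \<mu>. inversion u x = bessel_transform u x"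
proof -
  obtain F n where F: "F \<in> rpoly n" "\<And>x. x \<in> space \<mu> \<Longrightarrow> u x = poly_exp F x" using orbit_poly_expE[OF u] by blast
  have "integrable \<mu> (\<lambda>y. bessel_kernel x y * u y) \<longleftrightarrow> integrable \<mu> (\<lambda>y. bessel_kernel x y * poly_exp F y)"
    by (intro Bochner_Integration.integrable_cong refl) (simp add: F(2))
  then show "integrable \<mu> (\<lambda>y. bessel_kernel x y * u y)" using integrable_kernel[OF F(1)] by blast
  have "bessel_transform u = bessel_transform (poly_exp F)"
    unfolding bessel_transform_def
    by (intro ext arg_cong[of _ _ "\<lambda>z. _ * z"] Bochner_Integration.integral_cong refl) (simp add: F(2))
  note T = this
  have "AE x in \<mu>. inversion u x = inversion (poly_exp F) x"
    by (rule unitary_cong_AE[OF L2_unitary_inversion orbit_poly_exp_L2[OF u] poly_exp_L2[OF F(1)]]) (simp add: F(2))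
  then show "AE x in \<mu>. inversion u x = bessel_transform u x"
    using inversion_eq_bessel_transform[OF F(1)] by eventually_elim (simp add: T)
qed

end

lemma unitary_extension_unique:
  assumes U: "L2_unitary M U" and V: "L2_unitary M V" and W: "L2_dense M W"
    and eq: "\<And>u. u \<in> W \<Longrightarrow> AE x in M. U u x = V u x" and f: "f \<in> L2 M"
  shows "AE x in M. U f x = V f x"
proof -
  have L: "U f \<in> L2 M" "V f \<in> L2 M" using f U V unitary_L2 by blast+
  have "L2_norm M (\<lambda>x. U f x - V f x) \<le> \<epsilon>" if \<epsilon>: "\<epsilon> > 0" for \<epsilon>
  proof -
    obtain w where w: "w \<in> W" "L2_norm M (\<lambda>x. f x - w x) < \<epsilon> / 2"
      using W f \<epsilon> unfolding L2_dense_def by (meson half_gt_zero)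
    have wL: "w \<in> L2 M" using W w by (auto simp: L2_dense_def)
    then have L': "U w \<in> L2 M" "V w \<in> L2 M" using U V unitary_L2 by blast+
    have "L2_norm M (\<lambda>x. U f x - V f x) \<le> L2_norm M (\<lambda>x. U f x - U w x) + L2_norm M (\<lambda>x. U w x - V f x)"
      by (rule L2_norm_triangle_diff[OF L(1) L'(1) L(2)])
    also have "L2_norm M (\<lambda>x. U w x - V f x) = L2_norm M (\<lambda>x. V w x - V f x)"
      using eq[OF w(1)] L L' by (intro L2_norm_cong_AE L2_measurable L2_diff) auto
    also have "\<dots> = L2_norm M (\<lambda>x. f x - w x)"
      unfolding unitary_norm_diff[OF V wL f] by (rule L2_norm_minus)
    also have "L2_norm M (\<lambda>x. U f x - U w x) = L2_norm M (\<lambda>x. f x - w x)" by (rule unitary_norm_diff[OF U f wL])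
    finally show ?thesis using w(2) by linarith
  qed
  then have "L2_norm M (\<lambda>x. U f x - V f x) = 0" by (intro order_antisym[OF field_le_epsilon]) auto
  then have "AE x in M. U f x - V f x = 0" using L by (intro L2_norm_eq_0 L2_diff)
  then show ?thesis by simp
qed

theorem theoremD:
  fixes c\<^sub>1 :: "'a::euclidean_jordan_algebra"
    and dk :: "('a \<Rightarrow>\<^sub>L 'a) measure"
    and \<mu> :: "'a measure"
    and H :: "'g::topological_space monoid"
    and q :: "'g \<Rightarrow> 'a conf \<Rightarrow> 'a conf"
    and \<pi> :: "'g \<Rightarrow> ('a \<Rightarrow> complex) \<Rightarrow> 'a \<Rightarrow> complex"
  assumes "simple_jordan_algebra TYPE('a)"
    and "inner_is_trace_form TYPE('a)"
    and "DIM('a) > 1"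
    and "primitive_idempotent c\<^sub>1"
    and "normalized_haar_measure unit_stabilizer dk"
    and "\<mu> = orbit_measure c\<^sub>1 dk"
    and "universal_cover_of_conformal_group H q"
    and "minimal_representation H q c\<^sub>1 \<mu> \<pi>"
  shows "(\<forall>u\<in>orbit_poly_exp c\<^sub>1.
            (\<forall>x\<in>orbit c\<^sub>1. integrable \<mu>
               (\<lambda>y. complex_of_real (bessel_Jt (jlambda TYPE('a) - 1) (2 * sqrt (inner x y))) * u y)) \<and>
            (AE x in \<mu>. unitary_inversion H q \<pi> u x =
               complex_of_real (2 powr (- rlambda TYPE('a)) * Gamma (jlambda TYPE('a))) *
               (LINT y|\<mu>. complex_of_real (bessel_Jt (jlambda TYPE('a) - 1) (2 * sqrt (inner x y))) * u y)))
       \<and> L2_dense \<mu> (orbit_poly_exp c\<^sub>1)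
       \<and> L2_unitary \<mu> (unitary_inversion H q \<pi>)
       \<and> (\<forall>U. L2_unitary \<mu> U \<and>
             (\<forall>u\<in>orbit_poly_exp c\<^sub>1. AE x in \<mu>. U u x =
               complex_of_real (2 powr (- rlambda TYPE('a)) * Gamma (jlambda TYPE('a))) *
               (LINT y|\<mu>. complex_of_real (bessel_Jt (jlambda TYPE('a) - 1) (2 * sqrt (inner x y))) * u y))
             \<longrightarrow> (\<forall>f\<in>L2 \<mu>. AE x in \<mu>. U f x = unitary_inversion H q \<pi> f x))"
proof -
  interpret minimal_inversion c\<^sub>1 dk \<mu> "rlambda TYPE('a)" H q \<pi>
    by unfold_locales (use assms in auto)
  show ?thesis
  proof (intro conjI ballI allI impI L2_dense_orbit_poly_exp L2_unitary_inversion)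
    fix u assume u: "u \<in> orbit_poly_exp c\<^sub>1"
    show "integrable \<mu> (\<lambda>y. bessel_kernel x y * u y)" for x
      by (rule bessel_transform_orbit(1)[OF u])
    show "AE x in \<mu>. inversion u x = complex_of_real (2 powr (- rlambda TYPE('a)) * Gamma (jlambda TYPE('a))) *
        (LINT y|\<mu>. bessel_kernel x y * u y)"
      using bessel_transform_orbit(2)[OF u] unfolding bessel_transform_def .
  next
    fix U f
    assume U: "L2_unitary \<mu> U \<and> (\<forall>u\<in>orbit_poly_exp c\<^sub>1. AE x in \<mu>. U u x =
        complex_of_real (2 powr (- rlambda TYPE('a)) * Gamma (jlambda TYPE('a))) * (LINT y|\<mu>. bessel_kernel x y * u y))"
      and f: "f \<in> L2 \<mu>"
    show "AE x in \<mu>. U f x = inversion f x"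
    proof (rule unitary_extension_unique[OF _ L2_unitary_inversion L2_dense_orbit_poly_exp _ f])
      show "L2_unitary \<mu> U" using U by blast
      fix u assume u: "u \<in> orbit_poly_exp c\<^sub>1"
      have "AE x in \<mu>. U u x = bessel_transform u x" unfolding bessel_transform_def using U u by blast
      with bessel_transform_orbit(2)[OF u] show "AE x in \<mu>. U u x = inversion u x" by eventually_elim simp
    qed
  qed
qed

end
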